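(* Let $\lambda=(\lambda_1,\dots,\lambda_n)$ be integers with $0\ge\lambda_1\ge\cdots\ge\lambda_n$ and $\mu=(\mu_1,\dots,\mu_{n-1})$ integers such that $V(\lambda)^+_\mu\ne0$. Regard $V(\lambda)^+_\mu$ as a $Y^-(2)$-module via the homomorphism $Y^-(2)\to U(\mathfrak g_n)^{\mathfrak g_{n-1}}$ of the context. Then there is an isomorphism of $Y^-(2)$-modules $$V(\lambda)^+_\mu\cong L(\alpha_1,\beta_1)\otimes\cdots\otimes L(\alpha_n,\beta_n),$$ where $\alpha_1=-1/2$, $\alpha_i=\min\{\lambda_{i-1},\mu_{i-1}\}-i+1/2$ for $i=2,\dots,n$, $\beta_i=\max\{\lambda_i,\mu_i\}-i+1/2$ for $i=1,\dots,n-1$, and $\beta_n=\lambda_n-n+1/2$. In particular, $V(\lambda)^+_\mu$ admits the structure of a $Y(2)$-module.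
   Context: Indices run over $I_n=\{-n,\dots,-1,1,\dots,n\}$ ($0$ skipped). $\theta_{ij}=\operatorname{sgn} i\operatorname{sgn} j$, $F_{ij}=E_{ij}-\theta_{ij}E_{-j,-i}$; $\mathfrak g_n=\mathfrak{sp}(2n)=\operatorname{span}\{F_{ij}\}$, $\mathfrak g_{n-1}=\operatorname{span}\{F_{ij}: i,j\in I_{n-1}\}$. $V(\lambda)$ is the irreducible finite-dimensional $\mathfrak g_n$-module with highest vector $\xi$: $F_{ii}\xi=\lambda_i\xi$, $F_{ij}\xi=0$ for $-n\le i<j\le n$. $V(\lambda)^+_\mu=\{\eta\in V(\lambda): F_{ij}\eta=0\ (-n<i<j<n),\ F_{ii}\eta=\mu_i\eta\ (i=1,\dots,n-1)\}$. Yangians: $Y(N)$ for an index set $I$ has generators $t^{(r)}_{ij}$ ($i,j\in I$) with relations $(u-v)[t_{ij}(u),t_{kl}(v)]=t_{kj}(u)t_{il}(v)-t_{kj}(v)t_{il}(u)$, $t_{ij}(u)=\delta_{ij}+\sum_rt^{(r)}_{ij}u^{-r}$, coproduct $\Delta t_{ij}(u)=\sum_at_{ia}(u)\otimes t_{aj}(u)$; its twisted Yangian is the subalgebra generated by the coefficients of $s_{ij}(u)=\sum_a\theta_{aj}t_{ia}(u)t_{-j,-a}(-u)$. $Y(2n),Y^-(2n)$ use $I=I_n$; $Y(2),Y^-(2)$ use $I=\{-n,n\}$. The Sklyanin determinant of $S(u)=(s_{ij}(u))$ in $Y^-(2n)$ is defined by $A_{2n}S_1(u)R^t_{12}\cdots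 R^t_{1,2n}S_2(u-1)R^t_{23}\cdots R^t_{2,2n}\cdots S_{2n-1}(u-2n+2)R^t_{2n-1,2n}S_{2n}(u-2n+1)=\operatorname{sdet}S(u)A_{2n}$ ($A_{2n}$ the normalized antisymmetrizer on $(\mathbb C^{2n})^{\otimes 2n}$, $S_k$ acting in factor $k$, $R^t_{ij}=R^t_{ij}(-2u+i+j-2)$ acting in factors $i,j$, $R^t(u)=1-u^{-1}\sum\theta_{ij}E_{-j,-i}\otimes E_{ji}$), and the Sklyanin comatrix by $\operatorname{sdet}S(u)=\widehat S(u)S(u-2n+1)$. The map $s_{ij}(u)\mapsto\delta_{ij}+F_{ij}/(u-1/2)$ is a homomorphism $Y^-(2n)\to U(\mathfrak g_n)$; let $\widehat{\mathcal F}(u)$ be the image of $\widehat S(u)$. With $c(u)=\prod_{k=1}^n(1-(k-1/2)^2u^{-2})$, $\pi:S(u)\mapsto c(u)\frac{2u+1}{2u-2n+1}\widehat{\mathcal F}(-u+n-1)$ is a homomorphism $Y^-(2n)\to U(\mathfrak g_n)$. The assignment $s_{ij}(u)\mapsto s_{ij}(u)$ ($i,j\in\{-n,n\}$) is a homomorphism $Y^-(2)\to Y^-(2n)$, and its composite with $\pi$ lands in the centralizer $U(\mathfrak g_n)^{\mathfrak g_{n-1}}$, hence acts on $V(\lambda)^+_\mu$. For $\alpha-\beta\in\mathbb Z_{\ge0}$, $L(\alpha,\beta)$ is the irreducible $\mathfrak{gl}(2)$-module (basis $E_{ij}$, $i,j\in\{-n,n\}$) with highest vector $\omega$: $E_{-n,-n}\omega=\alpha\omega$,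 $E_{nn}\omega=\beta\omega$, $E_{-n,n}\omega=0$; it is a $Y(2)$-module via $t_{ij}(u)\mapsto\delta_{ij}+E_{ij}u^{-1}$, the tensor product is a $Y(2)$-module via the coproduct, and hence a $Y^-(2)$-module by restriction. *)

theory Defs
  imports Complex_Main "HOL-Combinatorics.Permutations"
begin

text \<open>Operators on a space with a finite basis indexed by a carrier set are
  represented by their matrices: functions from pairs of basis indices to complex numbers.\<close>
type_synonym 'x op = "'x \<Rightarrow> 'x \<Rightarrow> complex"

definition kd :: "'a \<Rightarrow> 'a \<Rightarrow> complex" where
  "kd a b = (if a = b then 1 else 0)"

definition mmul :: "'x set \<Rightarrow> 'x op \<Rightarrow> 'x op \<Rightarrow> 'x op" where
  "mmul B A C = (\<lambda>x y. \<Sum>z\<in>B. A x z * C z y)"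

definition mbr :: "'x set \<Rightarrow> 'x op \<Rightarrow> 'x op \<Rightarrow> 'x op" where
  "mbr B A C = (\<lambda>x y. mmul B A C x y - mmul B C A x y)"

fun mprod :: "'x set \<Rightarrow> 'x op list \<Rightarrow> 'x op" where
  "mprod B [] = kd"
| "mprod B (A # As) = mmul B A (mprod B As)"

definition vsp :: "'x set \<Rightarrow> ('x \<Rightarrow> complex) set" where
  "vsp B = {f. \<forall>x. x \<notin> B \<longrightarrow> f x = 0}"

definition app :: "'x set \<Rightarrow> 'x op \<Rightarrow> ('x \<Rightarrow> complex) \<Rightarrow> ('x \<Rightarrow> complex)" where
  "app B A f = (\<lambda>x. if x \<in> B then (\<Sum>y\<in>B. A x y * f y) else 0)"

definition csubspace :: "('x \<Rightarrow> complex) set \<Rightarrow> bool" where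
  "csubspace U \<longleftrightarrow> (\<lambda>x. 0) \<in> U \<and> (\<forall>f\<in>U. \<forall>g\<in>U. (\<lambda>x. f x + g x) \<in> U) \<and> (\<forall>c. \<forall>f\<in>U. (\<lambda>x. c * f x) \<in> U)"

definition Iset :: "nat \<Rightarrow> int set" where
  "Iset n = {i. 1 \<le> \<bar>i\<bar> \<and> \<bar>i\<bar> \<le> int n}"

definition theta :: "int \<Rightarrow> int \<Rightarrow> complex" where
  "theta i j = of_int (sgn i * sgn j)"

definition Fm :: "int \<Rightarrow> int \<Rightarrow> (int \<Rightarrow> int \<Rightarrow> complex)" where
  "Fm i j = (\<lambda>a b. kd (a, b) (i, j) - theta i j * kd (a, b) (-j, -i))"

definition gsp :: "nat \<Rightarrow> (int \<Rightarrow> int \<Rightarrow> complex) set" where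
  "gsp n = {X. \<exists>c. X = (\<lambda>a b. \<Sum>i\<in>Iset n. \<Sum>j\<in>Iset n. c i j * Fm i j a b)}"

definition sp_module :: "nat \<Rightarrow> ((int \<Rightarrow> int \<Rightarrow> complex) \<Rightarrow> 'v op) \<Rightarrow> bool" where
  "sp_module n \<rho> \<longleftrightarrow>
     (\<forall>X\<in>gsp n. \<forall>Y\<in>gsp n. \<rho> (\<lambda>a b. X a b + Y a b) = (\<lambda>x y. \<rho> X x y + \<rho> Y x y)
        \<and> \<rho> (mbr (Iset n) X Y) = mbr UNIV (\<rho> X) (\<rho> Y))
   \<and> (\<forall>c. \<forall>X\<in>gsp n. \<rho> (\<lambda>a b. c * X a b) = (\<lambda>x y. c * \<rho> X x y))"

definition sp_irreducible :: "nat \<Rightarrow> ((int \<Rightarrow> int \<Rightarrow> complex) \<Rightarrow> 'v op) \<Rightarrow> bool" where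
  "sp_irreducible n \<rho> \<longleftrightarrow>
     (\<forall>U. csubspace U \<and> (\<forall>X\<in>gsp n. \<forall>f\<in>U. app UNIV (\<rho> X) f \<in> U) \<longrightarrow> U = {\<lambda>x. 0} \<or> U = UNIV)"

definition sp_hw :: "nat \<Rightarrow> ((int \<Rightarrow> int \<Rightarrow> complex) \<Rightarrow> 'v op) \<Rightarrow> (nat \<Rightarrow> int) \<Rightarrow> ('v \<Rightarrow> complex) \<Rightarrow> bool" where
  "sp_hw n \<rho> lam \<xi> \<longleftrightarrow> \<xi> \<noteq> (\<lambda>x. 0)
     \<and> (\<forall>i\<in>{1..n}. app UNIV (\<rho> (Fm (int i) (int i))) \<xi> = (\<lambda>x. of_int (lam i) * \<xi> x))
     \<and> (\<forall>i\<in>Iset n. \<forall>j\<in>Iset n. i < j \<longrightarrow> app UNIV (\<rho> (Fm i j)) \<xi> = (\<lambda>x. 0))"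

definition Vplus :: "nat \<Rightarrow> ((int \<Rightarrow> int \<Rightarrow> complex) \<Rightarrow> 'v op) \<Rightarrow> (nat \<Rightarrow> int) \<Rightarrow> ('v \<Rightarrow> complex) set" where
  "Vplus n \<rho> \<mu> = {\<eta>.
     (\<forall>i\<in>Iset n. \<forall>j\<in>Iset n. - int n < i \<and> i < j \<and> j < int n \<longrightarrow> app UNIV (\<rho> (Fm i j)) \<eta> = (\<lambda>x. 0))
   \<and> (\<forall>i\<in>{1..<n}. app UNIV (\<rho> (Fm (int i) (int i))) \<eta> = (\<lambda>x. of_int (\<mu> i) * \<eta> x))}"

text \<open>image of S(u) under s_ij(u) \<mapsto> delta_ij + F_ij/(u-1/2), acting on C^{2n} (x) V\<close>
definition Sop :: "nat \<Rightarrow> ((int \<Rightarrow> int \<Rightarrow> complex) \<Rightarrow> 'v op) \<Rightarrow> complex \<Rightarrow> (int \<times> 'v) op" where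
  "Sop n \<rho> u = (\<lambda>(i, x) (j, y). kd (i, x) (j, y) + \<rho> (Fm i j) x y / (u - 1/2))"

definition LC :: "nat \<Rightarrow> nat \<Rightarrow> int list set" where
  "LC n m = {a. length a = m \<and> set a \<subseteq> Iset n}"

text \<open>carrier of (C^{2n})^{(x) 2n} (x) V\<close>
definition SC :: "nat \<Rightarrow> (int list \<times> 'v) set" where
  "SC n = LC n (2 * n) \<times> UNIV"

text \<open>S acting in tensor factor k (0-based)\<close>
definition embS :: "nat \<Rightarrow> (int \<times> 'v) op \<Rightarrow> (int list \<times> 'v) op" where
  "embS k S = (\<lambda>(a, x) (b, y).
     if (\<forall>r<length a. r \<noteq> k \<longrightarrow> a ! r = b ! r) then S (a ! k, x) (b ! k, y) else 0)"

text \<open>an operator on C^{2n} (x) C^{2n} acting in tensor factors k, l (0-based)\<close>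
definition embR :: "nat \<Rightarrow> nat \<Rightarrow> (int \<times> int) op \<Rightarrow> (int list \<times> 'v) op" where
  "embR k l R = (\<lambda>(a, x) (b, y).
     if x = y \<and> (\<forall>r<length a. r \<noteq> k \<and> r \<noteq> l \<longrightarrow> a ! r = b ! r)
     then R (a ! k, a ! l) (b ! k, b ! l) else 0)"

text \<open>R^t(w) = 1 - w^{-1} sum theta_ij E_{-j,-i} (x) E_ji\<close>
definition Rt :: "complex \<Rightarrow> (int \<times> int) op" where
  "Rt w = (\<lambda>(a1, a2) (b1, b2). kd (a1, a2) (b1, b2)
            - (if a1 = - a2 \<and> b1 = - b2 then theta a2 b2 else 0) / w)"

definition antisym :: "nat \<Rightarrow> (int list \<times> 'v) op" where
  "antisym m = (\<lambda>(a, x) (b, y). kd x y *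
     (\<Sum>\<sigma>\<in>{\<sigma>. \<sigma> permutes {..<m}}. (sign \<sigma> :: complex) *
        (if (\<forall>r<m. a ! r = b ! (\<sigma> r)) then 1 else 0)) / fact m)"

text \<open>the factors S_1(u) R^t_12 ... R^t_{1,2n} S_2(u-1) R^t_23 ... S_{2n}(u-2n+1),
  with R^t_{IJ} = R^t(-2u+I+J-2) (1-based I,J)\<close>
definition sdet_factors :: "nat \<Rightarrow> ((int \<Rightarrow> int \<Rightarrow> complex) \<Rightarrow> 'v op) \<Rightarrow> complex \<Rightarrow> (int list \<times> 'v) op list" where
  "sdet_factors n \<rho> u = concat (map (\<lambda>k.
      embS k (Sop n \<rho> (u - of_nat k))
      # map (\<lambda>l. embR k l (Rt (- 2 * u + of_nat k + of_nat l))) [Suc k..<2 * n]) [0..<2 * n])"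

definition liftT :: "'v op \<Rightarrow> (int list \<times> 'v) op" where
  "liftT D = (\<lambda>(a, x) (b, y). kd a b * D x y)"

definition sdet :: "nat \<Rightarrow> ((int \<Rightarrow> int \<Rightarrow> complex) \<Rightarrow> 'v op) \<Rightarrow> complex \<Rightarrow> 'v op" where
  "sdet n \<rho> u = (THE D. \<forall>p\<in>SC n. \<forall>q\<in>SC n.
      mmul (SC n) (antisym (2 * n)) (mprod (SC n) (sdet_factors n \<rho> u)) p q
      = mmul (SC n) (liftT D) (antisym (2 * n)) p q)"

definition liftV :: "'v op \<Rightarrow> (int \<times> 'v) op" where
  "liftV D = (\<lambda>(i, x) (j, y). kd i j * D x y)"

text \<open>image of the Sklyanin comatrix: sdet S(u) = Fhat(u) S(u-2n+1)\<close>
definition Fhat :: "nat \<Rightarrow> ((int \<Rightarrow> int \<Rightarrow> complex) \<Rightarrow> 'v op) \<Rightarrow> complex \<Rightarrow> (int \<times> 'v) op" where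
  "Fhat n \<rho> u = (THE M.
      (\<forall>p q. p \<notin> Iset n \<times> UNIV \<or> q \<notin> Iset n \<times> UNIV \<longrightarrow> M p q = 0)
    \<and> (\<forall>p\<in>Iset n \<times> UNIV. \<forall>q\<in>Iset n \<times> UNIV.
         mmul (Iset n \<times> UNIV) M (Sop n \<rho> (u - 2 * of_nat n + 1)) p q = liftV (sdet n \<rho> u) p q))"

definition cfun :: "nat \<Rightarrow> complex \<Rightarrow> complex" where
  "cfun n u = (\<Prod>k=1..n. 1 - (of_nat k - 1/2)^2 / u^2)"

text \<open>action of s_ij(u) (i,j in {-n,n}) of Y^-(2) on V via Y^-(2) -> Y^-(2n) -> U(g_n) -> End V\<close>
definition piS :: "nat \<Rightarrow> ((int \<Rightarrow> int \<Rightarrow> complex) \<Rightarrow> 'v op) \<Rightarrow> int \<Rightarrow> int \<Rightarrow> complex \<Rightarrow> 'v op" where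
  "piS n \<rho> i j u = (\<lambda>x y. cfun n u * (2 * u + 1) / (2 * u - 2 * of_nat n + 1)
       * Fhat n \<rho> (- u + of_nat n - 1) (i, x) (j, y))"

text \<open>W finite basis, E a b = action of E_ab (a,b in {-N,N}); finite-dimensional irreducible
  gl(2)-module with highest vector of weight (alpha,beta)\<close>
definition gl2_hw :: "int \<Rightarrow> 'w set \<Rightarrow> (int \<Rightarrow> int \<Rightarrow> 'w op) \<Rightarrow> complex \<Rightarrow> complex \<Rightarrow> bool" where
  "gl2_hw N W E \<alpha> \<beta> \<longleftrightarrow> finite W
   \<and> (\<forall>a\<in>{-N, N}. \<forall>b\<in>{-N, N}. \<forall>c\<in>{-N, N}. \<forall>d\<in>{-N, N}. \<forall>x\<in>W. \<forall>y\<in>W.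
        mbr W (E a b) (E c d) x y = kd b c * E a d x y - kd d a * E c b x y)
   \<and> (\<forall>U. U \<subseteq> vsp W \<and> csubspace U \<and> (\<forall>a\<in>{-N, N}. \<forall>b\<in>{-N, N}. \<forall>f\<in>U. app W (E a b) f \<in> U)
        \<longrightarrow> U = {\<lambda>x. 0} \<or> U = vsp W)
   \<and> (\<exists>\<omega>\<in>vsp W. \<omega> \<noteq> (\<lambda>x. 0) \<and> app W (E (-N) (-N)) \<omega> = (\<lambda>x. \<alpha> * \<omega> x)
        \<and> app W (E N N) \<omega> = (\<lambda>x. \<beta> * \<omega> x) \<and> app W (E (-N) N) \<omega> = (\<lambda>x. 0))"

text \<open>basis of L_1 (x) ... (x) L_n, L_k having basis W k\<close>
definition TC :: "nat \<Rightarrow> (nat \<Rightarrow> 'w set) \<Rightarrow> 'w list set" where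
  "TC n W = {ks. length ks = n \<and> (\<forall>r<n. ks ! r \<in> W (Suc r))}"

text \<open>t_ab(u) -> delta_ab + E_ab u^{-1} on L_k\<close>
definition Tk :: "(nat \<Rightarrow> int \<Rightarrow> int \<Rightarrow> 'w op) \<Rightarrow> nat \<Rightarrow> complex \<Rightarrow> int \<Rightarrow> int \<Rightarrow> 'w op" where
  "Tk E k u a b = (\<lambda>x y. kd a b * kd x y + E k a b x y / u)"

text \<open>t_ij(u) on the tensor product via the iterated coproduct
  Delta t_ij(u) = sum_a t_ia(u) (x) t_aj(u)\<close>
definition Ttens :: "nat \<Rightarrow> (nat \<Rightarrow> int \<Rightarrow> int \<Rightarrow> 'w op) \<Rightarrow> int \<Rightarrow> int \<Rightarrow> complex \<Rightarrow> 'w list op" where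
  "Ttens n E i j u = (\<lambda>ks ls.
     \<Sum>as\<in>{as. length as = n - 1 \<and> set as \<subseteq> {- int n, int n}}.
       (let c = i # as @ [j] in \<Prod>r<n. Tk E (Suc r) u (c ! r) (c ! Suc r) (ks ! r) (ls ! r)))"

definition Stens :: "nat \<Rightarrow> (nat \<Rightarrow> 'w set) \<Rightarrow> (nat \<Rightarrow> int \<Rightarrow> int \<Rightarrow> 'w op) \<Rightarrow> int \<Rightarrow> int \<Rightarrow> complex \<Rightarrow> 'w list op" where
  "Stens n W E i j u = (\<lambda>ks ls. \<Sum>a\<in>{- int n, int n}.
      theta a j * mmul (TC n W) (Ttens n E i a u) (Ttens n E (- j) (- a) (- u)) ks ls)"

definition alph :: "(nat \<Rightarrow> int) \<Rightarrow> (nat \<Rightarrow> int) \<Rightarrow> nat \<Rightarrow> complex" where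
  "alph lam \<mu> i = (if i = 1 then - 1/2
                  else of_int (min (lam (i - 1)) (\<mu> (i - 1))) - of_nat i + 1/2)"

definition bet :: "nat \<Rightarrow> (nat \<Rightarrow> int) \<Rightarrow> (nat \<Rightarrow> int) \<Rightarrow> nat \<Rightarrow> complex" where
  "bet n lam \<mu> i = (if i = n then of_int (lam n) - of_nat n + 1/2
                  else of_int (max (lam i) (\<mu> i)) - of_nat i + 1/2)"

end

theory Submission
 imports Defs "HOL-Library.Function_Algebras"
begin

text \<open>By fusion, the Sklyanin determinant acts on \<open>V\<close> as a scalar, so up to a scalar function
\<open>S(u)\<close> acts on \<open>V\<^sup>+\<close> as the \<open>{-n,n}\<close>-block of the resolvent \<open>G(u)\<close> of the matrix \<open>F = (F_ij)\<close>.
A vector \<open>v\<close> of \<open>V\<^sup>+\<close> is encoded by the power series \<open>\<xi>* exp(\<Sum> x_j F_jn) v\<close>, where \<open>\<xi>*\<close> is the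
covector dual to the highest vector. The series attached to \<open>G(u) v\<close> are found by a triangular recursion
whose steps are Lax matrices of one-variable polynomial sites; their product is the monodromy matrix
\<open>T(u) T\<^sup>t(-u)\<close> with the sites in reversed order. Irreducibility of this model makes the encoding surjective
and allows the sites to be reordered.\<close>

text \<open>The dimension of the weight space is not known beforehand, so bijectivity cannot come
  from counting. The series gives an injection into polynomials: sl(2)-strings of the covector bound
  the degrees by alpha_i - beta_i, and the image is a nonzero submodule of an irreducible model. The
  model is irreducible because the intervals from beta_i to alpha_i are disjoint and lie below 0,
  which is where dominance and 0 >= lambda_1 enter. The series has 2n - 1 variables. The weight mu
  fixes the difference of the exponents of x_i and x_{-i}, so the series is a fixed monomial times a
  polynomial in q_i = x_i x_{-i} for i < n and q_n = x_{-n}. The positive or negative part of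
  lambda_i - mu_i in that monomial produces the minima and maxima in alpha and beta. The tails r_m =
  q_m + ... + q_n are the variables in which the sites separate. The resolvent is used for large |u|
  only; cleared of denominators its action is polynomial in u, which carries stability of the image
  to all u. Only the (n,n) entry is computed by recursion; the others follow by commutators with
  F_{-n,n} and F_{n,-n}.\<close>

type_synonym arr = "nat => nat"
type_synonym 'v ser = "'v \<times> (int => nat)"
type_synonym 'v tns = "'v \<times> (nat => int)"

abbreviation (input) Iff (infixr "<->" 25) where "A <-> B == A = (B::bool)"
type_synonym pol = "(int => nat) => complex"
type_synonym 'v srv = "'v ser => complex"
type_synonym 'v tnv = "'v tns => complex"

text \<open>Functions are treated as abstract vectors: pointwise evaluation is switched off in the
  simplifier and requested through \<open>fa\<close> only where coordinates matter.\<close>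

declare zero_fun_apply [simp del] plus_fun_apply [simp del] minus_apply [simp del] uminus_apply [simp del]
lemmas fa = zero_fun_apply plus_fun_apply minus_apply uminus_apply

lemmas alg = algebra_simps

section \<open>Linear operators as a ring\<close>

typedef 'x lop = "{T :: ('x => complex) => ('x => complex).
  (ALL f g. T (f + g) = T f + T g) & (ALL c f. T (%x. c * f x) = (%x. c * T f x))}"
 morphisms ap Lop by(rule exI[of _ "%f. f"]) auto

definition clin :: "(('x => complex) => ('y => complex)) => bool" where
 "clin T <-> (ALL f g. T (f + g) = T f + T g) & (ALL c f. T (%x. c * f x) = (%x. c * T f x))"

lemma clinI:
 assumes "!!f g. T (f + g) = T f + T g" "!!c f. T (%x. c * f x) = (%x. c * T f x)"
 shows "clin T" using assms by(simp add: clin_def)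

lemma clin_add: "clin T ==> T (f + g) = T f + T g"
 and clin_scale: "clin T ==> T (%x. c * f x) = (%x. c * T f x)" by(simp_all add: clin_def)

lemma clin_0: "clin T ==> T 0 = 0" using clin_scale[of T 0 0] by(simp add: zero_fun_def)

lemma clin_sum: "clin T ==> T (SUM a:A. F a) = (SUM a:A. T (F a))" by(induction A rule: infinite_finite_induct) (auto simp: clin_0 clin_add)

lemma clin_minus: "clin T ==> T (- f) = - T f" using clin_scale[of T "-1" f] by(simp add: fun_Compl_def)

lemma clin_diff: "clin T ==> T (f - g) = T f - T g" using clin_add[of T f "- g"] clin_minus[of T g] by simp

lemma clin_ap: "clin (ap T)" using ap[of T] by(simp add: clin_def)

lemma ap_Lop: "clin T ==> ap (Lop T) = T" by(simp add: Lop_inverse clin_def)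

lemmas ap_vadd = clin_add[OF clin_ap]
lemmas ap_vscale = clin_scale[OF clin_ap]
lemmas ap_v0 = clin_0[OF clin_ap]
lemmas ap_vsum = clin_sum[OF clin_ap]
lemmas ap_vminus = clin_minus[OF clin_ap]
lemmas ap_vdiff = clin_diff[OF clin_ap]

lemma lop_eqI: "(!!f. ap S f = ap T f) ==> S = T" by(metis ap_inject ext)

instantiation lop :: (type) ring_1
begin
definition "0 = Lop (%f. 0)"
definition "1 = Lop (%f. f)"
definition "S + T = Lop (%f. ap S f + ap T f)"
definition "S - T = Lop (%f. ap S f - ap T f)"
definition "- T = Lop (%f. - ap T f)"
definition "S * T = Lop (%f. ap S (ap T f))"

lemma ap_0: "ap 0 f = 0" unfolding zero_lop_def by(subst ap_Lop) (auto intro!: clinI simp: zero_fun_def)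
lemma ap_1: "ap 1 f = f" unfolding one_lop_def by(subst ap_Lop) (auto intro!: clinI)
lemma ap_add: "ap (S + T) f = ap S f + ap T f" unfolding plus_lop_def by(subst ap_Lop) (auto intro!: clinI simp: ap_vadd ap_vscale fun_eq_iff fa alg)
lemma ap_diff: "ap (S - T) f = ap S f - ap T f" unfolding minus_lop_def by(subst ap_Lop) (auto intro!: clinI simp: ap_vadd ap_vscale fun_eq_iff fa alg)
lemma ap_minus: "ap (- T) f = - ap T f" unfolding uminus_lop_def by(subst ap_Lop) (auto intro!: clinI simp: ap_vadd ap_vscale fun_eq_iff fa alg)
lemma ap_mult: "ap (S * T) f = ap S (ap T f)" unfolding times_lop_def by(subst ap_Lop) (auto intro!: clinI simp: ap_vadd ap_vscale fun_eq_iff fa alg)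

instance
proof
 show "(0::'a lop) ~= 1" proof
  assume "(0::'a lop) = 1"
  hence "ap 0 (%x. 1) = ap (1::'a lop) (%x. 1)" by simp
  thus False by(simp add: ap_0 ap_1 fun_eq_iff fa)
 qed
qed (rule lop_eqI; simp add: ap_0 ap_1 ap_add ap_diff ap_minus ap_mult ap_vadd alg)+

end

lemmas ap_simps [simp] = ap_0 ap_1 ap_add ap_diff ap_minus ap_mult ap_v0

lemma ap_sum: "ap (SUM a:A. F a) f = (SUM a:A. ap (F a) f)" by(induction A rule: infinite_finite_induct) auto

definition vs :: "complex => ('x => complex) => ('x => complex)" (infixr "*." 75) where
 "c *. f = (%x. c * f x)"

lemma vs_apply: "(c *. f) x = c * f x" by(simp add: vs_def)

lemma vs_simps:
 "c *. (d *. f) = (c * d) *. f" "1 *. f = f" "0 *. f = 0" "c *. (f + g) = c *. f + c *. g"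
 "c *. (f - g) = c *. f - c *. g" "(c + d) *. f = c *. f + d *. f" "(c - d) *. f = c *. f - d *. f"
 "c *. (- f) = - (c *. f)" "(- c) *. f = - (c *. f)" "c *. 0 = 0" by(simp_all add: fun_eq_iff fa vs_apply alg)

lemma sum_fun_apply: "(SUM a:A. F a) x = (SUM a:A. F a x)" by(induction A rule: infinite_finite_induct) (auto simp: fa)

lemma vs_eq_0: "k *. f = 0 ==> k ~= 0 ==> f = 0" by(simp add: fun_eq_iff fa vs_apply)

lemma vs_sum: "c *. (SUM a:A. F a) = (SUM a:A. c *. F a)" by(simp add: fun_eq_iff fa vs_apply sum_fun_apply sum_distrib_left)

lemma ap_vs: "ap T (c *. f) = c *. ap T f" by(simp add: vs_def ap_vscale)

definition scl :: "complex => 'x lop => 'x lop" (infixr "*:" 75) where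
 "c *: T = Lop (%f. c *. ap T f)"

lemma ap_scl [simp]: "ap (c *: T) f = c *. ap T f" unfolding scl_def by(subst ap_Lop) (auto intro!: clinI simp: ap_vadd ap_vscale fun_eq_iff fa vs_apply alg)

lemma scl_simps:
 "c *: S * T = c *: (S * T)" "S * c *: T = c *: (S * T)" "c *: (d *: T) = (c * d) *: T"
 "c *: (S + T) = c *: S + c *: T" "c *: (S - T) = c *: S - c *: T" "c *: (- T) = - (c *: T)"
 "(c + d) *: T = c *: T + d *: T" "(c - d) *: T = c *: T - d *: T" "(- c) *: T = - (c *: T)"
 "0 *: T = 0" "1 *: T = T" "c *: (0::'x lop) = 0" by(rule lop_eqI; simp add: vs_simps ap_vs)+

lemma scl_sum: "c *: (SUM a:A. F a) = (SUM a:A. c *: F a)" by(induction A rule: infinite_finite_induct) (auto simp: scl_simps)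

lemma csub_vs: "csubspace U ==> f : U ==> c *. f : U" by(simp add: csubspace_def vs_def)
lemma csub_0: "csubspace U ==> 0 : U" by(simp add: csubspace_def zero_fun_def)
lemma csub_add: "csubspace U ==> f : U ==> g : U ==> f + g : U" by(simp add: csubspace_def plus_fun_def)
lemma csub_diff: "csubspace U ==> f : U ==> g : U ==> f - g : U" using csub_add[of U f "(-1) *. g"] csub_vs[of U g "-1"] by(simp add: vs_simps)
lemma csub_sum: "csubspace U ==> (!!a. a : A ==> F a : U) ==> (SUM a:A. F a) : U" by(induction A rule: infinite_finite_induct) (auto simp: csub_0 csub_add)
lemma csubI: "0 : U ==> (!!f g. f : U ==> g : U ==> f + g : U) ==> (!!c f. f : U ==> c *. f : U) ==> csubspace U"
 by(simp add: csubspace_def zero_fun_def plus_fun_def vs_def)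

section \<open>Polynomial dependence on the spectral parameter\<close>

definition PF :: "(complex => 'x => complex) => bool" where
 "PF g <-> (EX m G. ALL u. g u = (\<Sum>k<(m::nat). u ^ k *. G k))"

lemma PF_const: "PF (%u. f)" unfolding PF_def by(rule exI[of _ 1], rule exI[of _ "%k. f"]) (simp add: vs_simps)

lemma PF_ap: "PF g ==> PF (%u. ap T (g u))" unfolding PF_def by(elim exE, simp add: ap_vs ap_vsum, intro exI allI, rule refl)

lemma PF_var: assumes "PF g" shows "PF (%u. u *. g u)"
proof -
 obtain m G where "!!u. g u = (\<Sum>k<(m::nat). u ^ k *. G k)" using assms by(auto simp: PF_def)
 hence "u *. g u = (\<Sum>k<Suc m. u ^ k *. (if k = 0 then 0 else G (k - 1)))" for u by(simp add: sum.lessThan_Suc_shift vs_sum vs_simps del: sum.lessThan_Suc)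
 thus ?thesis unfolding PF_def by(intro exI allI)
qed

lemma PF_add: assumes "PF g" "PF h" shows "PF (%u. g u + h u)"
proof -
 obtain m G where 1: "!!u. g u = (\<Sum>k<(m::nat). u ^ k *. G k)" using assms by(auto simp: PF_def)
 obtain n H where 2: "!!u. h u = (\<Sum>k<(n::nat). u ^ k *. H k)" using assms by(auto simp: PF_def)
 have A: "(\<Sum>k<(m::nat). u ^ k *. G k) = (\<Sum>k<m+n. u ^ k *. (if k < m then G k else 0))" for m n u
  and G :: "nat => 'a => complex" by(rule sum.mono_neutral_cong_left) (auto simp: vs_simps)
 have "g u + h u = (\<Sum>k<m+n. u ^ k *. ((if k < m then G k else 0) + (if k < n then H k else 0)))" for u
  unfolding 1 2 A[of u G m n] A[of u H n m] by(simp add: vs_simps sum.distrib add.commute)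
 thus ?thesis unfolding PF_def by(intro exI allI)
qed

text \<open>The condition is tested on all polynomial families rather than on fixed vectors, which
  makes it closed under composition (\<open>LP_mult\<close>).\<close>

definition LP :: "(complex => 'x lop) => bool" where
 "LP T <-> (ALL g. PF g --> PF (%u. ap (T u) (g u)))"

lemma LP_const: "LP (%u. T)" by(simp add: LP_def PF_ap)
lemma LP_var: "LP T ==> LP (%u. u *: T u)" by(simp add: LP_def PF_var)
lemma LP_add: "LP S ==> LP T ==> LP (%u. S u + T u)" by(simp add: LP_def PF_add)
lemma LP_mult: "LP S ==> LP T ==> LP (%u. S u * T u)" by(simp add: LP_def)
lemma LP_PF: "LP T ==> PF (%u. ap (T u) f)" by(simp add: LP_def PF_const)

text \<open>Dividing \<open>g u - g w\<close> by \<open>u - w\<close> lowers the degree and stays in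
  \<open>U\<close> on the rest of \<open>Good\<close>. Only linear combinations of values are
  formed, so no topology enters. Statements known for large \<open>u\<close> are extended to every
  \<open>u\<close> in this way.\<close>

lemma PF_in_subspace:
 assumes U: "csubspace U" and "PF g" and "infinite Good" and "!!u. u : Good ==> g u : U"
 shows "g u : U" proof -
 obtain m G where "!!u. g u = (\<Sum>k<(m::nat). u ^ k *. G k)" using assms by(auto simp: PF_def)
 thus ?thesis using assms(3,4)
 proof(induction m arbitrary: g G Good u)
  case 0
  thus ?case by(simp add: csub_0[OF U])
 next
  case (Suc m)
  obtain w where w: "w : Good" using Suc.prems(2) by fastforce
  \<comment> \<open>The divided difference of \<open>g\<close> at \<open>u\<close> and
    \<open>w\<close>.\<close>
  define q where "q u = (\<Sum>j<m. u ^ j *. (SUM k:{Suc j..<Suc m}. w ^ (k - Suc j) *. G k))" for u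
  have eq: "g u = g w + (u - w) *. q u" for u proof -
   have "g u x - g w x = (u - w) * q u x" for x proof -
    have "g u x - g w x = (\<Sum>k<Suc m. (u ^ k - w ^ k) * G k x)"
     by(simp add: Suc.prems(1) sum_fun_apply vs_apply sum_subtractf left_diff_distrib del: sum.lessThan_Suc)
    also have "... = (\<Sum>k<Suc m. \<Sum>j<k. (u - w) * (w ^ (k - Suc j) * u ^ j * G k x))"
     by(rule sum.cong[OF refl]) (simp only: power_diff_sumr2 sum_distrib_left sum_distrib_right mult.assoc)
    also have "... = (\<Sum>j<m. SUM k:{Suc j..<Suc m}. (u - w) * (w ^ (k - Suc j) * u ^ j * G k x))" by(subst (1 2) sum.Sigma; simp del: sum.lessThan_Suc)
       (rule sum.reindex_bij_witness[of _ "%(j,k). (k,j)" "%(k,j). (j,k)"]; auto)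
    also have "... = (u - w) * q u x" by(simp add: q_def sum_fun_apply vs_apply fa sum_distrib_left alg)
    finally show ?thesis .
   qed
   thus ?thesis by(simp add: fun_eq_iff fa vs_apply alg)
  qed
  have "q u : U" for u proof(rule Suc.IH[of q _ "Good - {w}"])
   show "infinite (Good - {w})" using Suc.prems(2) by simp
   show "q u : U" if "u : Good - {w}" for u proof -
    have "g u - g w : U" using that w Suc.prems(3) csub_diff[OF U] by blast
    moreover have "g u - g w = (u - w) *. q u" by(subst eq) simp
    hence "q u = (1 / (u - w)) *. (g u - g w)" using that by(simp add: vs_simps(1,2))
        ultimately show ?thesis using csub_vs[OF U] by simp
   qed
  qed (simp add: q_def)
  thus ?case using eq[of u] w Suc.prems(3) csub_add[OF U] csub_vs[OF U] by metis
 qed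
qed

lemma csub_triv: "csubspace {0}" by(rule csubI) (auto simp: vs_simps)

lemma PF_zero:
 assumes "PF g" and "infinite Good" and "!!u. u : Good ==> g u = 0"
 shows "g u = 0" using PF_in_subspace[OF csub_triv assms(1,2), of u] assms(3) by simp

section \<open>Polynomial sites, their monodromy and its irreducibility\<close>

text \<open>Weyl algebra acting on arrays of coefficients of formal power series.\<close>

definition xv :: "'i => ('i => nat) lop" where
 "xv i = Lop (%f a. if a i = 0 then 0 else f (a(i := a i - 1)))"
definition dv :: "'i => ('i => nat) lop" where
 "dv i = Lop (%f a. of_nat (Suc (a i)) * f (a(i := Suc (a i))))"

lemma ap_xv: "ap (xv i) f a = (if a i = 0 then 0 else f (a(i := a i - 1)))" unfolding xv_def by(subst ap_Lop) (auto intro!: clinI simp: fun_eq_iff fa vs_apply)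
lemma ap_dv: "ap (dv i) f a = of_nat (Suc (a i)) * f (a(i := Suc (a i)))" unfolding dv_def by(subst ap_Lop) (auto intro!: clinI simp: fun_eq_iff fa vs_apply alg)

lemma dx_same: "dv i * xv i = xv i * dv i + 1" by(rule lop_eqI, rule ext) (auto simp: fa ap_xv ap_dv alg)
lemma dx_diff: "i ~= j ==> dv i * xv j = xv j * dv i" by(rule lop_eqI, rule ext) (auto simp: ap_xv ap_dv alg fun_upd_twist)
lemma xx_comm: "xv i * xv j = xv j * xv i" by(cases "i = j") (auto intro!: lop_eqI simp: fun_eq_iff fa vs_apply ap_xv fun_upd_twist)
lemma dd_comm: "dv i * dv j = dv j * dv i" by(cases "i = j") (auto intro!: lop_eqI simp: fun_eq_iff fa vs_apply ap_dv fun_upd_twist)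

text \<open>The sites of the model: polynomials in one variable with degree at most \<open>d\<close>. The matrix index
 False stands for \<open>-n\<close>, True for \<open>n\<close>.\<close>

definition lx :: "(nat => nat) => nat => complex => bool => bool => arr lop" where
 "lx d i z a b = (if a then (if b then (z - of_nat (d i)) *: 1 + xv i * dv i
                else of_nat (d i) *: xv i - xv i * (xv i * dv i))
          else (if b then dv i else z *: 1 - xv i * dv i))"

definition mm :: "(bool => bool => 'x lop) => (bool => bool => 'x lop) => bool => bool => 'x lop" where
 "mm A B a b = A a False * B False b + A a True * B True b"

definition id2 :: "bool => bool => 'x lop" where
 "id2 a b = (if a = b then 1 else 0)"

lemma mm_assoc: "mm (mm A B) C = mm A (mm B C)" by(intro ext) (simp add: mm_def alg)

lemma mm_id [simp]: "mm A id2 = A" "mm id2 A = A" by(auto intro!: ext simp: mm_def id2_def)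

text \<open>Each site multiplies from both sides, so it can be peeled off as the outermost pair of
  factors. With \<open>c' = d - c\<close> the right factors are, up to sign, transposed Lax matrices
  at \<open>-u\<close> (\<open>lx_flip\<close>).\<close>

fun Zm :: "(nat => nat) => (nat => complex) => (nat => complex) => nat list => complex
  => bool => bool => arr lop" where
 "Zm d c c' [] u = id2"
| "Zm d c c' (i # is) u = mm (mm (lx d i (u + c i)) (Zm d c c' is u)) (lx d i (u + c' i))"

text \<open>Coefficient arrays of the polynomials in the variables of \<open>is\<close> with degree
  at most \<open>d i\<close> in variable \<open>i\<close>: the tensor product of the sites.\<close>

definition HH :: "(nat => nat) => nat list => (arr => complex) set" where
 "HH d is = {h. ALL c. h c ~= 0 --> (ALL i:set is. c i <= d i) & (ALL i. i ~: set is --> c i = 0)}"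

definition om :: "arr => complex" where
 "om c = (if c = (%_. 0) then 1 else 0)"

text \<open>Extraction of the coefficient of \<open>x_i^p\<close>, returned as an array that no
  longer involves variable \<open>i\<close>; it splits off one site at a time.\<close>

definition sg :: "nat => nat => arr lop" where
 "sg i p = Lop (%h c. if c i = 0 then h (c(i := p)) else 0)"

lemma ap_sg: "ap (sg i p) h c = (if c i = 0 then h (c(i := p)) else 0)" unfolding sg_def by(subst ap_Lop) (auto intro!: clinI simp: fun_eq_iff fa)

lemma sg_xv: "sg i p * xv i = (if p = 0 then 0 else sg i (p - 1))" by(rule lop_eqI, rule ext) (auto simp: fa ap_sg ap_xv)
lemma sg_dv: "sg i p * dv i = of_nat (Suc p) *: sg i (Suc p)" by(rule lop_eqI, rule ext) (auto simp: fa vs_apply ap_sg ap_dv)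

text \<open>An operator on the other sites only, characterised by the commutations that the
  induction over sites uses.\<close>

definition off :: "nat => arr lop => bool" where
 "off i T <-> T * xv i = xv i * T & T * dv i = dv i * T & (ALL p. sg i p * T = T * sg i p)"

lemma off_mult: "off i S ==> off i T ==> off i (S * T)" unfolding off_def by(metis mult.assoc)
lemma off_add: "off i S ==> off i T ==> off i (S + T)" unfolding off_def by(simp add: alg)
lemma off_diff: "off i S ==> off i T ==> off i (S - T)" unfolding off_def by(simp add: alg)
lemma off_scl: "off i S ==> off i (z *: S)" unfolding off_def by(simp add: scl_simps)
lemma off_1: "off i 1" "off i 0" unfolding off_def by auto
lemma off_xv: "i ~= j ==> off i (xv j)" unfolding off_def by(auto simp: xx_comm dx_diff[symmetric] intro!: lop_eqI ext) (auto simp: ap_sg ap_xv fun_upd_twist)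
lemma off_dv: "i ~= j ==> off i (dv j)" unfolding off_def by(auto simp: dd_comm dx_diff intro!: lop_eqI ext) (auto simp: ap_sg ap_dv fun_upd_twist)

lemma off_lx: "i ~= j ==> off i (lx d j z a b)" by(simp add: lx_def off_add off_diff off_mult off_scl off_1 off_xv off_dv)

lemma off_mm: "(!!a b. off i (A a b)) ==> (!!a b. off i (B a b)) ==> off i (mm A B a b)" by(simp add: mm_def off_add off_mult)

lemma off_id2: "off i (id2 a b)" by(simp add: id2_def off_1)

lemma off_Zm: "i ~: set is ==> off i (Zm d c c' is u a b)" by(induction "is" arbitrary: a b) (auto simp: off_id2 intro!: off_mm off_lx)

lemma LP_lx: "LP (%u. lx d i (u + z) a b)"
proof -
 let ?A = "1::(nat=>nat) lop"
 have "LP (%u. u *: ?A + T)" for T by(intro LP_add LP_var LP_const)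
 moreover have "(u + z - of_nat (d i)) *: ?A + xv i * dv i = u *: 1 + ((z - of_nat (d i)) *: 1 + xv i * dv i)" for u by(simp add: scl_simps alg)
 moreover have "(u + z) *: ?A - xv i * dv i = u *: 1 + (z *: 1 - xv i * dv i)" for u by(simp add: scl_simps alg)
 ultimately have "LP (%u. (u + z - of_nat (d i)) *: ?A + xv i * dv i)"
  "LP (%u. (u + z) *: ?A - xv i * dv i)" by presburger+
 thus ?thesis by(cases a; cases b) (simp_all add: lx_def LP_const)
qed

lemma LP_mm: "(!!a b. LP (%u. A u a b)) ==> (!!a b. LP (%u. B u a b)) ==> LP (%u. mm (A u) (B u) a b)" by(simp add: mm_def LP_add LP_mult)

lemma LP_Zm: "LP (%u. Zm d c c' is u a b)" by(induction "is" arbitrary: a b) (auto simp: LP_const intro!: LP_mm LP_lx)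

lemma off_sgD: "off i T ==> sg i p * (T * X) = T * (sg i p * X)" unfolding off_def by(metis mult.assoc)

lemma sg_lx:
 "sg i p * lx d i z False False = (z - of_nat p) *: sg i p"
 "sg i p * lx d i z False True = of_nat (Suc p) *: sg i (Suc p)"
 "sg i p * lx d i z True True = (z - of_nat (d i) + of_nat p) *: sg i p" proof -
 have *: "sg i p * (xv i * dv i) = of_nat p *: sg i p" by(cases p) (simp_all add: mult.assoc[symmetric] sg_xv sg_dv scl_simps)
 show "sg i p * lx d i z False False = (z - of_nat p) *: sg i p"
  "sg i p * lx d i z True True = (z - of_nat (d i) + of_nat p) *: sg i p" by(simp_all add: lx_def alg * scl_simps)
 show "sg i p * lx d i z False True = of_nat (Suc p) *: sg i (Suc p)" by(simp add: lx_def sg_dv del: of_nat_Suc)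
qed

text \<open>The outer row \<open>False\<close> and the outer column \<open>True\<close> contain no
  raising entry, so the coefficient of \<open>x_i^p\<close> sees only the coefficients
  \<open>p\<close>, \<open>p + 1\<close> and \<open>p + 2\<close> of the argument.\<close>

lemma sg_Zm:
 fixes p :: nat and d :: "nat => nat" and c c' :: "nat => complex" and u :: complex
 assumes "i ~: set is"
 defines "Z == Zm d c c' is u"
 shows "sg i p * Zm d c c' (i # is) u False True =
   (u + c i - of_nat p) *: (of_nat (Suc p) *: (Z False False * sg i (Suc p)) + (u + c' i - of_nat (d i) + of_nat p) *: (Z False True * sg i p))
  + of_nat (Suc p) *: (of_nat (Suc (Suc p)) *: (Z True False * sg i (Suc (Suc p))) + (u + c' i - of_nat (d i) + of_nat (Suc p)) *: (Z True True * sg i (Suc p)))"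
proof -
 have o: "sg i q * (Z a b * X) = Z a b * (sg i q * X)" for a b q X unfolding Z_def using off_sgD[OF off_Zm[OF assms(1)]] .
 have e: "sg i p * (lx d i z False b * X) = (if b then of_nat (Suc p) *: (sg i (Suc p) * X) else (z - of_nat p) *: (sg i p * X))" for b z X
  by(simp add: mult.assoc[symmetric] sg_lx scl_simps left_diff_distrib del: of_nat_Suc)
 let ?A = "lx d i (u + c' i) False True"
 let ?B = "lx d i (u + c' i) True True"
 have l: "sg i p * Zm d c c' (i # is) u False True =
   sg i p * (lx d i (u + c i) False False * (Z False False * ?A + Z False True * ?B))
  + sg i p * (lx d i (u + c i) False True * (Z True False * ?A + Z True True * ?B))" by(simp add: mm_def Z_def alg)
 show ?thesis unfolding l e if_True if_False simp_thms distrib_left o sg_lx by(simp only: scl_simps(1-4))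
qed

lemma om0 [simp]: "om (%_. 0) = 1" by(simp add: om_def)

lemma lx_om: "ap (lx d i z False False) om = z *. om" "ap (lx d i z True True) om = (z - of_nat (d i)) *. om"
  "ap (lx d i z False True) om = 0" proof -
 have d: "ap (dv i) om = 0" by(auto simp: fun_eq_iff fa ap_dv om_def)
 show "ap (lx d i z False False) om = z *. om" "ap (lx d i z True True) om = (z - of_nat (d i)) *. om"
  "ap (lx d i z False True) om = 0" by(simp_all add: lx_def d)
qed

lemma Zm_om:
 "ap (Zm d c c' is u False True) om = 0 \<and>
  ap (Zm d c c' is u True True) om = (\<Prod>j\<leftarrow>is. (u + c j - of_nat (d j)) * (u + c' j - of_nat (d j))) *. om"
 by(induction "is") (simp_all add: id2_def mm_def lx_om ap_vs vs_simps vs_simps(6,7)[symmetric] mult_ac del: vs_simps(6,7))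

text \<open>The excluded equations are the possible zeros met in \<open>sing\<close>: the scalar
  produced by site \<open>i\<close> and the factors of the vacuum eigenvalue of the remaining sites,
  all at \<open>u = p - 1 - c i\<close>.\<close>

definition cond :: "(nat => nat) => (nat => complex) => (nat => complex) => nat list => bool" where
 "cond d c c' is <-> (ALL i:set is. ALL p:{1..d i}.
    2 * of_nat p - 1 - c i + c' i - of_nat (d i) ~= 0 \<and>
    (ALL j:set is. j ~= i --> of_nat p - 1 - c i + c j - of_nat (d j) ~= 0 & of_nat p - 1 - c i + c' j - of_nat (d j) ~= 0))"

lemma condD:
 assumes "cond d c c' is" "i : set is" "1 <= p" "p <= d i"
 shows "2 * of_nat p - 1 - c i + c' i - of_nat (d i) ~= 0"
  "j : set is ==> j ~= i ==> of_nat p - 1 - c i + c j - of_nat (d j) ~= 0"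
  "j : set is ==> j ~= i ==> of_nat p - 1 - c i + c' j - of_nat (d j) ~= 0" proof -
 have "p : {1..d i}" using assms by simp
 with assms(1,2) show "2 * of_nat p - 1 - c i + c' i - of_nat (d i) ~= 0"
  "j : set is ==> j ~= i ==> of_nat p - 1 - c i + c j - of_nat (d j) ~= 0"
  "j : set is ==> j ~= i ==> of_nat p - 1 - c i + c' j - of_nat (d j) ~= 0" unfolding cond_def by blast+
qed

lemma sg_HH: "h : HH d (i # is) ==> i ~: set is ==> ap (sg i p) h : HH d is" unfolding HH_def ap_sg by(auto split: if_splits) (metis fun_upd_other fun_upd_same)+

text \<open>The highest coefficient in the outermost variable is again singular for the inner sites,
  hence a multiple of \<open>om\<close>. If it belonged to a positive power, specialising
  \<open>u\<close> in the next lower coefficient equation would force a factor excluded by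
  \<open>cond\<close> to vanish.\<close>

lemma sing:
 assumes "distinct is" "cond d c c' is" "h : HH d is" "!!u. ap (Zm d c c' is u False True) h = 0"
 shows "h = h (%_. 0) *. om" using assms proof(induction "is" arbitrary: h)
 case Nil
 hence z: "h x = 0" if "x ~= (%_. 0)" for x using that by(auto simp: HH_def)
 show ?case
 proof(rule ext)
  fix x show "h x = (h (%_. 0) *. om) x" using z[of x] by(cases "x = (%_. 0)") (simp_all add: om_def vs_apply)
 qed
next
 case (Cons i "is")
 have i: "i ~: set is" using Cons.prems(1) by simp
 have cond: "cond d c c' is" using Cons.prems(2) by(auto simp: cond_def)
 let ?Z = "Zm d c c' is"
 define eta where "eta p = ap (sg i p) h" for p
 have eta_H: "eta p : HH d is" for p unfolding eta_def by(rule sg_HH[OF Cons.prems(3) i])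
 have eta_0: "eta p = 0" if "p > d i" for p using Cons.prems(3) that unfolding eta_def by(auto simp: fun_eq_iff fa ap_sg HH_def)
 have eq: "(u + c i - of_nat p) *. (of_nat (Suc p) *. ap (?Z u False False) (eta (Suc p)) + (u + c' i - of_nat (d i) + of_nat p) *. ap (?Z u False True) (eta p))
  + of_nat (Suc p) *. (of_nat (Suc (Suc p)) *. ap (?Z u True False) (eta (Suc (Suc p))) + (u + c' i - of_nat (d i) + of_nat (Suc p)) *. ap (?Z u True True) (eta (Suc p))) = 0" for u p
  using arg_cong[OF sg_Zm[OF i, of p d c c' u], of "%T. ap T h"] Cons.prems(4)[of u] unfolding eta_def by(simp add: ap_vs del: of_nat_Suc Zm.simps)
 \<comment> \<open>Above \<open>p\<close> all coefficients vanish, so the equation for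
   \<open>p\<close> has a single term. Its scalar factor is nonzero off two values of
   \<open>u\<close>, and polynomiality supplies those.\<close>
 have top: "eta p = eta p (%_. 0) *. om" if z: "!!q. q > p ==> eta q = 0" for p proof(rule Cons.IH[OF _ cond eta_H])
  show "distinct is" using Cons.prems(1) by simp
  fix u
  have g: "((u + c i - of_nat p) * (u + c' i - of_nat (d i) + of_nat p)) *. ap (?Z u False True) (eta p) = 0" for u
   using eq[of u p] z[of "Suc p"] z[of "Suc (Suc p)"] by(simp add: vs_simps(1,3,10))
  show "ap (?Z u False True) (eta p) = 0" proof(rule PF_zero[OF LP_PF[OF LP_Zm], of "- {of_nat p - c i, of_nat (d i) - of_nat p - c' i}"])
   show "infinite (- {of_nat p - c i, of_nat (d i) - of_nat p - c' i})" by(metis finite.emptyI finite_insert finite_compl infinite_UNIV_char_0)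
   fix u assume u: "u : - {of_nat p - c i, of_nat (d i) - of_nat p - c' i}"
   let ?k = "(u + c i - of_nat p) * (u + c' i - of_nat (d i) + of_nat p)"
   have "u + c i - of_nat p ~= 0" "u + c' i - of_nat (d i) + of_nat p ~= 0" using u by(auto simp: alg)
   hence k: "?k ~= 0" by simp
   show "ap (?Z u False True) (eta p) = 0" using vs_eq_0[OF g k] .
  qed
 qed
 have van: "eta p = 0" if p1: "p >= 1" for p proof(rule ccontr)
  assume ne: "eta p ~= 0"
  define S where "S = {q. eta q ~= 0}"
  have fS: "finite S" using eta_0 unfolding S_def by(metis (mono_tags, lifting) finite_nat_set_iff_bounded_le leI mem_Collect_eq)
  define m where "m = Max S"
  have m: "m : S" "!!q. q > m ==> eta q = 0" "p <= m" using Max_in[OF fS] Max_ge[OF fS] ne unfolding m_def S_def by(auto simp: not_le[symmetric])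
  obtain k where k: "m = Suc k" using m(3) p1 by(cases m) auto
  have e: "eta m = eta m (%_. 0) *. om" using top[of m] m(2) by blast
  hence n0: "eta m (%_. 0) ~= 0" using m(1) unfolding S_def by(auto simp: vs_simps(3))
  have md: "m <= d i" using m(1) eta_0[of m] unfolding S_def by(auto simp: not_le[symmetric])
  \<comment> \<open>At this value the factor \<open>u + c i - k\<close> vanishes, and only the
    vacuum eigenvalue on the top coefficient survives.\<close>
  let ?u = "of_nat k - c i"
  let ?s = "(\<Prod>j\<leftarrow>is. (?u + c j - of_nat (d j)) * (?u + c' j - of_nat (d j)))"
  let ?A = "?u + c' i - of_nat (d i) + of_nat (Suc k)"
  have "of_nat (Suc k) *. (?A *. ap (?Z ?u True True) (eta m)) = 0" using eq[of ?u k] m(2)[of "Suc m"] unfolding k by(simp add: vs_simps(3,10) del: of_nat_Suc)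
  hence "(of_nat (Suc k) * ?A * (eta m (%_. 0) * ?s)) *. om = 0" by(subst (asm) e) (simp add: ap_vs Zm_om vs_simps(1) mult.assoc del: of_nat_Suc)
  from fun_cong[OF this, of "%_. 0"]
  have z: "of_nat (Suc k) * ?A * (eta m (%_. 0) * ?s) = 0" by(simp add: vs_apply fa del: of_nat_Suc)
  have "2 * of_nat m - 1 - c i + c' i - of_nat (d i) ~= 0" by(rule condD(1)[OF Cons.prems(2)]) (use md k in auto)
  hence 1: "?u + c' i - of_nat (d i) + of_nat (Suc k) ~= 0" unfolding k by(simp add: alg)
  have "?s ~= 0" proof -
   have "(?u + c j - of_nat (d j)) * (?u + c' j - of_nat (d j)) ~= 0" if "j : set is" for j proof -
    have "j ~= i" using that i by auto
    hence "of_nat m - 1 - c i + c j - of_nat (d j) ~= 0 & of_nat m - 1 - c i + c' j - of_nat (d j) ~= 0" using condD(2,3)[OF Cons.prems(2), of i m j] md k that by auto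
    hence "?u + c j - of_nat (d j) ~= 0 & ?u + c' j - of_nat (d j) ~= 0" unfolding k by(simp add: alg)
    thus ?thesis by simp
   qed
   thus ?thesis by(auto simp: prod_list_zero_iff)
  qed
  thus False using z 1 n0 by(simp del: of_nat_Suc)
 qed
 have "h = ap (sg i 0) h" proof(rule ext)
  fix x
  have "h x = eta (x i) (x(i := 0))" by(simp add: eta_def ap_sg)
  also have "... = ap (sg i 0) h x" using van[of "x i"] by(cases "x i = 0") (auto simp: eta_def ap_sg fa fun_upd_idem)
  finally show "h x = ap (sg i 0) h x" .
 qed
 hence "h = eta 0" by(simp add: eta_def)
 thus ?case using top[of 0] van by(metis One_nat_def Suc_leI)
qed

text \<open>The change of total degree caused by the entry \<open>a b\<close>; it is a difference of
  index weights, so it adds up along matrix products.\<close>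

definition wt :: "bool => bool => int" where
 "wt a b = (if a = b then 0 else if b then - 1 else 1)"

definition Hm :: "nat list => int => (arr => complex) set" where
 "Hm is m = {h. ALL c. h c ~= 0 --> int (SUM i:set is. c i) <= m}"

definition fil :: "nat list => int => arr lop => bool" where
 "fil is e T <-> (ALL m. ALL h:Hm is m. ap T h : Hm is (m + e))"

lemma fil_mult: "fil is e S ==> fil is e' T ==> e'' = e + e' ==> fil is e'' (S * T)" unfolding fil_def by(auto simp: ac_simps) (metis add.assoc add.commute)
lemma Hm_add: "f : Hm is m ==> g : Hm is m ==> f + g : Hm is m" unfolding Hm_def by(auto simp: fa) (metis add.right_neutral)
lemma Hm_diff: "f : Hm is m ==> g : Hm is m ==> f - g : Hm is m" unfolding Hm_def by(auto simp: fa) (metis)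
lemma Hm_vs: "f : Hm is m ==> z *. f : Hm is m" unfolding Hm_def by(auto simp: vs_apply)
lemma fil_add: "fil is e S ==> fil is e T ==> fil is e (S + T)" unfolding fil_def by(auto simp: Hm_add)
lemma fil_diff: "fil is e S ==> fil is e T ==> fil is e (S - T)" unfolding fil_def by(auto simp: Hm_diff)
lemma fil_scl: "fil is e S ==> fil is e (z *: S)" unfolding fil_def by(auto simp: Hm_vs)
lemma fil_1: "fil is 0 1" unfolding fil_def by auto
lemma fil_0: "fil is e 0" unfolding fil_def Hm_def by(auto simp: fa)

lemma sum_upd: "i : A ==> finite A ==> (SUM j:A. (c(i := k)) j) + c i = (SUM j:A. c j) + (k::nat)" by(simp add: sum.remove[of A i] )

lemma fil_xv: assumes i: "i : set is" shows "fil is 1 (xv i)" unfolding fil_def Hm_def mem_Collect_eq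
proof(intro allI ballI impI)
 fix m h c assume "h : {h. ALL c. h c ~= 0 --> int (SUM i:set is. c i) <= m}" "ap (xv i) h c ~= 0"
 hence "int (SUM j:set is. (c(i := c i - 1)) j) <= m" "c i ~= 0" unfolding mem_Collect_eq by(metis ap_xv)+
 thus "int (SUM j:set is. c j) <= m + 1" using sum_upd[OF i finite_set, of c "c i - 1"] by linarith
qed

lemma fil_dv: assumes i: "i : set is" shows "fil is (-1) (dv i)" unfolding fil_def Hm_def mem_Collect_eq
proof(intro allI ballI impI)
 fix m h c assume "h : {h. ALL c. h c ~= 0 --> int (SUM i:set is. c i) <= m}" "ap (dv i) h c ~= 0"
 hence "int (SUM j:set is. (c(i := Suc (c i))) j) <= m" unfolding mem_Collect_eq by(metis ap_dv mult_zero_right)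
 thus "int (SUM j:set is. c j) <= m + - 1" using sum_upd[OF i finite_set, of c "Suc (c i)"] by linarith
qed

lemma fil_lx: "i : set is ==> fil is (wt a b) (lx d i z a b)"
proof -
 assume i: "i : set is"
 have xd: "fil is 0 (xv i * dv i)" by(rule fil_mult[OF fil_xv[OF i] fil_dv[OF i]]) simp
 have xxd: "fil is 1 (xv i * (xv i * dv i))" by(rule fil_mult[OF fil_xv[OF i] xd]) simp
 show ?thesis by(cases a; cases b) (simp_all add: lx_def wt_def fil_add fil_diff fil_scl fil_1 xd xxd fil_xv[OF i] fil_dv[OF i])
qed

lemma wt_add: "wt a c = wt a b + wt b c" by(auto simp: wt_def)

lemma fil_mm: "(!!a b. fil is (wt a b) (A a b)) ==> (!!a b. fil is (wt a b) (B a b)) ==> fil is (wt a b) (mm A B a b)"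
 unfolding mm_def by(intro fil_add fil_mult[OF _ _ wt_add])

lemma fil_id2: "fil is (wt a b) (id2 a b)" by(simp add: id2_def fil_1 fil_0 wt_def)

lemma fil_Zm: "set js <= set is ==> fil is (wt a b) (Zm d c c' js u a b)" by(induction js arbitrary: a b) (auto simp: fil_id2 intro!: fil_mm fil_lx)

lemma HH_vs: "f : HH d is ==> z *. f : HH d is" unfolding HH_def by(auto simp: vs_apply)
lemma HH_add: "f : HH d is ==> g : HH d is ==> f + g : HH d is" unfolding HH_def by(auto simp: fa) (metis add.right_neutral)+
lemma csub_HH: "csubspace (HH d is)" by(rule csubI) (auto simp: HH_vs HH_add, auto simp: HH_def fa)

lemma HH_set: "set is = set js ==> HH d is = HH d js" by(simp add: HH_def)

text \<open>A nonzero element of least total degree in \<open>U\<close> must be annihilated by the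
  entry \<open>False True\<close>, which lowers the degree; \<open>sing\<close> then makes it a
  multiple of \<open>om\<close>.\<close>

lemma om_in:
 assumes "distinct is" "cond d c c' is" "csubspace U" "U <= HH d is" "U ~= {0}"
  and st: "!!u h. h : U ==> ap (Zm d c c' is u False True) h : U"
 shows "om : U" proof -
 define P where "P m <-> (EX h:U. h ~= 0 & h : Hm is (int m))" for m
 obtain h0 where h0: "h0 : U" "h0 ~= 0" using assms(3,5) csub_0 by blast
 have "h0 : Hm is (int (SUM i:set is. d i))" using h0 assms(4) unfolding Hm_def HH_def by(auto intro!: sum_mono simp flip: of_nat_sum)
 hence ex: "EX m. P m" unfolding P_def using h0 by blast
 define m where "m = (LEAST m. P m)"
 have m: "P m" unfolding m_def using ex by(rule LeastI_ex)
 then obtain h where h: "h : U" "h ~= 0" "h : Hm is (int m)" unfolding P_def by blast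
 have z: "ap (Zm d c c' is u False True) h = 0" for u proof(rule ccontr)
  let ?g = "ap (Zm d c c' is u False True) h"
  assume n: "?g ~= 0"
  have g: "?g : Hm is (int m - 1)" using fil_Zm[of "is" "is" False True d c c' u] h(3) unfolding fil_def wt_def by auto
  obtain x where x: "?g x ~= 0" using n by(auto simp: fun_eq_iff fa)
  hence "int (SUM i:set is. x i) <= int m - 1" using g unfolding Hm_def by blast
  hence mpos: "m >= 1" by linarith
  hence "P (m - 1)" unfolding P_def using n st[OF h(1)] g by(metis of_nat_1 of_nat_diff)
  thus False using mpos not_less_Least[of "m - 1" P] unfolding m_def by simp
 qed
 have e: "h = h (%_. 0) *. om" by(rule sing[OF assms(1,2) _ z]) (use h assms(4) in auto)
 hence n: "h (%_. 0) ~= 0" using h(2) by(auto simp: vs_simps(3))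
 have "om = (inverse (h (%_. 0)) * h (%_. 0)) *. om" using n by(simp add: vs_simps(2))
 also have "... = inverse (h (%_. 0)) *. h" by(subst (3) e) (simp add: vs_simps(1))
 finally show ?thesis using csub_vs[OF assms(3) h(1)] by metis
qed

definition grid :: "(nat => nat) => nat list => (nat => nat) set" where
 "grid d is = {c. (ALL i:set is. c i <= d i) & (ALL i. i ~: set is --> c i = 0)}"

lemma finite_grid: "finite (grid d is)"
proof -
 let ?A = "Max (d ` set is)"
 have "grid d is <= {f. ALL x. (x : set is --> f x : {..?A}) & (x ~: set is --> f x = 0)}"
 proof(intro subsetI CollectI allI conjI impI)
  fix f x assume f: "f : grid d is"
  { assume x: "x : set is"
   have "f x <= d x" using f x by(simp add: grid_def)
   also have "d x <= ?A" using x by simp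
   finally show "f x : {..?A}" by simp }
  show "f x = 0" if "x ~: set is" using f that by(simp add: grid_def)
 qed
 thus ?thesis using finite_set_of_finite_funs[of "set is" "{..?A}" "0::nat"] finite_subset by blast
qed

lemma HH_grid: "HH d is = {h. ALL c. h c ~= 0 --> c : grid d is}" by(auto simp: HH_def grid_def)

text \<open>The contravariant form of the sites: the weight \<open>c! (d - c)!\<close> per variable
  makes the derivative adjoint to \<open>d x - x^2 D\<close>, so entry \<open>a b\<close> of a Lax
  matrix is adjoint to entry \<open>b a\<close>.\<close>

definition bf :: "(nat => nat) => nat list => (arr => complex) => (arr => complex) => complex" where
 "bf d is x y = (SUM c:grid d is. (PROD i:set is. fact (c i) * fact (d i - c i)) * x c * y c)"

definition pres :: "(nat => nat) => nat list => arr lop => bool" where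
 "pres d is T <-> (ALL h:HH d is. ap T h : HH d is)"
definition adj :: "(nat => nat) => nat list => arr lop => arr lop => bool" where
 "adj d is S T <-> pres d is S & pres d is T & (ALL x:HH d is. ALL y:HH d is. bf d is (ap S x) y = bf d is x (ap T y))"

lemma adj_mult: "adj d is S S' ==> adj d is T T' ==> adj d is (S * T) (T' * S')" unfolding adj_def pres_def by auto
lemma adj_add: "adj d is S S' ==> adj d is T T' ==> adj d is (S + T) (S' + T')" unfolding adj_def pres_def by(auto simp: HH_add) (simp add: bf_def fa alg sum.distrib)
lemma adj_1: "adj d is 1 1" "adj d is 0 0" unfolding adj_def pres_def by(auto simp: csub_0[OF csub_HH]) (simp add: bf_def fa)

lemma ap_lx:
 "ap (lx d i z False False) h c = (z - of_nat (c i)) * h c"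
 "ap (lx d i z True True) h c = (z - of_nat (d i) + of_nat (c i)) * h c"
 "ap (lx d i z False True) h c = of_nat (Suc (c i)) * h (c(i := Suc (c i)))"
 "ap (lx d i z True False) h c = (if c i = 0 then 0 else (of_nat (d i) - of_nat (c i - 1)) * h (c(i := c i - 1)))" proof -
 have x: "ap (xv i) (ap (dv i) h) c = of_nat (c i) * h c" for c by(auto simp: ap_xv ap_dv simp del: of_nat_Suc)
 show "ap (lx d i z False False) h c = (z - of_nat (c i)) * h c"
  "ap (lx d i z True True) h c = (z - of_nat (d i) + of_nat (c i)) * h c"
  "ap (lx d i z False True) h c = of_nat (Suc (c i)) * h (c(i := Suc (c i)))" by(simp_all add: lx_def fa vs_apply x ap_dv alg)
 show "ap (lx d i z True False) h c = (if c i = 0 then 0 else (of_nat (d i) - of_nat (c i - 1)) * h (c(i := c i - 1)))"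
  by(simp add: lx_def fa vs_apply ap_xv[of i "ap (xv i) (ap (dv i) h)"] x ap_xv[of i h] alg)
qed

text \<open>The raising entry annihilates \<open>x^d\<close>, so the degree bound survives
  it.\<close>

lemma pres_lx: "i : set is ==> pres d is (lx d i z a b)"
proof -
 assume i: "i : set is"
 have 0: "c : grid d is" if g: "c(i := k) : grid d is" and k: "k ~= d i | c i <= k" "c i <= Suc k" for c k unfolding grid_def mem_Collect_eq
 proof(intro conjI ballI allI impI)
  have g': "(c(i := k)) j <= d j" if "j : set is" for j using g that unfolding grid_def by blast
  fix j assume "j : set is"
  thus "c j <= d j" using g'[of j] k by(cases "j = i") auto
 next
  fix j assume j: "j ~: set is"
  hence "(c(i := k)) j = 0" using g unfolding grid_def by blast
  thus "c j = 0" using i j by(auto split: if_splits)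
 qed
 have 1: "c : grid d is" if "c(i := Suc (c i)) : grid d is" for c using 0[OF that] by simp
 have 2: "c : grid d is" if "c(i := c i - 1) : grid d is" "c i - 1 ~= d i" for c using 0[OF that(1)] that(2) by simp
 show ?thesis unfolding pres_def HH_grid
 proof(clarify)
  fix h c assume h: "ALL c. h c ~= 0 --> c : grid d is" and n: "ap (lx d i z a b) h c ~= 0"
  show "c : grid d is" proof(cases "a = b")
   case True
   hence "h c ~= 0" using n by(cases a) (auto simp: ap_lx)
   thus ?thesis using h by blast
  next
   case False
   show ?thesis
   proof(cases a)
    case True
    with n \<open>a ~= b\<close> have "ap (lx d i z True False) h c ~= 0" by simp
    hence "c i - 1 ~= d i" "h (c(i := c i - 1)) ~= 0" unfolding ap_lx by(metis diff_self mult_zero_left mult_zero_right)+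
    thus ?thesis using h 2 by blast
   next
    case False
    hence "h (c(i := Suc (c i))) ~= 0" using n \<open>a ~= b\<close> by(auto simp: ap_lx)
    thus ?thesis using h 1 by blast
   qed
  qed
 qed
qed

lemma adj_lx:
 assumes i: "i : set is"
 shows "adj d is (lx d i z a b) (lx d i z b a)" proof -
 define w where "w c = (PROD i:set is. fact (c i) * fact (d i - c i) :: complex)" for c :: "nat => nat"
 \<comment> \<open>The ratio of neighbouring weights converts the coefficient of the derivative into
   that of the raising entry.\<close>
 have ww: "w (c(i := Suc (c i))) * (of_nat (d i) - of_nat (c i)) = w c * of_nat (Suc (c i))" if "c i < d i" for c proof -
  have "(PROD j:set is - {i}. fact ((c(i := Suc (c i))) j) * fact (d j - (c(i := Suc (c i))) j) :: complex)
    = (PROD j:set is - {i}. fact (c j) * fact (d j - c j))" by(rule prod.cong) auto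
  moreover have "d i - c i = Suc (d i - Suc (c i))" using that by simp
  hence "fact (d i - c i) = (of_nat (d i) - of_nat (c i) :: complex) * fact (d i - Suc (c i))" using that by(simp add: of_nat_diff)
  ultimately show ?thesis unfolding w_def using i by(simp add: prod.remove[of "set is" i] del: of_nat_Suc)
 qed
 have pm: "bf d is (ap (lx d i z False True) x) y = bf d is x (ap (lx d i z True False) y)"
  if x: "x : HH d is" and y: "y : HH d is" for x y proof -
  let ?G = "grid d is"
  have gi: "c i <= d i" if "c : ?G" for c using that i by(auto simp: grid_def)
  have up: "c(i := Suc (c i)) : ?G" if "c : ?G" "c i < d i" for c using that i by(auto simp: grid_def)
  have dn: "c(i := c i - 1) : ?G" if c: "c : ?G" for c unfolding grid_def mem_Collect_eq proof(intro conjI ballI allI impI)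
   fix j assume "j : set is"
   hence "c j <= d j" using c unfolding grid_def by blast
   thus "(c(i := c i - 1)) j <= d j" by(cases "j = i") auto
  next
   fix j assume j: "j ~: set is"
   thus "(c(i := c i - 1)) j = 0" using c i unfolding grid_def by(cases "j = i") auto
  qed
  have "bf d is (ap (lx d i z False True) x) y = (SUM c:{c:?G. c i < d i}. w c * (of_nat (Suc (c i)) * x (c(i := Suc (c i)))) * y c)"
   unfolding bf_def ap_lx w_def
  proof(rule sum.mono_neutral_right[OF finite_grid])
   show "ALL c:?G - {c:?G. c i < d i}. (PROD i:set is. fact (c i) * fact (d i - c i)) * (of_nat (Suc (c i)) * x (c(i := Suc (c i)))) * y c = 0"
   proof
    fix c assume c: "c : ?G - {c:?G. c i < d i}"
    have "c(i := Suc (c i)) ~: ?G" using gi[of "c(i := Suc (c i))"] c by auto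
    hence "x (c(i := Suc (c i))) = 0" using x unfolding HH_grid by auto
    thus "(PROD i:set is. fact (c i) * fact (d i - c i)) * (of_nat (Suc (c i)) * x (c(i := Suc (c i)))) * y c = 0" by simp
   qed
  qed auto
  also have "... = (SUM c:{c:?G. c i ~= 0}. w c * x c * ((of_nat (d i) - of_nat (c i - 1)) * y (c(i := c i - 1))))"
  proof(rule sum.reindex_bij_witness[of _ "%c. c(i := c i - 1)" "%c. c(i := Suc (c i))"])
   fix c assume c: "c : {c:?G. c i < d i}"
   show "(c(i := Suc (c i)))(i := (c(i := Suc (c i))) i - 1) = c" by simp
   show "c(i := Suc (c i)) : {c:?G. c i ~= 0}" using up[of c] c by simp
   show "w (c(i := Suc (c i))) * x (c(i := Suc (c i))) * ((of_nat (d i) - of_nat ((c(i := Suc (c i))) i - 1)) * y ((c(i := Suc (c i)))(i := (c(i := Suc (c i))) i - 1)))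
     = w c * (of_nat (Suc (c i)) * x (c(i := Suc (c i)))) * y c" using arg_cong[OF ww[of c], of "%t. t * x (c(i := Suc (c i))) * y c"] c
    by(simp add: mult_ac del: of_nat_Suc)
  next
   fix c assume c: "c : {c:?G. c i ~= 0}"
   thus "(c(i := c i - 1))(i := Suc ((c(i := c i - 1)) i)) = c" by simp
   show "c(i := c i - 1) : {c:?G. c i < d i}" using dn[of c] gi[of c] c by auto
  qed
  also have "... = bf d is x (ap (lx d i z True False) y)" unfolding bf_def ap_lx w_def by(rule sum.mono_neutral_cong_left[OF finite_grid]) auto
  finally show ?thesis .
 qed
 have sym: "bf d is x y = bf d is y x" for x y by(simp add: bf_def mult_ac)
 have dg: "bf d is (ap (lx d i z a a) x) y = bf d is x (ap (lx d i z a a) y)" for a x y by(cases a) (simp_all add: bf_def ap_lx mult_ac)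
 have mp: "bf d is (ap (lx d i z True False) x) y = bf d is x (ap (lx d i z False True) y)"
  if "x : HH d is" "y : HH d is" for x y using pm[OF that(2,1)] sym[of x] sym[of y] by simp
 show ?thesis unfolding adj_def using pres_lx[OF i] dg pm mp by(cases a; cases b) auto
qed

lemma adj_mm: "(!!a b. adj d is (A a b) (A' b a)) ==> (!!a b. adj d is (B a b) (B' b a)) ==> adj d is (mm A B a b) (mm B' A' b a)"
 unfolding mm_def by(intro adj_add adj_mult)

lemma adj_id2: "adj d is (id2 a b) (id2 b a)" by(simp add: id2_def adj_1)

lemma adj_Zm: "set js <= set is ==> adj d is (Zm d c c' js u a b) (Zm d c' c js u b a)"
proof(induction js arbitrary: a b)
 case (Cons i js)
 have "adj d is (mm (mm (lx d i (u + c i)) (Zm d c c' js u)) (lx d i (u + c' i)) a b)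
   (mm (lx d i (u + c' i)) (mm (Zm d c' c js u) (lx d i (u + c i))) b a)" by(intro adj_mm adj_lx Cons.IH) (use Cons.prems in auto)
 thus ?case by(simp add: mm_assoc)
qed (simp add: adj_id2)

text \<open>Elimination of one coordinate: the functional \<open>kde\<close> does not annihilate
  \<open>U\<close>, so some \<open>x1\<close> in \<open>U\<close> has \<open>e\<close>-coordinate 1,
  and subtracting multiples of it reduces the claim to the remaining coordinates.\<close>

lemma annihilator:
 fixes U :: "('x => complex) set"
 assumes "finite G" "csubspace U" "!!f. f : U ==> ALL x. f x ~= 0 --> x : G"
  and "!!y. (ALL x. y x ~= 0 --> x : G) ==> (ALL f:U. (SUM x:G. f x * y x) = 0) ==> y = 0"
  and "ALL x. f x ~= 0 --> x : G"
 shows "f : U" using assms proof(induction G arbitrary: U f rule: finite_induct)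
 case empty
 hence "f = 0" by(auto simp: fun_eq_iff fa)
 thus ?case using csub_0[OF empty.prems(1)] by simp
next
 case (insert e G)
 define U' where "U' = {x:U. x e = 0}"
 define kde where "kde = (%x. if x = e then 1 else 0 :: complex)"
 have U': "csubspace U'"
  unfolding U'_def by(rule csubI) (use csub_0[OF insert.prems(1)] csub_add[OF insert.prems(1)] csub_vs[OF insert.prems(1)] in "auto simp: fa vs_apply")
 obtain x0 where x0: "x0 : U" "x0 e ~= 0" proof(rule ccontr)
  assume "~ thesis"
  hence "ALL f:U. f e = 0" using that by blast
  hence "f x * kde x = 0" if "f : U" for f x using that by(simp add: kde_def)
  hence "ALL f:U. (SUM x:insert e G. f x * kde x) = 0" by(blast intro: sum.neutral)
  hence "kde = 0" by(intro insert.prems(3)) (auto simp: kde_def)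
  hence "kde e = 0" by(simp add: fa)
  thus False by(simp add: kde_def)
 qed
 define x1 where "x1 = inverse (x0 e) *. x0"
 have x1: "x1 : U" "x1 e = 1" using x0 csub_vs[OF insert.prems(1)] by(auto simp: x1_def vs_apply)
 have dec: "g - g e *. x1 : U'" if "g : U" for g using that x1 csub_diff[OF insert.prems(1)] csub_vs[OF insert.prems(1)] by(auto simp: U'_def fa vs_apply)
 have all: "g : U'" if g: "ALL x. g x ~= 0 --> x : G" for g proof(rule insert.IH[OF U'])
  show "ALL x. f x ~= 0 --> x : G" if "f : U'" for f using that insert.prems(2)[of f] unfolding U'_def by auto
  show "y = 0" if y: "ALL x. y x ~= 0 --> x : G" and z: "ALL f:U'. (SUM x:G. f x * y x) = 0" for y proof -
   \<comment> \<open>The correction at \<open>e\<close> extends an annihilator of \<open>U'\<close>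
     to an annihilator of \<open>U\<close>.\<close>
   define y' where "y' = y - (SUM x:G. x1 x * y x) *. kde"
   have ye: "y e = 0" using y insert.hyps by blast
   have y'e: "y' e = - (SUM x:G. x1 x * y x)" by(simp add: y'_def fa vs_apply kde_def ye)
   have y'G: "y' x = y x" if "x : G" for x using that insert.hyps by(auto simp: y'_def fa vs_apply kde_def)
   have "(SUM x:insert e G. f x * y' x) = 0" if f: "f : U" for f proof -
    have "(SUM x:G. (f - f e *. x1) x * y x) = 0" using z dec[OF f] by blast
    hence "(SUM x:G. f x * y x) = f e * (SUM x:G. x1 x * y x)" by(simp add: fa vs_apply alg sum_subtractf sum_distrib_left)
    thus ?thesis using insert.hyps by(simp add: y'e y'G)
   qed
   hence "y' = 0" by(intro insert.prems(3)) (use y in "auto simp: y'_def fa vs_apply kde_def split: if_splits")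
   hence "y x = 0" for x using y'G[of x] ye y by(cases "x : G") (auto simp: fa)
   thus ?thesis by(simp add: fun_eq_iff fa)
  qed
 qed (use g in auto)
 have "ALL x. (f - f e *. x1) x ~= 0 --> x : G"
  using insert.prems(4) insert.prems(2)[OF x1(1)] x1(2) by(auto simp: fa vs_apply) (metis insertE mult.right_neutral mult_zero_right right_minus_eq)+
 hence "f - f e *. x1 : U" using all[of "f - f e *. x1"] by(simp add: U'_def)
 from csub_add[OF insert.prems(1) this csub_vs[OF insert.prems(1) x1(1), of "f e"]] show ?case by simp
qed

lemma om_HH: "om : HH d is" by(auto simp: HH_def om_def)

text \<open>Any nonzero invariant subspace contains \<open>om\<close>. Transposition exchanges left
  and right factors, so the orthogonal complement is stable under the lowering entry of the product
  with \<open>c\<close> and \<open>c'\<close> exchanged; if nonzero it would contain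
  \<open>om\<close> as well, but the form does not vanish at \<open>om\<close>. Hence
  \<open>cond\<close> is required in both orders.\<close>

lemma Zm_irred:
 assumes d: "distinct is" and c: "cond d c c' is" "cond d c' c is"
  and U: "csubspace U" "U <= HH d is" "U ~= {0}"
  and st: "!!u a b h. h : U ==> ap (Zm d c c' is u a b) h : U"
 shows "U = HH d is" proof -
 have om: "om : U" by(rule om_in[OF d c(1) U st])
 define V where "V = {y:HH d is. ALL x:U. bf d is x y = 0}"
 have V: "csubspace V" unfolding V_def
  by(intro csubI) (use csub_0[OF csub_HH] in "auto simp: HH_add HH_vs bf_def fa vs_apply alg sum.distrib simp flip: sum_distrib_left")
 have V0: "V = {0}" proof(rule ccontr)
  assume ne: "V ~= {0}"
  have "om : V" proof(rule om_in[OF d c(2) V _ ne])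
   fix u h assume h: "h : V"
   let ?A = "Zm d c' c is u False True"
   show "ap ?A h : V" unfolding V_def proof(intro CollectI conjI ballI)
    let ?B = "Zm d c c' is u True False"
    have ad: "adj d is ?B ?A" by(rule adj_Zm) simp
    show "ap ?A h : HH d is" using h ad unfolding V_def adj_def pres_def by blast
    fix x assume x: "x : U"
    have "bf d is x (ap ?A h) = bf d is (ap ?B x) h" using ad x h U(2) unfolding V_def adj_def by(auto simp: subset_iff)
    also have "... = 0" using st[OF x] h unfolding V_def by blast
    finally show "bf d is x (ap ?A h) = 0" .
   qed
  qed (auto simp: V_def)
  hence z: "bf d is om om = 0" using om unfolding V_def by blast
  have "(%_. 0) : grid d is" by(simp add: grid_def)
  hence "bf d is om om = (PROD i:set is. fact (d i))"
   unfolding bf_def using sum.remove[OF finite_grid, of "%_. 0" d "is" "%c. (PROD i:set is. fact (c i) * fact (d i - c i)) * om c * om c"] by(simp add: om_def)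
  thus False using z by simp
 qed
 have "f : U" if f: "f : HH d is" for f proof(rule annihilator[OF finite_grid U(1)])
  show "ALL x. g x ~= 0 --> x : grid d is" if "g : U" for g using that U(2) unfolding HH_grid by auto
  show "ALL x. f x ~= 0 --> x : grid d is" using f unfolding HH_grid by auto
  fix y assume y: "ALL x. y x ~= 0 --> x : grid d is" and z: "ALL f:U. (SUM x:grid d is. f x * y x) = 0"
  \<comment> \<open>Division by the weights of \<open>bf\<close> turns the plain annihilator into an
    element of \<open>V\<close>.\<close>
  define w where "w c = (PROD i:set is. fact (c i) * fact (d i - c i) :: complex)" for c :: "nat => nat"
  have w: "w c ~= 0" for c by(simp add: w_def)
  have "(%c. y c / w c) : V" unfolding V_def HH_grid bf_def w_def[symmetric] using y z w by(simp add: mult.commute)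
  hence "(%c. y c / w c) = 0" using V0 by simp
  hence "y c / w c = 0" for c by(metis zero_fun_apply)
  thus "y = 0" using w by(auto simp: fun_eq_iff fa)
 qed
 thus ?thesis using U(2) by blast
qed

section \<open>Exchange relations and reordering of the sites\<close>

fun Tm :: "(nat => nat) => (nat => complex) => nat list => complex => bool => bool => arr lop" where
 "Tm d c [] u = id2"
| "Tm d c (i # is) u = mm (lx d i (u + c i)) (Tm d c is u)"

fun TR :: "(nat => nat) => (nat => complex) => nat list => complex => bool => bool => arr lop" where
 "TR d c [] u = id2"
| "TR d c (i # is) u = mm (TR d c is u) (lx d i (u + c i))"

lemma Zm_Tm_TR: "Zm d c c' is u = mm (Tm d c is u) (TR d c' is u)" by(induction "is") (simp_all add: mm_assoc)

definition sgb :: "bool => bool => complex" where "sgb a b = (if a = b then 1 else - 1)"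

text \<open>Crossing symmetry of a site. It rewrites the right half of \<open>Zm\<close> as a
  transposed monodromy matrix at \<open>-u\<close>.\<close>

lemma lx_flip: "lx d i (u + (of_nat (d i) - c)) a b = (- sgb a b) *: lx d i (- u + c) (~ b) (~ a)"
 by(cases a; cases b) (simp_all add: lx_def sgb_def scl_simps alg)

lemma off_Tm: "i ~: set is ==> off i (Tm d c is u a b)" by(induction "is" arbitrary: a b) (auto simp: off_id2 intro!: off_mm off_lx)

lemma off_comm_lx: "off i T ==> T * lx d i z a b = lx d i z a b * T" unfolding off_def by(cases a; cases b) (simp_all add: lx_def alg scl_simps, (metis mult.assoc)+)

text \<open>Transposing a matrix product reverses it when entries of different factors commute, and
  those of distinct sites do.\<close>

lemma TR_flip:
 assumes "distinct is" "!!i. i : set is ==> c' i = of_nat (d i) - c i"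
 shows "TR d c' is u a b = ((- 1) ^ length is * sgb a b) *: Tm d c is (- u) (~ b) (~ a)" using assms proof(induction "is" arbitrary: a b)
 case Nil
 show ?case by(auto simp: id2_def sgb_def scl_simps)
next
 case (Cons i "is")
 have "TR d c' is u a e * lx d i (u + c' i) e b
   = ((- 1) ^ length (i # is) * sgb a b) *: (lx d i (- u + c i) (~ b) (~ e) * Tm d c is (- u) (~ e) (~ a))" for e proof -
  have "off i (Tm d c is (- u) (~ e) (~ a))" using Cons.prems(1) by(intro off_Tm) simp
  from off_comm_lx[OF this]
  show ?thesis using Cons.IH[of a e] Cons.prems by(simp add: lx_flip scl_simps(1-3)) (auto simp: sgb_def)
 qed
 thus ?case by(simp add: mm_def scl_simps(4) add.commute)
qed

text \<open>The Yangian relation of gl(2) with one order of the two points on each side; in this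
  form a product of commuting solutions is handled one factor at a time.\<close>

definition rtt :: "(complex => bool => bool => 'x lop) => bool" where
 "rtt X <-> (ALL u v i k a b. (u - v) *: (X u i a * X v k b) - X u k a * X v i b
             = (u - v) *: (X v k b * X u i a) - X v k a * X u i b)"

lemma rtt_affine:
 assumes "!!u a b. X u a b = (if a = b then u *: 1 else 0) + e a b"
  and "!!i a k b. e i a * e k b - e k b * e i a = (if k = a then e i b else 0) - (if i = b then e k a else 0)"
 shows "rtt X" unfolding rtt_def proof(intro allI)
 fix u v i k a b
 define s where "s i j = (if i = j then 1 else 0 :: complex)" for i j :: bool
 have X: "X u i a = (u * s i a) *: 1 + e i a" for u i a by(simp add: assms(1) s_def scl_simps)
 have c: "e i a * e k b = e k b * e i a + s k a *: e i b - s i b *: e k a" using assms(2)[of i a k b] by(cases "k = a"; cases "i = b") (simp_all add: s_def scl_simps alg)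
 have "X u k a * X v i b - X v k a * X u i b = (u - v) *: (s k a *: e i b - s i b *: e k a)" by(simp add: X alg scl_simps)
 moreover have "X u i a * X v k b - X v k b * X u i a = s k a *: e i b - s i b *: e k a" by(simp add: X c alg scl_simps)
 hence "(u - v) *: (X u i a * X v k b) - (u - v) *: (X v k b * X u i a) = (u - v) *: (s k a *: e i b - s i b *: e k a)" by(simp only: scl_simps(5)[symmetric])
 ultimately show "(u - v) *: (X u i a * X v k b) - X u k a * X v i b = (u - v) *: (X v k b * X u i a) - X v k a * X u i b"
  by(simp only: diff_eq_eq eq_diff_eq) (simp add: alg)
qed

lemma dx_assoc: "dv i * (xv i * T) = xv i * (dv i * T) + T" by(metis dx_same mult.assoc distrib_right mult_1)

lemma rtt_lx: "rtt (%u. lx d i (u + c))"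
proof(rule rtt_affine[where e = "lx d i c"])
 show "lx d i (u + c) a b = (if a = b then u *: 1 else 0) + lx d i c a b" for u a b by(simp add: lx_def scl_simps)
 show "lx d i c j a * lx d i c k b - lx d i c k b * lx d i c j a = (if k = a then lx d i c j b else 0) - (if j = b then lx d i c k a else 0)" for j a k b
  by(cases j; cases a; cases k; cases b) (simp_all add: lx_def alg scl_simps dx_same dx_assoc mult.assoc)
qed

lemma mm_sum: "mm A B a b = (SUM e:UNIV. A a e * B e b)" by(simp add: mm_def UNIV_bool)

text \<open>The coproduct: since entries of \<open>X\<close> and \<open>Y\<close> commute, the
  exchange is carried out first in \<open>X\<close> and then in \<open>Y\<close>.\<close>

lemma rtt_mm:
 assumes X: "rtt X" and Y: "rtt Y" and c: "!!u v i a k b. Y u i a * X v k b = X v k b * Y u i a"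
 shows "rtt (%u. mm (X u) (Y u))" unfolding rtt_def proof(intro allI)
 fix u v i k j l
 have e: "mm (X u) (Y u) i j * mm (X v) (Y v) k l = (SUM a:UNIV. SUM b:UNIV. X u i a * X v k b * (Y u a j * Y v b l))" for u v i j k l
 proof -
  have "X u i a * Y u a j * (X v k b * Y v b l) = X u i a * X v k b * (Y u a j * Y v b l)" for a b by(metis c mult.assoc)
  thus ?thesis by(simp add: mm_sum sum_product)
 qed
 let ?L = "%a b. X v k b * X u i a"
 have rX: "(u - v) *: (X u i a * X v k b) - X u k a * X v i b = (u - v) *: ?L a b - ?L b a" for a b using X unfolding rtt_def by blast
 have rY: "(u - v) *: (Y u a j * Y v b l) - Y u b j * Y v a l = (u - v) *: (Y v b l * Y u a j) - Y v b j * Y u a l" for a b using Y unfolding rtt_def by blast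
 have "(u - v) *: (mm (X u) (Y u) i j * mm (X v) (Y v) k l) - mm (X u) (Y u) k j * mm (X v) (Y v) i l
   = (SUM a:UNIV. SUM b:UNIV. ((u - v) *: (X u i a * X v k b) - X u k a * X v i b) * (Y u a j * Y v b l))"
  unfolding e by(simp only: scl_sum sum_subtractf left_diff_distrib scl_simps(1))
 also have "... = (SUM a:UNIV. SUM b:UNIV. ((u - v) *: (?L a b) - ?L b a) * (Y u a j * Y v b l))" by(simp only: rX)
 also have "... = (SUM a:UNIV. SUM b:UNIV. ?L a b * ((u - v) *: (Y u a j * Y v b l) - Y u b j * Y v a l))"
  unfolding left_diff_distrib right_diff_distrib sum_subtractf scl_simps(1,2) by(subst (3) sum.swap) simp
 also have "... = (SUM a:UNIV. SUM b:UNIV. ?L a b * ((u - v) *: (Y v b l * Y u a j) - Y v b j * Y u a l))" by(simp only: rY)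
 also have "... = (u - v) *: (mm (X v) (Y v) k l * mm (X u) (Y u) i j) - mm (X v) (Y v) k j * mm (X u) (Y u) i l"
  unfolding e right_diff_distrib scl_simps(2) sum_subtractf scl_sum by(subst (1 2) sum.swap) simp
 finally show "(u - v) *: (mm (X u) (Y u) i j * mm (X v) (Y v) k l) - mm (X u) (Y u) k j * mm (X v) (Y v) i l
   = (u - v) *: (mm (X v) (Y v) k l * mm (X u) (Y u) i j) - mm (X v) (Y v) k j * mm (X u) (Y u) i l" .
qed

lemma rtt_Tm: "distinct is ==> rtt (Tm d c is)"
proof(induction "is")
 case Nil
 show ?case by(auto simp: rtt_def id2_def)
next
 case (Cons i "is")
 have "rtt (%u. mm (lx d i (u + c i)) (Tm d c is u))" by(rule rtt_mm[OF rtt_lx]) (use Cons in "auto intro!: off_comm_lx off_Tm")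
 thus ?case by(simp add: rtt_def)
qed

text \<open>A pair of vectors is coded as one function with a boolean tag, so a relation between two
  spaces becomes a subspace to which the lemmas on single operators apply.\<close>

definition ds :: "'x lop => 'x lop => (bool \<times> 'x) lop" where
 "ds S T = Lop (%f (b, x). if b then ap S (%x. f (True, x)) x else ap T (%x. f (False, x)) x)"

lemma ap_ds: "ap (ds S T) f (b, x) = (if b then ap S (%x. f (True, x)) x else ap T (%x. f (False, x)) x)"
proof -
 have *: "(%x. (f + g) (b, x)) = (%x. f (b, x)) + (%x. g (b, x))" for f g :: "bool \<times> 'x => complex" and b by(simp add: fun_eq_iff fa)
 have "clin (%f (b, x). if b then ap S (%x. f (True, x)) x else ap T (%x. f (False, x)) x)" by(intro clinI ext; clarsimp simp: * ap_vadd ap_vscale; simp add: fa)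
 thus ?thesis unfolding ds_def by(subst ap_Lop) auto
qed

lemma ap_ds2: "(%x. ap (ds S T) f (True, x)) = ap S (%x. f (True, x))" "(%x. ap (ds S T) f (False, x)) = ap T (%x. f (False, x))" by(auto simp: ap_ds)

lemma ds_mult: "ds S T * ds S' T' = ds (S * S') (T * T')" by(rule lop_eqI, rule ext) (auto simp: ap_ds ap_ds2)
lemma ds_diff: "ds S T - ds S' T' = ds (S - S') (T - T')" by(rule lop_eqI, rule ext) (auto simp: ap_ds ap_ds2 fa)
lemma ds_scl: "z *: ds S T = ds (z *: S) (z *: T)" by(rule lop_eqI, rule ext) (auto simp: ap_ds ap_ds2 vs_apply)

lemma rtt_ds: "rtt X ==> rtt Y ==> rtt (%u a b. ds (X u a b) (Y u a b))" unfolding rtt_def ds_mult ds_diff ds_scl by(intro allI arg_cong2[where f = ds]) blast+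

lemma LP_Tm: "LP (%u. Tm d c is u a b)" by(induction "is" arbitrary: a b) (auto simp: LP_const intro!: LP_mm LP_lx)

lemma PF_pair:
 fixes g :: "complex => bool \<times> 'x => complex"
 shows "PF g <-> (ALL b. PF (%u x. g u (b, x)))" proof
 assume "PF g"
 then obtain m G where "!!u. g u = (\<Sum>k<(m::nat). u ^ k *. G k)" by(auto simp: PF_def)
 hence "(%x. g u (b, x)) = (\<Sum>k<m. u ^ k *. (%x. G k (b, x)))" for u b by(simp add: fun_eq_iff sum_fun_apply vs_apply)
 thus "ALL b. PF (%u x. g u (b, x))" unfolding PF_def by(intro allI exI)
next
 assume *: "ALL b. PF (%u x. g u (b, x))"
 define emb where "emb b h = (%(b', x). if b' = b then h x else 0 :: complex)" for b :: bool and h :: "'x => complex"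
 have "PF (%u. emb b (%x. g u (b, x)))" for b proof -
  from *[rule_format, of b] obtain m G where "ALL u. (%x. g u (b, x)) = (\<Sum>k<(m::nat). u ^ k *. G k)" unfolding PF_def by blast
  hence "emb b (%x. g u (b, x)) = (\<Sum>k<m. u ^ k *. emb b (G k))" for u by(auto simp: fun_eq_iff sum_fun_apply vs_apply emb_def intro!: sum.neutral)
  thus ?thesis unfolding PF_def by(intro exI allI)
 qed
 from PF_add[OF this[of True] this[of False]]
 have "PF (%u. emb True (%x. g u (True, x)) + emb False (%x. g u (False, x)))" .
 moreover have "emb True (%x. g u (True, x)) + emb False (%x. g u (False, x)) = g u" for u by(auto simp: fun_eq_iff fa emb_def)
 ultimately show "PF g" by simp
qed

lemma LP_ds: assumes "LP S" "LP T" shows "LP (%u. ds (S u) (T u))" unfolding LP_def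
proof(intro allI impI)
 fix g :: "complex => bool \<times> 'a => complex" assume "PF g"
 hence g: "PF (%u x. g u (b, x))" for b by(simp add: PF_pair)
 have "PF (%u x. ap (ds (S u) (T u)) (g u) (b, x))" for b using assms g[of True] g[of False] unfolding LP_def by(cases b) (auto simp: ap_ds2)
 thus "PF (%u. ap (ds (S u) (T u)) (g u))" by(simp add: PF_pair)
qed

text \<open>Only the entry \<open>True False\<close> is applied. For a highest vector
  \<open>Omega\<close> the span is nevertheless stable under all entries (\<open>NL_closed\<close>),
  so it is the submodule generated by \<open>Omega\<close>.\<close>

inductive_set NL :: "(complex => bool => bool => 'x lop) => ('x => complex) => ('x => complex) set"
 for X :: "complex => bool => bool => 'x lop" and Omega where
 base: "Omega : NL X Omega"
| add: "f : NL X Omega ==> g : NL X Omega ==> f + g : NL X Omega"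
| scale: "f : NL X Omega ==> z *. f : NL X Omega"
| low: "f : NL X Omega ==> ap (X v True False) f : NL X Omega"

lemma csub_NL: "csubspace (NL X Omega)" by(rule csubI) (use NL.scale[OF NL.base, where z = 0] NL.add NL.scale in "auto simp: vs_simps(3)")

text \<open>The exchange relation yields the vector only multiplied by \<open>u - v\<close>;
  polynomiality in \<open>u\<close> recovers the point \<open>u = v\<close>.\<close>

lemma NL_gen:
 assumes "csubspace N" "PF g" "!!u. u ~= v ==> (u - v) *. g u : N"
 shows "g u : N" proof(rule PF_in_subspace[OF assms(1,2), of "- {v}"])
 show "infinite (- {v})" by(simp add: finite_compl infinite_UNIV_char_0)
 fix u assume u: "u : - {v}"
 hence "g u = (1 / (u - v)) *. ((u - v) *. g u)" by(simp add: vs_simps(1,2))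
 thus "g u : N" using csub_vs[OF assms(1) assms(3)] u by(metis ComplD singletonI)
qed

text \<open>Moving another entry to the right past \<open>True False\<close> leaves corrections that
  again start with \<open>True False\<close> or, for the entry \<open>False True\<close>, are
  products of diagonal entries, which are treated before.\<close>

lemma NL_closed:
 assumes X: "rtt X" and LP: "!!a b. LP (%u. X u a b)"
  and hw: "!!u. ap (X u False True) Omega = 0" "!!u. ap (X u True True) Omega = A u *. Omega" "!!u. ap (X u False False) Omega = D u *. Omega"
 shows "z : NL X Omega ==> ap (X u a b) z : NL X Omega" proof -
 let ?N = "NL X Omega"
 note cs = csub_NL[of X Omega]
 have fA: "(u - v) *: (X u i a * X v k b) = (u - v) *: (X v k b * X u i a) + X u k a * X v i b - X v k a * X u i b" for u v i a k b
  using X unfolding rtt_def by(simp add: alg)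
 \<comment> \<open>The same relation with the two points exchanged: for the entry
   \<open>True True\<close> this version has its corrections start with
   \<open>True False\<close>.\<close>
 have fB: "(u - v) *: (X u i a * X v k b) = (u - v) *: (X v k b * X u i a) + X v i b * X u k a - X u i b * X v k a" for u v i a k b
  using fA[of v u k b i a] by(simp add: scl_simps alg)
 have gen: "ALL u. ap (X u a b) (ap (X v True False) f) : ?N"
  if c: "!!u. (u - v) *: (X u a b * X v True False) = (u - v) *: (X v True False * X u a b) + S u - T u"
   and N: "!!u. ap (X u a b) f : ?N" "!!u. ap (S u) f : ?N" "!!u. ap (T u) f : ?N" for v a b f S T proof
  fix u show "ap (X u a b) (ap (X v True False) f) : ?N" proof(rule NL_gen[OF cs, where v = v and g = "%u. ap (X u a b) (ap (X v True False) f)"])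
   show "PF (%u. ap (X u a b) (ap (X v True False) f))" by(rule LP_PF[OF LP])
   fix u show "(u - v) *. ap (X u a b) (ap (X v True False) f) : ?N" using arg_cong[OF c[of u], of "%T. ap T f"] N
    by(auto intro!: csub_add[OF cs] csub_diff[OF cs] csub_vs[OF cs] NL.low)
  qed
 qed
 have 1: "ALL u. ap (X u True True) z : ?N" if "z : ?N" for z using that proof induction
  case (low f v)
  show ?case by(rule gen[OF fB]) (use low in "auto intro: NL.low")
 qed (auto simp: hw ap_vadd ap_vs intro: NL.intros)
 have 2: "ALL u. ap (X u False False) z : ?N" if "z : ?N" for z using that proof induction
  case (low f v)
  show ?case by(rule gen[OF fA]) (use low in "auto intro: NL.low")
 qed (auto simp: hw ap_vadd ap_vs intro: NL.intros)
 have 3: "ALL u. ap (X u False True) z : ?N" if "z : ?N" for z using that proof induction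
  case (low f v)
  show ?case by(rule gen[OF fA]) (use low 1 2 in "auto")
 qed (auto simp: hw ap_vadd ap_vs csub_0[OF cs] intro: NL.intros)
 show "z : ?N ==> ap (X u a b) z : ?N" using 1 2 3 NL.low by(cases a; cases b) auto
qed

lemma Tm_om:
 "distinct is ==> ap (Tm d c is u False True) om = 0 \<and>
  ap (Tm d c is u True True) om = (\<Prod>j\<leftarrow>is. u + c j - of_nat (d j)) *. om \<and>
  ap (Tm d c is u False False) om = (\<Prod>j\<leftarrow>is. u + c j) *. om" proof(induction "is")
 case (Cons i "is")
 have "ap (dv i) om = 0" by(auto simp: fun_eq_iff fa ap_dv om_def)
 let ?A = "Tm d c is u True False"
 have "ap (lx d i z False True) (ap ?A om) = 0" for z proof -
  have "off i ?A" using Cons.prems by(intro off_Tm) simp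
  from arg_cong[OF off_comm_lx[OF this, of d z False True], of "%T. ap T om"]
  show ?thesis by(simp add: lx_om)
 qed
 thus ?case using Cons by(simp add: mm_def lx_om ap_vs vs_simps(1,10) mult_ac)
qed (simp add: id2_def vs_simps(2))

lemma pres_Tm: "set js <= set is ==> h : HH d is ==> ap (Tm d c js u a b) h : HH d is"
proof(induction js arbitrary: a b)
 case (Cons i js)
 thus ?case using pres_lx[of i "is" d] by(auto simp: mm_def pres_def intro!: HH_add)
qed (auto simp: id2_def csub_0[OF csub_HH])

lemma om_nz: "om ~= 0" by(metis om0 zero_fun_apply zero_neq_one)

lemma Tm_low_0: "ap (Tm d c is u True False) h (%_. 0) = 0"
proof(induction "is" arbitrary: h)
 case (Cons i "is")
 show ?case by(simp add: mm_def fa ap_lx Cons)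
qed (simp add: id2_def fa)

lemma Tm_irred:
 assumes "distinct is" "!!i. i : set is ==> c' i = of_nat (d i) - c i" "cond d c c' is" "cond d c' c is"
  "csubspace U" "U <= HH d is" "U ~= {0}" "!!u a b h. h : U ==> ap (Tm d c is u a b) h : U"
 shows "U = HH d is" proof(rule Zm_irred[OF assms(1,3-7)])
 fix u a b h assume h: "h : U"
 have "ap (TR d c' is u a b) h : U" for a b using assms(8)[OF h] by(simp add: TR_flip[OF assms(1,2)] csub_vs[OF assms(5)])
 thus "ap (Zm d c c' is u a b) h : U" by(simp add: Zm_Tm_TR mm_def csub_add[OF assms(5)] assms(8))
qed

text \<open>The domain of \<open>P\<close> and the set of vectors related to 0 are submodules.
  Irreducibility makes the first everything; the second is trivial because equality of constant
  coefficients in \<open>inv\<close> forbids \<open>om\<close> to be related to 0.\<close>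

lemma graph_half:
 assumes di: "distinct is" and c': "!!i. i : set is ==> c' i = of_nat (d i) - c i" and cd: "cond d c c' is" "cond d c' c is"
  and P: "P om om" "!!x y x' y'. P x y ==> P x' y' ==> P (x + x') (y + y')" "!!z x y. P x y ==> P (z *. x) (z *. y)"
   "!!x y u a b. P x y ==> P (ap (Tm d c is u a b) x) (ap (Tm d c js u a b) y)"
  and inv: "!!x y. P x y ==> x : HH d is & x (%_. 0) = y (%_. 0)"
 shows "x : HH d is ==> EX y. P x y" and "P x 0 ==> x = 0" proof -
 have P0: "P 0 0" using P(3)[OF P(1), of 0] by(simp add: vs_simps(3))
 have "{x. EX y. P x y} = HH d is" proof(rule Tm_irred[OF di c' cd])
  show "csubspace {x. EX y. P x y}" by(rule csubI) (use P0 P(2,3) in blast)+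
  show "{x. EX y. P x y} ~= {0}" using P(1) om_nz by blast
 qed (use P(4) inv in blast)+
 thus "x : HH d is ==> EX y. P x y" by blast
 assume x: "P x 0"
 show "x = 0" proof(rule ccontr)
  assume n: "x ~= 0"
  have "{x. P x 0} = HH d is" proof(rule Tm_irred[OF di c' cd])
   show "csubspace {x. P x 0}" by(rule csubI) (use P0 P(2)[of _ 0 _ 0] P(3)[of _ 0] in "auto simp: vs_simps(10)")
   show "{x. P x 0} ~= {0}" using x n by blast
   show "ap (Tm d c is u a b) h : {x. P x 0}" if "h : {x. P x 0}" for h u a b using P(4)[of h 0 u a b] that by simp
  qed (use inv in blast)+
  hence "P om 0" using om_HH by blast
  from inv[OF this] show False by(simp add: fa)
 qed
qed

text \<open>The submodule generated by the pair of vacuum vectors in the sum of the two orderings is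
  the graph of the intertwiner: the vacuum eigenvalues do not depend on the order, and
  \<open>graph_half\<close> applied from both sides gives totality and injectivity. An intertwiner
  for \<open>Tm\<close> also serves \<open>Zm\<close>, whose right half is a transposed
  \<open>Tm\<close>.\<close>

lemma site_reorder:
 assumes di: "distinct is" "distinct js" "set is = set js"
  and c': "!!i. i : set is ==> c' i = of_nat (d i) - c i"
  and cd: "cond d c c' is" "cond d c' c is"
 shows "EX phi. (ALL x:HH d is. ALL y:HH d is. phi (x + y) = phi x + phi y) & (ALL z. ALL x:HH d is. phi (z *. x) = z *. phi x)
   & bij_betw phi (HH d is) (HH d is)
   & (ALL x:HH d is. ALL u a b. phi (ap (Zm d c c' is u a b) x) = ap (Zm d c c' js u a b) (phi x))" proof -
 have cd': "cond d c c' js" "cond d c' c js" using cd di(3) by(simp_all add: cond_def)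
 have c'2: "!!i. i : set js ==> c' i = of_nat (d i) - c i" using c' di(3) by simp
 have HHj: "HH d js = HH d is" by(rule HH_set) (simp add: di(3))
 define X where "X u a b = ds (Tm d c is u a b) (Tm d c js u a b)" for u a b
 define pr where "pr x y = (%(b, z). if b then x z else y z :: complex)" for x y :: "arr => complex"
 have pr_eq: "pr x y = pr x' y' <-> x = x' & y = y'" for x y x' y' by(auto simp: pr_def fun_eq_iff split: if_splits)
 have pr_ex: "EX x y. f = pr x y" for f by(rule exI[of _ "%z. f (True, z)"], rule exI[of _ "%z. f (False, z)"]) (auto simp: pr_def fun_eq_iff)
 have pr_add: "pr x y + pr x' y' = pr (x + x') (y + y')" and pr_vs: "z *. pr x y = pr (z *. x) (z *. y)" for x y x' y' z by(auto simp: pr_def fun_eq_iff fa vs_apply)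
 have X_pr: "ap (X u a b) (pr x y) = pr (ap (Tm d c is u a b) x) (ap (Tm d c js u a b) y)" for u a b x y by(rule ext) (auto simp: X_def pr_def ap_ds)
 have "rtt (%u a b. ds (Tm d c is u a b) (Tm d c js u a b))" by(rule rtt_ds[OF rtt_Tm[OF di(1)] rtt_Tm[OF di(2)]])
 hence rX: "rtt X" unfolding X_def rtt_def .
 have LX: "LP (%u. X u a b)" for a b unfolding X_def by(intro LP_ds LP_Tm)
 define N where "N = NL X (pr om om)"
 note cN = csub_NL[of X "pr om om", folded N_def]
 have pl: "prod_list (map g is) = prod_list (map g js)" for g :: "nat => complex" using di by(metis prod.distinct_set_conv_list)
 have cl: "ap (X u a b) z : N" if "z : N" for u a b z unfolding N_def proof(rule NL_closed[OF rX LX])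
  show "ap (X u False True) (pr om om) = 0" for u by(simp add: X_pr Tm_om[OF di(1)] Tm_om[OF di(2)]) (auto simp: pr_def fun_eq_iff fa)
  show "ap (X u True True) (pr om om) = (\<Prod>j\<leftarrow>is. u + c j - of_nat (d j)) *. pr om om" for u by(simp add: X_pr Tm_om[OF di(1)] Tm_om[OF di(2)] pr_vs pl)
  show "ap (X u False False) (pr om om) = (\<Prod>j\<leftarrow>is. u + c j) *. pr om om" for u by(simp add: X_pr Tm_om[OF di(1)] Tm_om[OF di(2)] pr_vs pl)
 qed (use that in "simp add: N_def")
 \<comment> \<open>Equality of constant coefficients persists because the generating entry produces
   vectors without constant term (\<open>Tm_low_0\<close>).\<close>
 have inv: "x : HH d is & y : HH d is & x (%_. 0) = y (%_. 0)" if "pr x y : N" for x y proof -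
  have "ALL x y. z = pr x y --> x : HH d is & y : HH d is & x (%_. 0) = y (%_. 0)" if "z : N" for z using that unfolding N_def proof induction
   case base
   show ?case by(auto simp: pr_eq om_HH)
  next
   case (add f g)
   obtain x y x' y' where "f = pr x y" "g = pr x' y'" using pr_ex by metis
   thus ?case using add by(auto simp: pr_add pr_eq HH_add fa)
  next
   case (scale f z)
   obtain x y where "f = pr x y" using pr_ex by metis
   thus ?case using scale by(auto simp: pr_vs pr_eq HH_vs vs_apply)
  next
   case (low f v)
   obtain x y where "f = pr x y" using pr_ex by metis
   thus ?case using low di(3) by(auto simp: X_pr pr_eq Tm_low_0 intro!: pres_Tm)
  qed
  thus ?thesis using that by blast
 qed
 have omN: "pr om om : N" unfolding N_def by(rule NL.base)
 have PI: "pr (x + x') (y + y') : N" if "pr x y : N" "pr x' y' : N" for x y x' y' using csub_add[OF cN that] by(simp add: pr_add)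
 have PS: "pr (z *. x) (z *. y) : N" if "pr x y : N" for x y z using csub_vs[OF cN that] by(simp add: pr_vs)
 have PT: "pr (ap (Tm d c is u a b) x) (ap (Tm d c js u a b) y) : N" if "pr x y : N" for x y u a b using cl[OF that] by(simp add: X_pr)
 have inv': "y : HH d js & y (%_. 0) = x (%_. 0)" if "pr x y : N" for x y using inv[OF that] HHj by simp
 have tot1: "EX y. pr x y : N" if "x : HH d is" for x
  by(rule graph_half(1)[where P = "%x y. pr x y : N" and js = js, OF di(1) _ cd omN]) (use c' PI PS PT inv that in blast)+
 have k1: "x = 0" if "pr x 0 : N" for x by(rule graph_half(2)[where P = "%x y. pr x y : N" and js = js, OF di(1) _ cd omN]) (use c' PI PS PT inv that in blast)+
 have tot2: "EX x. pr x y : N" if "y : HH d js" for y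
  by(rule graph_half(1)[where P = "%y x. pr x y : N" and js = "is", OF di(2) _ cd' omN]) (use c'2 PI PS PT inv' that in blast)+
 have k2: "y = 0" if "pr 0 y : N" for y by(rule graph_half(2)[where P = "%y x. pr x y : N" and js = "is", OF di(2) _ cd' omN]) (use c'2 PI PS PT inv' that in blast)+
 have pr_diff: "pr x y - pr x' y' = pr (x - x') (y - y')" for x y x' y' by(auto simp: pr_def fun_eq_iff fa)
 have u2: "y = y'" if "pr x y : N" "pr x y' : N" for x y y' using csub_diff[OF cN that] k2[of "y - y'"] by(simp add: pr_diff)
 have u1: "x = x'" if "pr x y : N" "pr x' y : N" for x x' y using csub_diff[OF cN that] k1[of "x - x'"] by(simp add: pr_diff)
 define phi where "phi x = (THE y. pr x y : N)" for x
 have phi: "pr x (phi x) : N" if xH: "x : HH d is" for x proof -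
  obtain y where y: "pr x y : N" using tot1[OF xH] by blast
  show ?thesis unfolding phi_def by(rule theI[where P = "%y. pr x y : N", OF y]) (rule u2[OF _ y])
 qed
 have phi_I: "phi x = y" if "pr x y : N" for x y using phi[of x] u2[OF _ that] inv[OF that] by blast
 have t: "phi (ap (Tm d c is u a b) x) = ap (Tm d c js u a b) (phi x)" if "x : HH d is" for x u a b by(rule phi_I[OF PT[OF phi[OF that]]])
 have len: "length is = length js" using di by(metis distinct_card)
 have pT: "ap (Tm d c is u a b) x : HH d is" if "x : HH d is" for x u a b by(rule pres_Tm[OF subset_refl that])
 have ad: "phi (x + y) = phi x + phi y" if "x : HH d is" "y : HH d is" for x y by(rule phi_I[OF PI[OF phi[OF that(1)] phi[OF that(2)]]])
 have sc: "phi (z *. x) = z *. phi x" if "x : HH d is" for x z by(rule phi_I[OF PS[OF phi[OF that]]])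
 have "phi (ap (Zm d c c' is u a b) x) = ap (Zm d c c' js u a b) (phi x)" if x: "x : HH d is" for x u a b proof -
  have R: "phi (ap (TR d c' is u a b) x) = ap (TR d c' js u a b) (phi x)" for a b by(simp add: TR_flip[OF di(1) c'] TR_flip[OF di(2) c'2] len sc pT x t)
  have pR: "ap (TR d c' is u a b) x : HH d is" for a b by(simp add: TR_flip[OF di(1) c'] HH_vs pT x)
  show ?thesis by(simp add: Zm_Tm_TR mm_def ad pT pR t R)
 qed
 moreover have "bij_betw phi (HH d is) (HH d is)" proof(rule bij_betw_imageI)
  show "inj_on phi (HH d is)" proof(rule inj_onI)
   fix x y assume "x : HH d is" "y : HH d is" "phi x = phi y"
   thus "x = y" using phi[of x] phi[of y] u1[of x "phi x" y] by simp
  qed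
  show "phi ` HH d is = HH d is" proof
   show "phi ` HH d is <= HH d is" using inv[OF phi] by blast
   show "HH d is <= phi ` HH d is" proof
    fix y assume "y : HH d is"
    then obtain x where x: "pr x y : N" using tot2 HHj by blast
    show "y : phi ` HH d is" using phi_I[OF x] inv[OF x] by blast
   qed
  qed
 qed
 ultimately show ?thesis using ad sc by blast
qed

section \<open>Tensor products of gl(2)-modules in monomial bases\<close>

definition mo :: "'x set => 'x op => 'x lop" where "mo W A = Lop (app W A)"

lemma ap_mo: "ap (mo W A) f = app W A f" unfolding mo_def by(subst ap_Lop) (auto intro!: clinI simp: fun_eq_iff fa app_def alg sum.distrib sum_distrib_left)

lemma mo_cong: "(!!x y. x : W ==> y : W ==> A x y = A' x y) ==> mo W A = mo W A'" by(rule lop_eqI) (simp add: ap_mo app_def cong: sum.cong if_cong)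

lemma mo_add: "mo W (%x y. A x y + A' x y) = mo W A + mo W A'" by(rule lop_eqI) (simp add: ap_mo app_def fun_eq_iff fa distrib_right sum.distrib)
lemma mo_diff: "mo W (%x y. A x y - A' x y) = mo W A - mo W A'" by(rule lop_eqI) (simp add: ap_mo app_def fun_eq_iff fa left_diff_distrib sum_subtractf)
lemma mo_scl: "mo W (%x y. z * A x y) = z *: mo W A" by(rule lop_eqI) (simp add: ap_mo app_def fun_eq_iff vs_apply sum_distrib_left mult_ac)

lemma mo_mult:
 assumes "finite W" shows "mo W (mmul W A C) = mo W A * mo W C" proof(rule lop_eqI)
 fix f
 have "(SUM y:W. (SUM z:W. A x z * C z y) * f y) = (SUM z:W. A x z * (SUM y:W. C z y * f y))" for x
  by(simp add: sum_distrib_left sum_distrib_right mult.assoc) (rule sum.swap)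
 thus "ap (mo W (mmul W A C)) f = ap (mo W A * mo W C) f" by(simp add: ap_mo app_def fun_eq_iff mmul_def cong: sum.cong)
qed

lemma mo_mbr: "finite W ==> mo W (mbr W A C) = mo W A * mo W C - mo W C * mo W A" by(simp add: mbr_def mo_diff mo_mult)

text \<open>Evaluation at a coordinate of largest modulus bounds every eigenvalue; the weights
  \<open>alpha - j\<close> of a lowering string then force the string to stop.\<close>

lemma eigen_bound:
 assumes "finite W"
 shows "EX C. ALL f z. f : vsp W --> f ~= 0 --> app W A f = z *. f --> cmod z <= C" proof(intro exI allI impI)
 fix f z assume f: "f : vsp W" "f ~= 0" "app W A f = z *. f"
 obtain x where x: "x : W" "!!y. y : W ==> cmod (f y) <= cmod (f x)" proof -
  have "W ~= {}" using f(1,2) by(auto simp: vsp_def fun_eq_iff fa)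
  then obtain x where "x : W" "cmod (f x) = Max ((%y. cmod (f y)) ` W)"
   using Max_in[of "(%y. cmod (f y)) ` W"] assms by(metis (no_types, lifting) finite_imageI image_iff image_is_empty)
  thus ?thesis using that assms by simp
 qed
 have n: "f x ~= 0" proof
  assume "f x = 0"
  hence "f y = 0" for y using x(2)[of y] f(1) by(cases "y : W") (auto simp: vsp_def)
  thus False using f(2) by(auto simp: fun_eq_iff fa)
 qed
 let ?A = "SUM x:W. SUM y:W. cmod (A x y)"
 have "cmod z * cmod (f x) = cmod (SUM y:W. A x y * f y)" using fun_cong[OF f(3), of x] x(1) by(simp add: app_def vs_apply norm_mult)
 also have "... <= (SUM y:W. cmod (A x y) * cmod (f x))" by(rule order_trans[OF norm_sum]) (auto intro!: sum_mono mult_left_mono x(2) simp: norm_mult)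
 also have "... <= ?A * cmod (f x)" unfolding sum_distrib_right[symmetric]
  by(intro mult_right_mono member_le_sum[OF x(1), where f = "%x. SUM y:W. cmod (A x y)"]) (auto intro: sum_nonneg assms)
 finally show "cmod z <= ?A" using n by simp
qed

lemma eigen_indep:
 assumes "finite J" "!!j. j : J ==> ap P (v j) = l j *. v j" "inj_on l J" "(SUM j:J. v j) = 0" "j : J"
 shows "v j = 0" using assms proof(induction J arbitrary: v j rule: finite_induct)
 case (insert k J)
 have s: "(SUM i:J. (l i - l k) *. v i) = 0" proof -
  let ?A = "SUM i:insert k J. v i"
  have "ap P ?A - l k *. ?A = 0" using insert.prems(3) by(simp add: vs_simps)
  moreover have "ap P ?A = (SUM i:insert k J. l i *. v i)" using insert.prems(1) by(simp only: ap_vsum cong: sum.cong)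
  ultimately show ?thesis using insert.hyps by(simp add: vs_sum vs_simps sum_subtractf)
 qed
 have J: "v i = 0" if "i : J" for i proof -
  have "(l i - l k) *. v i = 0" proof(rule insert.IH[OF _ _ s that])
   show "ap P ((l j - l k) *. v j) = l j *. (l j - l k) *. v j" if "j : J" for j using insert.prems(1)[of j] that by(simp only: ap_vs vs_simps(1) mult.commute insertI2)
   show "inj_on l J" using insert.prems(2) by simp
  qed
  thus ?thesis using vs_eq_0 that insert.prems(2) insert.hyps by(metis inj_on_contraD insert_iff right_minus_eq)
 qed
 hence "v k = 0" using insert.prems(3) insert.hyps by simp
 thus ?case using J insert.prems(4) by auto
qed simp

lemma vsp_app: "app W A f : vsp W" by(simp add: vsp_def app_def)
lemma csub_vsp: "csubspace (vsp W)" by(rule csubI) (auto simp: vsp_def fa vs_apply)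

text \<open>The scaling makes \<open>w j\<close> correspond to the monomial \<open>x^j\<close>: the
  four generators act on the basis as the four entries of \<open>lx\<close> do at argument
  \<open>alpha\<close>.\<close>

definition gbasis :: "int => 'w set => (int => int => 'w op) => complex => complex => nat => (nat => 'w => complex) => bool" where
 "gbasis N W E alpha beta d w <-> finite W & alpha - beta = of_nat d & (ALL j. w j : vsp W)
  & (ALL j<=d. app W (E (-N) (-N)) (w j) = (alpha - of_nat j) *. w j & app W (E N N) (w j) = (beta + of_nat j) *. w j
     & app W (E (-N) N) (w j) = of_nat j *. w (j - 1) & app W (E N (-N)) (w j) = of_nat (d - j) *. w (Suc j))
  & (ALL a. (\<Sum>j\<le>d. a j *. w j) = 0 --> (ALL j<=d. a j = 0))
  & (ALL f:vsp W. EX a. f = (\<Sum>j\<le>d. a j *. w j))"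

lemma gl2_gbasis:
 assumes g: "gl2_hw N W E alpha beta" and N: "N ~= 0"
 shows "EX d w. gbasis N W E alpha beta d w" proof -
 have fin: "finite W" using g by(simp add: gl2_hw_def)
 define P Q X Y where "P = mo W (E (-N) (-N))" "Q = mo W (E N N)" "X = mo W (E (-N) N)" "Y = mo W (E N (-N))"
 note defs = P_Q_X_Y_def
 have g1: "ALL a:{-N, N}. ALL b:{-N, N}. ALL c:{-N, N}. ALL d:{-N, N}. ALL x:W. ALL y:W.
    mbr W (E a b) (E c d) x y = kd b c * E a d x y - kd d a * E c b x y" using g unfolding gl2_hw_def by(elim conjE)
 have rel: "mo W (E a b) * mo W (E c d) - mo W (E c d) * mo W (E a b) = kd b c *: mo W (E a d) - kd d a *: mo W (E c b)"
  if "a : {-N, N}" "b : {-N, N}" "c : {-N, N}" "d : {-N, N}" for a b c d proof -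
  have "mo W (mbr W (E a b) (E c d)) = mo W (%x y. kd b c * E a d x y - kd d a * E c b x y)" by(rule mo_cong) (use g1 that in blast)
  thus ?thesis by(simp add: mo_mbr[OF fin] mo_diff mo_scl)
 qed
 have NN: "- N ~= N" "N ~= - N" using N by auto
 have XY: "X * Y = Y * X + P - Q" and PY: "P * Y = Y * P - Y" and QY: "Q * Y = Y * Q + Y" using rel[of "-N" N N "-N"] rel[of "-N" "-N" N "-N"] rel[of N N N "-N"] NN
  by(simp_all add: defs kd_def scl_simps alg)
 obtain omega where omega: "omega : vsp W" "omega ~= 0" "ap P omega = alpha *. omega" "ap Q omega = beta *. omega" "ap X omega = 0"
  using g by(auto simp: gl2_hw_def defs ap_mo vs_def zero_fun_def)
 have irr: "U = {0} | U = vsp W" if "U <= vsp W" "csubspace U" "!!f. f : U ==> ap P f : U & ap Q f : U & ap X f : U & ap Y f : U" for U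
 proof -
  have "ALL a:{- N, N}. ALL b:{- N, N}. ALL f:U. app W (E a b) f : U" using that(3) by(simp add: defs ap_mo)
  thus ?thesis using g that(1,2) unfolding gl2_hw_def zero_fun_def by blast
 qed
 define v where "v j = ap (Y ^ j) omega" for j
 have vS: "v (Suc j) = ap Y (v j)" for j by(simp add: v_def)
 have v0: "v 0 = omega" by(simp add: v_def)
 have vW: "v j : vsp W" for j by(cases j) (auto simp: v0 vS omega defs ap_mo vsp_app)
 have "ap P (v j) = (alpha - of_nat j) *. v j & ap Q (v j) = (beta + of_nat j) *. v j" for j proof(induction j)
  case (Suc j)
  have "ap P (ap Y (v j)) = ap (Y * P - Y) (v j)" "ap Q (ap Y (v j)) = ap (Y * Q + Y) (v j)" by(simp_all flip: PY QY)
  thus ?case by(simp add: vS Suc ap_vs ap_vadd ap_vdiff vs_simps alg)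
 qed (simp add: v0 omega)
 hence Pv: "ap P (v j) = (alpha - of_nat j) *. v j" and Qv: "ap Q (v j) = (beta + of_nat j) *. v j" for j by blast+
 have Xv: "ap X (v (Suc j)) = (of_nat (Suc j) * (alpha - beta - of_nat j)) *. v j" for j proof(induction j)
  case 0
  have "ap X (v 1) = ap (Y * X + P - Q) omega" by(simp add: vS v0 flip: XY)
  thus ?case by(simp add: omega v0 vs_simps)
 next
  case (Suc j)
  have "ap X (v (Suc (Suc j))) = ap (Y * X + P - Q) (v (Suc j))" by(subst vS, simp flip: XY)
  also have "... = (of_nat (Suc j) * (alpha - beta - of_nat j)) *. v (Suc j) + (alpha - of_nat (Suc j)) *. v (Suc j) - (beta + of_nat (Suc j)) *. v (Suc j)"
   by(simp only: ap_add ap_diff ap_mult Suc ap_vs vS[symmetric] Pv Qv)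
  also have "... = (of_nat (Suc (Suc j)) * (alpha - beta - of_nat (Suc j))) *. v (Suc j)" by(simp add: fun_eq_iff fa vs_apply alg)
  finally show ?case .
 qed
 obtain C where C: "!!f z. f : vsp W ==> f ~= 0 ==> app W (E (-N) (-N)) f = z *. f ==> cmod z <= C" using eigen_bound[OF fin, of "E (-N) (-N)"] by blast
 have "EX j. v j = 0" proof(rule ccontr)
  assume "\<nexists>j. v j = 0"
  hence *: "cmod (alpha - of_nat j) <= C" for j using C[OF vW _ Pv[unfolded defs ap_mo]] by blast
  obtain j :: nat where "real j > C + cmod alpha" using reals_Archimedean2 by blast
  moreover have "real j <= cmod (alpha - of_nat j) + cmod alpha" using norm_triangle_ineq4[of alpha "alpha - of_nat j"] by simp
  ultimately show False using *[of j] by linarith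
 qed
 define p where "p = (LEAST j. v j = 0)"
 have p: "v p = 0" "!!j. j < p ==> v j ~= 0" unfolding p_def using LeastI_ex[OF \<open>EX j. v j = 0\<close>] not_less_Least by auto
 obtain d where d: "p = Suc d" using p(1) omega(2) v0 by(cases p) auto
 have vd: "v d ~= 0" "v (Suc d) = 0" using p d by auto
 have ab: "alpha - beta = of_nat d" using Xv[of d] vd vs_eq_0[of "of_nat (Suc d) * (alpha - beta - of_nat d)" "v d"] by(auto simp del: of_nat_Suc)
 \<comment> \<open>This normalisation turns the string \<open>Y^j omega\<close> into a basis on
   which \<open>X\<close> has coefficients \<open>j\<close> and \<open>Y\<close> has coefficients
   \<open>d - j\<close>.\<close>
 define k where "k j = (\<Prod>i<j. of_nat (d - i) :: complex)" for j
 have k0: "k j ~= 0" if "j <= d" for j using that by(auto simp: k_def)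
 define w where "w j = inverse (k j) *. v j" for j
 have kS: "k (Suc j) = k j * of_nat (d - j)" for j by(simp add: k_def)
 have wP: "ap P (w j) = (alpha - of_nat j) *. w j" "ap Q (w j) = (beta + of_nat j) *. w j" for j by(simp_all add: w_def ap_vs Pv Qv vs_simps(1) mult.commute)
 have wX: "ap X (w j) = of_nat j *. w (j - 1)" if "j <= d" for j proof(cases j)
  case (Suc i)
  have e: "inverse (k (Suc i)) * (of_nat (Suc i) * (of_nat d - of_nat i)) = of_nat (Suc i) * inverse (k i)"
   using that Suc k0[of i] by(simp add: kS of_nat_diff field_simps del: of_nat_Suc)
  show ?thesis by(simp add: Suc w_def ap_vs Xv ab vs_simps(1) e del: of_nat_Suc)
 qed (simp add: w_def v0 ap_vs omega vs_simps)
 have wY: "ap Y (w j) = of_nat (d - j) *. w (Suc j)" if "j <= d" for j proof(cases "j = d")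
  case True
  thus ?thesis by(simp add: w_def ap_vs vS[symmetric] vd vs_simps)
 next
  case False
  hence "inverse (k j) = of_nat (d - j) * inverse (k (Suc j))" using that k0[of j] by(simp add: kS)
  thus ?thesis by(simp add: w_def ap_vs vS[symmetric] vs_simps(1))
 qed
 define U where "U = {f. EX a. f = (\<Sum>j\<le>d. a j *. w j)}"
 have wU: "w j : U" if "j <= d" for j proof -
  have "w j = (\<Sum>i\<le>d. (if i = j then 1 else 0) *. w i)" using that by(simp add: if_distrib[of "%z. z *. _"] vs_simps sum.delta cong: if_cong)
  thus ?thesis unfolding U_def mem_Collect_eq by(rule exI[of _ "%i. if i = j then 1 else 0"])
 qed
 have Uc: "csubspace U" proof(rule csubI)
  have "0 = (\<Sum>j\<le>d. 0 *. w j)" by(simp add: vs_simps)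
  thus "0 : U" unfolding U_def mem_Collect_eq by(rule exI[of _ "%_. 0"])
  fix f g assume "f : U" "g : U"
  then obtain a b where "f = (\<Sum>j\<le>d. a j *. w j)" "g = (\<Sum>j\<le>d. b j *. w j)" unfolding U_def by blast
  hence "f + g = (\<Sum>j\<le>d. (a j + b j) *. w j)" by(simp add: vs_simps sum.distrib)
  thus "f + g : U" unfolding U_def mem_Collect_eq by(rule exI[of _ "%j. a j + b j"])
 next
  fix c f assume "f : U"
  then obtain a where "f = (\<Sum>j\<le>d. a j *. w j)" unfolding U_def by blast
  hence "c *. f = (\<Sum>j\<le>d. (c * a j) *. w j)" by(simp add: vs_sum vs_simps)
  thus "c *. f : U" unfolding U_def mem_Collect_eq by(rule exI[of _ "%j. c * a j"])
 qed
 have wd: "w (Suc d) = 0" by(simp add: w_def vd vs_simps)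
 have st: "ap T f : U" if fU: "f : U" and tw: "!!j. j <= d ==> ap T (w j) : U" for T f proof -
  obtain a where f: "f = (\<Sum>j\<le>d. a j *. w j)" using fU unfolding U_def by blast
  have "a j *. ap T (w j) : U" if "j : {..d}" for j using csub_vs[OF Uc tw] that by simp
  thus ?thesis unfolding f ap_vsum ap_vs by(rule csub_sum[OF Uc])
 qed
 have wW: "w j : vsp W" for j unfolding w_def by(rule csub_vs[OF csub_vsp vW])
 have "U = {0} | U = vsp W" proof(rule irr[OF _ Uc])
  show "U <= vsp W" using wW unfolding U_def by(auto intro!: csub_sum[OF csub_vsp] csub_vs[OF csub_vsp])
  fix f assume f: "f : U"
  have "w (Suc j) : U" if "j <= d" for j using that wU[of "Suc j"] wd csub_0[OF Uc] by(cases "j = d") auto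
  thus "ap P f : U & ap Q f : U & ap X f : U & ap Y f : U" using wU by(intro conjI st[OF f]) (auto simp: wP wX wY intro!: csub_vs[OF Uc])
 qed
 moreover have "w 0 = omega" by(simp add: w_def k_def v0 vs_simps)
 hence "U ~= {0}" using wU[of 0] omega(2) by auto
 ultimately have UW: "U = vsp W" by blast
 have ind: "a j = 0" if s: "(\<Sum>j\<le>d. a j *. w j) = 0" and j: "j <= d" for a j proof -
  have "a j *. w j = 0" proof(rule eigen_indep[of "{..d}" P "%j. a j *. w j" "%j. alpha - of_nat j"])
   show "inj_on (%j. alpha - of_nat j) {..d}" by(auto simp: inj_on_def)
  qed (use s j in "auto simp: ap_vs wP vs_simps(1) mult.commute")
  moreover have "w j ~= 0" proof
   assume "w j = 0"
   hence "v j = 0" using vs_eq_0[of "inverse (k j)" "v j"] k0[OF j] by(simp add: w_def)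
   thus False using p(2)[of j] j d by simp
  qed
  ultimately show ?thesis using vs_eq_0 by blast
 qed
 show ?thesis unfolding gbasis_def
 proof(intro exI[of _ d] exI[of _ w] conjI allI impI ballI)
  fix f assume "f : vsp W"
  thus "EX a. f = (\<Sum>j\<le>d. a j *. w j)" using UW unfolding U_def by blast
 qed (use fin ab wW wP wX wY ind in "simp_all add: defs ap_mo")
qed

text \<open>The monomial with exponents \<open>c\<close> is sent to the tensor product of the
  \<open>w i (c i)\<close>, one site at a time; \<open>s\<close> is the number of sites already
  passed.\<close>

fun tau :: "(nat => nat) => (nat => nat => 'w => complex) => nat => nat => (arr => complex) => 'w list => complex" where
 "tau d w s 0 h ks = (if ks = [] then h (%_. 0) else 0)"
| "tau d w s (Suc m) h ks = (case ks of [] => 0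
   | k # ks' => \<Sum>j\<le>d (Suc s). w (Suc s) j k * tau d w (Suc s) m (ap (sg (Suc s) j) h) ks')"

definition TCs :: "(nat => 'w set) => nat => nat => 'w list set" where
 "TCs W s m = {ks. length ks = m & (ALL r<m. ks ! r : W (Suc (s + r)))}"

text \<open>The iterated coproduct as a recursion on the first site; \<open>TT_paths\<close> unfolds
  it to the kind of sum over index words that defines \<open>Ttens\<close>.\<close>

fun TT :: "int => (nat => int => int => 'w op) => nat => nat => complex => int => int => 'w list op" where
 "TT N E s 0 u i j ks ls = kd i j"
| "TT N E s (Suc m) u i j ks ls = (SUM a:{-N, N}. Tk E (Suc s) u i a (hd ks) (hd ls) * TT N E (Suc s) m u a j (tl ks) (tl ls))"

lemma clin_tau: "clin (tau d w s m)"
proof(induction m arbitrary: s)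
 case 0
 show ?case by(intro clinI ext) (auto simp: fa)
next
 case (Suc m)
 show ?case by(intro clinI ext; simp split: list.split)
    (auto simp: ap_vadd ap_vscale clin_add[OF Suc] clin_scale[OF Suc] fa distrib_left sum.distrib sum_distrib_left mult_ac)
qed

lemmas tau_add = clin_add[OF clin_tau] and tau_0 = clin_0[OF clin_tau] and tau_sum = clin_sum[OF clin_tau]

lemma tau_vs: "tau d w s m (z *. h) = z *. tau d w s m h" using clin_scale[OF clin_tau] by(simp add: vs_def)

definition sites :: "nat => nat => nat list" where "sites s m = [Suc s..<Suc (s + m)]"

lemma sites_simps: "sites s 0 = []" "sites s (Suc m) = Suc s # sites (Suc s) m" by(simp_all add: sites_def upt_conv_Cons del: upt_Suc)
lemma set_sites: "set (sites s m) = {Suc s..s + m}" by(auto simp: sites_def)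
lemma TCs_0: "TCs W s 0 = {[]}" by(auto simp: TCs_def)
lemma TCs_Suc: "TCs W s (Suc m) = (%(k, ks). k # ks) ` (W (Suc s) \<times> TCs W (Suc s) m)"
proof -
 have "ks : TCs W s (Suc m) <-> (EX k ks'. ks = k # ks' & k : W (Suc s) & ks' : TCs W (Suc s) m)" for ks
  by(cases ks) (auto simp: TCs_def All_less_Suc2)
 thus ?thesis by(auto simp: image_iff)
qed

lemma finite_TCs: "(!!k. k : {Suc s..s + m} ==> finite (W k)) ==> finite (TCs W s m)" by(induction m arbitrary: s) (auto simp: TCs_0 TCs_Suc)

lemma sum_TCs: "(SUM ks:TCs W s (Suc m). F ks) = (SUM k:W (Suc s). SUM ks:TCs W (Suc s) m. F (k # ks))"
 unfolding TCs_Suc by(subst sum.reindex) (auto simp: inj_on_def sum.cartesian_product split_beta)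

lemma TCs_Cons: "k # ks : TCs W s (Suc m) <-> k : W (Suc s) & ks : TCs W (Suc s) m" by(auto simp: TCs_Suc)

definition ix :: "int => bool => int" where "ix N b = (if b then N else - N)"

text \<open>\<open>L\<close> stands for the encoding of the remaining sites. The factor
  \<open>u\<close> clears the denominator of \<open>1 + E/u\<close>; the four cases match an entry
  of \<open>lx\<close> acting on coefficients with a generator acting on the basis.\<close>

lemma site_tau:
 assumes g: "gbasis N (W (Suc s)) (E (Suc s)) alpha beta (d (Suc s)) (w (Suc s))" and N: "N ~= 0" and u: "u ~= 0"
  and h: "!!p. p > d (Suc s) ==> ap (sg (Suc s) p) h = 0" and L: "clin L" and x: "x : W (Suc s)"
 shows "(\<Sum>j\<le>d (Suc s). w (Suc s) j x * L (ap (sg (Suc s) j) (ap (lx d (Suc s) (u + alpha) a e) h)) ks)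
   = u * (\<Sum>j\<le>d (Suc s). (SUM l:W (Suc s). Tk E (Suc s) u (ix N a) (ix N e) x l * w (Suc s) j l) * L (ap (sg (Suc s) j) h) ks)" proof -
 let ?i = "Suc s" let ?d = "d (Suc s)" let ?w = "w (Suc s)"
 define t where "t j = L (ap (sg ?i j) h) ks" for j
 have t0: "t j = 0" if "j > ?d" for j using h[OF that] by(simp add: t_def clin_0[OF L] fa)
 have Lvs: "L (z *. f) ks = z * L f ks" for z f using clin_scale[OF L, of z f] by(simp add: vs_def)
 have fin: "finite (W ?i)" using g by(simp add: gbasis_def)
 have Tk: "(SUM l:W ?i. Tk E ?i u (ix N a) (ix N e) x l * ?w j l) = (if a = e then ?w j x else 0) + app (W ?i) (E ?i (ix N a) (ix N e)) (?w j) x / u" for j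
 proof -
  let ?C = "kd (ix N a) (ix N e)"
  have "(SUM l:W ?i. Tk E ?i u (ix N a) (ix N e) x l * ?w j l) =
    ?C * (SUM l:W ?i. kd x l * ?w j l) + (SUM l:W ?i. E ?i (ix N a) (ix N e) x l * ?w j l) / u"
   by(simp add: Tk_def distrib_right sum.distrib sum_distrib_left sum_divide_distrib mult.assoc)
  moreover have "(SUM l:W ?i. kd x l * ?w j l) = ?w j x" using x fin by(simp add: kd_def if_distrib[of "%z. z * _"] sum.delta cong: if_cong)
  moreover have "?C = (if a = e then 1 else 0)" using N by(auto simp: kd_def ix_def)
  ultimately show ?thesis using x by(simp add: app_def)
 qed
 have ab: "alpha = beta + of_nat ?d" using g by(auto simp: gbasis_def alg)
 let ?A = "\<Sum>j\<le>?d. (SUM l:W ?i. Tk E ?i u (ix N a) (ix N e) x l * ?w j l) * t j"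
 let ?B = "lx d ?i (u + alpha) a e"
 have lx: "ap (sg ?i j) (ap (lx d ?i z a e) h) = ap (sg ?i j * lx d ?i z a e) h" for z j by simp
 consider "a" "e" | "~ a" "~ e" | "~ a" "e" | "a" "~ e" by blast
 thus ?thesis
 proof cases
  case 1
  have "app (W ?i) (E ?i N N) (?w j) x = (beta + of_nat j) * ?w j x" if "j <= ?d" for j using g that by(simp add: gbasis_def vs_apply)
  hence "?A = (\<Sum>j\<le>?d. (?w j x + (beta + of_nat j) * ?w j x / u) * t j)" unfolding Tk using 1 by(intro sum.cong) (auto simp: ix_def)
  moreover have "ap (sg ?i j) (ap ?B h) = (u + beta + of_nat j) *. ap (sg ?i j) h" for j unfolding lx using 1 by(simp add: sg_lx ab alg)
  ultimately show ?thesis unfolding t_def[symmetric] by(simp only: Lvs t_def[symmetric] sum_distrib_left) (rule sum.cong, use u in "auto simp: field_simps")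
 next
  case 2
  have "app (W ?i) (E ?i (-N) (-N)) (?w j) x = (alpha - of_nat j) * ?w j x" if "j <= ?d" for j using g that by(simp add: gbasis_def vs_apply)
  hence "?A = (\<Sum>j\<le>?d. (?w j x + (alpha - of_nat j) * ?w j x / u) * t j)" unfolding Tk using 2 by(intro sum.cong) (auto simp: ix_def)
  moreover have "ap (sg ?i j) (ap ?B h) = (u + alpha - of_nat j) *. ap (sg ?i j) h" for j unfolding lx using 2 by(simp add: sg_lx)
  ultimately show ?thesis unfolding t_def[symmetric] by(simp only: Lvs t_def[symmetric] sum_distrib_left) (rule sum.cong, use u in "auto simp: field_simps")
 next
  case 3
  have "app (W ?i) (E ?i (-N) N) (?w j) x = of_nat j * ?w (j - 1) x" if "j <= ?d" for j using g that by(simp add: gbasis_def vs_apply)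
  hence "?A = (\<Sum>j\<le>?d. of_nat j * ?w (j - 1) x / u * t j)" unfolding Tk using 3 by(intro sum.cong) (auto simp: ix_def)
  also have "... = (\<Sum>j<?d. of_nat (Suc j) * ?w j x / u * t (Suc j))" by(simp add: sum.atMost_shift del: of_nat_Suc)
  also have "... = (\<Sum>j\<le>?d. of_nat (Suc j) * ?w j x / u * t (Suc j))" by(rule sum.mono_neutral_left) (auto simp: t0)
  finally have e1: "?A = ..." .
  have "ap (sg ?i j) (ap ?B h) = of_nat (Suc j) *. ap (sg ?i (Suc j)) h" for j unfolding lx using 3 by(simp add: sg_lx del: of_nat_Suc)
  thus ?thesis unfolding t_def[symmetric] e1
   by(simp only: Lvs t_def[symmetric] sum_distrib_left) (rule sum.cong, use u in "auto simp: field_simps simp del: of_nat_Suc")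
 next
  case 4
  have "app (W ?i) (E ?i N (-N)) (?w j) x = of_nat (?d - j) * ?w (Suc j) x" if "j <= ?d" for j using g that by(simp add: gbasis_def vs_apply)
  hence "?A = (\<Sum>j\<le>?d. of_nat (?d - j) * ?w (Suc j) x / u * t j)" unfolding Tk using 4 by(intro sum.cong) (auto simp: ix_def)
  also have "... = (\<Sum>j<?d. of_nat (?d - j) * ?w (Suc j) x / u * t j)" by(rule sum.mono_neutral_right) auto
  finally have e1: "?A = ..." .
  have s: "ap (sg ?i j) (ap ?B h) = (if j = 0 then 0 else (of_nat ?d - of_nat (j - 1)) *. ap (sg ?i (j - 1)) h)" for j
   using 4 by(auto simp: fun_eq_iff ap_sg ap_lx fa vs_apply)
  have "(\<Sum>j\<le>?d. ?w j x * L (ap (sg ?i j) (ap ?B h)) ks) = (\<Sum>j<?d. ?w (Suc j) x * ((of_nat ?d - of_nat j) * t j))"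
   unfolding s by(simp add: sum.atMost_shift clin_0[OF L] fa Lvs t_def)
  thus ?thesis unfolding t_def[symmetric] e1 by(simp only: sum_distrib_left) (rule sum.cong, use u in "auto simp: field_simps of_nat_diff")
 qed
qed

lemma HH_Cons_sg0: "h : HH d (i # is) ==> p > d i ==> ap (sg i p) h = 0" by(auto simp: HH_def fun_eq_iff fa ap_sg)

lemma sum_rot: "(SUM l:A. SUM m:B. SUM j:C. f l m j) = (SUM j:C. SUM l:A. SUM m:B. f l m j)"
proof -
 have "(SUM l:A. SUM m:B. SUM j:C. f l m j) = (SUM l:A. SUM j:C. SUM m:B. f l m j)" by(intro sum.cong refl sum.swap)
 thus ?thesis by(simp add: sum.swap[of _ C])
qed

lemma tau_TT:
 assumes "!!k. k : {Suc s..s + m} ==> gbasis N (W k) (E k) (alpha k) (beta k) (d k) (w k)" and N: "N ~= 0" and u: "u ~= 0"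
  and "h : HH d (sites s m)" and "ks : TCs W s m"
 shows "(SUM ls:TCs W s m. TT N E s m u (ix N a) (ix N b) ks ls * tau d w s m h ls)
   = inverse u ^ m * tau d w s m (ap (Tm d alpha (sites s m) u a b) h) ks" using assms(1,4,5) proof(induction m arbitrary: s h ks a)
 case 0
 thus ?case using N by(auto simp: TCs_0 sites_simps id2_def kd_def ix_def fa)
next
 case (Suc m)
 obtain k ks' where ks: "ks = k # ks'" "k : W (Suc s)" "ks' : TCs W (Suc s) m" using Suc.prems(3) by(auto simp: TCs_Suc)
 let ?i = "Suc s" let ?T = "%e. Tm d alpha (sites (Suc s) m) u e b"
 have ni: "?i ~: set (sites ?i m)" by(auto simp: set_sites)
 have hh: "h : HH d (?i # sites ?i m)" using Suc.prems(2) by(simp add: sites_simps)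
 have IH: "(SUM ls:TCs W ?i m. TT N E ?i m u (ix N e) (ix N b) ks' ls * tau d w ?i m (ap (sg ?i j) h) ls)
   = inverse u ^ m * tau d w ?i m (ap (sg ?i j) (ap (?T e) h)) ks'" for e j proof -
  have "(SUM ls:TCs W ?i m. TT N E ?i m u (ix N e) (ix N b) ks' ls * tau d w ?i m (ap (sg ?i j) h) ls)
   = inverse u ^ m * tau d w ?i m (ap (?T e) (ap (sg ?i j) h)) ks'" by(rule Suc.IH) (use Suc.prems(1) ks(3) sg_HH[OF hh ni] in auto)
  moreover have "ap (?T e) (ap (sg ?i j) h) = ap (sg ?i j) (ap (?T e) h)" using off_Tm[OF ni, of d alpha u e b] unfolding off_def by(metis ap_mult)
  ultimately show ?thesis by simp
 qed
 have Th: "ap (sg ?i p) (ap (?T e) h) = 0" if "p > d ?i" for p e proof -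
  have "ap (sg ?i p) (ap (?T e) h) = ap (?T e) (ap (sg ?i p) h)" using off_Tm[OF ni, of d alpha u e b] unfolding off_def by(metis ap_mult)
  thus ?thesis using HH_Cons_sg0[OF hh that] by simp
 qed
 have set2: "(SUM a:{-N, N}. f a) = f (ix N False) + f (ix N True)" for f :: "int => complex" using N by(subst sum.insert) (auto simp: ix_def)
 have g: "gbasis N (W ?i) (E ?i) (alpha ?i) (beta ?i) (d ?i) (w ?i)" using Suc.prems(1) by simp
 have one: "(SUM l:W ?i. SUM ls:TCs W ?i m. Tk E ?i u (ix N a) (ix N e) k l * TT N E ?i m u (ix N e) (ix N b) ks' ls * (\<Sum>j\<le>d ?i. w ?i j l * tau d w ?i m (ap (sg ?i j) h) ls))
   = inverse u ^ Suc m * (\<Sum>j\<le>d ?i. w ?i j k * tau d w ?i m (ap (sg ?i j) (ap (lx d ?i (u + alpha ?i) a e) (ap (?T e) h))) ks')" for e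
 proof -
  have "(SUM l:W ?i. SUM ls:TCs W ?i m. Tk E ?i u (ix N a) (ix N e) k l * TT N E ?i m u (ix N e) (ix N b) ks' ls * (\<Sum>j\<le>d ?i. w ?i j l * tau d w ?i m (ap (sg ?i j) h) ls))
    = (\<Sum>j\<le>d ?i. (SUM l:W ?i. Tk E ?i u (ix N a) (ix N e) k l * w ?i j l) * (SUM ls:TCs W ?i m. TT N E ?i m u (ix N e) (ix N b) ks' ls * tau d w ?i m (ap (sg ?i j) h) ls))"
  proof -
   have "(SUM l:W ?i. SUM ls:TCs W ?i m. Tk E ?i u (ix N a) (ix N e) k l * TT N E ?i m u (ix N e) (ix N b) ks' ls * (\<Sum>j\<le>d ?i. w ?i j l * tau d w ?i m (ap (sg ?i j) h) ls))
    = (SUM l:W ?i. SUM ls:TCs W ?i m. \<Sum>j\<le>d ?i. Tk E ?i u (ix N a) (ix N e) k l * w ?i j l * (TT N E ?i m u (ix N e) (ix N b) ks' ls * tau d w ?i m (ap (sg ?i j) h) ls))"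
    by(simp only: sum_distrib_left mult_ac)
   also have "... = (\<Sum>j\<le>d ?i. SUM l:W ?i. SUM ls:TCs W ?i m. Tk E ?i u (ix N a) (ix N e) k l * w ?i j l * (TT N E ?i m u (ix N e) (ix N b) ks' ls * tau d w ?i m (ap (sg ?i j) h) ls))"
    by(rule sum_rot)
   finally show ?thesis by(simp only: sum_product)
  qed
  also have "... = inverse u ^ m * (\<Sum>j\<le>d ?i. (SUM l:W ?i. Tk E ?i u (ix N a) (ix N e) k l * w ?i j l) * tau d w ?i m (ap (sg ?i j) (ap (?T e) h)) ks')"
   unfolding IH by(simp add: sum_distrib_left mult_ac)
  also have "... = inverse u ^ m * (inverse u * (u * (\<Sum>j\<le>d ?i. (SUM l:W ?i. Tk E ?i u (ix N a) (ix N e) k l * w ?i j l) * tau d w ?i m (ap (sg ?i j) (ap (?T e) h)) ks')))"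
   using u by simp
  also have "... = inverse u ^ m * (inverse u * (\<Sum>j\<le>d ?i. w ?i j k * tau d w ?i m (ap (sg ?i j) (ap (lx d ?i (u + alpha ?i) a e) (ap (?T e) h))) ks'))"
   by(subst site_tau[where L = "tau d w ?i m" and W = W and E = E and s = s and d = d and w = w and alpha = "alpha ?i" and beta = "beta ?i", OF g N u Th clin_tau ks(2)]) simp_all
  finally show ?thesis by(simp add: mult_ac)
 qed
 have "(SUM ls:TCs W s (Suc m). TT N E s (Suc m) u (ix N a) (ix N b) ks ls * tau d w s (Suc m) h ls)
   = (SUM l:W ?i. SUM ls:TCs W ?i m. Tk E ?i u (ix N a) (ix N False) k l * TT N E ?i m u (ix N False) (ix N b) ks' ls * (\<Sum>j\<le>d ?i. w ?i j l * tau d w ?i m (ap (sg ?i j) h) ls))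
   + (SUM l:W ?i. SUM ls:TCs W ?i m. Tk E ?i u (ix N a) (ix N True) k l * TT N E ?i m u (ix N True) (ix N b) ks' ls * (\<Sum>j\<le>d ?i. w ?i j l * tau d w ?i m (ap (sg ?i j) h) ls))"
  unfolding sum_TCs by(simp add: set2 ks distrib_right sum.distrib del: sum.insert)
 also have "... = inverse u ^ Suc m * tau d w s (Suc m) (ap (Tm d alpha (sites s (Suc m)) u a b) h) ks"
  unfolding one by(simp add: ks sites_simps mm_def ap_vadd tau_add fa distrib_left sum.distrib)
 finally show ?case .
qed

text \<open>Here the word includes its last letter, which the final Kronecker symbol forces to be
  \<open>j\<close>; \<open>Ttens_TT\<close> strips it off.\<close>

lemma TT_paths:
 assumes N: "N ~= 0" and "length ks = m" "length ls = m"
 shows "TT N E s m u i j ks ls = (SUM bs:{bs. length bs = m & set bs <= {-N, N}}.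
   (\<Prod>r<m. Tk E (Suc (s + r)) u ((i # bs) ! r) (bs ! r) (ks ! r) (ls ! r)) * kd (last (i # bs)) j)" using assms(2,3)
proof(induction m arbitrary: s i ks ls)
 case 0
 have "{bs. length bs = 0 & set bs <= {-N, N}} = {[]}" by auto
 thus ?case by simp
next
 case (Suc m)
 obtain k ks' l ls' where kl: "ks = k # ks'" "ls = l # ls'" "length ks' = m" "length ls' = m" using Suc.prems by(metis length_Suc_conv)
 let ?A = "{-N, N} \<times> {bs. length bs = m & set bs <= {-N, N}}"
 have S: "{bs. length bs = Suc m & set bs <= {-N, N}} = (%(b, bs). b # bs) ` ?A" proof(rule set_eqI)
  fix bs show "bs : {bs. length bs = Suc m & set bs <= {-N, N}} <-> bs : (%(b, bs). b # bs) ` ?A" by(cases bs) (auto simp: image_iff)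
 qed
 show ?case unfolding S by(subst sum.reindex)
    (auto simp: inj_on_def sum.cartesian_product split_beta kl Suc.IH[OF kl(3,4)] prod.lessThan_Suc_shift sum_distrib_left mult.assoc
     simp del: prod.lessThan_Suc sum.insert intro!: sum.cong)
qed

lemma Ttens_TT:
 assumes n: "n >= 1" and "length ks = n" "length ls = n" and j: "j : {- int n, int n}"
 shows "Ttens n E i j u ks ls = TT (int n) E 0 n u i j ks ls" proof -
 obtain m where m: "n = Suc m" using n by(cases n) auto
 let ?B = "{bs. length bs = n & set bs <= {- int n, int n}}"
 let ?A = "SUM bs:{bs:?B. last bs = j}. (\<Prod>r<n. Tk E (Suc r) u ((i # bs) ! r) (bs ! r) (ks ! r) (ls ! r))"
 have "TT (int n) E 0 n u i j ks ls = ?A" unfolding TT_paths[of "int n" ks n ls, OF _ assms(2,3)] using n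
 proof(subst TT_paths[of "int n" ks n ls, OF _ assms(2,3)])
  show "(SUM bs:?B. (\<Prod>r<n. Tk E (Suc (0 + r)) u ((i # bs) ! r) (bs ! r) (ks ! r) (ls ! r)) * kd (last (i # bs)) j)
    = ?A" proof(rule sum.mono_neutral_cong_right)
   show "finite ?B" using finite_lists_length_eq[of "{- int n, int n}" n] by(simp add: conj_commute)
  qed (use m in "auto simp: kd_def")
 qed (use n in auto)
 also have "... = Ttens n E i j u ks ls" unfolding Ttens_def Let_def proof(rule sum.reindex_bij_witness[of _ "%as. as @ [j]" butlast])
  fix bs assume bs: "bs : {bs:?B. last bs = j}"
  hence nn: "bs ~= []" using m by auto
  show e: "butlast bs @ [j] = bs" using bs nn by auto
  show "butlast bs : {as. length as = n - 1 & set as <= {- int n, int n}}" using bs by(auto dest: in_set_butlastD)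
  let ?C = "i # butlast bs @ [j]"
  show "(\<Prod>r<n. Tk E (Suc r) u (?C ! r) (?C ! Suc r) (ks ! r) (ls ! r)) = (\<Prod>r<n. Tk E (Suc r) u ((i # bs) ! r) (bs ! r) (ks ! r) (ls ! r))" by(simp add: e)
 qed (use j m in auto)
 finally show ?thesis by simp
qed

lemma TC_TCs: "TC n W = TCs W 0 n" by(simp add: TC_def TCs_def)

lemma tau_vsp: "(!!k. k : {Suc s..s + m} ==> gbasis N (W k) (E k) (alpha k) (beta k) (d k) (w k)) ==> tau d w s m h : vsp (TCs W s m)"
proof(induction m arbitrary: s h)
 case (Suc m)
 show ?case unfolding vsp_def
 proof(intro CollectI allI impI)
  fix ks assume ks: "ks ~: TCs W s (Suc m)"
  show "tau d w s (Suc m) h ks = 0" proof(cases ks)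
   case (Cons k ks')
   have "w (Suc s) j k = 0 | tau d w (Suc s) m (ap (sg (Suc s) j) h) ks' = 0" for j proof(cases "k : W (Suc s)")
    case True
    hence "ks' ~: TCs W (Suc s) m" using ks by(auto simp: Cons TCs_Cons)
    moreover have "tau d w (Suc s) m (ap (sg (Suc s) j) h) : vsp (TCs W (Suc s) m)" by(rule Suc.IH) (use Suc.prems in auto)
    ultimately show ?thesis by(simp add: vsp_def)
   next
    case False
    have "w (Suc s) j : vsp (W (Suc s))" using Suc.prems[of "Suc s"] by(simp add: gbasis_def)
    thus ?thesis using False by(simp add: vsp_def)
   qed
   hence "(\<Sum>j\<le>d (Suc s). w (Suc s) j k * tau d w (Suc s) m (ap (sg (Suc s) j) h) ks') = 0" by(intro sum.neutral) auto
   thus ?thesis by(simp add: Cons)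
  qed simp
 qed
qed (auto simp: vsp_def TCs_0)

lemma gbasis_indep: "gbasis N W E alpha beta d w ==> (\<Sum>j\<le>d. a j *. w j) = 0 ==> j <= d ==> a j = 0" unfolding gbasis_def by blast

lemma tau_inj:
 "(!!k. k : {Suc s..s + m} ==> gbasis N (W k) (E k) (alpha k) (beta k) (d k) (w k)) ==> h : HH d (sites s m) ==> tau d w s m h = 0 ==> h = 0"
proof(induction m arbitrary: s h)
 case 0
 have "h (%_. 0) = 0" using fun_cong[OF 0(3), of "[]"] by(simp add: fa)
 thus ?case using 0(2) by(auto simp: HH_def sites_simps fun_eq_iff fa) (metis ext)
next
 case (Suc m)
 let ?i = "Suc s"
 have ni: "?i ~: set (sites ?i m)" by(auto simp: set_sites)
 have hh: "h : HH d (?i # sites ?i m)" using Suc.prems(2) by(simp add: sites_simps)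
 have g: "gbasis N (W ?i) (E ?i) (alpha ?i) (beta ?i) (d ?i) (w ?i)" using Suc.prems(1) by simp
 have z: "ap (sg ?i j) h = 0" if j: "j <= d ?i" for j proof(rule Suc.IH)
  show "tau d w ?i m (ap (sg ?i j) h) = 0" proof(rule ext)
   fix ks
   let ?A = "\<Sum>j\<le>d ?i. tau d w ?i m (ap (sg ?i j) h) ks *. w ?i j"
   have "?A = 0" proof(rule ext)
    fix k
    have "tau d w s (Suc m) h (k # ks) = 0" using Suc.prems(3) by(simp add: fa)
    thus "?A k = 0 k" by(simp add: sum_fun_apply vs_apply fa mult.commute)
   qed
   from gbasis_indep[OF g this j] show "tau d w ?i m (ap (sg ?i j) h) ks = 0 ks" by(simp add: fa)
  qed
 qed (use Suc.prems sg_HH[OF hh ni] in auto)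
 show ?case
 proof(rule ext)
  fix c
  have "h c = ap (sg ?i (c ?i)) h (c(?i := 0))" by(simp add: ap_sg)
  also have "... = 0" using z[of "c ?i"] HH_Cons_sg0[OF hh, of "c ?i"] by(cases "c ?i <= d ?i") (auto simp: fa)
  finally show "h c = 0 c" by(simp add: fa)
 qed
qed

lemma tau_surj:
 "(!!k. k : {Suc s..s + m} ==> gbasis N (W k) (E k) (alpha k) (beta k) (d k) (w k)) ==> F : vsp (TCs W s m)
  ==> EX h:HH d (sites s m). tau d w s m h = F" proof(induction m arbitrary: s F)
 case 0
 show ?case
 proof(rule bexI[of _ "F [] *. om"])
  show "tau d w s 0 (F [] *. om) = F" using 0 by(auto simp: fun_eq_iff vsp_def TCs_0 vs_apply)
  show "F [] *. om : HH d (sites s 0)" by(simp add: sites_simps HH_vs om_HH)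
 qed
next
 case (Suc m)
 let ?i = "Suc s" let ?d = "d (Suc s)"
 let ?B = "set (sites ?i m)"
 have ni: "?i ~: ?B" by(auto simp: set_sites)
 have g: "gbasis N (W ?i) (E ?i) (alpha ?i) (beta ?i) (d ?i) (w ?i)" using Suc.prems(1) by simp
 have "EX a. (%k. F (k # ks)) = (\<Sum>j\<le>?d. a j *. w ?i j)" for ks proof -
  have "(%k. F (k # ks)) : vsp (W ?i)" using Suc.prems(2) by(auto simp: vsp_def TCs_Cons)
  thus ?thesis using g by(auto simp: gbasis_def)
 qed
 then obtain a where a: "!!ks. (%k. F (k # ks)) = (\<Sum>j\<le>?d. a ks j *. w ?i j)" by metis
 have "EX h:HH d (sites ?i m). tau d w ?i m h = (%ks. a ks j)" if j: "j <= ?d" for j proof(rule Suc.IH)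
  show "(%ks. a ks j) : vsp (TCs W ?i m)" unfolding vsp_def proof(intro CollectI allI impI)
   fix ks assume "ks ~: TCs W ?i m"
   hence "(%k. F (k # ks)) = 0" using Suc.prems(2) by(auto simp: vsp_def TCs_Cons fun_eq_iff fa)
   hence "(\<Sum>j\<le>?d. a ks j *. w ?i j) = 0" by(simp add: a)
   from gbasis_indep[OF g this j] show "a ks j = 0" .
  qed
 qed (use Suc.prems in auto)
 then obtain H where H: "!!j. j <= ?d ==> H j : HH d (sites ?i m)" "!!j. j <= ?d ==> tau d w ?i m (H j) = (%ks. a ks j)" by metis
 define h where "h c = (if c ?i <= ?d then H (c ?i) (c(?i := 0)) else 0)" for c
 let ?A = "?i # sites ?i m"
 have hH: "h : HH d ?A" unfolding HH_def mem_Collect_eq proof(intro allI impI)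
  fix c assume n: "h c ~= 0"
  hence c: "c ?i <= ?d" "H (c ?i) (c(?i := 0)) ~= 0" by(auto simp: h_def split: if_splits)
  hence "(ALL i:?B. (c(?i := 0)) i <= d i) & (ALL i. i ~: ?B --> (c(?i := 0)) i = 0)" using H(1)[OF c(1)] unfolding HH_def by blast
  thus "(ALL i:set ?A. c i <= d i) & (ALL i. i ~: set ?A --> c i = 0)" using c(1) ni by(auto split: if_splits)
 qed
 have sh: "ap (sg ?i j) h = H j" if "j <= ?d" for j proof(rule ext)
  fix c show "ap (sg ?i j) h c = H j c" using H(1)[OF that] that ni by(auto simp: ap_sg h_def HH_def fun_upd_idem)
 qed
 have "tau d w s (Suc m) h = F" proof(rule ext)
  fix ks show "tau d w s (Suc m) h ks = F ks" proof(cases ks)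
   case Nil
   have "[] ~: TCs W s (Suc m)" by(simp add: TCs_def)
   thus ?thesis using Suc.prems(2) by(simp add: Nil vsp_def)
  next
   case (Cons k ks')
   show ?thesis using fun_cong[OF a[of ks'], of k] by(simp add: Cons sh H sum_fun_apply vs_apply mult.commute)
  qed
 qed
 thus ?case using hH by(auto simp: sites_simps)
qed

text \<open>By \<open>TR_flip\<close> the transposed factors at \<open>-u\<close> form the right
  half of \<open>Zm\<close>. The sign \<open>(-1)^n\<close> of that lemma is compensated by the
  \<open>n\<close> denominators \<open>-u\<close>.\<close>

lemma Stens_tau:
 assumes gb: "!!k. k : {1..n} ==> gbasis (int n) (W k) (E k) (alpha k) (beta k) (d k) (w k)" and n: "n >= 1" and u: "u ~= 0"
  and h: "h : HH d [1..<Suc n]"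
 shows "app (TC n W) (Stens n W E (ix (int n) a) (ix (int n) b) u) (tau d w 0 n h)
   = inverse u ^ (2 * n) *. tau d w 0 n (ap (Zm d alpha (%i. of_nat (d i) - alpha i) [1..<Suc n] u a b) h)" proof -
 let ?s = "[1..<Suc n]" let ?N = "int n" let ?T = "Tm d alpha ?s"
 have st: "sites 0 n = ?s" by(simp add: sites_def)
 have N: "?N ~= 0" using n by simp
 have fin: "finite (TC n W)" unfolding TC_TCs by(rule finite_TCs) (use gb in "auto simp: gbasis_def")
 have T: "ap (mo (TC n W) (Ttens n E (ix ?N a) (ix ?N b) u)) (tau d w 0 n h) = inverse u ^ n *. tau d w 0 n (ap (?T u a b) h)"
  if "h : HH d ?s" "u ~= 0" for a b u h proof(rule ext)
  fix ks
  show "ap (mo (TC n W) (Ttens n E (ix ?N a) (ix ?N b) u)) (tau d w 0 n h) ks = (inverse u ^ n *. tau d w 0 n (ap (?T u a b) h)) ks"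
  proof(cases "ks : TC n W")
   case True
   have "(SUM ls:TC n W. Ttens n E (ix ?N a) (ix ?N b) u ks ls * tau d w 0 n h ls) = (SUM ls:TCs W 0 n. TT ?N E 0 n u (ix ?N a) (ix ?N b) ks ls * tau d w 0 n h ls)"
    unfolding TC_TCs[symmetric] by(rule sum.cong[OF refl], subst Ttens_TT[OF n]) (use True in "auto simp: TC_def ix_def")
   also have "... = inverse u ^ n * tau d w 0 n (ap (Tm d alpha (sites 0 n) u a b) h) ks"
    by(rule tau_TT[where beta = beta]) (use gb N that True in "auto simp: st TC_TCs")
   finally show ?thesis using True by(simp add: ap_mo app_def st vs_apply)
  next
   case False
   have "tau d w 0 n (ap (?T u a b) h) : vsp (TCs W 0 n)" by(rule tau_vsp) (use gb in auto)
   thus ?thesis using False by(simp add: ap_mo app_def vs_apply vsp_def TC_TCs)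
  qed
 qed
 have ix: "- ix ?N a = ix ?N (~ a)" for a by(simp add: ix_def)
 have pT: "ap (?T u a b) h : HH d ?s" if "h : HH d ?s" for u a b h by(rule pres_Tm[OF subset_refl that])
 have th: "theta (ix ?N e) (ix ?N b) = sgb e b" for e b using n by(auto simp: theta_def ix_def sgb_def)
 have S: "mo (TC n W) (Stens n W E (ix ?N a) (ix ?N b) u) = (SUM e:UNIV. sgb e b *: (mo (TC n W) (Ttens n E (ix ?N a) (ix ?N e) u) * mo (TC n W) (Ttens n E (ix ?N (~ b)) (ix ?N (~ e)) (- u))))"
 proof -
  have "(SUM a:{- int n, int n}. f a) = f (ix ?N False) + f (ix ?N True)" for f :: "int => complex" using n by(subst sum.insert) (auto simp: ix_def)
  hence "Stens n W E (ix ?N a) (ix ?N b) u = (%ks ls. sgb False b * mmul (TC n W) (Ttens n E (ix ?N a) (ix ?N False) u) (Ttens n E (ix ?N (~ b)) (ix ?N True) (- u)) ks ls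
    + sgb True b * mmul (TC n W) (Ttens n E (ix ?N a) (ix ?N True) u) (Ttens n E (ix ?N (~ b)) (ix ?N False) (- u)) ks ls)"
   unfolding Stens_def by(simp only: ix th) simp
  thus ?thesis by(simp add: UNIV_bool mo_add mo_scl mo_mult[OF fin] add.commute)
 qed
 have c: "inverse u ^ n * inverse (- u) ^ n = (- 1) ^ n * inverse u ^ (2 * n)" by(simp add: power_mult_distrib[symmetric] mult_2 power_add)
 have "ap (mo (TC n W) (Stens n W E (ix ?N a) (ix ?N b) u)) (tau d w 0 n h)
   = (SUM e:UNIV. (inverse u ^ (2 * n)) *. tau d w 0 n (ap (?T u a e * ((- 1) ^ n * sgb e b) *: ?T (- u) (~ b) (~ e)) h))" unfolding S ap_sum
 proof(intro sum.cong refl)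
  fix e
  have "ap (sgb e b *: (mo (TC n W) (Ttens n E (ix ?N a) (ix ?N e) u) * mo (TC n W) (Ttens n E (ix ?N (~ b)) (ix ?N (~ e)) (- u)))) (tau d w 0 n h)
    = (sgb e b * (inverse (- u) ^ n * inverse u ^ n)) *. tau d w 0 n (ap (?T u a e) (ap (?T (- u) (~ b) (~ e)) h))"
   using u by(simp only: ap_scl ap_mult T[OF h] T[OF pT[OF h]] ap_vs vs_simps(1) neg_equal_0_iff_equal not_False_eq_True simp_thms)
  also have "sgb e b * (inverse (- u) ^ n * inverse u ^ n) = inverse u ^ (2 * n) * ((- 1) ^ n * sgb e b)" using c by(simp add: mult_ac)
  also have "(inverse u ^ (2 * n) * ((- 1) ^ n * sgb e b)) *. tau d w 0 n (ap (?T u a e) (ap (?T (- u) (~ b) (~ e)) h))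
   = inverse u ^ (2 * n) *. tau d w 0 n (ap (?T u a e * ((- 1) ^ n * sgb e b) *: ?T (- u) (~ b) (~ e)) h)"
   by(simp only: ap_mult ap_scl ap_vs tau_vs vs_simps(1))
  finally show "ap (sgb e b *: (mo (TC n W) (Ttens n E (ix ?N a) (ix ?N e) u) * mo (TC n W) (Ttens n E (ix ?N (~ b)) (ix ?N (~ e)) (- u)))) (tau d w 0 n h)
   = inverse u ^ (2 * n) *. tau d w 0 n (ap (?T u a e * ((- 1) ^ n * sgb e b) *: ?T (- u) (~ b) (~ e)) h)" .
 qed
 also have "... = inverse u ^ (2 * n) *. tau d w 0 n (ap (Zm d alpha (%i. of_nat (d i) - alpha i) ?s u a b) h)"
  unfolding Zm_Tm_TR mm_sum TR_flip[OF distinct_upt refl] ap_sum tau_sum vs_sum by(simp del: upt_Suc)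
 finally show ?thesis by(simp add: ap_mo)
qed

lemma tau_bij:
 assumes gb: "!!k. k : {1..n} ==> gbasis (int n) (W k) (E k) (alpha k) (beta k) (d k) (w k)"
 shows "bij_betw (tau d w 0 n) (HH d [1..<Suc n]) (vsp (TC n W))" proof(rule bij_betw_imageI)
 have st: "sites 0 n = [1..<Suc n]" by(simp add: sites_def)
 have gb': "!!k. k : {Suc 0..0 + n} ==> gbasis (int n) (W k) (E k) (alpha k) (beta k) (d k) (w k)" using gb by simp
 let ?A = "HH d [1..<Suc n]"
 show "inj_on (tau d w 0 n) ?A" proof(rule inj_onI)
  fix x y assume xy: "x : ?A" "y : ?A" "tau d w 0 n x = tau d w 0 n y"
  have "x - y = 0" by(rule tau_inj[OF gb']) (use xy csub_diff[OF csub_HH] in "auto simp: st clin_diff[OF clin_tau]")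
  thus "x = y" by simp
 qed
 show "tau d w 0 n ` ?A = vsp (TC n W)" proof
  show "tau d w 0 n ` ?A <= vsp (TC n W)"
   unfolding TC_TCs by(intro image_subsetI tau_vsp[where N = "int n" and E = E and alpha = alpha and beta = beta] gb')
  show "vsp (TC n W) <= tau d w 0 n ` ?A" proof
   fix F assume "F : vsp (TC n W)"
   hence "EX h:HH d (sites 0 n). tau d w 0 n h = F"
    unfolding TC_TCs by(intro tau_surj[where N = "int n" and E = E and alpha = alpha and beta = beta and W = W] gb')
   thus "F : tau d w 0 n ` ?A" unfolding st by blast
  qed
 qed
qed

section \<open>Representations of sp(2n) and the highest covector\<close>

lemma Iset_minus [simp]: "- i : Iset n <-> i : Iset n" by(simp add: Iset_def)
lemma finite_Iset [simp]: "finite (Iset n)" by(rule finite_subset[of _ "{- int n..int n}"]) (auto simp: Iset_def)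
lemma Iset_nz: "i : Iset n ==> i ~= 0" by(auto simp: Iset_def)

lemma theta_same: "i ~= 0 ==> theta i i = 1" "i ~= 0 ==> theta i (- i) = - 1" "i ~= 0 ==> theta (- i) i = - 1" by(auto simp: theta_def sgn_if)

text \<open>A single numerical weight bounds the length of nonvanishing words.\<close>

definition ent :: "'v lop => 'v => 'v => complex" where "ent T x y = ap T (kd y) x"

lemma ap_ent: "ap (T::'v::finite lop) f x = (SUM y:UNIV. ent T x y * f y)"
proof -
 have e: "f = (SUM y:UNIV. f y *. kd y)" by(rule ext) (simp add: sum_fun_apply vs_apply kd_def if_distrib[of "%z. _ * z"] cong: if_cong)
 have "ap T f = (SUM y:UNIV. f y *. ap T (kd y))" by(subst e) (simp only: ap_vsum ap_vs)
 thus ?thesis by(simp add: sum_fun_apply vs_apply ent_def mult.commute)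
qed

lemma ent_mult: "ent (S * T) x y = (SUM z:UNIV. ent S x z * ent (T::'v::finite lop) z y)"
 unfolding ent_def[of "S * T"] by(simp add: ap_ent[of S]) (simp add: ent_def)

text \<open>Comparing the largest entry of \<open>w\<close> on both sides of the commutator relation
  excludes eigenvalues beyond twice the entry sum of \<open>H\<close> unless \<open>w\<close> is
  0.\<close>

lemma weight_bound:
 fixes H :: "'v::finite lop"
 shows "EX B. ALL w z. H * w - w * H = z *: w --> B < cmod z --> w = 0" proof(intro exI allI impI)
 fix w z
 define S where "S = (SUM x:UNIV. SUM y:UNIV. cmod (ent H x y))"
 assume e: "H * w - w * H = z *: w" and big: "2 * S < cmod z"
 obtain x y where m: "!!x' y'. cmod (ent w x' y') <= cmod (ent w x y)" proof -
  let ?S = "(%(x, y). cmod (ent w x y)) ` (UNIV :: ('v \<times> 'v) set)"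
  have "Max ?S : ?S" by(rule Max_in) auto
  then obtain p where "Max ?S = (%(x, y). cmod (ent w x y)) p" by blast
  then obtain x y where "Max ?S = cmod (ent w x y)" by(cases p) simp
  moreover have "cmod (ent w x' y') <= Max ?S" for x' y' by(rule Max_ge) auto
  ultimately show ?thesis using that by metis
 qed
 let ?M = "cmod (ent w x y)"
 have row: "(SUM z:UNIV. cmod (ent H x z)) <= S" unfolding S_def by(rule member_le_sum[where f = "%x. SUM y:UNIV. cmod (ent H x y)"]) (auto intro: sum_nonneg)
 have "(SUM z:UNIV. cmod (ent H z y)) <= (SUM z:UNIV. SUM y:UNIV. cmod (ent H z y))" by(intro sum_mono member_le_sum) auto
 hence col: "(SUM z:UNIV. cmod (ent H z y)) <= S" by(simp add: S_def)
 have "cmod z * ?M = cmod (ent (H * w) x y - ent (w * H) x y)" using arg_cong[OF e, of "%T. ent T x y"] by(simp add: ent_def fa vs_apply norm_mult)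
 also have "... <= cmod (ent (H * w) x y) + cmod (ent (w * H) x y)" by(rule norm_triangle_ineq4)
 also have "... <= (SUM z:UNIV. cmod (ent H x z) * ?M) + (SUM z:UNIV. ?M * cmod (ent H z y))" unfolding ent_mult
  by(intro add_mono order_trans[OF norm_sum] sum_mono) (auto simp: norm_mult intro!: mult_left_mono mult_right_mono m)
 also have "... <= S * ?M + S * ?M" unfolding sum_distrib_right[symmetric] sum_distrib_left[symmetric]
  using mult_right_mono[OF row, of ?M] mult_right_mono[OF col, of ?M] by(simp add: mult.commute)
 finally have "(cmod z - 2 * S) * ?M <= 0" by(simp add: alg)
 hence "?M <= 0" using big by(simp add: mult_le_0_iff)
 hence "ent w x' y' = 0" for x' y' using m[of x' y'] by simp
 thus "w = 0" by(intro lop_eqI ext) (simp add: ap_ent[of w] fa)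
qed

locale sp_rep =
 fixes n :: nat and F :: "int => int => ('v::finite) lop"
 assumes n1: "n >= 1"
  and comm: "!!a b c d. a : Iset n ==> b : Iset n ==> c : Iset n ==> d : Iset n ==>
   F a b * F c d = F c d * F a b + kd c b *: F a d - kd a d *: F c b
    - theta a b *: (kd c (- a) *: F (- b) d - kd (- b) d *: F c (- a))"
  and sym: "!!a b. a : Iset n ==> b : Iset n ==> F (- b) (- a) = (- theta a b) *: F a b"
begin

abbreviation "I == Iset n"
abbreviation "nn == int n"
abbreviation sn :: "int => complex" where "sn j == of_int (sgn j)"

definition Fs :: "(int => int => bool) => 'v lop set" where
 "Fs P = {F a b |a b. a : I & b : I & P a b}"

text \<open>The grading element: its commutator multiplies \<open>F a b\<close> by
  \<open>a - b\<close>, so a word all of whose letters have \<open>a < b\<close>, or all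
  \<open>a > b\<close>, has a weight at least as large as its length in absolute value.\<close>

definition H0 :: "'v lop" where "H0 = (SUM i:{1..n}. of_nat i *: F (int i) (int i))"

lemma H0_comm:
 assumes "a : I" "b : I"
 shows "H0 * F a b - F a b * H0 = of_int (a - b) *: F a b" proof -
 have c: "F (int i) (int i) * F a b - F a b * F (int i) (int i) = (kd a (int i) - kd (int i) b - kd a (- int i) + kd (- int i) b) *: F a b"
  if "i : {1..n}" for i proof -
  have i: "int i : I" using that by(auto simp: Iset_def)
  show ?thesis using comm[OF i i assms] that by(auto simp: kd_def theta_same scl_simps)
 qed
 have s: "(SUM i:{1..n}. of_nat i * (kd a (int i) - kd a (- int i))) = of_int a" if "a : I" for a proof -
  have "(SUM i:{1..n}. of_nat i * (kd a (int i) - kd a (- int i))) = (SUM i:{1..n}. if i = nat \<bar>a\<bar> then of_int a else 0)"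
   using that by(intro sum.cong) (auto simp: kd_def Iset_def)
  thus ?thesis using that by(auto simp: Iset_def)
 qed
 have "H0 * F a b - F a b * H0 = (SUM i:{1..n}. of_nat i *: (F (int i) (int i) * F a b - F a b * F (int i) (int i)))"
  by(simp add: H0_def sum_distrib_left sum_distrib_right scl_simps sum_subtractf)
 also have "... = (SUM i:{1..n}. (of_nat i * (kd a (int i) - kd a (- int i)) - of_nat i * (kd b (int i) - kd b (- int i))) *: F a b)"
 proof(intro sum.cong refl)
  fix i assume "i : {1..n}"
  have k: "kd (int i) b = kd b (int i)" "kd (- int i) b = kd b (- int i)" by(auto simp: kd_def)
  show "of_nat i *: (F (int i) (int i) * F a b - F a b * F (int i) (int i)) = (of_nat i * (kd a (int i) - kd a (- int i)) - of_nat i * (kd b (int i) - kd b (- int i))) *: F a b"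
   unfolding c[OF \<open>i : {1..n}\<close>] k scl_simps(3) by(simp add: alg)
 qed
 also have "... = ((SUM i:{1..n}. of_nat i * (kd a (int i) - kd a (- int i))) - (SUM i:{1..n}. of_nat i * (kd b (int i) - kd b (- int i)))) *: F a b"
  by(rule lop_eqI) (simp add: ap_sum fun_eq_iff sum_fun_apply vs_apply sum_distrib_right flip: sum_subtractf)
 finally show ?thesis by(simp only: s[OF assms(1)] s[OF assms(2)] of_int_diff)
qed

lemma word_weight:
 assumes "set L <= Fs P" and P: "!!a b. P a b ==> s * (a - b) >= 1" and s: "s = 1 | s = - 1"
 shows "EX z. s * z >= int (length L) & H0 * prod_list L - prod_list L * H0 = of_int z *: prod_list L" using assms(1) proof(induction L)
 case Nil
 show ?case by(rule exI[of _ 0]) (simp add: scl_simps)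
next
 case (Cons X L)
 obtain z where z: "s * z >= int (length L)" "H0 * prod_list L - prod_list L * H0 = of_int z *: prod_list L" using Cons by auto
 obtain a b where X: "X = F a b" "a : I" "b : I" "P a b" using Cons.prems by(auto simp: Fs_def)
 have "H0 * (X * prod_list L) - X * prod_list L * H0 = (H0 * X - X * H0) * prod_list L + X * (H0 * prod_list L - prod_list L * H0)" by(simp add: alg)
 also have "... = of_int (a - b + z) *: (X * prod_list L)" unfolding z(2) X(1) H0_comm[OF X(2,3)] by(simp add: scl_simps left_diff_distrib)
 finally show ?case using z(1) P[OF X(4)] by(intro exI[of _ "a - b + z"]) (auto simp: alg)
qed

lemma long_words_vanish:
 assumes P: "!!a b. P a b ==> s * (a - b) >= 1" and s: "s = 1 | s = - 1"
 shows "EX N. ALL L. set L <= Fs P --> length L >= N --> prod_list L = 0" proof -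
 obtain B where B: "!!w z. H0 * w - w * H0 = z *: w ==> B < cmod z ==> w = 0" using weight_bound[of H0] by blast
 show ?thesis
 proof(intro exI[of _ "nat \<lceil>B\<rceil> + 1"] allI impI)
  fix L assume L: "set L <= Fs P" "length L >= nat \<lceil>B\<rceil> + 1"
  obtain z where z: "s * z >= int (length L)" "H0 * prod_list L - prod_list L * H0 = of_int z *: prod_list L" using word_weight[OF L(1) P s] by blast
  have "\<bar>z\<bar> >= int (length L)" using z(1) s by auto
  hence "real_of_int \<bar>z\<bar> > B" using L(2) by linarith
  thus "prod_list L = 0" using B[OF z(2)] by simp
 qed
qed

end

definition lf :: "(('x => complex) => complex) => bool" where
 "lf l <-> (ALL f g. l (f + g) = l f + l g) & (ALL c f. l (c *. f) = c * l f)"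

lemma lf_add: "lf l ==> l (f + g) = l f + l g" and lf_vs: "lf l ==> l (c *. f) = c * l f" by(auto simp: lf_def)
lemma lf_0: "lf l ==> l 0 = 0" using lf_vs[of l 0 0] by(simp add: vs_simps)
lemma lf_sum: "lf l ==> l (SUM a:A. f a) = (SUM a:A. l (f a))" by(induction A rule: infinite_finite_induct) (auto simp: lf_0 lf_add)
lemma lf_minus: "lf l ==> l (- f) = - l f" using lf_vs[of l "-1" f] by(simp add: vs_simps)
lemma lf_diff: "lf l ==> l (f - g) = l f - l g" using lf_add[of l f "- g"] by(simp add: lf_minus)

locale sp_hwrep = sp_rep n F for n and F :: "int => int => ('v::finite) lop" +
 fixes lam :: "nat => int" and xi :: "'v => complex"
 assumes irr: "!!U. csubspace U ==> (!!a b f. a : Iset n ==> b : Iset n ==> f : U ==> ap (F a b) f : U) ==> U = {0} | U = UNIV"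
  and xi0: "xi ~= 0"
  and xiw: "!!i. i : {1..n} ==> ap (F (int i) (int i)) xi = of_int (lam i) *. xi"
  and xir: "!!a b. a : Iset n ==> b : Iset n ==> a < b ==> ap (F a b) xi = 0"
begin

text \<open>The multiple that clears the resolvent: \<open>S0 u\<close> times \<open>Gf u\<close>
  acts polynomially in the model (\<open>Ph_inter\<close>), and the same factor occurs in the action
  of the twisted Yangian (\<open>piS_value\<close>).\<close>

definition S0 :: "complex => complex" where
 "S0 u = (u + 1/2) * (PROD m:{1..n}. (u + 1/2 - (of_int (lam m) - of_nat m)) * (u + 1/2 + (of_int (lam m) - of_nat m)))"

definition lm :: "int => complex" where
 "lm i = (if i > 0 then of_int (lam (nat i)) else - of_int (lam (nat (- i))))"

lemma F_neg: "i : I ==> F (- i) (- i) = - F i i" using sym[of i i] by(simp add: theta_same Iset_nz scl_simps)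

lemma xiw': "i : I ==> ap (F i i) xi = lm i *. xi"
proof -
 assume i: "i : I"
 show ?thesis
 proof(cases "i > 0")
  case True
  hence j: "nat i : {1..n}" "int (nat i) = i" using i by(auto simp: Iset_def)
  show ?thesis using xiw[OF j(1)] j(2) True by(simp add: lm_def)
 next
  case False
  hence j: "nat (- i) : {1..n}" "int (nat (- i)) = - i" using i by(auto simp: Iset_def)
  have "ap (F (- i) (- i)) xi = of_int (lam (nat (- i))) *. xi" using xiw[OF j(1)] j(2) by simp
  thus ?thesis using F_neg[OF i] False by(simp add: lm_def vs_simps) (metis minus_minus)
 qed
qed

text \<open>Highest covectors, without the choice of an invariant form: functionals annihilating the
  image of every generator with \<open>a > b\<close>.\<close>

definition killing :: "(('v => complex) => complex) => bool" where
 "killing l <-> lf l & (ALL a:I. ALL b:I. a > b --> (ALL f. l (ap (F a b) f) = 0))"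

text \<open>Exchanging two neighbouring generators changes the word by shorter words only, and these
  are assumed to be killed.\<close>

lemma comm_word:
 assumes "a : I" "b : I" "c : I" "d : I"
  and l: "lf l" and z: "!!a b. a : I ==> b : I ==> l (ap S (ap (F a b) f)) = 0"
 shows "l (ap S (ap (F a b) (ap (F c d) f))) = l (ap S (ap (F c d) (ap (F a b) f)))" proof -
 have "ap (F a b) (ap (F c d) f) = ap (F a b * F c d) f" by simp
 also have "... = ap (F c d) (ap (F a b) f) + kd c b *. ap (F a d) f - kd a d *. ap (F c b) f
    - theta a b *. (kd c (- a) *. ap (F (- b) d) f - kd (- b) d *. ap (F c (- a)) f)" unfolding comm[OF assms(1-4)] by simp
 finally show ?thesis using assms(1-4) by(simp add: ap_vadd ap_vdiff ap_vs lf_add[OF l] lf_diff[OF l] lf_vs[OF l] z)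
qed

text \<open>In a word applied to \<open>xi\<close> the last letter decides: if \<open>a < b\<close>
  it annihilates \<open>xi\<close>, if \<open>a = b\<close> it is a scalar, and if
  \<open>a > b\<close> it can be moved to the left end. So \<open>l\<close> vanishes on all words
  applied to \<open>xi\<close>, which span the module.\<close>

lemma killing_zero:
 assumes l: "killing l" and z: "l xi = 0" shows "l f = 0" proof -
 have lf: "lf l" using l by(simp add: killing_def)
 let ?A = "Fs (%a b. True)"
 have w: "l (ap (prod_list L) xi) = 0" if "set L <= ?A" for L using that proof(induction "length L" arbitrary: L rule: less_induct)
  case less
  \<comment> \<open>A letter with \<open>a > b\<close> travels through \<open>A\<close> to the left
    end, where \<open>l\<close> annihilates it; each exchange costs shorter words, covered by the
    induction on length.\<close>
  have mv: "l (ap (prod_list A) (ap (F a b) (ap (prod_list B) xi))) = 0"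
   if "set A <= ?A" "set B <= ?A" "length A + length B < length L" "a : I" "b : I" "a > b" for A B a b using that(1-3)
  proof(induction A arbitrary: B rule: rev_induct)
   case Nil
   thus ?case using l that(4-6) by(simp add: killing_def)
  next
   case (snoc X A)
   obtain c d where X: "X = F c d" "c : I" "d : I" using snoc.prems by(auto simp: Fs_def)
   have sw: "l (ap (prod_list A) (ap (F c d) (ap (F a b) (ap (prod_list B) xi)))) = l (ap (prod_list A) (ap (F a b) (ap (F c d) (ap (prod_list B) xi))))"
   proof(rule comm_word[OF X(2,3) that(4,5) lf])
    fix a b assume ab: "a : I" "b : I"
    have "l (ap (prod_list (A @ F a b # B)) xi) = 0" by(rule less.hyps) (use snoc.prems ab in "auto simp: Fs_def")
    thus "l (ap (prod_list A) (ap (F a b) (ap (prod_list B) xi))) = 0" by simp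
   qed
   have "l (ap (prod_list A) (ap (F a b) (ap (prod_list (F c d # B)) xi))) = 0" by(rule snoc.IH) (use snoc.prems X in "auto simp: Fs_def")
   thus ?case using sw by(simp add: X)
  qed
  show ?case
  proof(cases L rule: rev_cases)
   case Nil
   thus ?thesis by(simp add: z)
  next
   case (snoc A X)
   then obtain a b where X: "X = F a b" "a : I" "b : I" using less.prems by(auto simp: Fs_def)
   consider "a < b" | "a = b" | "a > b" by linarith
   thus ?thesis
   proof cases
    case 1
    thus ?thesis using xir[OF X(2,3)] by(simp add: snoc X lf_0[OF lf])
   next
    case 2
    have "l (ap (prod_list A) xi) = 0" by(rule less.hyps) (use less.prems snoc in auto)
    thus ?thesis using xiw'[OF X(2)] 2 by(simp add: snoc X ap_vs lf_vs[OF lf])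
   next
    case 3
    thus ?thesis using mv[of A "[]" a b] X less.prems snoc by simp
   qed
  qed
 qed
 define U where "U = {f. ALL L. set L <= ?A --> l (ap (prod_list L) f) = 0}"
 have "U = {0} | U = UNIV" proof(rule irr)
  show "csubspace U" unfolding U_def by(rule csubI) (auto simp: lf_0[OF lf] ap_vadd ap_vs lf_add[OF lf] lf_vs[OF lf])
  fix a b f assume ab: "a : I" "b : I" "f : U"
  show "ap (F a b) f : U" unfolding U_def proof(intro CollectI allI impI)
   fix L assume "set L <= ?A"
   hence "set (L @ [F a b]) <= ?A" using ab by(auto simp: Fs_def)
   hence "l (ap (prod_list (L @ [F a b])) f) = 0" using ab(3) unfolding U_def by blast
   thus "l (ap (prod_list L) (ap (F a b) f)) = 0" by simp
  qed
 qed
 moreover have "xi : U" using w by(simp add: U_def)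
 ultimately have "f : U" using xi0 by auto
 hence "l (ap (prod_list []) f) = 0" unfolding U_def by(auto dest!: spec[of _ "[]"])
 thus ?thesis by simp
qed

text \<open>A longest nonvanishing product of generators with \<open>a > b\<close> becomes 0 when
  one more is multiplied from the right, so each of its rows is such a covector. Its weight is read
  off from the difference \<open>l'\<close>, which kills as well and vanishes at
  \<open>xi\<close>.\<close>

lemma covector_ex:
 "EX l. killing l & l xi ~= 0 & (ALL i:I. ALL f. l (ap (F i i) f) = lm i * l f)" proof -
 let ?P = "%a b::int. a > b"
 obtain N where N: "!!L. set L <= Fs ?P ==> length L >= N ==> prod_list L = 0" using long_words_vanish[of ?P 1] by auto
 define K where "K = {k. EX L. set L <= Fs ?P & length L = k & prod_list L ~= 0}"
 have "K <= {..N}" using N unfolding K_def by(force simp: not_le[symmetric])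
 hence fK: "finite K" by(rule finite_subset) simp
 have "0 : K" unfolding K_def by(auto intro: exI[of _ "[]"])
 hence "Max K : K" using fK by(intro Max_in) auto
 then obtain L where L: "set L <= Fs ?P" "length L = Max K" "prod_list L ~= 0" unfolding K_def by auto
 have Lz: "prod_list L * F a b = 0" if "a : I" "b : I" "a > b" for a b proof(rule ccontr)
  assume "prod_list L * F a b ~= 0"
  hence "Suc (Max K) : K" using L that unfolding K_def by(intro CollectI exI[of _ "L @ [F a b]"]) (auto simp: Fs_def)
  thus False using Max_ge[OF fK] by(metis Suc_n_not_le_n)
 qed
 obtain f x where fx: "ap (prod_list L) f x ~= 0" proof(rule ccontr)
  assume "~ thesis"
  hence "ap (prod_list L) f x = 0" for f x using that by blast
  hence "prod_list L = 0" by(intro lop_eqI ext) (simp add: fa)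
  thus False using L(3) by simp
 qed
 define l where "l g = ap (prod_list L) g x" for g
 have lf: "lf l" by(auto simp: lf_def l_def ap_vadd ap_vs fa vs_apply)
 have k: "killing l" unfolding killing_def proof(intro conjI ballI impI allI)
  fix a b f assume ab: "a : I" "b : I" "a > b"
  show "l (ap (F a b) f) = 0" using arg_cong[OF Lz[OF ab], of "%T. ap T f x"] by(simp add: l_def fa)
 qed (rule lf)
 have nz: "l xi ~= 0" using killing_zero[OF k, of f] fx by(auto simp: l_def)
 have "l (ap (F i i) f) = lm i * l f" if i: "i : I" for i f proof -
  define l' where "l' f = l (ap (F i i) f) - lm i * l f" for f
  have "killing l'" unfolding killing_def proof(intro conjI ballI impI allI)
   show "lf l'" by(auto simp: lf_def l'_def ap_vadd ap_vs lf_add[OF lf] lf_vs[OF lf] alg)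
   fix a b f assume ab: "a : I" "b : I" "a > b"
   have la: "l (ap (F a b) g) = 0" for g using k ab by(auto simp: killing_def)
   have "l (ap (F i i) (ap (F a b) f)) = l (ap (F i i * F a b) f)" by simp
   also have "... = 0" unfolding comm[OF i i ab(1,2)] using la i by(auto simp: lf_add[OF lf] lf_diff[OF lf] lf_vs[OF lf] kd_def lf_0[OF lf])
   finally show "l' (ap (F a b) f) = 0" by(simp add: l'_def la)
  qed
  moreover have "l' xi = 0" by(simp add: l'_def xiw'[OF i] lf_vs[OF lf])
  ultimately have "l' f = 0" by(rule killing_zero)
  thus ?thesis by(simp add: l'_def)
 qed
 thus ?thesis using k nz by blast
qed

definition xs :: "('v => complex) => complex" where
 "xs = (SOME l. killing l & l xi ~= 0 & (ALL i:I. ALL f. l (ap (F i i) f) = lm i * l f))"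

lemma xs: "killing xs" "xs xi ~= 0" "i : I ==> xs (ap (F i i) f) = lm i * xs f" using someI_ex[OF covector_ex] unfolding xs_def[symmetric] by auto

lemma lf_xs: "lf xs" using xs(1) by(simp add: killing_def)
lemma xs_low: "a : I ==> b : I ==> a > b ==> xs (ap (F a b) f) = 0" using xs(1) by(simp add: killing_def)

text \<open>The vectors invisible to all words with \<open>a < b\<close> form a submodule, since any
  other letter can be moved left to the covector, which scales or kills it. The submodule omits
  \<open>xi\<close>, so it is 0.\<close>

lemma raising_faithful:
 assumes z: "!!L. set L <= Fs (<) ==> xs (ap (prod_list L) z) = 0"
 shows "z = 0" proof -
 define U where "U = {z. ALL L. set L <= Fs (<) --> xs (ap (prod_list L) z) = 0}"
 have Ud: "xs (ap (prod_list L) z) = 0" if "z : U" "set L <= Fs (<)" for z L using that unfolding U_def by blast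
 have st: "xs (ap (prod_list L) (ap (F a b) z)) = 0" if "set L <= Fs (<)" "a : I" "b : I" "z : U" for L a b z using that
 proof(induction L arbitrary: a b z rule: rev_induct)
  case Nil
  have "xs z = 0" using Ud[OF Nil(4), of "[]"] by simp
  moreover have "a < b ==> xs (ap (F a b) z) = 0" using Ud[OF Nil(4), of "[F a b]"] Nil(2,3) by(auto simp: Fs_def)
  ultimately show ?case using xs(3)[of a z] xs_low[of a b z] Nil(2,3) by(cases a b rule: linorder_cases) auto
 next
  case (snoc X L)
  obtain c d where X: "X = F c d" "c : I" "d : I" "c < d" using snoc.prems by(auto simp: Fs_def)
  have L: "set L <= Fs (<)" using snoc.prems by simp
  have Xz: "ap X z : U" unfolding U_def proof(intro CollectI allI impI)
   fix K assume "set K <= Fs (<)"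
   hence "set (K @ [X]) <= Fs (<)" using snoc.prems(1) by auto
   hence "xs (ap (prod_list (K @ [X])) z) = 0" by(rule Ud[OF snoc.prems(4)])
   thus "xs (ap (prod_list K) (ap X z)) = 0" by simp
  qed
  have "xs (ap (prod_list L) (ap (F c d) (ap (F a b) z))) = xs (ap (prod_list L) (ap (F a b) (ap (F c d) z)))"
   by(rule comm_word[OF X(2,3) snoc.prems(2,3) lf_xs]) (rule snoc.IH[OF L _ _ snoc.prems(4)])
  also have "... = 0" using snoc.IH[OF L snoc.prems(2,3) Xz] by(simp add: X)
  finally show ?case by(simp add: X)
 qed
 have "U = {0} | U = UNIV" proof(rule irr)
  show "csubspace U" unfolding U_def by(rule csubI) (auto simp: lf_0[OF lf_xs] ap_vadd ap_vs lf_add[OF lf_xs] lf_vs[OF lf_xs])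
  show "ap (F a b) f : U" if "a : I" "b : I" "f : U" for a b f using st[OF _ that] unfolding U_def by blast
 qed
 moreover have "xi ~: U" proof
  assume "xi : U"
  hence "xs (ap (prod_list []) xi) = 0" by(rule Ud) simp
  thus False using xs(2) by simp
 qed
 ultimately have "U = {0}" by blast
 thus ?thesis using z unfolding U_def by blast
qed

text \<open>The covector generates a finite-dimensional \<open>sl(2)\<close>-module under right multiplication.\<close>

lemma sl2_covector:
 assumes ef: "e * f = f * e + h" and he: "h * e = e * h + (e + e)"
  and f: "!!v. xs (ap f v) = 0" and h: "!!v. xs (ap h v) = N * xs v" and nil: "e ^ M = 0"
 shows "EX m. N = of_nat m & (ALL v. xs (ap (e ^ Suc m) v) = 0)" proof -
 have hp: "xs (ap (e ^ p) (ap h v)) = (N - 2 * of_nat p) * xs (ap (e ^ p) v)" for p v proof(induction p arbitrary: v)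
  case (Suc p)
  have "e ^ Suc p * h = e ^ p * (h * e) - e ^ p * (e + e)" by(subst he) (simp add: power_Suc2 alg mult.assoc del: power_Suc)
  hence "xs (ap (e ^ Suc p) (ap h v)) = xs (ap (e ^ p * (h * e) - e ^ p * (e + e)) v)" by(metis ap_mult)
  also have "... = (N - 2 * of_nat (Suc p)) * xs (ap (e ^ p) (ap e v))"
   by(simp only: lf_diff[OF lf_xs] lf_add[OF lf_xs] ap_vadd ap_diff ap_add ap_mult Suc) (simp add: alg)
  finally show ?case by(simp add: power_Suc2 del: power_Suc)
 qed (simp add: h)
 have fp: "xs (ap (e ^ Suc p) (ap f v)) = of_nat (Suc p) * (N - of_nat p) * xs (ap (e ^ p) v)" for p v proof(induction p arbitrary: v)
  case 0
  have "xs (ap e (ap f v)) = xs (ap (f * e + h) v)" by(simp flip: ef)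
  thus ?case by(simp add: lf_add[OF lf_xs] f h)
 next
  case (Suc p)
  have "xs (ap (e ^ Suc (Suc p)) (ap f v)) = xs (ap (e ^ Suc p) (ap (e * f) v))" by(simp add: power_Suc2 del: power_Suc)
  also have "... = xs (ap (e ^ Suc p) (ap f (ap e v))) + xs (ap (e ^ Suc p) (ap h v))" unfolding ef by(simp add: ap_vadd lf_add[OF lf_xs] del: power_Suc)
  also have "... = of_nat (Suc p) * (N - of_nat p) * xs (ap (e ^ Suc p) v) + (N - 2 * of_nat (Suc p)) * xs (ap (e ^ Suc p) v)"
   unfolding Suc hp by(simp add: power_Suc2 del: power_Suc of_nat_Suc)
  finally show ?case by(simp add: alg)
 qed
 define p where "p = (LEAST p. ALL v. xs (ap (e ^ p) v) = 0)"
 have "ALL v. xs (ap (e ^ M) v) = 0" by(simp add: nil lf_0[OF lf_xs])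
 hence p: "ALL v. xs (ap (e ^ p) v) = 0" unfolding p_def by(rule LeastI)
 have "p ~= 0" using p xs(2) by(metis ap_1 power_0)
 then obtain m where m: "p = Suc m" by(cases p) auto
 have "~ (ALL v. xs (ap (e ^ m) v) = 0)" using not_less_Least[of m "%p. ALL v. xs (ap (e ^ p) v) = 0"] m unfolding p_def by auto
 then obtain v where v: "xs (ap (e ^ m) v) ~= 0" by blast
 have "of_nat (Suc m) * (N - of_nat m) * xs (ap (e ^ m) v) = 0" using p fp[of m v] m by simp
 hence "N = of_nat m" using v by(simp del: of_nat_Suc)
 thus ?thesis using p m by blast
qed

end

declare scl_simps(6,9-12) [simp] vs_simps(2,3,10) [simp]

lemma ap_pt: "ap T (%y. f y + g y) = ap T f + ap T g" "ap T (%y. c * f y) = c *. ap T f" using ap_vadd[of T f g] ap_vs[of T c f] by(simp_all add: plus_fun_def vs_def)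
lemma lf_pt: "lf l ==> l (%y. f y + g y) = l f + l g" "lf l ==> l (%y. c * f y) = c * l f" "lf l ==> l (%y. 0) = 0"
 using lf_add[of l f g] lf_vs[of l c f] lf_0[of l] by(simp_all add: plus_fun_def vs_def zero_fun_def)

section \<open>The exponential series of a vector\<close>

definition lv :: "'v lop => ('v \<times> 'b) lop" where
 "lv T = Lop (%z (y, a). ap T (%y'. z (y', a)) y)"
definition ls :: "'b lop => ('v \<times> 'b) lop" where
 "ls S = Lop (%z (y, a). ap S (%a'. z (y, a')) a)"

lemma ap_lv:
 fixes T :: "'a lop" and z :: "'a \<times> 'b => complex"
 shows "ap (lv T) z (y, a) = ap T (%y'. z (y', a)) y" proof -
 have "clin (%z (y, a). ap T (%y'. z (y', a)) y)" by(intro clinI ext) (clarsimp simp: fa ap_pt vs_apply)+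
 thus ?thesis unfolding lv_def by(subst ap_Lop) auto
qed

lemma ap_ls:
 fixes S :: "'a lop" and z :: "'b \<times> 'a => complex"
 shows "ap (ls S) z (y, a) = ap S (%a'. z (y, a')) a" proof -
 have "clin (%z (y, a). ap S (%a'. z (y, a')) a)" by(intro clinI ext) (clarsimp simp: fa ap_pt vs_apply)+
 thus ?thesis unfolding ls_def by(subst ap_Lop) auto
qed

lemma ap_lv2: "(%y. ap (lv T) z (y, a)) = ap T (%y. z (y, a))" by(simp add: ap_lv)
lemma ap_ls2: "(%a. ap (ls S) z (y, a)) = ap S (%a. z (y, a))" by(simp add: ap_ls)

lemma lv_hom: "lv (S * T) = lv S * lv T" "lv (S + T) = lv S + lv T" "lv (S - T) = lv S - lv T" "lv (c *: S) = c *: lv S" "lv 1 = 1" "lv 0 = 0"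
 by(rule lop_eqI, rule ext, clarsimp simp: ap_lv ap_lv2 fa vs_apply)+
lemma ls_hom: "ls (S * T) = ls S * ls T" "ls (S + T) = ls S + ls T" "ls (S - T) = ls S - ls T" "ls (c *: S) = c *: ls S" "ls 1 = 1" "ls 0 = 0"
 by(rule lop_eqI, rule ext, clarsimp simp: ap_ls ap_ls2 fa vs_apply)+

text \<open>\<open>ls S\<close> need not be given by a matrix. The two commute because
  \<open>T\<close> is a finite matrix, so only finite linear combinations are moved through
  \<open>S\<close>.\<close>

lemma lv_ls:
 fixes T :: "'v::finite lop" and S :: "'b lop"
 shows "lv T * ls S = ls S * lv T" proof(rule lop_eqI, rule ext)
 fix z :: "'v \<times> 'b => complex" and p :: "'v \<times> 'b"
 obtain y a where p: "p = (y, a)" by(cases p)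
 have "(%a. ap T (%y'. z (y', a)) y) = (SUM y':UNIV. ent T y y' *. (%a. z (y', a)))" by(rule ext) (simp add: ap_ent[of T] sum_fun_apply vs_apply)
 hence "ap (ls S * lv T) z (y, a) = (SUM y':UNIV. ent T y y' * ap S (%a. z (y', a)) a)" by(simp add: ap_ls ap_lv ap_vsum ap_vs sum_fun_apply vs_apply)
 thus "ap (lv T * ls S) z p = ap (ls S * lv T) z p" by(simp add: p ap_lv ap_ls ap_ent[of T])
qed

definition ad :: "'x lop => 'x lop => 'x lop" where "ad S T = S * T - T * S"

lemma ad_simps:
 "ad S (T * U) = ad S T * U + T * ad S U" "ad (S * T) U = S * ad T U + ad S U * T"
 "ad S (T + U) = ad S T + ad S U" "ad (S + T) U = ad S U + ad T U"
 "ad S (T - U) = ad S T - ad S U" "ad (S - T) U = ad S U - ad T U"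
 "ad S (c *: T) = c *: ad S T" "ad (c *: S) T = c *: ad S T" "ad S 1 = 0" "ad 1 S = 0" "ad S S = 0" "ad 0 S = 0" "ad S 0 = 0" by(simp_all add: ad_def alg scl_simps)
lemma ad_sum: "ad S (SUM a:A. T a) = (SUM a:A. ad S (T a))" "ad (SUM a:A. T a) S = (SUM a:A. ad (T a) S)"
 by(simp_all add: ad_def sum_distrib_left sum_distrib_right sum_subtractf)
lemma ad_lv_ls: "ad (lv (T :: 'v::finite lop)) (ls S) = 0" "ad (ls S) (lv (T :: 'v::finite lop)) = 0" by(simp_all add: ad_def lv_ls)
lemma ad_lv: "ad (lv S) (lv T) = lv (ad S T)" and ad_ls: "ad (ls S) (ls T) = ls (ad S T)" by(simp_all add: ad_def lv_hom ls_hom)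
lemma ad_D: "S * T = T * S + ad S T" by(simp add: ad_def)

definition pair :: "(('v => complex) => complex) => ('v \<times> 'b => complex) => 'b => complex" where
 "pair l z a = l (%y. z (y, a))"

lemma pair_lin:
 fixes f g :: "'a \<times> 'b => complex"
 assumes "lf l" shows "pair l (f + g) = pair l f + pair l g" "pair l (c *. f) = c *. pair l f" "pair l 0 = 0"
 using assms by(auto simp: pair_def fun_eq_iff fa vs_apply lf_pt[OF assms])

lemma pair_diff: "lf l ==> pair l (f - g) = pair l f - pair l g" using pair_lin(1)[of l f "(-1) *. g"] pair_lin(2)[of l "-1" g] by(simp add: vs_simps)
lemma pair_sum: "lf l ==> pair l (SUM a:A. f a) = (SUM a:A. pair l (f a))" by(induction A rule: infinite_finite_induct) (auto simp: pair_lin)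

lemma pair_ls:
 fixes l :: "('v::finite => complex) => complex"
 assumes "lf l" shows "pair l (ap (ls S) z) = ap S (pair l z)" proof -
 have k: "(%y. g y) = (SUM y:UNIV. g y *. kd y)" for g :: "'v => complex"
  by(rule ext) (simp add: sum_fun_apply vs_apply kd_def if_distrib[of "%z. _ * z"] cong: if_cong)
 have e: "pair l z = (SUM y:UNIV. l (kd y) *. (%a. z (y, a)))" for z :: "'v \<times> 'a => complex"
  by(rule ext) (simp add: pair_def sum_fun_apply vs_apply, subst k, simp add: lf_sum[OF assms] lf_vs[OF assms] mult.commute)
 show ?thesis by(simp add: e ap_vsum ap_vs ap_ls2)
qed

lemma pair_lv: "pair l (ap (lv T) z) = pair (%g. l (ap T g)) z" by(rule ext) (simp add: pair_def ap_lv2)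

lemma lv_minus: "lv (- S) = - lv S" and ls_minus: "ls (- S) = - ls S" using lv_hom(4)[of "-1" S] ls_hom(4)[of "-1" S] by(simp_all add: scl_simps)

lemma half_scl: "(1/2) *: (S + S) = S" by(rule lop_eqI) (simp add: fun_eq_iff fa vs_apply)

lemma scl_two: "(2 * z) *: S = z *: S + z *: S" by(rule lop_eqI) (simp add: fun_eq_iff fa vs_apply)

context sp_rep
begin

definition J :: "int set" where "J = I - {nn}"
text \<open>The coordinate of index n is set to 1: the series depends on 2n - 1 variables, while
  sums can still run over all of \<open>I\<close>.\<close>

definition xr :: "int => (int => nat) lop" where "xr k = (if k = nn then 1 else xv k)"
abbreviation X :: "int => 'v ser lop" where "X k == ls (xr k)"
abbreviation Dd :: "int => 'v ser lop" where "Dd k == ls (dv k)"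
text \<open>\<open>F (- nn) nn\<close> is twice a matrix unit, whence the half.\<close>

definition fj :: "int => 'v lop" where "fj j = (if j = - nn then (1/2) *: F (- nn) nn else F j nn)"
definition YY :: "'v ser lop" where "YY = (SUM j:J. X j * lv (fj j))"
definition EE :: "'v ser lop" where "EE = (SUM j:J. X j * Dd j)"
definition deg :: "(int => nat) => nat" where "deg a = (SUM j:J. a j)"

lemma finJ [simp]: "finite J" by(simp add: J_def)
lemma nI [simp]: "nn : I" using n1 by(simp add: Iset_def)
lemma nnJ [simp]: "- nn : J" using n1 by(simp add: Iset_def J_def)
lemma J_I: "j : J ==> j : I" and J_n: "j : J ==> j ~= nn" by(auto simp: J_def)
lemma J_m: "j : J ==> j ~= - nn ==> - j : J" by(auto simp: J_def Iset_def)
lemma I_J: "I = insert nn J" using nI by(auto simp: J_def)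
lemma nJ [simp]: "nn ~: J" by(simp add: J_def)

lemma xr_J: "j : J ==> xr j = xv j" by(auto simp: xr_def J_def)
lemma xr_n [simp]: "xr nn = 1" by(simp add: xr_def)

lemma ad_X: "ad (X i) (X j) = 0" "ad (Dd i) (Dd j) = 0"
 "i : J ==> ad (Dd i) (X j) = (if i = j then 1 else 0)" "i : J ==> ad (X j) (Dd i) = (if i = j then - 1 else 0)" proof -
 show "ad (X i) (X j) = 0" "ad (Dd i) (Dd j) = 0" by(auto simp: ad_def xr_def xx_comm dd_comm ls_hom simp flip: ls_hom(1))
 assume i: "i : J"
 let ?A = "if i = j then 1 else 0"
 have d: "dv i * xr j - xr j * dv i = ?A" using J_n[OF i] by(auto simp: xr_def dx_same dx_diff)
 show "ad (Dd i) (X j) = ?A" by(simp only: ad_ls ad_def[of "dv i"] d) (simp add: ls_hom)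
 have d': "xr j * dv i - dv i * xr j = - ?A" by(simp flip: d)
 show "ad (X j) (Dd i) = (if i = j then - 1 else 0)" by(simp only: ad_ls ad_def[of "xr j"] d') (simp add: ls_minus ls_hom)
qed

lemmas ad_U = ad_simps ad_X ad_lv_ls

lemma ad_EE_X: "k : J ==> ad EE (X k) = X k" by(simp add: EE_def ad_sum ad_U if_distrib[of "%z. _ * z"] sum.delta cong: if_cong)
lemma ad_EE_D: "k : J ==> ad EE (Dd k) = - Dd k"
proof -
 assume k: "k : J"
 have "ad EE (Dd k) = (SUM j:J. if j = k then - Dd k else 0)" unfolding EE_def ad_sum using k by(intro sum.cong) (auto simp: ad_U)
 thus ?thesis using k by simp
qed
lemma ad_EE_lv: "ad EE (lv T) = 0" by(simp add: EE_def ad_sum ad_U)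

abbreviation tq :: "(int => int => 'v lop) => int => int => int => int => 'v lop" where
 "tq Z a b c d == kd c b *: Z a d - kd a d *: Z c b - theta a b *: (kd c (- a) *: Z (- b) d - kd (- b) d *: Z c (- a))"
text \<open>The law under which the matrix \<open>F\<close> itself transforms. Powers and resolvent
  of \<open>F\<close> obey it too, so one set of conjugation formulas serves both \<open>F\<close>
  and \<open>Gf\<close>.\<close>

definition teq :: "(int => int => 'v lop) => bool" where
 "teq Z <-> (ALL a:I. ALL b:I. ALL c:I. ALL d:I.
   ad (F a b) (Z c d) = tq Z a b c d)"

lemma ad_aux: "x + a - b - c - x = a - b - (c::'v lop)" by simp

lemma teq_F: "teq F" unfolding teq_def ad_def by(intro ballI) (subst comm, assumption+, rule ad_aux)

lemma teqD: "teq Z ==> a : I ==> b : I ==> c : I ==> d : I ==>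
  ad (F a b) (Z c d) = tq Z a b c d" unfolding teq_def by blast

lemma th_n: "theta i nn = sn i" using n1 by(simp add: theta_def)
lemma th_nn: "theta (- nn) nn = - 1" using n1 by(simp add: theta_def)

lemma ad_fj_Z:
 assumes Z: "teq Z" and j: "j : J" and k: "k : I" and l: "l : I"
 shows "ad (fj j) (Z k l) = (if k = nn then Z j l else 0) - (if l = j then Z k nn else 0)
   - (if j = - nn then 0 else sn j *: ((if k = - j then Z (- nn) l else 0) - (if l = - nn then Z k (- j) else 0)))" proof(cases "j = - nn")
 case True
 let ?A = "(if k = nn then Z (- nn) l else 0) - (if l = - nn then Z k nn else 0)"
 have "ad (F (- nn) nn) (Z k l) = ?A + ?A" using teqD[OF Z _ nI k l, of "- nn"] by(auto simp: th_nn kd_def scl_simps(9-12))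
 thus ?thesis using True by(simp add: fj_def ad_simps half_scl)
next
 case False
 thus ?thesis using teqD[OF Z J_I[OF j] nI k l] J_n[OF j] by(auto simp: fj_def kd_def th_n scl_simps(10,11))
qed

text \<open>The \<open>fj\<close> span a Heisenberg algebra with central element
  \<open>fj (- nn)\<close>, so repeated commutators of \<open>YY\<close> with an \<open>fj\<close>
  stop after the first.\<close>

lemma ad_fj_fj: assumes i: "i : J" and j: "j : J"
 shows "ad (fj i) (fj j) = (if j = - i then (- 2 * sn i) *: fj (- nn) else 0)" proof -
 have F: "ad (fj i) (F j nn) = (if j = - i then (- sn i) *: F (- nn) nn else 0)" using ad_fj_Z[OF teq_F i J_I[OF j] nI] J_n[OF j] J_n[OF i] n1
  by(auto simp: scl_simps)
 have h: "(- 2 * z) *: fj (- nn) = (- z) *: F (- nn) nn" for z by(simp add: fj_def scl_simps(3))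
 show ?thesis
 proof(cases "j = - nn")
  case True
  hence "j ~= - i" using J_n[OF i] by auto
  moreover have "fj j = (1/2) *: F j nn" using True by(simp add: fj_def)
  ultimately show ?thesis using F by(simp add: ad_simps(7) scl_simps(12))
 next
  case False
  hence "fj j = F j nn" by(simp add: fj_def)
  thus ?thesis using F unfolding h by simp
 qed
qed

text \<open>The logarithmic derivative of the exponential: D_j exp(Y) = (f_j + [Y, f_j]/2) exp(Y),
  because [Y, f_j] commutes with Y.\<close>

definition MM :: "int => 'v ser lop" where
 "MM j = lv (fj j) + (if j = - nn then 0 else sn j *: (X (- j) * lv (fj (- nn))))"

lemma ad_YY_fj: assumes j: "j : J" shows "ad YY (lv (fj j)) = (if j = - nn then 0 else (2 * sn j) *: (X (- j) * lv (fj (- nn))))"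
proof -
 let ?A = "X (- j) * lv (fj (- nn))"
 have "ad YY (lv (fj j)) = (SUM i:J. if i = - j then (2 * sn j) *: ?A else 0)" unfolding YY_def ad_sum proof(intro sum.cong refl)
  fix i assume i: "i : J"
  show "ad (X i * lv (fj i)) (lv (fj j)) = (if i = - j then (2 * sn j) *: ?A else 0)"
   using ad_fj_fj[OF i j] by(auto simp: ad_simps ad_lv ad_lv_ls lv_hom scl_simps(2) sgn_minus)
 qed
 thus ?thesis using J_m[OF j] by auto
qed

text \<open>Formally \<open>EE - YY\<close> is exp(Y) E exp(-Y) with the Euler operator E, so
  commutation with it expresses homogeneity of a conjugated operator. Here D_j - M_j is exp(Y) D_j
  exp(-Y), of degree -1; by \<open>uniq\<close> it annihilates the exponential series.\<close>

lemma ring_R1: assumes j: "j : J" shows "(EE + 1 - YY) * (Dd j - MM j) = (Dd j - MM j) * (EE - YY)"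
proof -
 have YD: "ad YY (Dd j) = - lv (fj j)" proof -
  have "ad YY (Dd j) = (SUM i:J. if i = j then - lv (fj j) else 0)" unfolding YY_def ad_sum using j by(intro sum.cong) (auto simp: ad_U)
  thus ?thesis using j by simp
 qed
 have YA: "ad YY (lv (fj (- nn))) = 0" using ad_YY_fj[OF nnJ] by simp
 have YX: "ad YY (X k) = 0" for k unfolding YY_def ad_sum by(simp add: ad_U)
 have EM: "ad EE (MM j) = MM j - lv (fj j)" using J_m[OF j] by(auto simp: MM_def ad_simps ad_EE_lv ad_EE_X)
 have YM: "ad YY (MM j) = MM j - lv (fj j) + (MM j - lv (fj j))" by(auto simp: MM_def ad_simps ad_YY_fj[OF j] YA YX scl_simps(12) scl_two)
 have "ad (EE - YY) (Dd j - MM j) = - (Dd j - MM j)" by(simp add: ad_simps ad_EE_D[OF j] YD EM YM)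
 thus ?thesis by(simp add: ad_def alg)
qed

text \<open>Vector fields in the coordinates with x_n = 1: on the series of a vector of
  \<open>VP\<close> the generator \<open>F i k\<close> with \<open>i < k\<close>, acting on values,
  agrees with \<open>DD i k\<close>, acting on variables (\<open>FD\<close>).\<close>

definition DD :: "int => int => (int => nat) lop" where
 "DD i k = xr k * dv i - theta i k *: (xr (- i) * dv (- k))"

text \<open>The difference of the two actions maps solutions of \<open>(EE - YY) z = 0\<close> to
  solutions, and those are determined by their part of degree 0.\<close>

lemma ring_R2: assumes i: "i : J" "i ~= - nn" and k: "k : J" "k ~= - nn"
 shows "(EE - YY) * (lv (F i k) - ls (DD i k)) = (lv (F i k) - ls (DD i k)) * (EE - YY)" proof -
 note mi = J_m[OF i] and mk = J_m[OF k]
 have E: "ad EE (ls (DD i k)) = 0" using i k mi mk by(simp add: DD_def ls_hom ad_simps ad_EE_X ad_EE_D)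
 let ?A = "X (- i) * lv (fj (- k))"
 have YF: "ad YY (lv (F i k)) = theta i k *: ?A - X k * lv (fj i)" proof -
  have "ad (fj j) (F i k) = (if j = - i then theta i k *: fj (- k) else 0) - (if j = k then fj i else 0)" if j: "j : J" for j proof(cases "j = - nn")
   case True
   thus ?thesis using ad_fj_Z[OF teq_F j J_I[OF i(1)] J_I[OF k(1)]] i k J_n[OF i(1)] J_n[OF k(1)] by auto
  next
   case False
   have "F (- nn) k = sn k *: F (- k) nn" using sym[of "- k" "nn"] J_I[OF k(1)] by(simp add: th_n sgn_minus)
   thus ?thesis using ad_fj_Z[OF teq_F j J_I[OF i(1)] J_I[OF k(1)]] i k J_n[OF i(1)] J_n[OF k(1)] J_n[OF mk] False
    by(auto simp: scl_simps(3,9) fj_def theta_def sgn_minus)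
  qed
  hence "ad YY (lv (F i k)) = (SUM j:J. (if j = - i then theta i k *: ?A else 0) - (if j = k then X k * lv (fj i) else 0))" unfolding YY_def ad_sum
   by(intro sum.cong) (auto simp: ad_simps ad_lv ad_lv_ls lv_hom scl_simps(2) right_diff_distrib lv_hom(3)[of 0, simplified])
  thus ?thesis using mi k by(simp add: sum_subtractf)
 qed
 have YD: "ad YY (ls (DD i k)) = theta i k *: ?A - X k * lv (fj i)" proof -
  have "ad (X j) (ls (DD i k)) = (if j = - k then theta i k *: X (- i) else 0) - (if j = i then X k else 0)" for j using i mk by(auto simp: DD_def ls_hom ad_simps ad_X)
  hence "ad YY (ls (DD i k)) = (SUM j:J. (if j = - k then theta i k *: ?A else 0) - (if j = i then X k * lv (fj i) else 0))" unfolding YY_def ad_sum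
   by(intro sum.cong) (auto simp: ad_simps ad_lv_ls scl_simps(1) left_diff_distrib)
  thus ?thesis using i mk by(simp add: sum_subtractf)
 qed
 have "ad (EE - YY) (lv (F i k) - ls (DD i k)) = 0" by(simp add: ad_simps ad_EE_lv E YF YD)
 thus ?thesis by(simp add: ad_def)
qed

lemma antisym_sum: "(SUM j:J. if j = - nn then 0 else sn j *: (X j * X (- j))) = 0" (is "?S = 0")
proof -
 let ?K = "J - {- nn}"
 let ?A = "SUM j:?K. sn j *: (X j * X (- j))"
 have "?S = ?A" by(rule sum.mono_neutral_cong_right) auto
 moreover have "?A = (SUM j:?K. - (sn j *: (X j * X (- j))))" proof(rule sum.reindex_bij_witness[of _ uminus uminus])
  fix j show "- (of_int (sgn (- j)) *: (X (- j) * X (- (- j)))) = sn j *: (X j * X (- j))" using ad_X(1)[of j "- j"] by(simp add: sgn_minus scl_simps ad_def)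
 qed (auto simp: J_def)
 ultimately have e: "?S = - ?S" unfolding sum_negf by argo
 have "?S + ?S = ?S + - ?S" by(rule arg_cong[where f = "%z. ?S + z", OF e])
 hence "?S + ?S = 0" by(simp only: add.right_inverse)
 hence "(1/2) *: (?S + ?S) = 0" by(simp only: scl_simps(12))
 thus ?thesis by(simp only: half_scl)
qed

text \<open>The sum is exp(Y) Z_{n,n} exp(-Y). It commutes with the conjugated Euler operator
  because Z_{n,n} contains no variable.\<close>

lemma ring_R3: assumes Z: "teq Z"
 defines "S == SUM k:I. X k * lv (Z k nn)"
 shows "(EE - YY) * S = S * (EE - YY)" proof -
 let ?Z = "%k. lv (Z k nn) :: 'v ser lop"
 have E: "ad EE S = (SUM k:J. X k * ?Z k)" unfolding S_def I_J using finJ by(simp add: ad_sum ad_simps ad_EE_lv ls_hom ad_EE_X)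
 have one: "ad (lv (fj j)) S = ?Z j - (if j = - nn then 0 else sn j *: (X (- j) * ?Z (- nn)))" if j: "j : J" for j proof -
  have a: "ad (fj j) (Z k nn) = (if k = nn then Z j nn else 0) - (if j = - nn then 0 else if k = - j then sn j *: Z (- nn) nn else 0)"
   if "k : I" for k using ad_fj_Z[OF Z j that nI] J_n[OF j] n1 by(auto simp: scl_simps)
  have "ad (lv (fj j)) S = (SUM k:I. (if k = nn then ?Z j else 0) - (if k = - j then (if j = - nn then 0 else sn j *: (X (- j) * ?Z (- nn))) else 0))"
   unfolding S_def ad_sum by(intro sum.cong) (auto simp: ad_simps ad_lv_ls ad_lv a lv_hom ls_hom scl_simps(2) right_diff_distrib lv_hom(3)[of 0, simplified])
  thus ?thesis using J_I[OF j] by(simp add: sum_subtractf)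
 qed
 have XS: "ad (X j) S = 0" for j unfolding S_def ad_sum by(simp add: ad_U)
 have "ad YY S = (SUM j:J. X j * ?Z j - (if j = - nn then 0 else sn j *: (X j * X (- j))) * ?Z (- nn))"
  unfolding YY_def ad_sum by(intro sum.cong) (auto simp: ad_simps XS one right_diff_distrib scl_simps(1,2) mult.assoc)
 also have "... = (SUM j:J. X j * ?Z j)" unfolding sum_subtractf sum_distrib_right[symmetric] antisym_sum by simp
 finally have "ad (EE - YY) S = 0" by(simp add: ad_simps E)
 thus ?thesis by(simp add: ad_def)
qed

end

lemma ad_min: "ad S (- T) = - ad S T" "ad (- S) T = - ad S T" by(simp_all add: ad_def)

context sp_rep
begin

text \<open>Unlike column n, the other columns do not commute with \<open>EE - YY\<close>; the
  defect recorded here cancels in the contraction of \<open>ring_R4\<close>.\<close>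

lemma ring_S: assumes Z: "teq Z" and l: "l : I"
 defines "S == %l. SUM k:I. X k * lv (Z k l)"
 shows "ad (EE - YY) (S l) = (if l = nn then 0 else X l * S nn)
   - (if l = - nn then SUM j:J. if j = - nn then 0 else sn j *: (X j * S (- j)) else 0)" proof -
 let ?Z = "%k l. lv (Z k l) :: 'v ser lop"
 have E: "ad EE (S l) = (SUM k:J. X k * ?Z k l)" unfolding S_def I_J using finJ by(simp add: ad_sum ad_simps ad_EE_lv ls_hom ad_EE_X)
 have one: "ad (lv (fj j)) (S l) = ?Z j l - (if j = - nn then 0 else sn j *: (X (- j) * ?Z (- nn) l))
   - (if l = j then S nn else 0) + (if j = - nn | l ~= - nn then 0 else sn j *: S (- j))" if j: "j : J" for j proof -
  have "ad (lv (fj j)) (X k * ?Z k l) = (if k = nn then ?Z j l else 0) - (if k = - j then (if j = - nn then 0 else sn j *: (X (- j) * ?Z (- nn) l)) else 0)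
    - (if l = j then X k * ?Z k nn else 0) + (if j = - nn | l ~= - nn then 0 else sn j *: (X k * ?Z k (- j)))"
   if "k : I" for k proof -
   have "ad (lv (fj j)) (X k * ?Z k l) = X k * lv (ad (fj j) (Z k l))" by(simp add: ad_simps(1) ad_lv_ls ad_lv)
   thus ?thesis unfolding ad_fj_Z[OF Z j that l] using J_n[OF j] by(auto simp: lv_hom ls_hom scl_simps(1-8) right_diff_distrib distrib_left lv_minus)
  qed
  hence "ad (lv (fj j)) (S l) = (SUM k:I. (if k = nn then ?Z j l else 0) - (if k = - j then (if j = - nn then 0 else sn j *: (X (- j) * ?Z (- nn) l)) else 0)
    - (if l = j then X k * ?Z k nn else 0) + (if j = - nn | l ~= - nn then 0 else sn j *: (X k * ?Z k (- j))))" unfolding S_def ad_sum by(intro sum.cong refl) auto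
  also have "... = ?Z j l - (if j = - nn then 0 else sn j *: (X (- j) * ?Z (- nn) l))
   - (SUM k:I. if l = j then X k * ?Z k nn else 0) + (SUM k:I. if j = - nn | l ~= - nn then 0 else sn j *: (X k * ?Z k (- j)))"
   using J_I[OF j] by(simp only: sum.distrib sum_subtractf) simp
  finally show ?thesis by(auto simp: S_def scl_sum)
 qed
 have XS: "ad (X j) (S l) = 0" for j l unfolding S_def ad_sum by(simp add: ad_U)
 have "ad YY (S l) = (SUM j:J. X j * ?Z j l - (if j = - nn then 0 else sn j *: (X j * X (- j))) * ?Z (- nn) l
   - (if j = l then X l * S nn else 0) + (if l = - nn then if j = - nn then 0 else sn j *: (X j * S (- j)) else 0))"
  unfolding YY_def ad_sum by(intro sum.cong) (auto simp: ad_simps XS one right_diff_distrib distrib_left scl_simps(1,2) mult.assoc)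
 also have "... = (SUM j:J. X j * ?Z j l) - (if l = nn then 0 else X l * S nn)
   + (SUM j:J. if l = - nn then if j = - nn then 0 else sn j *: (X j * S (- j)) else 0)"
  unfolding sum.distrib sum_subtractf sum_distrib_right[symmetric] antisym_sum using l by(auto simp: I_J)
 finally have "ad (EE - YY) (S l) = (if l = nn then 0 else X l * S nn)
   - (SUM j:J. if l = - nn then if j = - nn then 0 else sn j *: (X j * S (- j)) else 0)" by(simp add: ad_simps E)
 thus ?thesis by simp
qed

text \<open>The coordinates transported by the symplectic form, with \<open>yr (- nn)\<close> equal
  to 1. Contracting the indices of Z with \<open>X\<close> and \<open>yr\<close> gives exp(Y)
  Z_{n,-n} exp(-Y).\<close>

definition yr :: "int => 'v ser lop" where "yr l = (- sn l) *: X (- l)"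

lemma ring_R4: assumes Z: "teq Z"
 defines "S == %l. SUM k:I. X k * lv (Z k l)"
 shows "ad (EE - YY) (SUM l:I. yr l * S l) = 0" proof -
 let ?K = "J - {- nn}"
 have nn: "nn ~= - nn" using n1 by linarith
 have K: "j : ?K ==> j : J & - j : J & j ~= nn & j ~= - nn & j : I" for j by(auto simp: J_def)
 have YX: "ad YY (X k) = 0" for k unfolding YY_def ad_sum by(simp add: ad_U)
 have ay: "ad (EE - YY) (yr l) = (if l = - nn then 0 else yr l)" if "l : I" for l proof(cases "l = - nn")
  case True
  thus ?thesis by(simp add: yr_def ad_simps ls_hom)
 next
  case False
  hence "- l : J" using that by(auto simp: J_def)
  thus ?thesis using False by(simp add: yr_def ad_simps ad_min YX ad_EE_X)
 qed
 have x1: "X nn = 1" by(simp add: ls_hom)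
 let ?Q = "SUM j:?K. sn j *: (X j * S (- j))"
 have q: "(SUM j:J. if j = - nn then 0 else sn j *: (X j * S (- j))) = ?Q" by(rule sum.mono_neutral_cong_right) auto
 have q2: "(SUM l:?K. yr l * S l) = ?Q" proof(rule sum.reindex_bij_witness[of _ uminus uminus])
  fix j show "of_int (sgn (- j)) *: (X (- j) * S (- (- j))) = yr j * S j" by(simp add: yr_def sgn_minus scl_simps)
 qed (auto simp: J_def)
 let ?D = "SUM l:?K. yr l * X l"
 have q3: "?D = 0" proof -
  have "?D = - (SUM j:J. if j = - nn then 0 else sn j *: (X j * X (- j)))" unfolding sum_negf[symmetric] proof(rule sum.mono_neutral_cong_left)
   fix x assume "x : ?K"
   thus "yr x * X x = - (if x = - nn then 0 else sn x *: (X x * X (- x)))" using ad_X(1)[of x "- x"] by(simp add: yr_def scl_simps ad_def)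
  qed auto
  thus ?thesis unfolding antisym_sum by simp
 qed
 have sn: "ad (EE - YY) (S nn) = 0" using ring_S[OF Z nI] nn by(simp add: S_def)
 have sm: "ad (EE - YY) (S (- nn)) = X (- nn) * S nn - ?Q" using ring_S[OF Z, of "- nn"] nn unfolding q[unfolded S_def] unfolding S_def by simp
 have sk: "ad (EE - YY) (S l) = X l * S nn" if "l : ?K" for l using ring_S[OF Z, of l] K[OF that] by(simp add: S_def)
 let ?A = "SUM l:?K. ad (EE - YY) (yr l * S l)"
 let ?B = "ad (EE - YY) (yr (- nn) * S (- nn))"
 let ?C = "ad (EE - YY) (yr nn * S nn)"
 have "ad (EE - YY) (SUM l:I. yr l * S l) = (SUM l:I. ad (EE - YY) (yr l * S l))" by(rule ad_sum(1))
 also have "... = ?C + (?B + ?A)" unfolding I_J sum.insert[OF finJ nJ] sum.remove[OF finJ nnJ] ..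
 also have "?A = (SUM l:?K. yr l * S l + yr l * X l * S nn)" proof(intro sum.cong refl)
  fix l assume l: "l : ?K"
  show "ad (EE - YY) (yr l * S l) = yr l * S l + yr l * X l * S nn" unfolding ad_simps(1) sk[OF l] using ay[of l] K[OF l] by(simp add: mult.assoc)
 qed
 also have "... = ?Q" unfolding sum.distrib sum_distrib_right[symmetric] q2 q3 by simp
 also have "?C = - (X (- nn) * S nn)" unfolding ad_simps(1) sn using ay[of "nn"] nn n1 by(simp add: yr_def scl_simps)
 also have "?B = X (- nn) * S nn - ?Q" unfolding ad_simps(1) sm using ay[of "- nn"] n1 x1 by(simp add: yr_def scl_simps)
 finally show ?thesis by simp
qed

definition emb :: "('v => complex) => 'v srv" where
 "emb v = (%(y, a). if a = (%_. 0) then v y else 0)"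
text \<open>The series exp(Y) v: \<open>YY\<close> raises the degree by one, so the coefficient at
  \<open>a\<close> receives only the power \<open>deg a\<close>.\<close>

definition uu :: "('v => complex) => 'v srv" where
 "uu v = (%(y, a). ap (YY ^ deg a) (emb v) (y, a) / fact (deg a))"

lemma ap_EE: "ap EE z (y, a) = of_nat (deg a) * z (y, a)"
proof -
 have "ap (X j * Dd j) z (y, a) = of_nat (a j) * z (y, a)" if "j : J" for j by(cases "a j = 0") (simp_all add: ap_ls xr_J[OF that] ap_xv ap_dv del: of_nat_Suc)
 thus ?thesis by(simp add: EE_def ap_sum sum_fun_apply deg_def sum_distrib_right)
qed

lemma ap_YY: "ap YY z (y, a) = (SUM j:J. if a j = 0 then 0 else ap (fj j) (%y. z (y, a(j := a j - 1))) y)"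
 by(simp add: YY_def ap_sum sum_fun_apply, intro sum.cong) (auto simp: ap_ls xr_J ap_xv ap_lv)

lemma deg_dec: "j : J ==> a j ~= 0 ==> deg (a(j := a j - 1)) = deg a - 1" unfolding deg_def by(simp add: sum.remove[OF finJ])
lemma deg_pos: "j : J ==> a j ~= 0 ==> deg a ~= 0" by(auto simp: deg_def)

lemma YY_cong: assumes "!!y b. Suc (deg b) = deg a ==> z (y, b) = z' (y, b)" shows "ap YY z (y, a) = ap YY z' (y, a)" unfolding ap_YY
proof(intro sum.cong refl)
 fix j assume j: "j : J"
 show "(if a j = 0 then 0 else ap (fj j) (%y. z (y, a(j := a j - 1))) y) = (if a j = 0 then 0 else ap (fj j) (%y. z' (y, a(j := a j - 1))) y)"
  using assms[of "a(j := a j - 1)"] deg_dec[OF j, of a] deg_pos[OF j, of a] by auto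
qed

lemma YY_deg0: "deg a = 0 ==> ap YY z (y, a) = 0" using YY_cong[of a z 0 y] by(auto simp: fa)

lemma uu_eq: "ap (EE - YY) (uu v) = 0"
proof(rule ext)
 fix p :: "'v ser"
 obtain y a where p: "p = (y, a)" by(cases p)
 show "ap (EE - YY) (uu v) p = 0 p" proof(cases "deg a")
  case 0
  thus ?thesis by(simp add: p fa ap_EE YY_deg0)
 next
  case (Suc d)
  have "ap YY (uu v) (y, a) = ap YY ((1 / fact d) *. ap (YY ^ d) (emb v)) (y, a)" by(rule YY_cong) (use Suc in "simp add: uu_def vs_apply")
  also have "... = ap (YY ^ Suc d) (emb v) (y, a) / fact d" by(simp add: ap_vs vs_apply)
  finally show ?thesis using Suc by(simp add: p fa ap_EE uu_def del: of_nat_Suc power_Suc)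
 qed
qed

lemma uu_deg0: "deg a = 0 ==> uu v (y, a) = emb v (y, a)" by(simp add: uu_def)

lemma deg_zero [simp]: "deg (%_. 0) = 0" by(simp add: deg_def)
lemma uu_zero: "uu v (y, %_. 0) = v y" by(simp add: uu_deg0 emb_def)

text \<open>\<open>deg a + c\<close> times the coefficient at \<open>a\<close> is expressed by
  coefficients of degree one less; only degree 0 with \<open>c = 0\<close> is free.\<close>

lemma uniq:
 assumes e: "ap (EE + of_nat c - YY) z = 0" and z: "!!y a. c = 0 ==> deg a = 0 ==> z (y, a) = 0"
 shows "z = 0" proof -
 have "ALL y. z (y, a) = 0" for a proof(induction "deg a" arbitrary: a rule: less_induct)
  case less
  show ?case
  proof
   fix y
   have "ap YY z (y, a) = ap YY 0 (y, a)" by(rule YY_cong) (use less in "auto simp: fa")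
   moreover have "ap (of_nat c) z = of_nat c *. z" for c by(induction c) (auto simp: vs_simps)
   ultimately have "(of_nat (deg a) + of_nat c) * z (y, a) = 0" using fun_cong[OF e, of "(y, a)"] by(simp add: fa ap_EE vs_apply alg)
   thus "z (y, a) = 0" using z[of a y] by(auto simp flip: of_nat_add)
  qed
 qed
 thus ?thesis by(auto simp: fun_eq_iff fa)
qed

lemma uniq0: "ap (EE - YY) z = 0 ==> (!!y a. deg a = 0 ==> z (y, a) = 0) ==> z = 0" using uniq[of 0 z] by simp

lemma uu_lin: "uu (f + g) = uu f + uu g" "uu (c *. f) = c *. uu f" "uu 0 = 0"
proof -
 have *: "emb (f + g) = emb f + emb g" "emb (c *. f) = c *. emb f" "emb 0 = 0" by(auto simp: emb_def fun_eq_iff fa vs_apply)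
 show "uu (f + g) = uu f + uu g" "uu (c *. f) = c *. uu f" "uu 0 = 0" unfolding uu_def * ap_vadd ap_vs ap_v0 by(auto simp: fun_eq_iff fa vs_apply add_divide_distrib)
qed

text \<open>Powers of \<open>YY\<close> expand into words with \<open>a < b\<close>, and long words
  vanish; the series is therefore a polynomial. The prefix \<open>T\<close> in the induction
  collects the letters already read.\<close>

lemma YY_nilp: "EX N. YY ^ N = 0"
proof -
 obtain N where N: "!!L. set L <= Fs (<) ==> length L >= N ==> prod_list L = 0" using long_words_vanish[of "(<)" "- 1"] by auto
 have "lv T * YY ^ k = 0" if "!!L. set L <= Fs (<) ==> length L = k ==> T * prod_list L = 0" for T k using that
 proof(induction k arbitrary: T)
  case 0
  from 0[of "[]"] show ?case by(simp add: lv_hom)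
 next
  case (Suc k)
  have "lv (T * fj j) * YY ^ k = 0" if j: "j : J" for j proof(rule Suc.IH)
   fix L assume L: "set L <= Fs (<)" "length L = k"
   have "F j nn : Fs (<)" using J_I[OF j] J_n[OF j] nI by(force simp: Fs_def Iset_def)
   hence "T * (F j nn * prod_list L) = 0" using Suc.prems[of "F j nn # L"] L by simp
   thus "T * fj j * prod_list L = 0" by(auto simp: fj_def scl_simps(1,2) mult.assoc)
  qed
  moreover have "lv T * YY ^ Suc k = (SUM j:J. X j * (lv (T * fj j) * YY ^ k))"
   unfolding power_Suc by(subst YY_def) (simp add: sum_distrib_left sum_distrib_right lv_hom lv_ls mult.assoc[symmetric])
  ultimately show ?case by simp
 qed
 from this[of N 1] N have "lv 1 * YY ^ N = 0" by simp
 thus ?thesis by(auto simp: lv_hom)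
qed

lemma uu_vanish: "EX N. ALL v y a. deg a >= N --> uu v (y, a) = 0"
proof -
 obtain N where "YY ^ N = 0" using YY_nilp by blast
 hence "YY ^ d = 0" if "d >= N" for d using that by(metis le_add_diff_inverse power_add mult_zero_left)
 thus ?thesis by(intro exI[of _ N]) (auto simp: uu_def fa)
qed

lemma uu_junk: assumes k: "k ~: J" "a k ~= 0" shows "uu v (y, a) = 0"
proof -
 have "ap (YY ^ d) (emb v) (y, a) = 0" if "a k ~= 0" for d y a using that proof(induction d arbitrary: y a)
  case (Suc d)
  have "ap (YY ^ Suc d) (emb v) (y, a) = (SUM j:J. if a j = 0 then 0 else ap (fj j) (%y. ap (YY ^ d) (emb v) (y, a(j := a j - 1))) y)" by(simp add: ap_YY)
  also have "... = (SUM j:J. 0)" proof(intro sum.cong refl)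
   fix j assume "j : J"
   hence "(%y. ap (YY ^ d) (emb v) (y, a(j := a j - 1))) = 0" using k(1) Suc.prems by(intro ext) (auto simp: fa intro!: Suc.IH)
   thus "(if a j = 0 then 0 else ap (fj j) (%y. ap (YY ^ d) (emb v) (y, a(j := a j - 1))) y) = 0" by(simp add: fa)
  qed
  finally show ?case by simp
 qed (auto simp: emb_def)
 thus ?thesis using k(2) by(simp add: uu_def)
qed

lemma D_uu: assumes j: "j : J" shows "ap (Dd j) (uu v) = ap (MM j) (uu v)"
proof -
 have e: "ap ((EE + 1 - YY) * (Dd j - MM j)) (uu v) = 0" unfolding ring_R1[OF j] by(simp only: ap_mult uu_eq ap_v0)
 let ?A = "ap (Dd j - MM j) (uu v)"
 have "?A = 0" proof(rule uniq[of 1])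
  show "ap (EE + of_nat 1 - YY) ?A = 0" using e by simp
 qed simp
 thus ?thesis by simp
qed

definition VP :: "(nat => int) => ('v => complex) set" where
 "VP mu = {v. (ALL i:I. ALL j:I. - nn < i & i < j & j < nn --> ap (F i j) v = 0)
   & (ALL i:{1..<n}. ap (F (int i) (int i)) v = of_int (mu i) *. v)}"

lemma X_deg0: "k : J ==> deg a = 0 ==> ap (X k * T) z (y, a) = 0" using deg_pos[of k a] by(auto simp: ap_ls xr_J ap_xv)

lemma lv_emb: "deg a = 0 ==> ap (lv T) (uu v) (y, a) = emb (ap T v) (y, a)"
proof -
 assume a: "deg a = 0"
 have "(%y. uu v (y, a)) = (if a = (%_. 0) then v else 0)" by(auto simp: uu_deg0[OF a] emb_def fa)
 thus ?thesis by(auto simp: ap_lv emb_def fa)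
qed

text \<open>The difference of the two sides solves \<open>(EE - YY) z = 0\<close>, so it suffices to
  look at degree 0, where only the action on \<open>v\<close> itself remains.\<close>

lemma FD_mid:
 assumes i: "i : J" "i ~= - nn" and k: "k : J" "k ~= - nn"
  and v: "ap (F i k) v = c *. v"
 shows "ap (lv (F i k)) (uu v) = ap (ls (DD i k)) (uu v) + c *. uu v" proof -
 let ?z = "ap (lv (F i k) - ls (DD i k)) (uu v) - c *. uu v"
 have "ap ((EE - YY) * (lv (F i k) - ls (DD i k))) (uu v) = 0" unfolding ring_R2[OF i k] by(simp only: ap_mult uu_eq ap_v0)
 hence "ap (EE - YY) ?z = 0" by(simp only: ap_vdiff ap_vs ap_mult uu_eq) (simp add: vs_simps)
 hence "?z = 0" proof(rule uniq0)
  fix y a assume a: "deg a = 0"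
  have "ap (ls (DD i k)) (uu v) (y, a) = 0" using X_deg0[OF k(1) a] X_deg0[OF J_m[OF i] a] by(simp add: DD_def ls_hom fa vs_apply)
  thus "?z (y, a) = 0" using v by(simp add: fa vs_apply lv_emb[OF a] uu_deg0[OF a]) (simp add: emb_def vs_apply)
 qed
 thus ?thesis by(simp add: alg)
qed

text \<open>The logarithmic derivative \<open>D_uu\<close> solved for \<open>F i nn\<close>; for
  \<open>i = - nn\<close> the halving in \<open>fj\<close> produces the factor 2 contained in
  \<open>DD\<close>.\<close>

lemma FD_n: assumes i: "i : J" shows "ap (lv (F i nn)) (uu v) = ap (ls (DD i nn)) (uu v)"
proof -
 let ?A = "ap (lv (fj (- nn))) (uu v)"
 have A: "ap (Dd (- nn)) (uu v) = ?A" using D_uu[OF nnJ] by(simp add: MM_def)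
 show ?thesis
 proof(cases "i = - nn")
  case True
  have "F i nn = fj (- nn) + fj (- nn)" by(simp add: fj_def True half_scl flip: scl_simps(4))
  thus ?thesis using A n1 by(simp add: True DD_def th_nn lv_hom ls_hom)
 next
  case False
  have "ap (Dd i) (uu v) = ap (lv (F i nn)) (uu v) + sn i *. ap (X (- i)) ?A" using D_uu[OF i] False by(simp add: MM_def fj_def)
  thus ?thesis unfolding DD_def by(simp add: ls_hom th_n A)
 qed
qed

lemma FD:
 assumes v: "v : VP mu" and ik: "i : I" "k : I" "i < k"
 shows "ap (lv (F i k)) (uu v) = ap (ls (DD i k)) (uu v)" proof(cases "k = nn")
 case True
 hence "i : J" using ik I_J by auto
 thus ?thesis using FD_n True by simp
next
 case kn: False
 hence kJ: "k : J" using ik I_J by auto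
 show ?thesis
 proof(cases "i = - nn")
  case True
  hence kk: "k ~= - nn" using ik by auto
  have "F i k = sn k *: F (- k) nn" using sym[of "- k" "nn"] ik by(simp add: th_n sgn_minus True)
  moreover have "DD i k = sn k *: DD (- k) nn" proof -
   have "(sn k :: complex) * sn k = 1" using Iset_nz[OF ik(2)] by(auto simp: sgn_if)
   thus ?thesis using n1 Iset_nz[OF ik(2)] by(simp add: DD_def True theta_def sgn_minus scl_simps)
  qed
  ultimately show ?thesis using FD_n[OF J_m[OF kJ kk]] by(simp add: lv_hom ls_hom)
 next
  case False
  have iJ: "i : J" using ik by(auto simp: J_def Iset_def)
  have "- nn < i" "k < nn" using ik kn False by(auto simp: Iset_def)
  hence "ap (F i k) v = 0 *. v" using v ik by(auto simp: VP_def)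
  moreover have "k ~= - nn" using ik by(auto simp: Iset_def)
  ultimately show ?thesis using FD_mid[OF iJ False kJ, of v 0] by simp
 qed
qed

lemma F_torus:
 assumes v: "v : VP mu" and i: "i : {1..<n}"
 shows "ap (lv (F (int i) (int i))) (uu v) = ap (ls (DD (int i) (int i))) (uu v) + of_int (mu i) *. uu v" proof -
 have "int i : J" "int i ~= - nn" using i by(auto simp: J_def Iset_def)
 thus ?thesis using FD_mid[of "int i" "int i" v "of_int (mu i)"] v i by(auto simp: VP_def)
qed

lemma uu_Znn: assumes Z: "teq Z" shows "uu (ap (Z nn nn) v) = (SUM k:I. ap (X k) (ap (lv (Z k nn)) (uu v)))"
proof -
 let ?S = "SUM k:I. X k * lv (Z k nn)"
 let ?z = "ap ?S (uu v) - uu (ap (Z nn nn) v)"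
 have "ap ((EE - YY) * ?S) (uu v) = 0" unfolding ring_R3[OF Z] by(simp only: ap_mult uu_eq ap_v0)
 hence "ap (EE - YY) ?z = 0" by(simp only: ap_vdiff ap_mult uu_eq) simp
 hence "?z = 0" proof(rule uniq0)
  fix y a assume a: "deg a = 0"
  have "ap ?S (uu v) (y, a) = (SUM k:I. if k = nn then emb (ap (Z k nn) v) (y, a) else 0)" unfolding ap_sum sum_fun_apply
  proof(intro sum.cong refl)
   fix k assume "k : I"
   thus "ap (X k * lv (Z k nn)) (uu v) (y, a) = (if k = nn then emb (ap (Z k nn) v) (y, a) else 0)" using X_deg0[OF _ a, of k] by(auto simp: I_J lv_emb[OF a] ls_hom)
  qed
  thus "?z (y, a) = 0" by(simp add: fa uu_deg0[OF a])
 qed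
 thus ?thesis by(simp add: ap_sum)
qed

lemma uu_Znm: assumes Z: "teq Z"
 shows "uu (ap (Z nn (- nn)) v) = (SUM l:I. SUM k:I. (- sn l) *. ap (X (- l)) (ap (X k) (ap (lv (Z k l)) (uu v))))" proof -
 let ?S = "SUM l:I. yr l * (SUM k:I. X k * lv (Z k l))"
 let ?z = "ap ?S (uu v) - uu (ap (Z nn (- nn)) v)"
 have "ap ((EE - YY) * ?S) (uu v) = ap (?S * (EE - YY)) (uu v)" using ring_R4[OF Z] by(simp add: ad_def)
 hence "ap (EE - YY) ?z = 0" by(simp only: ap_vdiff ap_mult uu_eq ap_v0) simp
 hence "?z = 0" proof(rule uniq0)
  fix y a assume a: "deg a = 0"
  have t: "ap (yr l * (X k * lv (Z k l))) (uu v) (y, a) = (if l = - nn & k = nn then emb (ap (Z k l) v) (y, a) else 0)" if "l : I" "k : I" for k l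
  proof(cases "l = - nn")
   case True
   hence "ap (yr l * (X k * lv (Z k l))) (uu v) (y, a) = ap (X k * lv (Z k l)) (uu v) (y, a)" using n1 by(simp add: yr_def ls_hom)
   thus ?thesis using that True X_deg0[OF _ a, of k] by(auto simp: I_J lv_emb[OF a] ls_hom)
  next
   case False
   hence "- l : J" using that by(auto simp: J_def)
   thus ?thesis using False X_deg0[OF _ a, of "- l"] by(simp add: yr_def fa vs_apply)
  qed
  have "ap ?S (uu v) (y, a) = (SUM l:I. SUM k:I. if l = - nn & k = nn then emb (ap (Z k l) v) (y, a) else 0)"
   unfolding sum_distrib_left ap_sum sum_fun_apply by(intro sum.cong refl t)
  also have "... = (SUM l:I. if l = - nn then emb (ap (Z nn (- nn)) v) (y, a) else 0)" by(intro sum.cong refl) simp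
  finally show "?z (y, a) = 0" by(simp add: fa uu_deg0[OF a])
 qed
 hence "uu (ap (Z nn (- nn)) v) = ap ?S (uu v)" by simp
 also have "... = (SUM l:I. SUM k:I. (- sn l) *. ap (X (- l)) (ap (X k) (ap (lv (Z k l)) (uu v))))"
  unfolding sum_distrib_left ap_sum by(intro sum.cong refl) (simp add: yr_def vs_simps)
 finally show ?thesis .
qed

end

section \<open>Reduction to the variables q and r\<close>

lemma ap_num: "ap (xv i) (ap (dv i) f) a = of_nat (a i) * f a" by(cases "a i = 0") (simp_all add: ap_xv ap_dv del: of_nat_Suc)

text \<open>The exponents of x_i and x_{-i} are \<open>c i\<close> plus fixed shifts, that of x_{-n}
  is \<open>c n\<close>. Thus \<open>rd\<close> divides a series supported on such exponents by a
  monomial and reads the quotient as a series in q_i = x_i x_{-i} and q_n = x_{-n}.\<close>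

definition rx :: "nat => (nat => nat) => (nat => nat) => (nat => nat) => int => nat" where
 "rx n kp km c k = (if 0 < k & k < int n then c (nat k) + kp (nat k)
   else if - int n < k & k < 0 then c (nat (- k)) + km (nat (- k))
   else if k = - int n then c n else 0)"
definition nj :: "nat => (nat => nat) => bool" where "nj n c <-> (ALL i. i ~: {1..n} --> c i = 0)"
definition rd :: "nat => (nat => nat) => (nat => nat) => (pol) => arr => complex" where
 "rd n kp km f c = (if nj n c then f (rx n kp km c) else 0)"

lemma nj_upd: "i : {1..n} ==> nj n (c(i := t)) = nj n c" by(auto simp: nj_def)

lemma rx_upd: "i : {1..<n} ==> rx n kp km (c(i := t)) = (rx n kp km c)(int i := t + kp i, - int i := t + km i)" by(rule ext) (auto simp: rx_def)
lemma rx_upd_n: "n >= 1 ==> rx n kp km (c(n := t)) = (rx n kp km c)(- int n := t)" by(rule ext) (auto simp: rx_def)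
lemma rx_at: "i : {1..<n} ==> rx n kp km c (int i) = c i + kp i" "i : {1..<n} ==> rx n kp km c (- int i) = c i + km i"
 "n >= 1 ==> rx n kp km c (- int n) = c n" by(auto simp: rx_def)

lemma rd_lin: "rd n kp km (f + g) = rd n kp km f + rd n kp km g" "rd n kp km (f - g) = rd n kp km f - rd n kp km g"
 "rd n kp km (z *. f) = z *. rd n kp km f" "rd n kp km 0 = 0" by(auto simp: rd_def fun_eq_iff fa vs_apply)

lemma rd_sum: "rd n kp km (SUM a:A. f a) = (SUM a:A. rd n kp km (f a))" by(induction A rule: infinite_finite_induct) (auto simp: rd_lin)

lemma rd_N:
 assumes "i : {1..<n}"
 shows "rd n kp km (ap (xv (int i)) (ap (dv (int i)) f)) = ap (xv i) (ap (dv i) (rd n kp km f)) + of_nat (kp i) *. rd n kp km f"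
  and "rd n kp km (ap (xv (- int i)) (ap (dv (- int i)) f)) = ap (xv i) (ap (dv i) (rd n kp km f)) + of_nat (km i) *. rd n kp km f"
 by(rule ext; simp add: rd_def fa vs_apply ap_num rx_at(1,2)[OF assms] alg)+

lemma rd_n:
 assumes "n >= 1"
 shows "rd n kp km (ap (dv (- int n)) f) = ap (dv n) (rd n kp km f)" "rd n kp km (ap (xv (- int n)) f) = ap (xv n) (rd n kp km f)"
 using assms by(auto simp: fun_eq_iff rd_def ap_dv ap_xv rx_at rx_upd_n nj_upd)

text \<open>With one of the two shifts zero, the cut-off at exponent 0 of x_i or x_{-i} coincides
  with the cut-off for q_i.\<close>

lemma rd_q:
 assumes i: "i : {1..<n}" and k: "kp i = 0 | km i = 0"
 shows "rd n kp km (ap (xv (int i)) (ap (xv (- int i)) f)) = ap (xv i) (rd n kp km f)" proof(rule ext)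
 fix c
 have u: "(rx n kp km c)(int i := c i - Suc 0 + kp i, - int i := c i - Suc 0 + km i) = rx n kp km (c(i := c i - Suc 0))" using rx_upd[OF i] by simp
 show "rd n kp km (ap (xv (int i)) (ap (xv (- int i)) f)) c = ap (xv i) (rd n kp km f) c" using i k by(auto simp: rd_def ap_xv rx_at(1,2)[OF i] nj_upd u[symmetric])
qed

text \<open>The two derivatives give (N + kp)(N + km) for the exponent N, which is N (N + kp + km)
  when one shift is zero; this keeps the operator a polynomial in \<open>xv i\<close> and
  \<open>dv i\<close>.\<close>

lemma rd_dd:
 assumes i: "i : {1..<n}" and k: "kp i = 0 | km i = 0"
 shows "rd n kp km (ap (dv (- int i)) (ap (dv (int i)) f)) = ap (dv i) (ap (xv i) (ap (dv i) (rd n kp km f)) + of_nat (kp i + km i) *. rd n kp km f)"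
proof(rule ext)
 fix c
 have u: "rx n kp km (c(i := Suc (c i))) = (rx n kp km c)(- int i := Suc (c i) + km i, int i := Suc (c i) + kp i)" using rx_upd[OF i] i by(simp add: fun_upd_twist)
 show "rd n kp km (ap (dv (- int i)) (ap (dv (int i)) f)) c = ap (dv i) (ap (xv i) (ap (dv i) (rd n kp km f)) + of_nat (kp i + km i) *. rd n kp km f) c"
  using i k by(auto simp: rd_def ap_dv[of "int i"] ap_dv[of "- int i"] ap_dv[of i "_ + _"] ap_num fa vs_apply rx_at(1,2)[OF i] nj_upd u alg)
qed

text \<open>The linear change of variables \<open>r_m = q_m + \<dots> + q_n\<close>.\<close>

definition PQ :: "nat => arr lop" where "PQ m = dv m - (if m = 1 then 0 else dv (m - 1))"
definition RQ :: "nat => nat => arr lop" where "RQ n m = (SUM j:{m..n}. xv j)"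

lemma PQ_comm: "PQ a * PQ b = PQ b * PQ a" by(simp add: PQ_def alg dd_comm)

lemma dv_RQ: "m <= n ==> dv m * RQ n l = RQ n l * dv m + (if l <= m then 1 else 0)"
proof -
 assume m: "m <= n"
 have "dv m * RQ n l = (SUM j:{l..n}. xv j * dv m + (if j = m then 1 else 0))" unfolding RQ_def sum_distrib_left by(intro sum.cong refl) (simp add: dx_same dx_diff)
 thus ?thesis using m by(simp add: sum.distrib RQ_def sum_distrib_right)
qed

lemma PQ_RQ: "m : {1..n} ==> l : {1..n} ==> PQ m * RQ n l = RQ n l * PQ m + (if m = l then 1 else 0)" using dv_RQ[of m n l] dv_RQ[of "m - 1" n l]
 by(auto simp: PQ_def left_diff_distrib right_diff_distrib)

definition PP :: "nat list => (nat => nat) => arr lop" where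
 "PP js c = prod_list (map (%j. PQ j ^ c j) js)"

lemma PQ_pow_comm: "PQ m * PQ j ^ k = PQ j ^ k * PQ m" by(induction k) (simp_all add: mult.assoc[symmetric] PQ_comm[of m j], simp add: mult.assoc)

lemma PQ_PP: "PQ m * PP js c = PP js c * PQ m"
proof(induction js)
 case (Cons j js)
 have "PQ m * PP (j # js) c = PQ j ^ c j * (PQ m * PP js c)" by(simp add: PP_def PQ_pow_comm flip: mult.assoc)
 thus ?case by(simp add: Cons) (simp add: PP_def mult.assoc)
qed (simp add: PP_def)

lemma PP_cong: "(!!j. j : set js ==> c j = c' j) ==> PP js c = PP js c'" unfolding PP_def by(intro arg_cong[where f = prod_list] map_cong) auto

lemma PP_Suc: "distinct js ==> m : set js ==> PP js (c(m := Suc (c m))) = PP js c * PQ m"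
proof(induction js)
 case (Cons j js)
 show ?case
 proof(cases "j = m")
  case True
  let ?A = "c(m := Suc (c m))"
  have "PP js ?A = PP js c" using Cons True by(intro PP_cong) auto
  moreover have "PP (j # js) ?A = PQ m ^ c m * (PQ m * PP js ?A)" by(simp add: PP_def True mult.assoc power_commutes[of "PQ m", symmetric, unfolded mult.assoc])
  ultimately show ?thesis by(simp add: PQ_PP) (simp add: PP_def True mult.assoc)
 next
  case False
  thus ?thesis using Cons by(simp add: PP_def mult.assoc)
 qed
qed simp

lemma PQ_pow_RQ: "j : {1..n} ==> m : {1..n} ==> PQ j ^ k * RQ n m = RQ n m * PQ j ^ k + (if j = m then of_nat k * PQ j ^ (k - 1) else 0)"
proof(induction k)
 case (Suc k)
 have "PQ j ^ Suc k * RQ n m = PQ j * (PQ j ^ k * RQ n m)" by(simp add: mult.assoc)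
 also have "... = PQ j * RQ n m * PQ j ^ k + (if j = m then of_nat k * PQ j ^ k else 0)"
  unfolding Suc(1)[OF Suc(2,3)] using mult_of_nat_commute[of k "PQ m", symmetric] by(cases k) (auto simp: distrib_left mult.assoc[symmetric])
 also have "... = RQ n m * PQ j ^ Suc k + (if j = m then of_nat (Suc k) * PQ j ^ (Suc k - 1) else 0)" unfolding PQ_RQ[OF Suc(2,3)] by(auto simp: distrib_right mult.assoc)
 finally show ?case .
qed simp

lemma PP_RQ: "distinct js ==> set js <= {1..n} ==> m : {1..n} ==>
 PP js c * RQ n m = RQ n m * PP js c + (if m : set js then of_nat (c m) * PP js (c(m := c m - 1)) else 0)" proof(induction js)
 case (Cons j js)
 let ?C = "c(m := c m - 1)"
 have P: "PP (j # js) c' = PQ j ^ c' j * PP js c'" for c' by(simp add: PP_def)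
 let ?A = "if m : set js then of_nat (c m) * (PQ j ^ c j * PP js ?C) else 0"
 let ?B = "if j = m then of_nat (c j) * PQ j ^ (c j - 1) else 0"
 have "PP (j # js) c * RQ n m = PQ j ^ c j * (RQ n m * PP js c + (if m : set js then of_nat (c m) * PP js ?C else 0))" using Cons by(simp add: P mult.assoc)
 also have "... = PQ j ^ c j * RQ n m * PP js c + ?A" by(simp add: distrib_left mult.assoc flip: mult_of_nat_commute)
    (metis mult.assoc mult_of_nat_commute)
 also have "PQ j ^ c j * RQ n m = RQ n m * PQ j ^ c j + ?B" using Cons.prems by(intro PQ_pow_RQ) auto
 also have "(RQ n m * PQ j ^ c j + ?B) * PP js c + ?A
  = RQ n m * PP (j # js) c + (if m : set (j # js) then of_nat (c m) * PP (j # js) ?C else 0)" proof(cases "j = m")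
  case True
  have "PP js ?C = PP js c" using Cons.prems True by(intro PP_cong) auto
  thus ?thesis unfolding P using True Cons.prems(1) by(simp add: distrib_right mult.assoc)
 next
  case False
  thus ?thesis by(simp add: P mult.assoc)
 qed
 finally show ?case .
qed (simp add: PP_def)

text \<open>Taylor coefficients at 0 with respect to the variables r, written with the derivatives
  \<open>PQ\<close>; no linear forms have to be substituted into coefficient arrays.\<close>

definition rc :: "nat => (arr => complex) => arr => complex" where
 "rc n h c = (if nj n c then ap (PP [1..<Suc n] c) h (%_. 0) / (PROD j:{1..n}. fact (c j)) else 0)"

lemma rc_lin: "rc n (f + g) = rc n f + rc n g" "rc n (f - g) = rc n f - rc n g"
 "rc n (z *. f) = z *. rc n f" "rc n 0 = 0" by(auto simp: rc_def fun_eq_iff fa vs_apply ap_vadd ap_vdiff ap_vs add_divide_distrib diff_divide_distrib)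
lemma rc_sum: "rc n (SUM a:A. f a) = (SUM a:A. rc n (f a))" by(induction A rule: infinite_finite_induct) (auto simp: rc_lin)

lemma rc_P: assumes m: "m : {1..n}" shows "rc n (ap (PQ m) h) = ap (dv m) (rc n h)"
proof(rule ext)
 fix c
 have "(PROD j:{1..n}. fact ((c(m := Suc (c m))) j)) = of_nat (Suc (c m)) * (PROD j:{1..n}. fact (c j) :: complex)"
  using m by(subst (1 2) prod.remove[of _ m]) (auto simp del: of_nat_Suc intro!: prod.cong)
 moreover have "PP [1..<Suc n] (c(m := Suc (c m))) = PP [1..<Suc n] c * PQ m" using m by(intro PP_Suc) auto
 ultimately show "rc n (ap (PQ m) h) c = ap (dv m) (rc n h) c" using m by(simp add: rc_def ap_dv nj_upd del: of_nat_Suc upt_Suc)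
qed

lemma RQ_0: "ap (RQ n m) h (%_. 0) = 0" by(simp add: RQ_def ap_sum sum_fun_apply ap_xv)

lemma ap_of_nat: "ap (of_nat k) f = of_nat k *. f" by(induction k) (auto simp: vs_simps)

lemma rc_R: assumes m: "m : {1..n}" shows "rc n (ap (RQ n m) h) = ap (xv m) (rc n h)"
proof(rule ext)
 fix c
 let ?A = "PP [1..<Suc n] (c(m := c m - 1))"
 let ?B = "PP [1..<Suc n] c"
 have e: "?B * RQ n m = RQ n m * ?B + of_nat (c m) * ?A" using PP_RQ[of "[1..<Suc n]" n m c] m by(simp add: atLeastLessThanSuc_atLeastAtMost del: upt_Suc)
 have "ap ?B (ap (RQ n m) h) (%_. 0) = of_nat (c m) * ap ?A h (%_. 0)" using arg_cong[OF e, of "%T. ap T h (%_. 0)"] by(simp add: fa RQ_0 ap_of_nat vs_apply del: upt_Suc)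
 moreover have "(PROD j:{1..n}. fact (c j)) = of_nat (c m) * (PROD j:{1..n}. fact ((c(m := c m - 1)) j) :: complex)" if "c m ~= 0"
  using m that fact_reduce[of "c m", where 'a = complex] by(subst (1 2) prod.remove[of _ m]) (auto intro!: prod.cong)
 ultimately show "rc n (ap (RQ n m) h) c = ap (xv m) (rc n h) c" using m by(auto simp: rc_def ap_xv nj_upd simp del: upt_Suc)
qed

lemma dv_PQ: "m >= 1 ==> dv m = (SUM j:{1..m}. PQ j)"
proof(induction m rule: dec_induct)
 case (step m)
 thus ?case by(simp add: PQ_def)
qed (simp add: PQ_def)

lemma rc_d: "m : {1..n} ==> rc n (ap (dv m) h) = (SUM j:{1..m}. ap (dv j) (rc n h))" using dv_PQ[of m] rc_P[of _ n h] by(auto simp: ap_sum rc_sum intro!: sum.cong)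

text \<open>All q-derivatives of \<open>h\<close> also have vanishing r-coefficients, so a
  coefficient of \<open>h\<close> reduces to one of lower total degree of a derivative.\<close>

lemma rc_inj:
 assumes "!!c. ~ nj n c ==> h c = 0" and "rc n h = 0" shows "h = 0" proof -
 have "h c = 0" if "!!c. ~ nj n c ==> h c = 0" "rc n h = 0" for c h using that
 proof(induction "SUM j:{1..n}. c j" arbitrary: c h rule: less_induct)
  case less
  show ?case
  proof(cases "nj n c & (EX m:{1..n}. c m ~= 0)")
   case True
   then obtain m where m: "m : {1..n}" "c m ~= 0" by blast
   let ?c = "c(m := c m - 1)"
   have "ap (dv m) h ?c = 0" proof(rule less.hyps[of ?c "ap (dv m) h"])
    show "(SUM j:{1..n}. ?c j) < (SUM j:{1..n}. c j)" using m by(intro sum_strict_mono_ex1 bexI[of _ m]) auto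
    show "ap (dv m) h c = 0" if "~ nj n c" for c using less.prems(1)[of "c(m := Suc (c m))"] that m by(simp add: ap_dv nj_upd)
    show "rc n (ap (dv m) h) = 0" using rc_d[OF m(1), of h] less.prems(2) by simp
   qed
   thus ?thesis using m by(simp add: ap_dv del: of_nat_Suc)
  next
   case False
   show ?thesis
   proof(cases "nj n c")
    case True
    hence c: "c = (%_. 0)" using False by(intro ext) (auto simp: nj_def)
    have "PP js (%_. 0) = 1" for js by(induction js) (auto simp: PP_def)
    thus ?thesis using fun_cong[OF less.prems(2), of c] by(simp add: c rc_def nj_def fa)
   qed (rule less.prems)
  qed
 qed
 thus ?thesis using assms by(intro ext) (auto simp: fa)
qed

section \<open>Lax form of one recursion step\<close>

definition lg :: "'x lop => 'x lop => complex => complex => bool => bool => 'x lop" where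
 "lg r p delta z a b = (if a then (if b then (z - delta) *: 1 + r * p else delta *: r - r * (r * p))
           else (if b then p else z *: 1 - r * p))"

lemma lx_lg: "lx d i z = lg (xv i) (dv i) (of_nat (d i)) z" by(intro ext) (simp add: lx_def lg_def)

definition act :: "(bool => bool => 'x lop) => (bool => 'x => complex) => bool => 'x => complex" where
 "act M C a = ap (M a True) (C True) + ap (M a False) (C False)"

lemma act_mm: "act (mm M N) C = act M (act N C)" by(rule ext) (simp add: act_def mm_def ap_vadd alg)
lemma act_id2: "act id2 C = C" by(rule ext) (simp add: act_def id2_def)
lemma act_vs: "act M (%a. z *. C a) = (%a. z *. act M C a)" by(rule ext) (simp add: act_def ap_vs vs_simps)

lemmas vl = ap_vadd ap_vdiff ap_vs ap_vminus fa vs_apply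

text \<open>The combination \<open>y - D x\<close> is only rescaled by the step, and
  \<open>x\<close> changes by a scalar and a multiple of that combination. This triangular shape is
  what a Lax matrix can express.\<close>

lemma lax_site:
 assumes dq: "!!v. ap D (ap q v) = ap q (ap D v) + v"
  and x: "kappa *. x1 = kappa *. x + (ap q (ap D x) + kp *. x) - ap q y"
  and y: "kappa *. y1 = kappa *. y + ap D (ap q (ap D x) + (kp + km) *. x) - (ap q (ap D y) + (km + 1) *. y)"
 shows "kappa *. x1 = (kappa + kp) *. x - ap q (y - ap D x)"
  and "kappa *. (y1 - ap D x1) = (kappa - km) *. (y - ap D x)" proof -
 show x': "kappa *. x1 = (kappa + kp) *. x - ap q (y - ap D x)" unfolding x by(rule ext) (simp add: vl alg)
 have "kappa *. (y1 - ap D x1) = kappa *. y1 - ap D (kappa *. x1)" by(simp add: vs_simps ap_vs)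
 thus "kappa *. (y1 - ap D x1) = (kappa - km) *. (y - ap D x)" unfolding y x' by(simp only: ap_vadd ap_vdiff ap_vs dq) (rule ext, simp add: vl alg)
qed

text \<open>In terms of the column with entries \<open>a x + r' y\<close> and \<open>y\<close> the
  step is a Lax matrix. Its argument is \<open>b - 1\<close>, and \<open>delta\<close> is fixed by
  the coefficient \<open>a1\<close> of the new column.\<close>

lemma lax_right:
 assumes pr: "!!v. ap p (ap r v) = ap r (ap p v) + v"
  and x: "kappa *. x1 = a *. x - w" and r': "r'y = ap r y - w" and y1: "kappa *. (y1 - ap p x1) = b *. y"
 shows "kappa *. (a1 *. x1 + ap r y1) = ap (lg r p (b - 1 - a1) (b - 1) True True) (a *. x + r'y) + ap (lg r p (b - 1 - a1) (b - 1) True False) y"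
  and "kappa *. y1 = ap (lg r p (b - 1 - a1) (b - 1) False True) (a *. x + r'y) + ap (lg r p (b - 1 - a1) (b - 1) False False) y" proof -
 have y1': "kappa *. y1 = b *. y + ap p (a *. x - w)" proof -
  have "kappa *. y1 = kappa *. (y1 - ap p x1) + ap p (kappa *. x1)" by(simp add: vs_simps ap_vs)
  thus ?thesis unfolding x y1 .
 qed
 let ?A = "a1 *. x1 + ap r y1"
 have e: "kappa *. ?A = a1 *. (kappa *. x1) + ap r (kappa *. y1)" by(simp add: vs_simps ap_vs mult.commute)
 show "kappa *. y1 = ap (lg r p (b - 1 - a1) (b - 1) False True) (a *. x + r'y) + ap (lg r p (b - 1 - a1) (b - 1) False False) y"
  unfolding y1' r' by(simp add: lg_def ap_vadd ap_vdiff ap_vs pr) (rule ext, simp add: vl alg)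
 show "kappa *. ?A = ap (lg r p (b - 1 - a1) (b - 1) True True) (a *. x + r'y) + ap (lg r p (b - 1 - a1) (b - 1) True False) y"
  unfolding e x y1' r' by(simp add: lg_def ap_vadd ap_vdiff ap_vs pr) (rule ext, simp add: vl alg)
qed

text \<open>For the left factors the column \<open>C\<close> is described by two linear relations to
  \<open>x\<close> and \<open>y\<close>; applying the Lax matrix of a site produces the relations
  that \<open>lax_left_site\<close> takes as input.\<close>

lemma lax_left:
 assumes pr: "!!v. ap p (ap r v) = ap r (ap p v) + v"
  and c1: "C True - ap r (C False) = S *. x" and c2: "B *. C False = S *. (y + z)"
 shows "act (lg r p delta (B - 1)) C False = S *. (y + z + ap p x)"
  and "act (lg r p delta (B - 1)) C True - ap r (act (lg r p delta (B - 1)) C False) = ((B - 1 - delta) * S) *. x" proof -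
 have C: "C True = ap r (C False) + S *. x" by(simp flip: c1)
 let ?A = "lg r p delta (B - 1)"
 have "act ?A C False = ap p (S *. x) + B *. C False" unfolding act_def C by(simp add: lg_def ap_vadd pr) (rule ext, simp add: vl alg)
 also have "... = S *. (y + z + ap p x)" unfolding c2 by(simp add: vs_simps ap_vs)
 finally show f: "act ?A C False = S *. (y + z + ap p x)" .
 let ?B = "ap r (act ?A C False)"
 have "act ?A C True = ?B + (B - 1 - delta) *. (S *. x)" unfolding act_def C by(simp add: lg_def ap_vadd ap_vdiff ap_vs pr) (rule ext, simp add: vl alg)
 thus "act ?A C True - ?B = ((B - 1 - delta) * S) *. x" by(simp add: vs_simps)
qed

text \<open>Passing from the tail r to the next tail r' = r - q restores the relations of
  \<open>lax_left\<close> for the following site.\<close>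

lemma lax_left_site:
 assumes c1: "c1 - ap r c2 = (nu * S) *. x" and c2: "c2 = S *. (y + ap D x)" and nu: "nu = kappa + km"
  and r': "ap r' c2 = ap r c2 - ap q c2"
  and dq: "!!v. ap D (ap q v) = ap q (ap D v) + v"
  and x: "kappa *. x1 = kappa *. x + (ap q (ap D x) + km *. x) + ap q y"
  and y: "kappa *. y1 = kappa *. y - ap D (ap q (ap D x) + (kp + km) *. x) - (ap q (ap D y) + (kp + 1) *. y)"
 shows "c1 - ap r' c2 = (kappa * S) *. x1" and "(kappa - kp) *. c2 = (kappa * S) *. (y1 + ap D x1)" proof -
 have "c1 - ap r' c2 = (nu * S) *. x + ap q c2" using c1 r' by(simp add: alg)
 also have "... = S *. (kappa *. x1)" unfolding x c2 nu by(rule ext) (simp add: vl alg)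
 finally show "c1 - ap r' c2 = (kappa * S) *. x1" by(simp add: vs_simps mult.commute)
 have "kappa *. (y1 + ap D x1) = kappa *. y1 + ap D (kappa *. x1)" by(simp add: vs_simps ap_vs)
 also have "... = (kappa - kp) *. (y + ap D x)" unfolding x y by(simp only: ap_vadd ap_vdiff ap_vs dq) (rule ext, simp add: vl alg)
 finally have "S *. (kappa *. (y1 + ap D x1)) = S *. ((kappa - kp) *. (y + ap D x))" by simp
 thus "(kappa - kp) *. c2 = (kappa * S) *. (y1 + ap D x1)" unfolding c2 by(simp add: vs_simps(1) mult.commute)
qed

fun Zq :: "nat => (nat => complex) => (nat => complex) => nat list => complex => bool => bool => arr lop" where
 "Zq n alpha beta [] u = id2"
| "Zq n alpha beta (i # is) u = mm (mm (lg (RQ n i) (PQ i) (alpha i - beta i) (u + alpha i)) (Zq n alpha beta is u)) (lg (RQ n i) (PQ i) (alpha i - beta i) (u - beta i))"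

lemma rc_lg: "m : {1..n} ==> rc n (ap (lg (RQ n m) (PQ m) delta z a b) h) = ap (lg (xv m) (dv m) delta z a b) (rc n h)" by(simp add: lg_def rc_lin rc_R rc_P)

lemma rc_mm:
 assumes "!!a b h. rc n (ap (A a b) h) = ap (A' a b) (rc n h)" "!!a b h. rc n (ap (B a b) h) = ap (B' a b) (rc n h)"
 shows "rc n (ap (mm A B a b) h) = ap (mm A' B' a b) (rc n h)" by(simp add: mm_def rc_lin assms)

lemma rc_Zq:
 assumes "set is <= {1..n}" "!!i. i : set is ==> alpha i - beta i = of_nat (d i)"
 shows "rc n (ap (Zq n alpha beta is u a b) h) = ap (Zm d alpha (%i. - beta i) is u a b) (rc n h)" using assms
proof(induction "is" arbitrary: a b h)
 case (Cons i "is")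
 have *: "rc n (ap (lg (RQ n i) (PQ i) (alpha i - beta i) z a b) h) = ap (lx d i z a b) (rc n h)" for z a b h using Cons.prems by(simp add: rc_lg lx_lg)
 show ?case unfolding Zq.simps Zm.simps using * Cons by(intro rc_mm) (auto simp flip: diff_conv_add_uminus)
qed (simp add: id2_def rc_lin)

lemma RQ_Suc: "m <= n ==> RQ n (Suc m) = RQ n m - xv m" by(simp add: RQ_def sum.atLeast_Suc_atMost[of m n])

lemma PQ_RQ_v: "m : {1..n} ==> ap (PQ m) (ap (RQ n m) v) = ap (RQ n m) (ap (PQ m) v) + v" using arg_cong[OF PQ_RQ[of m n m], of "%T. ap T v"] by simp
lemma dx_v: "ap (dv m) (ap (xv m) v) = ap (xv m) (ap (dv m) v) + v" using arg_cong[OF dx_same[of m], of "%T. ap T v"] by simp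

definition kdf :: "(nat => int) => (nat => int) => nat => nat" where "kdf a b i = nat (a i - b i)"
lemma kpkm: "kdf a b i = 0 | kdf b a i = 0" by(auto simp: kdf_def)

section \<open>The triangular recursion for the resolvent\<close>

locale sp_lax = sp_hwrep n F lam xi for n and F :: "int => int => ('v::finite) lop" and lam xi +
 fixes mu :: "nat => int" and v :: "'v => complex" and Gf :: "int => int => 'v lop" and u :: complex
 assumes v: "v : VP mu" and teqG: "teq Gf"
  and G_eq: "!!i. i : Iset n ==> (SUM j:Iset n. F i j * Gf j (int n)) = (u + of_nat n + 1/2) *: Gf i (int n) - kd i (int n) *: 1"
begin

definition ff :: "pol" where "ff = pair xs (uu v)"
definition gm :: "int => pol" where "gm k = pair xs (ap (lv (Gf k nn)) (uu v))"

text \<open>The scalar created by moving all \<open>F i j\<close> with \<open>j > i\<close> past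
  \<open>Gf j nn\<close>. For negative \<open>i\<close> the index 0 is missing from the count, and
  the doubled term \<open>j = - i\<close> makes up for it.\<close>

lemma count_gt: assumes i: "i : I" shows "(SUM j:{j:I. i < j}. 1 + kd j (- i)) = of_int (nn - i)"
proof(cases "i > 0")
 case True
 have "{j:I. i < j} = {i<..int n}" using True by(auto simp: Iset_def)
 moreover have "(SUM j:{i<..int n}. 1 + kd j (- i)) = (SUM j:{i<..int n}. 1 :: complex)" using True by(intro sum.cong) (auto simp: kd_def)
 moreover have "of_nat (nat (nn - i)) = (of_int (nn - i) :: complex)" using i by(subst of_nat_nat) (auto simp: Iset_def)
 ultimately show ?thesis by simp
next
 case False
 have "{j:I. i < j} = {i<..int n} - {0}" using False i by(auto simp: Iset_def)
 have in': "- i : {i<..int n} - {0}" using False i by(auto simp: Iset_def)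
 have c: "card ({i<..int n} - {0}) = nat (nn - i) - 1" using False i by(subst card_Diff_singleton) (auto simp: Iset_def)
 have "(SUM j:{i<..int n} - {0}. 1 + kd j (- i)) = (SUM j:{i<..int n} - {0}. 1) + (SUM j:{i<..int n} - {0}. if j = - i then 1 else 0 :: complex)"
  unfolding sum.distrib by(simp add: kd_def)
 also have "... = of_nat (nat (nn - i) - 1) + 1" using in' by(subst sum.delta) (auto simp: c)
 also have "... = of_nat (nat (nn - i))" using in' by(subst of_nat_diff) auto
 also have "... = of_int (nn - i)" using in' by(subst of_nat_nat) auto
 finally show ?thesis using \<open>{j:I. i < j} = _\<close> by simp
qed

text \<open>In the resolvent equation paired with the covector, \<open>F i j\<close> vanishes for
  \<open>j < i\<close>, is a weight for \<open>j = i\<close>, and for \<open>j > i\<close> is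
  commuted to the right, where it becomes the vector field \<open>DD i j\<close>. So
  \<open>gm i\<close> depends only on the \<open>gm j\<close> with \<open>j > i\<close>.\<close>

lemma gm_rec:
 assumes i: "i : I"
 shows "(u + 1/2 - lm i + of_int i) *. gm i = kd i nn *. ff + (SUM j:{j:I. i < j}. ap (DD i j) (gm j))" proof -
 let ?w = "u + of_nat n + 1/2"
 have t: "pair xs (ap (lv (F i j * Gf j nn)) (uu v)) = (if i < j then ap (DD i j) (gm j) + (1 + kd j (- i)) *. gm i else 0) + (if j = i then lm i *. gm i else 0)"
  if j: "j : I" for j proof -
  consider "j < i" | "j = i" | "i < j" by linarith
  thus ?thesis
  proof cases
   case 1
   have "pair xs (ap (lv (F i j)) z) = 0" for z :: "'v srv" unfolding pair_lv using xs_low[OF i j 1] by(simp add: pair_def fun_eq_iff fa)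
   thus ?thesis using 1 by(simp add: lv_hom)
  next
   case 2
   have "pair xs (ap (lv (F i i)) z) = lm i *. pair xs z" for z :: "'v srv" unfolding pair_lv using xs(3)[OF i] by(simp add: pair_def fun_eq_iff vs_apply)
   thus ?thesis using 2 by(simp add: lv_hom gm_def)
  next
   case 3
   have in': "i ~= nn" "- j ~= nn" using 3 i j by(auto simp: Iset_def)
   have "F i j * Gf j nn = Gf j nn * F i j + ad (F i j) (Gf j nn)" by(rule ad_D)
   also have "ad (F i j) (Gf j nn) = (1 + kd j (- i)) *: Gf i nn" unfolding teqD[OF teqG i j j nI] using in' 3 i by(auto simp: kd_def theta_same Iset_nz scl_simps(7))
   finally have e: "lv (F i j * Gf j nn) = lv (Gf j nn) * lv (F i j) + (1 + kd j (- i)) *: lv (Gf i nn)" by(simp only: lv_hom)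
   have "ap (lv (Gf j nn)) (ap (lv (F i j)) (uu v)) = ap (ls (DD i j)) (ap (lv (Gf j nn)) (uu v))" unfolding FD[OF v i j 3] by(simp add: lv_ls flip: ap_mult)
   thus ?thesis unfolding e using 3 by(simp add: pair_lin[OF lf_xs] pair_ls[OF lf_xs] gm_def)
  qed
 qed
 let ?A = "SUM j:{j:I. i < j}. (1 + kd j (- i)) *. gm i"
 let ?B = "SUM j:{j:I. i < j}. ap (DD i j) (gm j)"
 let ?C = "lv (SUM j:I. F i j * Gf j nn)"
 have "?w *. gm i - kd i nn *. ff = pair xs (ap ?C (uu v))" unfolding G_eq[OF i] by(simp add: lv_hom pair_diff[OF lf_xs] pair_lin[OF lf_xs] gm_def ff_def)
 also have "?C = (SUM j:I. lv (F i j * Gf j nn) :: 'v ser lop)" by(induction rule: finite_induct[OF finite_Iset]) (simp_all add: lv_hom)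
 also have "pair xs (ap ... (uu v)) = (SUM j:I. (if i < j then ap (DD i j) (gm j) + (1 + kd j (- i)) *. gm i else 0) + (if j = i then lm i *. gm i else 0))"
  unfolding ap_sum pair_sum[OF lf_xs] by(intro sum.cong refl t)
 also have "... = ?B + ?A + lm i *. gm i" proof -
  have A: "(SUM j:I. if i < j then g j else 0) = (SUM j:{j:I. i < j}. g j)" for g :: "int => pol"
   by(rule sum.inter_filter[symmetric]) simp
  show ?thesis unfolding sum.distrib[of _ _ "I"] A using i by(simp add: sum.distrib)
 qed
 also have "?A = of_int (nn - i) *. gm i" unfolding count_gt[OF i, symmetric] by(rule ext) (simp add: sum_fun_apply vs_apply sum_distrib_right)
 finally have e: "?w *. gm i - kd i nn *. ff = ?B + of_int (nn - i) *. gm i + lm i *. gm i" .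
 have "(u + 1/2 - lm i + of_int i) *. gm i = (?w *. gm i - kd i nn *. ff) + kd i nn *. ff - of_int (nn - i) *. gm i - lm i *. gm i"
  by(rule ext) (simp add: fa vs_apply alg)
 thus ?thesis unfolding e by simp
qed

text \<open>A recursion step uses the earlier \<open>gm\<close> only through two sums, one
  multiplied by coordinates and one differentiated: \<open>Xp\<close> and \<open>Yp\<close> while
  the index descends from n to 1, then \<open>Xn\<close> and \<open>Yn\<close> from -1 to
  -n.\<close>

definition Xp :: "nat => pol" where "Xp m = (SUM k:{m..n}. ap (xr (int k)) (gm (int k)))"
definition Yp :: "nat => pol" where "Yp m = (SUM k:{m..n}. ap (dv (- int k)) (gm (int k)))"
definition Xn :: "nat => pol" where "Xn m = Xp 1 + (SUM k:{1..m}. ap (xv (- int k)) (gm (- int k)))"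
definition Yn :: "nat => pol" where "Yn m = Yp 1 - (SUM k:{1..m}. ap (dv (int k)) (gm (- int k)))"

definition kap :: "nat => complex" where "kap m = u + 1/2 - (of_int (lam m) - of_nat m)"
definition kan :: "nat => complex" where "kan m = u + 1/2 + (of_int (lam m) - of_nat m)"

lemma Xp_Suc: "m <= n ==> Xp m = Xp (Suc m) + ap (xr (int m)) (gm (int m))"
 and Yp_Suc: "m <= n ==> Yp m = Yp (Suc m) + ap (dv (- int m)) (gm (int m))" by(simp_all add: Xp_def Yp_def sum.atLeast_Suc_atMost[of m n] add.commute)

lemma th_pos: "k > 0 ==> l > 0 ==> theta (int k) (int l) = 1" "k > 0 ==> l > 0 ==> theta (- int k) (int l) = - 1"
 "k > 0 ==> l > 0 ==> theta (- int k) (- int l) = 1" by(auto simp: theta_def)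

lemma xr_dv: "k ~= l ==> ap (xr k) (ap (dv l) z) = ap (dv l) (ap (xr k) z)"
proof -
 assume "k ~= l"
 hence "xr k * dv l = dv l * xr k" by(auto simp: xr_def dx_diff)
 from arg_cong[OF this, of "%T. ap T z"] show ?thesis by simp
qed

lemma gm_pos:
 assumes m: "m : {1..n}"
 shows "kap m *. gm (int m) = (if m = n then ff else 0) + ap (dv (int m)) (Xp (Suc m)) - ap (xv (- int m)) (Yp (Suc m))" proof -
 have i: "int m : I" using m by(auto simp: Iset_def)
 have s: "{j:I. int m < j} = int ` {Suc m..n}" using m unfolding image_int_atLeastAtMost by(auto simp: Iset_def)
 have "(SUM j:{j:I. int m < j}. ap (DD (int m) j) (gm j)) = (SUM k:{Suc m..n}. ap (DD (int m) (int k)) (gm (int k)))"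
  unfolding s by(subst sum.reindex) (auto simp: inj_on_def)
 also have "... = (SUM k:{Suc m..n}. ap (dv (int m)) (ap (xr (int k)) (gm (int k))) - ap (xv (- int m)) (ap (dv (- int k)) (gm (int k))))"
 proof(intro sum.cong refl)
  fix k assume k: "k : {Suc m..n}"
  have "xr (- int m) = xv (- int m)" using m by(auto simp: xr_def)
  thus "ap (DD (int m) (int k)) (gm (int k)) = ap (dv (int m)) (ap (xr (int k)) (gm (int k))) - ap (xv (- int m)) (ap (dv (- int k)) (gm (int k)))"
   using m k by(simp add: DD_def th_pos xr_dv)
 qed
 also have "... = ap (dv (int m)) (Xp (Suc m)) - ap (xv (- int m)) (Yp (Suc m))" by(simp add: Xp_def Yp_def ap_vsum sum_subtractf)
 finally show ?thesis using gm_rec[OF i] m by(simp add: kap_def lm_def kd_def alg)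
qed

lemma gm_neg:
 assumes m: "m : {1..n}"
 shows "kan m *. gm (- int m) = ap (dv (- int m)) (Xn (m - 1)) + ap (xr (int m)) (Yn (m - 1))" proof -
 have i: "- int m : I" using m by(auto simp: Iset_def)
 have s: "{j:I. - int m < j} = int ` {1..n} \<union> (%k. - int k) ` {1..m - 1}" proof(intro equalityI subsetI)
  fix j assume j: "j : {j:I. - int m < j}"
  show "j : int ` {1..n} \<union> (%k. - int k) ` {1..m - 1}" proof(cases "j > 0")
   case True
   hence "j = int (nat j)" "nat j : {1..n}" using j by(auto simp: Iset_def)
   thus ?thesis by blast
  next
   case False
   hence "j = - int (nat (- j))" "nat (- j) : {1..m - 1}" using j by(auto simp: Iset_def)
   thus ?thesis by blast
  qed
 qed (use m in "auto simp: Iset_def")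
 have mn: "xr (- int k) = xv (- int k)" if "k > 0" for k using that by(auto simp: xr_def)
 have a: "ap (DD (- int m) (int k)) (gm (int k)) = ap (dv (- int m)) (ap (xr (int k)) (gm (int k))) + ap (xr (int m)) (ap (dv (- int k)) (gm (int k)))" if "k : {1..n}" for k
  using m that by(simp add: DD_def th_pos xr_dv)
 have b: "ap (DD (- int m) (- int k)) (gm (- int k)) = ap (dv (- int m)) (ap (xv (- int k)) (gm (- int k))) - ap (xr (int m)) (ap (dv (int k)) (gm (- int k)))" if "k : {1..m - 1}" for k
  using m that xr_dv[of "- int k" "- int m"] by(auto simp add: DD_def th_pos mn)
 have "(SUM j:{j:I. - int m < j}. ap (DD (- int m) j) (gm j)) = (SUM k:{1..n}. ap (DD (- int m) (int k)) (gm (int k))) + (SUM k:{1..m-1}. ap (DD (- int m) (- int k)) (gm (- int k)))"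
  unfolding s by(subst sum.union_disjoint) (auto simp: inj_on_def sum.reindex)
 also have "... = ap (dv (- int m)) (Xn (m - 1)) + ap (xr (int m)) (Yn (m - 1))"
  by(simp add: a b Xn_def Yn_def Xp_def Yp_def ap_vadd ap_vdiff ap_vsum sum.distrib sum_subtractf)
 finally show ?thesis using gm_rec[OF i] m by(simp add: kan_def lm_def kd_def alg)
qed

lemma Xn_n: "pair xs (uu (ap (Gf nn nn) v)) = Xn n"
proof -
 have s: "I = int ` {1..n} \<union> (%k. - int k) ` {1..n}" proof(intro equalityI subsetI)
  fix j assume j: "j : I"
  show "j : int ` {1..n} \<union> (%k. - int k) ` {1..n}" proof(cases "j > 0")
   case True
   hence "j = int (nat j)" "nat j : {1..n}" using j by(auto simp: Iset_def)
   thus ?thesis by blast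
  next
   case False
   hence "j = - int (nat (- j))" "nat (- j) : {1..n}" using j by(auto simp: Iset_def)
   thus ?thesis by blast
  qed
 qed (auto simp: Iset_def)
 have mn: "xr (- int k) = xv (- int k)" if "k > 0" for k using that by(auto simp: xr_def)
 have "pair xs (uu (ap (Gf nn nn) v)) = (SUM k:I. ap (xr k) (gm k))" unfolding uu_Znn[OF teqG] by(simp add: pair_sum[OF lf_xs] pair_ls[OF lf_xs] gm_def)
 also have "... = (SUM k:{1..n}. ap (xr (int k)) (gm (int k))) + (SUM k:{1..n}. ap (xr (- int k)) (gm (- int k)))"
  unfolding s by(subst sum.union_disjoint) (auto simp: inj_on_def sum.reindex)
 finally show ?thesis by(simp add: Xn_def Xp_def mn)
qed

abbreviation "kp == kdf lam mu"
abbreviation "km == kdf mu lam"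
abbreviation "al == alph lam mu"
abbreviation "be == bet n lam mu"
abbreviation "RD == rd n kp km"
definition xq :: "nat => arr => complex" where "xq m = RD (Xp m)"
definition yq :: "nat => arr => complex" where "yq m = RD (Yp m)"
definition xm :: "nat => arr => complex" where "xm m = RD (Xn m)"
definition ym :: "nat => arr => complex" where "ym m = RD (Yn m)"

text \<open>The parameters of the theorem appear here: \<open>lam m\<close> minus the shift
  \<open>kp m\<close> is the minimum of \<open>lam m\<close> and \<open>mu m\<close>, and
  \<open>lam m\<close> plus \<open>km m\<close> is their maximum.\<close>

lemma par_a: "m : {1..<n} ==> u - al (Suc m) = kap m + of_nat (kp m)" by(auto simp: alph_def kap_def kdf_def min_def alg)
lemma par_b: "m : {1..<n} ==> u - be m + 1 = kap m - of_nat (km m)" by(auto simp: bet_def kap_def kdf_def max_def alg)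
lemma par_c: "m : {1..<n} ==> u + be m = kan m + of_nat (km m)" by(auto simp: bet_def kan_def kdf_def max_def alg)
lemma par_d: "m : {1..<n} ==> u + al (Suc m) + 1 = kan m - of_nat (kp m)" by(auto simp: alph_def kan_def kdf_def min_def alg)
lemma par_n: "u + be n = kan n" by(simp add: bet_def kan_def alg)
lemma dxv: "ap (dv k) (ap (xv k) z) = ap (xv k) (ap (dv k) z) + z" using arg_cong[OF dx_same[of k], of "%T. ap T z"] by simp
lemma xxv: "ap (xv k) (ap (xv l) z) = ap (xv l) (ap (xv k) z)" using arg_cong[OF xx_comm[of k l], of "%T. ap T z"] by simp
lemma ddv: "ap (dv k) (ap (dv l) z) = ap (dv l) (ap (dv k) z)" using arg_cong[OF dd_comm[of k l], of "%T. ap T z"] by simp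

lemma site_pos:
 assumes m: "m : {1..<n}"
 shows "kap m *. xq m = (u - al (Suc m)) *. xq (Suc m) - ap (xv m) (yq (Suc m) - ap (dv m) (xq (Suc m)))"
  and "kap m *. (yq m - ap (dv m) (xq m)) = (u - be m + 1) *. (yq (Suc m) - ap (dv m) (xq (Suc m)))" proof -
 have m': "m : {1..n}" "m <= n" "xr (int m) = xv (int m)" "m ~= n" using m by(auto simp: xr_def)
 have g: "kap m *. gm (int m) = ap (dv (int m)) (Xp (Suc m)) - ap (xv (- int m)) (Yp (Suc m))" using gm_pos[OF m'(1)] m'(4) by simp
 let ?A = "ap (dv m) (xq (Suc m))"
 let ?B = "kap m *. gm (int m)"
 have "kap m *. Xp m = kap m *. Xp (Suc m) + ap (xv (int m)) ?B" unfolding Xp_Suc[OF m'(2)] m'(3) by(simp add: vs_simps ap_vs)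
 hence 1: "kap m *. xq m = kap m *. xq (Suc m) + (ap (xv m) ?A + of_nat (kp m) *. xq (Suc m)) - ap (xv m) (yq (Suc m))"
  unfolding g xq_def yq_def by(simp add: ap_vdiff rd_lin rd_N[OF m] rd_q[of m n kp km, OF m kpkm] flip: rd_lin(3))
 have "kap m *. Yp m = kap m *. Yp (Suc m) + ap (dv (- int m)) ?B" unfolding Yp_Suc[OF m'(2)] by(simp add: vs_simps ap_vs)
 hence 2: "kap m *. yq m = kap m *. yq (Suc m) + ap (dv m) (ap (xv m) ?A + (of_nat (kp m) + of_nat (km m)) *. xq (Suc m)) - (ap (xv m) (ap (dv m) (yq (Suc m))) + (of_nat (km m) + 1) *. yq (Suc m))"
  unfolding g xq_def yq_def by(simp add: ap_vdiff dxv rd_lin rd_N[OF m] rd_dd[of m n kp km, OF m kpkm] vs_simps(6) flip: rd_lin(3))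
 show "kap m *. xq m = (u - al (Suc m)) *. xq (Suc m) - ap (xv m) (yq (Suc m) - ?A)"
  and "kap m *. (yq m - ap (dv m) (xq m)) = (u - be m + 1) *. (yq (Suc m) - ?A)" unfolding par_a[OF m] par_b[OF m] by(rule lax_site[OF dx_v 1 2])+
qed

lemma site_neg:
 assumes m: "m : {1..<n}" and c1: "c1 - ap (RQ n m) c2 = ((u + be m) * S) *. xm (m - 1)" and c2: "c2 = S *. (ym (m - 1) + ap (dv m) (xm (m - 1)))"
 shows "c1 - ap (RQ n (Suc m)) c2 = (kan m * S) *. xm m" "(u + al (Suc m) + 1) *. c2 = (kan m * S) *. (ym m + ap (dv m) (xm m))" proof -
 have m': "m : {1..n}" "m <= n" "xr (int m) = xv (int m)" using m by(auto simp: xr_def)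
 obtain l where l: "m = Suc l" using m by(cases m) auto
 let ?B = "kan m *. gm (- int m)"
 have "Xn m = Xn (m - 1) + ap (xv (- int m)) (gm (- int m))" "Yn m = Yn (m - 1) - ap (dv (int m)) (gm (- int m))" unfolding l by(simp_all add: Xn_def Yn_def alg)
 hence X: "kan m *. Xn m = kan m *. Xn (m - 1) + ap (xv (- int m)) ?B"
  and Y: "kan m *. Yn m = kan m *. Yn (m - 1) - ap (dv (int m)) ?B" by(simp_all add: vs_simps ap_vs)
 let ?A = "ap (xv m) (ap (dv m) (xm (m - 1)))"
 have 1: "kan m *. xm m = kan m *. xm (m - 1) + (?A + of_nat (km m) *. xm (m - 1)) + ap (xv m) (ym (m - 1))"
  using arg_cong[OF X, of RD] unfolding gm_neg[OF m'(1)] m'(3) xm_def ym_def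
  by(simp add: ap_vadd rd_lin rd_N[OF m] rd_q[of m n kp km, OF m kpkm] xxv[of "- int m" "int m"] add.assoc)
 have 2: "kan m *. ym m = kan m *. ym (m - 1) - ap (dv m) (?A + (of_nat (kp m) + of_nat (km m)) *. xm (m - 1)) - (ap (xv m) (ap (dv m) (ym (m - 1))) + (of_nat (kp m) + 1) *. ym (m - 1))"
  using arg_cong[OF Y, of RD] unfolding gm_neg[OF m'(1)] m'(3) xm_def ym_def
  by(simp add: ap_vadd dxv rd_lin rd_N[OF m] rd_dd[of m n kp km, OF m kpkm] ddv[of "int m" "- int m"] vs_simps(6) diff_diff_eq)
 let ?C = "ap (RQ n (Suc m)) c2"
 have r: "?C = ap (RQ n m) c2 - ap (xv m) c2" using RQ_Suc[OF m'(2)] by simp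
 show "c1 - ?C = (kan m * S) *. xm m" "(u + al (Suc m) + 1) *. c2 = (kan m * S) *. (ym m + ap (dv m) (xm m))"
  unfolding par_d[OF m] by(rule lax_left_site[OF c1 c2 par_c[OF m] r dx_v 1 2])+
qed

definition yy :: "nat => arr => complex" where "yy m = yq m - (if m = 1 then 0 else ap (dv (m - 1)) (xq m))"
text \<open>Up to scalars, the column produced by the right factors of the sites n, ..., m. It
  starts with \<open>ff\<close> and 0 because the source term of the resolvent equation occurs at
  index n only.\<close>

definition CC :: "nat => bool => arr => complex" where
 "CC m a = (if m = Suc n then (if a then RD ff else 0) else if a then (u - al m) *. xq m + ap (RQ n m) (yy m) else yy m)"

lemma CC_step:
 assumes m: "m : {1..n}"
 shows "act (lg (RQ n m) (PQ m) (al m - be m) (u - be m)) (CC (Suc m)) = (%a. kap m *. CC m a)" proof -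
 let ?B = "ap (PQ m) (xq m)"
 have dm: "yy m - ?B = yq m - ap (dv m) (xq m)" by(simp add: yy_def PQ_def)
 have ab: "u - be m + 1 - 1 = u - be m" "u - be m - (u - al m) = al m - be m" by simp_all
 let ?A = "lg (RQ n m) (PQ m) (al m - be m) (u - be m)"
 have "kap m *. ((u - al m) *. xq m + ap (RQ n m) (yy m)) = act ?A (CC (Suc m)) True
   & kap m *. yy m = act ?A (CC (Suc m)) False" proof(cases "m = n")
  case True
  have "kap n *. Xp n = ff" "Yp n = ap (dv (- nn)) (Xp n)" using gm_pos[OF m] n1 by(simp_all add: True Xp_def Yp_def)
  hence "kap n *. xq n = RD ff" and y: "yq n = ap (dv n) (xq n)" by(simp_all add: xq_def yq_def rd_n[OF n1] flip: rd_lin(3))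
  hence x: "kap m *. xq m = 1 *. RD ff - 0" by(simp add: True)
  have z: "kap m *. (yy m - ?B) = (u - be m + 1) *. 0" unfolding dm using y by(simp add: True)
  show ?thesis using lax_right[OF PQ_RQ_v[OF m] x _ z, of 0 "u - al m"] unfolding ab by(simp add: act_def CC_def True)
 next
  case False
  hence mn: "m : {1..<n}" using m by auto
  have yS: "yy (Suc m) = yq (Suc m) - ap (dv m) (xq (Suc m))" using m by(simp add: yy_def)
  let ?C = "ap (xv m) (yy (Suc m))"
  have x: "kap m *. xq m = (u - al (Suc m)) *. xq (Suc m) - ?C" unfolding yS by(rule site_pos(1)[OF mn])
  have z: "kap m *. (yy m - ?B) = (u - be m + 1) *. yy (Suc m)" unfolding dm yS by(rule site_pos(2)[OF mn])
  have r: "ap (RQ n (Suc m)) (yy (Suc m)) = ap (RQ n m) (yy (Suc m)) - ?C" using RQ_Suc[of m n] m by simp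
  show ?thesis using lax_right[OF PQ_RQ_v[OF m] x r z, of "u - al m"] unfolding ab by(simp add: act_def CC_def False)
 qed
 thus ?thesis using m by(intro ext) (auto simp: CC_def)
qed

text \<open>For the list m, ..., 1 the right factors act in the order m, ..., 1 and the left factors
  in the order 1, ..., m, just as the recursion runs down the positive indices and then from -1 to
  -m. Hence the reversed sites.\<close>

definition Dm :: "nat => bool => arr => complex" where
 "Dm m = act (Zq n al be (rev [1..<Suc m]) u) (CC (Suc m))"

lemma Dm_Suc: assumes "Suc m <= n"
 shows "Dm (Suc m) = (%a. kap (Suc m) *. act (lg (RQ n (Suc m)) (PQ (Suc m)) (al (Suc m) - be (Suc m)) (u + al (Suc m))) (Dm m) a)" proof -
 have r: "rev [1..<Suc (Suc m)] = Suc m # rev [1..<Suc m]" by simp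
 show ?thesis unfolding Dm_def r Zq.simps act_mm using CC_step[of "Suc m"] assms by(simp add: act_vs del: upt_Suc)
qed

definition SS :: "nat => complex" where "SS m = (u + 1/2) * (PROD j:{1..m}. kap j * kan j)"

lemma Dm_step:
 assumes m: "m < n" and I1: "Dm m True - ap (RQ n (Suc m)) (Dm m False) = SS m *. xm m"
  and I2: "(u + al (Suc m) + 1) *. Dm m False = SS m *. (ym m + (if m = 0 then 0 else ap (dv m) (xm m)))"
 defines "c == act (lg (RQ n (Suc m)) (PQ (Suc m)) (al (Suc m) - be (Suc m)) (u + al (Suc m))) (Dm m)"
 shows "c False = SS m *. (ym m + ap (dv (Suc m)) (xm m))"
  and "c True - ap (RQ n (Suc m)) (c False) = ((u + be (Suc m)) * SS m) *. xm m" proof -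
 have p: "Suc m : {1..n}" using m by simp
 have B: "u + al (Suc m) + 1 - 1 = u + al (Suc m)" "u + al (Suc m) - (al (Suc m) - be (Suc m)) = u + be (Suc m)" by simp_all
 have d: "y + (if m = 0 then 0 else ap (dv m) x) + ap (PQ (Suc m)) x = y + ap (dv (Suc m)) x" for x y by(simp add: PQ_def)
 note L = lax_left[OF PQ_RQ_v[OF p] I1 I2, of "al (Suc m) - be (Suc m)", unfolded B d]
 show "c False = SS m *. (ym m + ap (dv (Suc m)) (xm m))" unfolding c_def by(rule L(1))
 show "c True - ap (RQ n (Suc m)) (c False) = ((u + be (Suc m)) * SS m) *. xm m" unfolding c_def by(rule L(2))
qed

text \<open>These are the two relations that \<open>lax_left\<close> takes as input at site m + 1.
  They hold for m = 0 because alpha_1 = -1/2 makes both \<open>u - al 1\<close> and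
  \<open>u + al 1 + 1\<close> equal to u + 1/2.\<close>

lemma Dm_inv:
 assumes "m < n"
 shows "Dm m True - ap (RQ n (Suc m)) (Dm m False) = SS m *. xm m
  & (u + al (Suc m) + 1) *. Dm m False = SS m *. (ym m + (if m = 0 then 0 else ap (dv m) (xm m)))" using assms proof(induction m)
 case 0
 have "Dm 0 = CC 1" by(simp add: Dm_def act_id2)
 moreover have "xq 1 = xm 0" "yy 1 = ym 0" by(simp_all add: xq_def xm_def Xn_def yy_def yq_def ym_def Yn_def)
 ultimately show ?case using 0 by(simp add: CC_def SS_def alph_def add.commute)
next
 case (Suc m)
 let ?c = "act (lg (RQ n (Suc m)) (PQ (Suc m)) (al (Suc m) - be (Suc m)) (u + al (Suc m))) (Dm m)"
 have m: "m < n" "Suc m : {1..<n}" using Suc.prems by auto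
 note I = Suc.IH[OF m(1)]
 note S = Dm_step[OF m(1) conjunct1[OF I] conjunct2[OF I]]
 have "?c True - ap (RQ n (Suc m)) (?c False) = ((u + be (Suc m)) * SS m) *. xm (Suc m - 1)" "?c False = SS m *. (ym (Suc m - 1) + ap (dv (Suc m)) (xm (Suc m - 1)))"
  using S by simp_all
 note N = site_neg[OF m(2) this]
 have D: "Dm (Suc m) = (%a. kap (Suc m) *. ?c a)" using Suc.prems by(intro Dm_Suc) simp
 have SS: "SS (Suc m) = kap (Suc m) * (kan (Suc m) * SS m)" by(simp add: SS_def)
 let ?A = "u + al (Suc (Suc m)) + 1"
 let ?B = "RQ n (Suc (Suc m))"
 have "Dm (Suc m) True - ap ?B (Dm (Suc m) False) = kap (Suc m) *. (?c True - ap ?B (?c False))" unfolding D by(simp add: ap_vs vs_simps)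
 moreover have "?A *. Dm (Suc m) False = kap (Suc m) *. (?A *. ?c False)" unfolding D by(simp only: vs_simps(1) mult.commute)
 ultimately show ?case unfolding N SS by(simp add: vs_simps)
qed

lemma Xn_Suc: "Xn (Suc k) = Xn k + ap (xv (- int (Suc k))) (gm (- int (Suc k)))" by(simp add: Xn_def add.assoc)

theorem lax_nn: "SS n *. RD (pair xs (uu (ap (Gf nn nn) v))) = ap (Zq n al be (rev [1..<Suc n]) u True True) (RD ff)"
proof -
 obtain m where m: "n = Suc m" using n1 by(cases n) auto
 let ?c = "act (lg (RQ n n) (PQ n) (al n - be n) (u + al n)) (Dm m)"
 have mn: "m < n" using m by simp
 note I = Dm_inv[OF mn]
 note S = Dm_step[OF mn conjunct1[OF I] conjunct2[OF I], folded m]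
 have "Xn n = Xn m + ap (xv (- nn)) (gm (- nn))" using Xn_Suc[of m] by(simp only: m[symmetric])
 hence "kan n *. Xn n = kan n *. Xn m + ap (xv (- nn)) (kan n *. gm (- nn))" by(simp add: vs_simps ap_vs)
 moreover have "kan n *. gm (- nn) = ap (dv (- nn)) (Xn m) + Yn m" proof -
  have "n - 1 = m" "n : {1..n}" using m by auto
  thus ?thesis using gm_neg[of n] by(simp only: xr_n ap_1)
 qed
 ultimately have x: "kan n *. xm n = kan n *. xm m + ap (xv n) (ap (dv n) (xm m) + ym m)" unfolding xm_def ym_def by(simp add: rd_lin rd_n[OF n1] flip: rd_lin(3))
 have "?c True = ((u + be n) * SS m) *. xm m + ap (RQ n n) (?c False)" by(simp flip: S(2))
 also have "... = SS m *. (kan n *. xm n)" unfolding S(1) x par_n by(simp add: RQ_def ap_vs ap_vadd vs_simps add.commute mult.commute)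
 finally have "Dm n True = SS n *. xm n" using Dm_Suc[of m] m by(simp add: SS_def vs_simps alg)
 moreover have "Dm n True = ap (Zq n al be (rev [1..<Suc n]) u True True) (RD ff)" by(simp add: Dm_def act_def CC_def del: upt_Suc)
 ultimately show ?thesis by(simp add: xm_def Xn_n)
qed

theorem lax_nn_rc:
 assumes "!!i. i : {1..n} ==> al i - be i = of_nat (d i)"
 shows "SS n *. rc n (RD (pair xs (uu (ap (Gf nn nn) v)))) = ap (Zm d al (%i. - be i) (rev [1..<Suc n]) u True True) (rc n (RD (pair xs (uu v))))"
proof -
 let ?A = "rev [1..<Suc n]"
 have s: "set ?A <= {1..n}" by auto
 have "rc n (ap (Zq n al be ?A u True True) (RD ff)) = ap (Zm d al (%i. - be i) ?A u True True) (rc n (RD ff))" by(rule rc_Zq[OF s]) (use s assms in blast)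
 thus ?thesis unfolding ff_def lax_nn[unfolded ff_def, symmetric] by(simp add: rc_lin)
qed

end

text \<open>\<open>P\<close> acts like a derivative: at the least exponent that kills
  \<open>g\<close>, the commutator with \<open>q\<close> leaves a nonzero multiple of the last
  surviving power, so \<open>q\<close> raises that exponent by one.\<close>

lemma nilp_cancel:
 fixes P :: "'x lop"
 assumes Pq: "!!g. ap P (ap q g) = ap q (ap P g) + s *. g" and s: "s ~= 0"
  and nil: "EX M. ap (P ^ M) g = 0" and z: "ap (P ^ Suc N) (ap q g) = 0"
 shows "ap (P ^ N) g = 0" proof(rule ccontr)
 assume nz: "ap (P ^ N) g ~= 0"
 have Pk: "ap (P ^ Suc k) (ap q g) = ap q (ap (P ^ Suc k) g) + (of_nat (Suc k) * s) *. ap (P ^ k) g" for k proof(induction k)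
  case 0
  show ?case by(simp add: Pq)
 next
  case (Suc k)
  have "ap (P ^ Suc (Suc k)) (ap q g) = ap P (ap (P ^ Suc k) (ap q g))" by simp
  also have "... = ap P (ap q (ap (P ^ Suc k) g) + (of_nat (Suc k) * s) *. ap (P ^ k) g)" unfolding Suc ..
  also have "... = ap q (ap (P ^ Suc (Suc k)) g) + (s *. ap (P ^ Suc k) g + (of_nat (Suc k) * s) *. ap (P ^ Suc k) g)"
   by(simp only: ap_vadd ap_vs Pq ap_mult power_Suc add.assoc)
  also have "s *. ap (P ^ Suc k) g + (of_nat (Suc k) * s) *. ap (P ^ Suc k) g = (of_nat (Suc (Suc k)) * s) *. ap (P ^ Suc k) g"
   unfolding vs_simps(6)[symmetric] by(simp add: distrib_right)
  finally show ?case .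
 qed
 define m where "m = (LEAST M. ap (P ^ M) g = 0)"
 have m: "ap (P ^ m) g = 0" unfolding m_def using nil by(rule LeastI_ex)
 have mle: "~ m <= N" proof
  assume "m <= N"
  hence "P ^ N = P ^ (N - m) * P ^ m" by(simp flip: power_add)
  thus False using nz m by simp
 qed
 then obtain k where k: "m = Suc k" by(cases m) auto
 have "ap (P ^ k) g ~= 0" using not_less_Least[of k "%M. ap (P ^ M) g = 0"] k m_def by simp
 moreover have "ap (P ^ Suc k) (ap q g) = 0" proof -
  have "P ^ Suc k = P ^ (k - N) * P ^ Suc N" using mle k by(simp flip: power_add del: power_Suc)
  thus ?thesis using z by(simp del: power_Suc)
 qed
 ultimately show False using Pk[of k] m k vs_eq_0[of "of_nat (Suc k) * s" "ap (P ^ k) g"] s by(simp del: of_nat_Suc power_Suc)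
qed

lemma nilp_cancel_pow:
 fixes P :: "'x lop"
 assumes Pq: "!!g. ap P (ap q g) = ap q (ap P g) + s *. g" and s: "s ~= 0"
  and nil: "EX M. ap (P ^ M) g = 0" and z: "ap (P ^ (N + k)) (ap (q ^ k) g) = 0"
 shows "ap (P ^ N) g = 0" using z proof(induction k arbitrary: N)
 case (Suc k)
 have nilq: "EX M. ap (P ^ M) (ap (q ^ k) g) = 0" for k proof(induction k)
  case (Suc k)
  then obtain M where M: "ap (P ^ M) (ap (q ^ k) g) = 0" by blast
  have "EX c. ap (P ^ M) (ap q f) = ap q (ap (P ^ M) f) + c *. ap (P ^ (M - 1)) f" for M f proof(induction M)
   case (Suc M)
   then obtain c where c: "ap (P ^ M) (ap q f) = ap q (ap (P ^ M) f) + c *. ap (P ^ (M - 1)) f" by blast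
   have "c *. ap (P ^ Suc (M - 1)) f = (if M = 0 then 0 else c) *. ap (P ^ M) f + (if M = 0 then c else 0) *. ap P f" by(cases M) auto
   show ?case
   proof(cases M)
    case 0
    thus ?thesis by(intro exI[of _ s]) (simp add: Pq)
   next
    case (Suc l)
    thus ?thesis using c by(intro exI[of _ "s + c"]) (simp add: Pq ap_vadd ap_vs vs_simps add.assoc)
   qed
  qed (auto intro: exI[of _ 0])
  then obtain c where "ap (P ^ Suc M) (ap q (ap (q ^ k) g)) = ap q (ap (P ^ Suc M) (ap (q ^ k) g)) + c *. ap (P ^ (Suc M - 1)) (ap (q ^ k) g)" by blast
  hence "ap (P ^ Suc M) (ap (q ^ Suc k) g) = 0" using M by simp
  thus ?case by blast
 qed (simp add: nil)
 have "ap (P ^ Suc (N + k)) (ap q (ap (q ^ k) g)) = 0" using Suc.prems by simp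
 hence "ap (P ^ (N + k)) (ap (q ^ k) g) = 0" by(rule nilp_cancel[OF Pq s nilq])
 thus ?case by(rule Suc.IH)
qed simp

lemma sum_triangle: "(SUM m:{1..n}. SUM l:{m..n}. f m l) = (SUM l:{1..n}. SUM m:{1..l::nat}. f m l :: 'a::comm_monoid_add)"
proof -
 have "(SUM m:{1..n}. SUM l:{m..n}. f m l) = (SUM m:{1..n}. SUM l:{l:{1..n}. m <= l}. f m l)" by(intro sum.cong) auto
 also have "... = (SUM l:{1..n}. SUM m:{m:{1..n}. m <= l}. f m l)" by(rule sum.swap_restrict) auto
 also have "... = (SUM l:{1..n}. SUM m:{1..l}. f m l)" by(intro sum.cong) auto
 finally show ?thesis .
qed

text \<open>Abel summation: \<open>PQ m\<close> is a difference of q-derivatives, and the squares of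
  consecutive tails differ by a multiple of \<open>xv m\<close>.\<close>

lemma lower_qr:
 assumes delta: "!!l. l : {1..n} ==> (SUM m:{1..l}. delta m) = - e l"
 shows "(SUM m:{1..n}. delta m *: RQ n m - RQ n m * (RQ n m * PQ m))
  = - (SUM l:{1..n}. xv l * (e l *: 1 + xv l * dv l + (SUM m:{1..<l}. xv m * dv m + xv m * dv m)))" proof -
 have t: "k <= n ==> (SUM m:{1..k}. RQ n m * (RQ n m * PQ m)) = (SUM m:{1..k}. (RQ n m * RQ n m - RQ n (Suc m) * RQ n (Suc m)) * dv m) + (if k = 0 then 0 else RQ n (Suc k) * (RQ n (Suc k) * dv k))" for k
 proof(induction k)
  case (Suc k)
  thus ?case by(auto simp: PQ_def alg)
 qed simp
 have cR: "RQ n l * xv m = xv m * RQ n l" for l m unfolding RQ_def sum_distrib_left sum_distrib_right by(intro sum.cong refl xx_comm)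
 have sq: "RQ n m * RQ n m - RQ n (Suc m) * RQ n (Suc m) = (SUM l:{m..n}. xv l) * xv m + (SUM l:{Suc m..n}. xv l) * xv m" if "m <= n" for m
 proof -
  have r: "RQ n (Suc m) = RQ n m - xv m" by(rule RQ_Suc[OF that])
  have "RQ n m * RQ n m - RQ n (Suc m) * RQ n (Suc m) = RQ n m * xv m + RQ n (Suc m) * xv m" unfolding r by(simp add: alg cR)
  thus ?thesis by(simp add: RQ_def)
 qed
 let ?A = "SUM m:{1..n}. RQ n m * (RQ n m * PQ m)"
 have "?A = (SUM m:{1..n}. (RQ n m * RQ n m - RQ n (Suc m) * RQ n (Suc m)) * dv m)" using t[of n] by(simp add: RQ_def)
 also have "... = (SUM m:{1..n}. SUM l:{m..n}. xv l * (xv m * dv m) + (if l = m then 0 else xv l * (xv m * dv m)))"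
 proof(intro sum.cong refl)
  fix m assume m: "m : {1..n}"
  have "(SUM l:{m..n}. if l = m then 0 else xv l * (xv m * dv m)) = (SUM l:{Suc m..n}. xv l * (xv m * dv m))" by(rule sum.mono_neutral_cong_right) auto
  thus "(RQ n m * RQ n m - RQ n (Suc m) * RQ n (Suc m)) * dv m = (SUM l:{m..n}. xv l * (xv m * dv m) + (if l = m then 0 else xv l * (xv m * dv m)))"
   using m by(simp add: sq sum.distrib sum_distrib_right distrib_right mult.assoc)
 qed
 also have "... = (SUM l:{1..n}. xv l * (xv l * dv l + (SUM m:{1..<l}. xv m * dv m + xv m * dv m)))" unfolding sum_triangle
 proof(intro sum.cong refl)
  fix l assume l: "l : {1..n}"
  have s: "{1..l} = insert l {1..<l}" using l by auto
  have "(SUM m:{1..<l}. xv l * (xv m * dv m) + (if l = m then 0 else xv l * (xv m * dv m))) = (SUM m:{1..<l}. xv l * (xv m * dv m + xv m * dv m))"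
   by(intro sum.cong) (auto simp: distrib_left)
  thus "(SUM m:{1..l}. xv l * (xv m * dv m) + (if l = m then 0 else xv l * (xv m * dv m))) = xv l * (xv l * dv l + (SUM m:{1..<l}. xv m * dv m + xv m * dv m))"
   unfolding s by(simp add: distrib_left sum_distrib_left)
 qed
 finally have 1: "?A = ..." .
 have "(SUM m:{1..n}. delta m *: RQ n m) = (SUM m:{1..n}. SUM l:{m..n}. delta m *: xv l)" by(simp add: RQ_def scl_sum)
 also have "... = (SUM l:{1..n}. (SUM m:{1..l}. delta m) *: xv l)"
  unfolding sum_triangle by(intro sum.cong refl lop_eqI) (simp add: ap_sum fun_eq_iff vs_apply sum_fun_apply sum_distrib_right)
 also have "... = (SUM l:{1..n}. - (xv l * (e l *: 1)))" proof(intro sum.cong refl)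
  fix l assume l: "l : {1..n}"
  show "(SUM m:{1..l}. delta m) *: xv l = - (xv l * (e l *: 1))" unfolding delta[OF l] by(simp add: scl_simps)
 qed
 finally show ?thesis unfolding sum_subtractf 1 by(simp add: distrib_left sum.distrib sum_negf alg)
qed

lemma ap_two: "ap T (2 * f) = 2 * ap T f" by(simp only: mult_2 ap_vadd)

lemma rd_minus: "rd n kp km (- f) = - rd n kp km f" using rd_lin(2)[of n kp km 0 f] by(simp add: rd_lin)

section \<open>The encoding map: long root vectors, injectivity, degree bounds\<close>

locale sp_br = sp_hwrep n F lam xi for n and F :: "int => int => ('v::finite) lop" and lam xi +
 fixes mu :: "nat => int" and d :: "nat => nat"
 assumes d: "!!i. i : {1..n} ==> alph lam mu i - bet n lam mu i = of_nat (d i)"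
begin

abbreviation "kp == kdf lam mu"
abbreviation "km == kdf mu lam"
abbreviation "RD == rd n kp km"
definition pu :: "('v => complex) => pol" where "pu v = pair xs (uu v)"
definition Ph :: "('v => complex) => arr => complex" where "Ph v = rc n (RD (pu v))"

lemma Ph_lin: "Ph (f + g) = Ph f + Ph g" "Ph (f - g) = Ph f - Ph g" "Ph (z *. f) = z *. Ph f" "Ph 0 = 0"
proof -
 show a: "Ph (f + g) = Ph f + Ph g" for f g by(simp add: Ph_def pu_def uu_lin pair_lin[OF lf_xs] rd_lin rc_lin)
 show s: "Ph (z *. f) = z *. Ph f" for z f by(simp add: Ph_def pu_def uu_lin pair_lin[OF lf_xs] rd_lin rc_lin)
 show "Ph (f - g) = Ph f - Ph g" using a[of f "(-1) *. g"] s[of "-1" g] by(simp add: vs_simps)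
 show "Ph 0 = 0" using s[of 0 0] by simp
qed

lemma VP_sub: "csubspace (VP mu)" unfolding VP_def by(rule csubI) (auto simp: ap_vadd ap_vs vs_simps mult.commute)

lemma VP_teq:
 assumes Z: "teq Z" and a: "a : {- nn, nn}" "b : {- nn, nn}" and v: "v : VP mu"
 shows "ap (Z a b) v : VP mu" proof -
 have ab: "a : I" "b : I" using a by auto
 have c: "ap (F i j) (ap (Z a b) v) = ap (Z a b) (ap (F i j) v)" if "i : I" "j : I" "\<bar>i\<bar> < nn" "\<bar>j\<bar> < nn" for i j proof -
  have "ad (F i j) (Z a b) = 0" unfolding teqD[OF Z that(1,2) ab] using that(3,4) a by(auto simp: kd_def)
  hence "F i j * Z a b = Z a b * F i j" by(simp add: ad_def)
  from arg_cong[OF this, of "%T. ap T v"] show ?thesis by simp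
 qed
 show ?thesis unfolding VP_def
 proof(intro CollectI conjI ballI impI)
  fix i j assume "i : I" "j : I" "- nn < i & i < j & j < nn"
  thus "ap (F i j) (ap (Z a b) v) = 0" using c[of i j] v by(auto simp: VP_def)
 next
  fix i assume i: "i : {1..<n}"
  hence "int i : I" by(auto simp: Iset_def)
  thus "ap (F (int i) (int i)) (ap (Z a b) v) = of_int (mu i) *. ap (Z a b) v" using c[of "int i" "int i"] v i by(auto simp: VP_def ap_vs)
 qed
qed

lemma pu_FD: "v : VP mu ==> i : I ==> k : I ==> i < k ==> pair xs (ap (lv (F i k)) (uu v)) = ap (DD i k) (pu v)" by(simp add: FD pair_ls[OF lf_xs] pu_def)

text \<open>This generator commutes with all \<open>fj\<close>, so it passes through the
  exponential. It acts as twice the derivative in q_n, which is the sum of all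
  r-derivatives.\<close>

lemma Ph_raise:
 assumes v: "v : VP mu"
 shows "Ph (ap (F (- nn) nn) v) = 2 *. (SUM j:{1..n}. ap (dv j) (Ph v))" proof -
 let ?F = "F (- nn) nn"
 have F: "?F = fj (- nn) + fj (- nn)" by(simp add: fj_def half_scl flip: scl_simps(4))
 let ?A = "ap (lv ?F) (uu v)"
 have "ad (EE - YY) (lv ?F) = 0" using ad_YY_fj[OF nnJ] by(simp add: ad_simps F lv_hom ad_EE_lv)
 hence "ap ((EE - YY) * lv ?F) (uu v) = ap (lv ?F * (EE - YY)) (uu v)" by(simp add: ad_def)
 hence "ap (EE - YY) ?A = 0" by(simp only: ap_mult uu_eq ap_v0)
 hence "ap (EE - YY) (?A - uu (ap ?F v)) = 0" using uu_eq[of "ap ?F v"] by(simp only: ap_vdiff) simp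
 hence "?A - uu (ap ?F v) = 0" by(rule uniq0) (simp add: fa lv_emb uu_deg0)
 hence "uu (ap ?F v) = ?A" by simp
 also have "... = ap (ls (DD (- nn) nn)) (uu v)" by(rule FD_n[OF nnJ])
 finally have "pu (ap ?F v) = ap (DD (- nn) nn) (pu v)" by(simp add: pu_def pair_ls[OF lf_xs])
 also have "... = 2 *. ap (dv (- nn)) (pu v)" by(rule ext) (simp add: DD_def th_nn fa vs_apply)
 finally show ?thesis using rc_d[of n n "RD (pu v)"] n1 by(simp add: Ph_def rd_lin rc_lin rd_n)
qed

text \<open>The parameters telescope up to the shifts; the right-hand side supplies the constant
  \<open>e\<close> of \<open>lower_qr\<close>.\<close>

lemma d_sum:
 assumes "l : {1..n}"
 shows "(SUM m:{1..l}. of_nat (d m)) = - (of_int (lam l) + (if l = n then 0 else of_nat (km l)) + (SUM m:{1..<l}. of_nat (kp m) + of_nat (km m)) :: complex)"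
 using assms
proof(induction l)
 case (Suc l)
 let ?A = "bet n lam mu (Suc l)"
 have dd: "of_nat (d (Suc l)) = alph lam mu (Suc l) - ?A" using d[of "Suc l"] Suc.prems by simp
 have b: "?A = of_int (lam (Suc l)) + (if Suc l = n then 0 else of_nat (km (Suc l))) - of_nat (Suc l) + 1/2" by(auto simp: bet_def kdf_def max_def)
 show ?case
 proof(cases "l = 0")
  case True
  thus ?thesis using dd b by(simp add: alph_def)
 next
  case False
  hence l: "l : {1..n}" "l ~= n" using Suc.prems by auto
  have al: "alph lam mu (Suc l) = of_int (lam l) - of_nat (kp l) - of_nat (Suc l) + 1/2" using False by(auto simp: alph_def kdf_def min_def)
  have s: "{1..<Suc l} = insert l {1..<l}" using False by auto
  have "(SUM m:{1..Suc l}. of_nat (d m)) = (SUM m:{1..l}. of_nat (d m)) + (of_nat (d (Suc l)) :: complex)" by simp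
  thus ?thesis unfolding Suc.IH[OF l(1)] dd b al using l(2) unfolding s by simp
 qed
qed simp

lemma Iset_split: "(SUM k:I. f k) = (SUM m:{1..n}. f (int m) + f (- int m) :: 'c::comm_monoid_add)"
proof -
 have s: "I = int ` {1..n} \<union> (%k. - int k) ` {1..n}" proof(intro equalityI subsetI)
  fix j assume j: "j : I"
  show "j : int ` {1..n} \<union> (%k. - int k) ` {1..n}" proof(cases "j > 0")
   case True
   hence "j = int (nat j)" "nat j : {1..n}" using j by(auto simp: Iset_def)
   thus ?thesis by blast
  next
   case False
   hence "j = - int (nat (- j))" "nat (- j) : {1..n}" using j by(auto simp: Iset_def)
   thus ?thesis by blast
  qed
 qed (auto simp: Iset_def)
 show ?thesis unfolding s sum.distrib by(subst sum.union_disjoint) (auto simp: inj_on_def sum.reindex)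
qed

definition eE :: "int => (int => nat) lop" where "eE k = xr k * dv k"
definition qQ :: "int => (int => nat) lop" where "qQ l = xr l * xr (- l)"

lemma xr_comm: "xr k * xr l = xr l * xr k" by(auto simp: xr_def xx_comm)
lemma qQ_minus: "qQ (- l) = qQ l" unfolding qQ_def using xr_comm[of l "- l"] by simp

text \<open>Its index order is opposite to that of the vector fields, so the generator is first
  rewritten by \<open>uu_Znm\<close> as a sum over all \<open>F k l\<close>, of which the covector
  leaves those with \<open>k <= l\<close>.\<close>

lemma pu_lower:
 assumes v: "v : VP mu"
 shows "pu (ap (F nn (- nn)) v) = - ((SUM l:{1..n}. (2 * of_int (lam l)) *. ap (qQ (int l)) (pu v))
  + 2 *. (SUM l:I. SUM k:{k:I. k < l}. sn l *. ap (qQ l) (ap (eE k) (pu v))))" proof -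
 let ?f = "pu v"
 have t: "pair xs (ap (lv (F k l)) (uu v)) = (if k = l then lm l *. ?f else if k < l then ap (DD k l) ?f else 0)" if kl: "k : I" "l : I" for k l
 proof -
  consider "l < k" | "k = l" | "k < l" by linarith
  thus ?thesis
  proof cases
   case 1
   have "pair xs (ap (lv (F k l)) z) = 0" for z :: "'v srv" unfolding pair_lv using xs_low[OF kl 1] by(simp add: pair_def fun_eq_iff fa)
   thus ?thesis using 1 by simp
  next
   case 2
   thus ?thesis unfolding pair_lv using xs(3)[OF kl(1)] by(simp add: pair_def fun_eq_iff vs_apply pu_def)
  next
   case 3
   thus ?thesis using pu_FD[OF v kl 3] by simp
  qed
 qed
 let ?S = "%g. SUM l:I. SUM k:{k:I. k < l}. g k l :: pol"
 let ?B = "?S (%k l. sn l *. ap (qQ l) (ap (eE k) ?f))"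
 have qv: "ap (xr (- l)) (ap (xr l) z) = ap (qQ l) z" for l z using arg_cong[OF xr_comm[of l "- l"], of "%T. ap T z"] by(simp add: qQ_def)
 let ?C = "SUM l:I. (- (sn l * lm l)) *. ap (qQ l) ?f"
 have A: "?C = - (SUM l:{1..n}. (2 * of_int (lam l)) *. ap (qQ (int l)) ?f)" unfolding Iset_split sum_negf[symmetric]
  by(intro sum.cong refl ext) (simp add: qQ_minus lm_def sgn_minus fa vs_apply)
 have mult: "sn l * theta k l = sn k" if "l : I" for k l using Iset_nz[OF that] by(auto simp: theta_def sgn_if)
 have dd: "(- sn l) *. ap (xr (- l)) (ap (xr k) (ap (DD k l) ?f)) = - (sn l *. ap (qQ l) (ap (eE k) ?f)) + sn k *. ap (qQ k) (ap (eE (- l)) ?f)"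
  if "l : I" for k l proof -
  have o: "xr (- l) * (xr k * (xr l * dv k)) = qQ l * eE k" "xr (- l) * (xr k * (xr (- k) * dv (- l))) = qQ k * eE (- l)"
   unfolding qQ_def eE_def by(metis (no_types) mult.assoc xr_comm)+
  have "xr (- l) * (xr k * DD k l) = qQ l * eE k - theta k l *: (qQ k * eE (- l))" by(simp add: DD_def right_diff_distrib scl_simps(2) o)
  from arg_cong[OF this, of "%T. ap T ?f"]
  have e: "ap (xr (- l)) (ap (xr k) (ap (DD k l) ?f)) = ap (qQ l) (ap (eE k) ?f) - theta k l *. ap (qQ k) (ap (eE (- l)) ?f)" by simp
  show ?thesis unfolding e mult[OF that, of k, symmetric] by(simp add: vs_simps)
 qed
 let ?D = "?S (%k l. sn k *. ap (qQ k) (ap (eE (- l)) ?f))"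
 \<comment> \<open>Replacing (k, l) by (-l, -k) preserves \<open>k < l\<close> and identifies the
   contributions of the two terms of \<open>DD k l\<close>.\<close>
 have B2: "?D = - ?B" proof -
  have "?D = (SUM k:I. SUM l:{l:I. k < l}. sn k *. ap (qQ k) (ap (eE (- l)) ?f))" by(rule sum.swap_restrict) simp_all
  also have "... = (SUM l:I. SUM k:{k:I. k < l}. - (sn l *. ap (qQ l) (ap (eE k) ?f)))"
  proof(rule sum.reindex_bij_witness[of _ uminus uminus])
   fix k assume "k : I"
   show "(SUM ka:{ka:I. ka < - k}. - (of_int (sgn (- k)) *. ap (qQ (- k)) (ap (eE ka) ?f))) = (SUM l:{l:I. k < l}. sn k *. ap (qQ k) (ap (eE (- l)) ?f))"
    by(rule sum.reindex_bij_witness[of _ uminus uminus]) (auto simp: qQ_minus sgn_minus vs_simps)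
  qed auto
  finally show ?thesis by(simp add: sum_negf)
 qed
 let ?A = "?S (%k l. - (sn l *. ap (qQ l) (ap (eE k) ?f)) + sn k *. ap (qQ k) (ap (eE (- l)) ?f))"
 have "pu (ap (F nn (- nn)) v) = (SUM l:I. SUM k:I. (- sn l) *. ap (xr (- l)) (ap (xr k) (if k = l then lm l *. ?f else if k < l then ap (DD k l) ?f else 0)))"
  unfolding pu_def uu_Znm[OF teq_F] pair_sum[OF lf_xs] pair_lin(2)[OF lf_xs] pair_ls[OF lf_xs] unfolding pu_def[symmetric] by(intro sum.cong refl) (simp add: t)
 also have "... = (SUM l:I. (- (sn l * lm l)) *. ap (qQ l) ?f + (SUM k:{k:I. k < l}. (- sn l) *. ap (xr (- l)) (ap (xr k) (ap (DD k l) ?f))))"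
 proof(intro sum.cong refl)
  fix l assume l: "l : I"
  have "(SUM k:I. (- sn l) *. ap (xr (- l)) (ap (xr k) (if k = l then lm l *. ?f else if k < l then ap (DD k l) ?f else 0)))
   = (SUM k:I. (if k = l then (- (sn l * lm l)) *. ap (qQ l) ?f else 0) + (if k < l then (- sn l) *. ap (xr (- l)) (ap (xr k) (ap (DD k l) ?f)) else 0))"
   by(intro sum.cong refl) (auto simp: ap_vs vs_simps qv)
  also have "... = (- (sn l * lm l)) *. ap (qQ l) ?f + (SUM k:{k:I. k < l}. (- sn l) *. ap (xr (- l)) (ap (xr k) (ap (DD k l) ?f)))"
   unfolding sum.distrib using l by(simp add: sum.inter_filter)
  finally show "(SUM k:I. (- sn l) *. ap (xr (- l)) (ap (xr k) (if k = l then lm l *. ?f else if k < l then ap (DD k l) ?f else 0))) = ..." .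
 qed
 also have "... = ?C + ?A" unfolding sum.distrib[of _ _ "I"] by(simp add: dd)
 also have "?A = - ?B - ?B" unfolding sum.distrib B2 by(simp add: sum_negf)
 also have "- ?B - ?B = - (2 *. ?B)" by(rule ext) (simp add: fa vs_apply)
 finally show ?thesis unfolding A by simp
qed

lemma Ph_lower:
 assumes v: "v : VP mu"
 shows "Ph (ap (F nn (- nn)) v) = 2 *. (SUM m:{1..n}. ap (of_nat (d m) *: xv m - xv m * (xv m * dv m)) (Ph v))" proof -
 let ?h = "RD (pu v)"
 let ?N = "%m. ap (xv m) (ap (dv m) ?h)"
 define kn where "kn l = (if l = n then 0 else of_nat (km l) :: complex)" for l
 define e where "e l = of_int (lam l) + kn l + (SUM m:{1..<l}. of_nat (kp m) + of_nat (km m))" for l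
 have q: "RD (ap (qQ (int l)) z) = ap (xv l) (RD z)" if "l : {1..n}" for l z proof(cases "l = n")
  case True
  have "xr (- nn) = xv (- nn)" using n1 by(simp add: xr_def)
  thus ?thesis using n1 by(simp add: True qQ_def rd_n)
 next
  case False
  hence l: "l : {1..<n}" using that by auto
  have "xr (- int l) = xv (- int l)" "xr (int l) = xv (int l)" using l by(auto simp: xr_def)
  thus ?thesis by(simp add: qQ_def rd_q[OF l kpkm])
 qed
 have e1: "RD (ap (eE (int m)) (pu v)) = ?N m + of_nat (kp m) *. ?h" if "m : {1..<n}" for m using that by(simp add: eE_def xr_def rd_N[OF that])
 have e2: "RD (ap (eE (- int m)) (pu v)) = ?N m + kn m *. ?h" if "m : {1..n}" for m proof(cases "m = n")
  case True
  thus ?thesis using n1 by(simp add: eE_def xr_def rd_n kn_def)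
 next
  case False
  hence "m : {1..<n}" using that by auto
  thus ?thesis using False by(simp add: eE_def xr_def rd_N kn_def)
 qed
 have rng: "(SUM k:{k:I. k < int l}. g k) - (SUM k:{k:I. k < - int l}. g k) = g (- int l) + (SUM m:{1..<l}. g (int m) + g (- int m))"
  if l: "l : {1..n}" for l and g :: "int => arr => complex" proof -
  have li: "- int l : I" using l by(auto simp: Iset_def)
  have "(SUM k:{k:I. k < int l}. g k) = (SUM k:I. (if k < - int l then g k else 0) + ((if k = - int l then g k else 0) + (if - int l < k & k < int l then g k else 0)))"
   unfolding sum.inter_filter[OF finite_Iset] using l by(intro sum.cong refl) auto
  hence "(SUM k:{k:I. k < int l}. g k) = (SUM k:{k:I. k < - int l}. g k) + (g (- int l) + (SUM k:{k:I. - int l < k & k < int l}. g k))"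
   unfolding sum.distrib sum.inter_filter[OF finite_Iset] using li by(simp only: sum.delta[OF finite_Iset] if_True)
  moreover have "(SUM k:{k:I. - int l < k & k < int l}. g k) = (SUM m:{1..<l}. g (int m) + g (- int m))" proof -
   have "(SUM k:{k:I. - int l < k & k < int l}. g k) = (SUM m:{1..n}. (if m < l then g (int m) else 0) + (if m < l then g (- int m) else 0))"
    unfolding sum.inter_filter[OF finite_Iset] Iset_split by(intro sum.cong) auto
   also have "... = (SUM m:{1..<l}. g (int m) + g (- int m))" by(rule sum.mono_neutral_cong_right) (use l in auto)
   finally show ?thesis .
  qed
  ultimately show ?thesis by simp
 qed
 let ?A = "SUM m:{1..n}. of_nat (d m) *: RQ n m - RQ n m * (RQ n m * PQ m)"
 let ?B = "SUM l:{1..n}. xv l * (e l *: 1 + xv l * dv l + (SUM m:{1..<l}. xv m * dv m + xv m * dv m))"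
 let ?C = "SUM l:I. sn l *. RD (ap (qQ l) (SUM k:{k:I. k < l}. ap (eE k) (pu v)))"
 let ?D = "RD (pu (ap (F nn (- nn)) v))"
 have "?D = - ((SUM l:{1..n}. (2 * of_int (lam l)) *. ap (xv l) ?h)
  + 2 *. ?C)" unfolding pu_lower[OF v] by(simp add: rd_minus rd_lin rd_sum q vs_sum[symmetric] ap_vsum)
 also have "?C
   = (SUM l:{1..n}. ap (xv l) (?N l + kn l *. ?h + (SUM m:{1..<l}. ?N m + of_nat (kp m) *. ?h + (?N m + of_nat (km m) *. ?h))))" unfolding Iset_split
 proof(intro sum.cong refl)
  fix l assume l: "l : {1..n}"
  let ?T = "%l. SUM k:{k:I. k < l}. ap (eE k) (pu v)"
  have "of_int (sgn (int l)) *. RD (ap (qQ (int l)) (?T (int l))) + of_int (sgn (- int l)) *. RD (ap (qQ (- int l)) (?T (- int l))) = ap (xv l) (RD (?T (int l)) - RD (?T (- int l)))"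
   using l by(simp add: q qQ_minus sgn_minus vs_simps ap_vdiff)
  also have "RD (?T (int l)) - RD (?T (- int l)) = RD (ap (eE (- int l)) (pu v)) + (SUM m:{1..<l}. RD (ap (eE (int m)) (pu v)) + RD (ap (eE (- int m)) (pu v)))"
   unfolding rd_sum by(rule rng[OF l])
  also have "... = ?N l + kn l *. ?h + (SUM m:{1..<l}. ?N m + of_nat (kp m) *. ?h + (?N m + of_nat (km m) *. ?h))" using l by(simp add: e2 e1 kn_def)
  finally show "of_int (sgn (int l)) *. RD (ap (qQ (int l)) (?T (int l))) + of_int (sgn (- int l)) *. RD (ap (qQ (- int l)) (?T (- int l)))
   = ap (xv l) (?N l + kn l *. ?h + (SUM m:{1..<l}. ?N m + of_nat (kp m) *. ?h + (?N m + of_nat (km m) *. ?h)))" .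
 qed
 finally have "?D = 2 *. ap (- ?B) ?h"
  by(intro ext) (simp add: ap_sum sum_fun_apply fa vs_apply ap_vadd ap_vs ap_vsum ap_two e_def sum.distrib sum_distrib_left sum_distrib_right alg)
 also have "- ?B = ?A" proof(rule lower_qr[symmetric])
  fix l assume l: "l : {1..n}"
  show "(SUM m:{1..l}. of_nat (d m)) = - e l" unfolding d_sum[OF l] e_def kn_def by simp
 qed
 finally have e: "?D = 2 *. ap ?A ?h" .
 have r: "rc n (ap (of_nat (d m) *: RQ n m - RQ n m * (RQ n m * PQ m)) ?h) = ap (of_nat (d m) *: xv m - xv m * (xv m * dv m)) (rc n ?h)" if "m : {1..n}" for m
  using that by(simp add: rc_lin rc_R rc_P)
 have "rc n (ap ?A ?h) = (SUM m:{1..n}. ap (of_nat (d m) *: xv m - xv m * (xv m * dv m)) (rc n ?h))" unfolding ap_sum rc_sum by(intro sum.cong refl r)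
 thus ?thesis unfolding Ph_def e by(simp only: rc_lin)
qed

end

lemma pow_scl: "(c *: T) ^ K = c ^ K *: T ^ K" by(induction K) (simp_all add: scl_simps(1-3) mult.commute)

lemma dv_pow_zero: "ap (dv m ^ K) g = 0 ==> K <= c m ==> g c = 0"
proof(induction K arbitrary: g c)
 case (Suc K)
 have "ap (dv m ^ K) (ap (dv m) g) = 0" using Suc.prems(1) by(simp add: power_Suc2 del: power_Suc)
 hence "ap (dv m) g (c(m := c m - 1)) = 0" by(rule Suc.IH) (use Suc.prems in simp)
 thus ?case using Suc.prems by(simp add: ap_dv del: of_nat_Suc)
qed (simp add: fa)

text \<open>Finite total degree, which makes each \<open>PQ m\<close> nilpotent on \<open>g\<close>
  (\<open>fin_nilp\<close>).\<close>

definition fin :: "nat => (arr => complex) => bool" where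
 "fin n g <-> (EX K. ALL c. K <= (SUM j:{1..n}. c j) --> g c = 0)"

lemma fin_xv: assumes m: "m : {1..n}" and g: "fin n g" shows "fin n (ap (xv m ^ t) g)"
proof(induction t)
 case (Suc t)
 then obtain K where K: "!!c. K <= (SUM j:{1..n}. c j) ==> ap (xv m ^ t) g c = 0" by(auto simp: fin_def)
 have le: "(SUM j:{1..n}. c j) <= Suc (SUM j:{1..n}. (c(m := c m - 1)) j)" for c
  using sum.remove[OF _ m, of c] sum.remove[OF _ m, of "c(m := c m - 1)"] by(simp cong: sum.cong_simp)
 hence "ap (xv m ^ Suc t) g c = 0" if "Suc K <= (SUM j:{1..n}. c j)" for c proof -
  have "K <= (SUM j:{1..n}. (c(m := c m - 1)) j)" using order_trans[OF that le] by(simp only: Suc_le_mono)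
  hence "ap (xv m ^ t) g (c(m := c m - 1)) = 0" by(rule K)
  thus ?thesis by(simp add: ap_xv)
 qed
 thus ?case unfolding fin_def by blast
qed (use g in simp)

lemma fin_nilp: assumes m: "m : {1..n}" and g: "fin n g" shows "EX M. ap (PQ m ^ M) g = 0"
proof -
 obtain K where K: "!!c. K <= (SUM j:{1..n}. c j) ==> g c = 0" using g by(auto simp: fin_def)
 have S: "(SUM j:{1..n}. (c(k := Suc (c k))) j) = Suc (SUM j:{1..n}. c j)" if "k : {1..n}" for c :: "nat => nat" and k
  using sum.remove[OF _ that, of c] sum.remove[OF _ that, of "c(k := Suc (c k))"] by(simp cong: sum.cong_simp)
 have "ap (PQ m ^ M) g c = 0" if "K <= (SUM j:{1..n}. c j) + M" for M c using that proof(induction M arbitrary: c)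
  case (Suc M)
  have z: "ap (dv k) (ap (PQ m ^ M) g) c = 0" if "k : {1..n}" for k proof -
   have "ap (PQ m ^ M) g (c(k := Suc (c k))) = 0" proof(rule Suc.IH)
    show "K <= (SUM j:{1..n}. (c(k := Suc (c k))) j) + M" unfolding S[OF that] using Suc.prems by simp
   qed
   thus ?thesis by(simp add: ap_dv)
  qed
  have "ap (PQ m ^ Suc M) g = ap (dv m) (ap (PQ m ^ M) g) - (if m = 1 then 0 else ap (dv (m - 1)) (ap (PQ m ^ M) g))" by(simp add: PQ_def)
  moreover have "m ~= 1 ==> m - 1 : {1..n}" using m by auto
  ultimately show ?case using z[OF m] z[of "m - 1"] by(auto simp: fa simp del: power_Suc)
 qed (use K in simp)
 thus ?thesis by(intro exI[of _ K] ext) (simp add: fa)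
qed

text \<open>Completing a power: x_{-i}^t times a function of q_i becomes q_i^t times that function
  after multiplication by x_i^t, and the shift is gone.\<close>

lemma rd_mul_pos:
 assumes i: "i : {1..<n}" and k: "kp i = 0"
 shows "rd n kp (km(i := 0)) (ap (xv (int i) ^ t) f) = ap (xv i ^ t) (rd n kp (km(i := t)) f)" proof -
 have one: "rd n kp (km(i := t)) (ap (xv (int i)) f) = ap (xv i) (rd n kp (km(i := Suc t)) f)" for t f proof(rule ext)
  fix c
  have a: "rx n kp (km(i := t)) c (int i) = c i" using i k by(simp add: rx_at(1))
  have b: "rx n kp (km(i := Suc t)) (c(i := c i - 1)) = (rx n kp (km(i := t)) c)(int i := c i - 1)" if "c i ~= 0"
   using i k that by(simp add: rx_upd) (auto simp: fun_eq_iff rx_def)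
  show "rd n kp (km(i := t)) (ap (xv (int i)) f) c = ap (xv i) (rd n kp (km(i := Suc t)) f) c" using i b by(auto simp: rd_def ap_xv a nj_upd)
 qed
 have "rd n kp (km(i := s)) (ap (xv (int i) ^ t) f) = ap (xv i ^ t) (rd n kp (km(i := s + t)) f)" for s by(induction t arbitrary: s) (simp_all add: one)
 from this[of 0] show ?thesis by simp
qed

lemma rd_mul_neg:
 assumes i: "i : {1..<n}" and k: "km i = 0"
 shows "rd n (kp(i := 0)) km (ap (xv (- int i) ^ t) f) = ap (xv i ^ t) (rd n (kp(i := t)) km f)" proof -
 have one: "rd n (kp(i := t)) km (ap (xv (- int i)) f) = ap (xv i) (rd n (kp(i := Suc t)) km f)" for t f proof(rule ext)
  fix c
  have a: "rx n (kp(i := t)) km c (- int i) = c i" using i k by(simp add: rx_at(2))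
  have b: "rx n (kp(i := Suc t)) km (c(i := c i - 1)) = (rx n (kp(i := t)) km c)(- int i := c i - 1)" if "c i ~= 0"
   using i k that by(simp add: rx_upd) (auto simp: fun_eq_iff rx_def)
  show "rd n (kp(i := t)) km (ap (xv (- int i)) f) c = ap (xv i) (rd n (kp(i := Suc t)) km f) c" using i b by(auto simp: rd_def ap_xv a nj_upd)
 qed
 have "rd n (kp(i := s)) km (ap (xv (- int i) ^ t) f) = ap (xv i ^ t) (rd n (kp(i := s + t)) km f)" for s by(induction t arbitrary: s) (simp_all add: one)
 from this[of 0] show ?thesis by simp
qed

text \<open>Each factor \<open>xv 1 * dv (- 1)\<close> raises the exponent of x_1 and lowers that of
  x_{-1}; relative to a shift enlarged by 2 it is the derivative in q_1.\<close>

lemma rd_D1: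
 assumes n: "1 < n" and k: "km 1 = 0"
 shows "rd n (kp(1 := kp 1 + 2 * K)) km (ap ((xv 1 * dv (- 1)) ^ K) g) = ap (dv 1 ^ K) (rd n kp km g)" proof -
 have i: "1 : {1..<n}" using n by simp
 have one: "rd n (kp(1 := t + 2)) km (ap (xv 1) (ap (dv (- 1)) g)) = ap (dv 1) (rd n (kp(1 := t)) km g)" for t g proof(rule ext)
  fix c
  let ?r = "rx n (kp(1 := t + 2)) km c"
  have a: "?r 1 = c 1 + t + 2" "?r (- 1) = c 1" using i k rx_at(1,2)[OF i, of "kp(1 := t + 2)" km c] by simp_all
  have b: "rx n (kp(1 := t)) km (c(1 := Suc (c 1))) = ?r(1 := c 1 + t + 1, - 1 := Suc (c 1))" using i k by(auto simp: fun_eq_iff rx_def)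
  show "rd n (kp(1 := t + 2)) km (ap (xv 1) (ap (dv (- 1)) g)) c = ap (dv 1) (rd n (kp(1 := t)) km g) c" using i a b by(simp add: rd_def ap_xv ap_dv nj_upd)
 qed
 let ?A = "xv 1 * dv (- 1)"
 have "rd n (kp(1 := s + 2 * K)) km (ap (?A ^ K) g) = ap (dv 1 ^ K) (rd n (kp(1 := s)) km g)" for s proof(induction K arbitrary: s)
  case (Suc K)
  have A: "rd n (kp(1 := s + 2 * Suc K)) km (ap (?A ^ Suc K) g) = ap (dv 1) (rd n (kp(1 := s + 2 * K)) km (ap (?A ^ K) g))" using one[of "s + 2 * K"] by simp
  show ?case using A Suc by(simp only: ap_mult power_Suc)
 qed simp
 from this[of "kp 1"] show ?thesis by simp
qed

text \<open>The vector field of the simple root between i and i + 1 raises the shifts of x_{i+1} and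
  x_{-i} by one; in the variables q it is minus the derivative in r_{i+1}.\<close>

lemma rd_D_mid:
 assumes i: "i : {1..<n}" and i1: "Suc i : {1..<n}" and k: "kp i = 0" "km (Suc i) = 0"
 shows "rd n (kp(Suc i := kp (Suc i) + K)) (km(i := km i + K)) (ap ((xv (int i + 1) * dv (int i) - xv (- int i) * dv (- int i - 1)) ^ K) g)
  = ap ((dv i - dv (Suc i)) ^ K) (rd n kp km g)" proof -
 let ?D = "xv (int i + 1) * dv (int i) - xv (- int i) * dv (- int i - 1)"
 let ?A = "dv i - dv (Suc i)"
 have one: "rd n (kp(Suc i := Suc s)) (km(i := Suc t)) (ap ?D g) = ap ?A (rd n (kp(Suc i := s)) (km(i := t)) g)" for s t g proof(rule ext)
  fix c
  let ?r = "rx n (kp(Suc i := Suc s)) (km(i := Suc t)) c"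
  have e: "int (Suc i) = int i + 1" "- int (Suc i) = - int i - 1" by simp_all
  have a: "?r (int i) = c i" "?r (- int i) = Suc (c i + t)" "?r (int i + 1) = Suc (c (Suc i) + s)" "?r (- int i - 1) = c (Suc i)"
   using k rx_at(1,2)[OF i, of "kp(Suc i := Suc s)" "km(i := Suc t)" c] rx_at(1,2)[OF i1, of "kp(Suc i := Suc s)" "km(i := Suc t)" c] unfolding e by simp_all
  have b: "rx n (kp(Suc i := s)) (km(i := t)) (c(i := Suc (c i))) = ?r(int i + 1 := c (Suc i) + s, int i := Suc (c i))"
   using i i1 k unfolding e[symmetric] by(auto simp: fun_eq_iff rx_def)
  have b': "rx n (kp(Suc i := s)) (km(i := t)) (c(Suc i := Suc (c (Suc i)))) = ?r(- int i := c i + t, - int i - 1 := Suc (c (Suc i)))"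
   using i i1 k unfolding e[symmetric] by(auto simp: fun_eq_iff rx_def)
  show "rd n (kp(Suc i := Suc s)) (km(i := Suc t)) (ap ?D g) c = ap ?A (rd n (kp(Suc i := s)) (km(i := t)) g) c"
   using i i1 a b b' by(simp add: rd_def ap_xv ap_dv nj_upd fa)
 qed
 have "rd n (kp(Suc i := s + K)) (km(i := t + K)) (ap (?D ^ K) g) = ap (?A ^ K) (rd n (kp(Suc i := s)) (km(i := t)) g)" for s t proof(induction K)
  case (Suc K)
  have A: "rd n (kp(Suc i := s + Suc K)) (km(i := t + Suc K)) (ap (?D ^ Suc K) g) = ap ?A (rd n (kp(Suc i := s + K)) (km(i := t + K)) (ap (?D ^ K) g))"
   using one[of "s + K" "t + K" "ap (?D ^ K) g"] by simp
  show ?case using A Suc by(simp only: ap_mult power_Suc)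
 qed simp
 from this[of "kp (Suc i)" "km i"] show ?thesis by simp
qed

lemma rd_D_last:
 assumes i: "i : {1..<n}" and i1: "Suc i = n" and k: "kp i = 0"
 shows "rd n kp (km(i := km i + K)) (ap ((dv (int i) - xv (- int i) * dv (- int n)) ^ K) g)
  = ap ((dv i - dv n) ^ K) (rd n kp km g)" proof -
 let ?D = "dv (int i) - xv (- int i) * dv (- int n)"
 have one: "rd n kp (km(i := Suc t)) (ap ?D g) = ap (dv i - dv n) (rd n kp (km(i := t)) g)" for t g proof(rule ext)
  fix c
  let ?r = "rx n kp (km(i := Suc t)) c"
  have n: "n : {1..n}" "1 <= n" using i by auto
  have a: "?r (int i) = c i" "?r (- int i) = Suc (c i + t)" "?r (- int n) = c n"
   using k rx_at(1,2)[OF i, of kp "km(i := Suc t)" c] rx_at(3)[OF n(2), of kp "km(i := Suc t)" c] by simp_all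
  have b: "rx n kp (km(i := t)) (c(i := Suc (c i))) = ?r(int i := Suc (c i))" using i i1 k by(auto simp: fun_eq_iff rx_def)
  have b': "rx n kp (km(i := t)) (c(n := Suc (c n))) = ?r(- int i := c i + t, - int n := Suc (c n))" using i i1 k by(auto simp: fun_eq_iff rx_def)
  show "rd n kp (km(i := Suc t)) (ap ?D g) c = ap (dv i - dv n) (rd n kp (km(i := t)) g) c" using i n a b b' by(simp add: rd_def ap_xv ap_dv nj_upd fa)
 qed
 have "rd n kp (km(i := t + K)) (ap (?D ^ K) g) = ap ((dv i - dv n) ^ K) (rd n kp (km(i := t)) g)" for t proof(induction K)
  case (Suc K)
  have A: "rd n kp (km(i := t + Suc K)) (ap (?D ^ Suc K) g) = ap (dv i - dv n) (rd n kp (km(i := t + K)) (ap (?D ^ K) g))" using one[of "t + K" "ap (?D ^ K) g"] by simp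
  show ?case using A Suc by(simp only: ap_mult power_Suc)
 qed simp
 from this[of "km i"] show ?thesis by simp
qed

lemma commute_pow: "S * T = T * S ==> S * T ^ k = T ^ k * (S :: 'a::ring_1)" by(induction k) (simp_all add: mult.assoc, metis mult.assoc)

lemma commute_pow2: "S * T = T * S ==> S ^ l * T ^ k = T ^ k * (S :: 'a::ring_1) ^ l" using commute_pow[of "T ^ k" S l] commute_pow[of S T k] by simp

context sp_br
begin

text \<open>Operators on the variables commute with the action on values, so \<open>FD\<close> can
  be used at every letter; the vector fields occur in \<open>S\<close> in the opposite
  order.\<close>

lemma word_uu:
 assumes v: "v : VP mu" and L: "set L <= Fs (<)"
 shows "EX S. ap (lv (prod_list L)) (uu v) = ap (ls S) (uu v)" using L proof(induction L)
 case Nil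
 show ?case by(intro exI[of _ 1]) (simp add: lv_hom ls_hom)
next
 case (Cons X L)
 then obtain S where S: "ap (lv (prod_list L)) (uu v) = ap (ls S) (uu v)" by auto
 obtain a b where X: "X = F a b" "a : I" "b : I" "a < b" using Cons.prems by(auto simp: Fs_def)
 have "ap (lv (prod_list (X # L))) (uu v) = ap (lv X * ls S) (uu v)" by(simp add: lv_hom S)
 also have "... = ap (ls S) (ap (lv (F a b)) (uu v))" by(simp add: lv_ls X(1))
 also have "... = ap (ls (S * DD a b)) (uu v)" unfolding FD[OF v X(2-4)] by(simp add: ls_hom)
 finally show ?case by blast
qed

lemma pair_lv_zero: "pair xs (ap (lv T) (uu w)) (%_. 0) = xs (ap T w)" by(simp add: pair_def ap_lv uu_zero)

text \<open>Each word with \<open>a < b\<close> acts on the series through the variables alone, so a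
  vanishing series makes \<open>v\<close> invisible to all these words.\<close>

lemma pu_inj: assumes v: "v : VP mu" and z: "pu v = 0" shows "v = 0"
proof(rule raising_faithful)
 fix L assume "set L <= Fs (<)"
 then obtain S where S: "ap (lv (prod_list L)) (uu v) = ap (ls S) (uu v)" using word_uu[OF v] by blast
 have "pair xs (ap (lv (prod_list L)) (uu v)) = 0" unfolding S pair_ls[OF lf_xs] using z by(simp add: pu_def)
 thus "xs (ap (prod_list L) v) = 0" using pair_lv_zero[of "prod_list L" v] by(simp add: fa)
qed

text \<open>\<open>F i i\<close> acts on the pairing by \<open>lam i\<close> through the covector,
  and through the series by \<open>mu i\<close> plus the exponent of x_i minus that of
  x_{-i}.\<close>

lemma pu_support:
 assumes v: "v : VP mu" and a: "pu v a ~= 0"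
 shows "EX c. nj n c & a = rx n kp km c" proof -
 have j: "a k = 0" if "k ~: J" for k proof(rule ccontr)
  assume "a k ~= 0"
  hence "(%y. uu v (y, a)) = 0" using uu_junk[OF that] by(auto simp: fa)
  thus False using a lf_0[OF lf_xs] by(simp add: pu_def pair_def)
 qed
 have t: "a (int i) + km i = a (- int i) + kp i" if i: "i : {1..<n}" for i proof -
  have i': "int i : I" using i by(auto simp: Iset_def)
  have e1: "pair xs (ap (lv (F (int i) (int i))) (uu v)) = ap (DD (int i) (int i)) (pu v) + of_int (mu i) *. pu v"
   unfolding F_torus[OF v i] by(simp add: pair_lin[OF lf_xs] pair_ls[OF lf_xs] pu_def)
  have e2: "pair xs (ap (lv (F (int i) (int i))) (uu v)) = of_int (lam i) *. pu v"
   unfolding pair_lv using xs(3)[OF i'] i by(simp add: pair_def fun_eq_iff vs_apply pu_def lm_def)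
  have e3: "ap (DD (int i) (int i)) (pu v) a = (of_nat (a (int i)) - of_nat (a (- int i))) * pu v a" using i by(simp add: DD_def theta_def xr_def fa ap_num alg)
  have "of_int (lam i) * pu v a = (of_nat (a (int i)) - of_nat (a (- int i)) + of_int (mu i)) * pu v a"
   using fun_cong[OF e1[unfolded e2], of a] by(simp add: fa vs_apply e3 distrib_right)
  hence "(of_int (lam i) :: complex) = of_int (int (a (int i)) - int (a (- int i)) + mu i)" using a by simp
  hence "lam i = int (a (int i)) - int (a (- int i)) + mu i" unfolding of_int_eq_iff .
  thus ?thesis by(auto simp: kdf_def)
 qed
 define c where "c i = (if i = n then a (- nn) else if i : {1..<n} then a (int i) - kp i else 0)" for i
 have "nj n c" using n1 by(auto simp: nj_def c_def)
 moreover have "a = rx n kp km c" proof(rule ext)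
  fix k
  consider "k ~: J" | "k = - nn" | i where "k = int i" "i : {1..<n}" | i where "k = - int i" "i : {1..<n}" proof -
   assume h: "k ~: J ==> thesis" "k = - nn ==> thesis" "!!i. k = int i ==> i : {1..<n} ==> thesis" "!!i. k = - int i ==> i : {1..<n} ==> thesis"
   show thesis
   proof(cases "k : J & k ~= - nn")
    case True
    hence "k = int (nat k) & nat k : {1..<n} | k = - int (nat (- k)) & nat (- k) : {1..<n}" by(auto simp: J_def Iset_def)
    thus thesis using h(3,4) by blast
   qed (use h(1,2) in blast)
  qed
  thus "a k = rx n kp km c k" proof cases
   case 1
   thus ?thesis using j n1 by(auto simp: rx_def J_def Iset_def)
  next
   case 2
   show ?thesis unfolding 2 rx_at(3)[OF n1] by(simp add: c_def)
  next
   case 3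
   thus ?thesis using t[OF 3(2)] kpkm[of lam mu i] by(auto simp: rx_at(1) c_def)
  next
   case 4
   thus ?thesis using t[OF 4(2)] kpkm[of lam mu i] by(auto simp: rx_at(2) c_def)
  qed
 qed
 ultimately show ?thesis by blast
qed

lemma Ph_inj: assumes v: "v : VP mu" and z: "Ph v = 0" shows "v = 0"
proof -
 have "RD (pu v) = 0" by(rule rc_inj[of n]) (use z in "auto simp: Ph_def rd_def")
 hence r: "nj n c ==> pu v (rx n kp km c) = 0" for c by(auto simp: rd_def fun_eq_iff fa split: if_splits)
 have "pu v = 0" using pu_support[OF v] r by(intro ext) (auto simp: fa)
 thus ?thesis by(rule pu_inj[OF v])
qed

lemma fin_pu: "fin n (RD (pu v))"
proof -
 obtain N where N: "!!v y a. deg a >= N ==> uu v (y, a) = 0" using uu_vanish by blast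
 show ?thesis unfolding fin_def
 proof(intro exI allI impI)
  fix c assume c: "N <= (SUM j:{1..n}. c j)"
  have "(SUM j:{1..n}. c j) <= (SUM j:{1..n}. rx n kp km c (- int j))" by(intro sum_mono) (auto simp: rx_def)
  also have "... = (SUM j:(%j. - int j) ` {1..n}. rx n kp km c j)" by(subst sum.reindex) (auto simp: inj_on_def)
  also have "... <= deg (rx n kp km c)" unfolding deg_def by(rule sum_mono2[OF finJ]) (auto simp: J_def Iset_def)
  finally have "(%y. uu v (y, rx n kp km c)) = 0" using c N by(auto simp: fa)
  thus "RD (pu v) c = 0" using lf_0[OF lf_xs] by(simp add: rd_def pu_def pair_def)
 qed
qed

text \<open>Turns a power that the covector annihilates into a differential equation for the
  series.\<close>

lemma pu_word_zero:
 assumes v: "v : VP mu" and ik: "i : I" "k : I" "i < k" and z: "!!w. xs (ap ((c *: F i k) ^ K) w) = 0"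
 shows "ap ((c *: DD i k) ^ K) (pu v) = 0" proof -
 have "ap (lv ((c *: F i k) ^ K)) (uu v) = ap (ls ((c *: DD i k) ^ K)) (uu v)" proof(induction K)
  case (Suc K)
  have "ap (lv ((c *: F i k) ^ Suc K)) (uu v) = ap (lv (c *: F i k) * ls ((c *: DD i k) ^ K)) (uu v)" by(simp add: lv_hom Suc)
  also have "... = ap (ls ((c *: DD i k) ^ K)) (c *. ap (lv (F i k)) (uu v))" unfolding lv_ls by(simp add: lv_hom)
  also have "... = ap (ls ((c *: DD i k) ^ Suc K)) (uu v)" unfolding FD[OF v ik] by(simp add: ls_hom power_Suc2 del: power_Suc)
  finally show ?case .
 qed (simp add: lv_hom ls_hom)
 moreover have "pair xs (ap (lv ((c *: F i k) ^ K)) (uu v)) = 0" unfolding pair_lv using z by(simp add: pair_def fun_eq_iff fa)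
 ultimately show ?thesis by(simp add: pair_ls[OF lf_xs] pu_def)
qed

lemma F_nilp: assumes "i : I" "k : I" "i < k" shows "EX M. (c *: F i k) ^ M = 0"
proof -
 obtain N where N: "!!L. set L <= Fs (<) ==> length L >= N ==> prod_list L = 0" using long_words_vanish[of "(<)" "- 1"] by auto
 have "F i k : Fs (<)" using assms unfolding Fs_def by blast
 hence "prod_list (replicate N (F i k)) = 0" by(intro N) auto
 hence "F i k ^ N = 0" by simp
 thus ?thesis by(intro exI[of _ N]) (simp add: pow_scl)
qed

lemma xs_vs: "xs (c *. f) = c * xs f" by(rule lf_vs[OF lf_xs])

text \<open>The long-root sl(2) at index 1: the covector has weight \<open>- lam 1 = N\<close>, so
  the power N + 1 of the raising element annihilates the series. Completing the monomial by
  \<open>km 1\<close> factors and cancelling them again lowers the exponent to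
  \<open>d 1 + 1\<close>.\<close>

lemma deg_1: assumes v: "v : VP mu" shows "ap (PQ 1 ^ Suc (d 1)) (RD (pu v)) = 0"
proof -
 have I: "1 : I" "- 1 : I" using n1 by(auto simp: Iset_def)
 let ?e = "(1/2) *: F (- 1) 1" and ?f = "(1/2) *: F 1 (- 1)" and ?h = "- F 1 1"
 have n: "F (- 1) (- 1) = - F 1 1" using F_neg[OF I(1)] by simp
 have ef: "?e * ?f = ?f * ?e + ?h" proof -
  have "F (- 1) 1 * F 1 (- 1) = F 1 (- 1) * F (- 1) 1 + (-4) *: F 1 1" unfolding comm[OF I(2,1,1,2)] by(rule lop_eqI, rule ext) (simp add: kd_def theta_def n vl)
  thus ?thesis by(intro lop_eqI ext) (simp add: scl_simps(1-3) vl)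
 qed
 have he: "?h * ?e = ?e * ?h + (?e + ?e)" proof -
  have "F 1 1 * F (- 1) 1 = F (- 1) 1 * F 1 1 + (-2) *: F (- 1) 1" unfolding comm[OF I(1,1,2,1)] by(rule lop_eqI, rule ext) (simp add: kd_def theta_def vl)
  thus ?thesis by(intro lop_eqI ext) (simp add: scl_simps(1-3) vl)
 qed
 have "xs (ap ?f w) = 0" for w using xs_low[OF I, of w] by(simp add: xs_vs)
 moreover have "xs (ap ?h w) = - of_int (lam 1) * xs w" for w using xs(3)[OF I(1), of w] by(simp add: lf_minus[OF lf_xs] lm_def)
 moreover obtain M where "?e ^ M = 0" using F_nilp[OF I(2,1)] by auto
 ultimately obtain N where N: "- of_int (lam 1) = (of_nat N :: complex)" "!!w. xs (ap (?e ^ Suc N) w) = 0" using sl2_covector[OF ef he] by blast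
 have D: "ap (((1/2) *: DD (- 1) 1) ^ Suc N) (pu v) = 0" by(rule pu_word_zero[OF v I(2,1) _ N(2)]) simp
 have d1: "of_nat (d 1) = (of_nat N :: complex) - (if n = 1 then 0 else of_nat (km 1))" using d_sum[of 1] n1 N(1) by simp
 have P1: "PQ 1 = dv 1" by(simp add: PQ_def)
 show ?thesis
 proof(cases "n = 1")
  case True
  have "xr 1 = 1" unfolding xr_def using True by simp
  hence dd: "(1/2) *: DD (- 1) 1 = dv (- 1)" unfolding DD_def by(intro lop_eqI ext) (simp add: theta_def vl)
  have "RD (ap (dv (- 1) ^ K) (pu v)) = ap (dv 1 ^ K) (RD (pu v))" for K using rd_n(1)[of n kp km] True by(induction K) simp_all
  from this[of "Suc N"] have "ap (dv 1 ^ Suc N) (RD (pu v)) = 0" using D unfolding dd by(simp add: rd_lin del: power_Suc)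
  moreover have "d 1 = N" using d1 True by simp
  ultimately show ?thesis unfolding P1 by simp
 next
  case False
  hence n2: "1 < n" "1 : {1..<n}" using n1 by auto
  have dd: "(1/2) *: DD (- 1) 1 = xv 1 * dv (- 1)" unfolding DD_def using n2 by(intro lop_eqI ext) (simp add: xr_def theta_def vl)
  have N': "Suc N = Suc (d 1) + km 1" proof -
   have "of_nat (d 1 + km 1) = (of_nat N :: complex)" using d1 False by simp
   thus ?thesis unfolding of_nat_eq_iff by simp
  qed
  \<comment> \<open>Multiplication by this power of x_1 clears the shift of x_{-1}, as
    \<open>rd_D1\<close> requires.\<close>
  let ?A = "ap (xv 1 ^ km 1) (pu v)"
  let ?B = "xv 1 * dv (- 1)"
  let ?D = "rd n kp (km(1 := 0)) ?A"
  let ?E = "xv 1 * dv (- 1 :: int)"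
  have "?B * xv 1 = xv 1 * ?E" by(simp add: mult.assoc dx_diff)
  hence "?B ^ Suc N * xv 1 ^ km 1 = xv 1 ^ km 1 * ?E ^ Suc N" by(rule commute_pow2)
  from arg_cong[OF this, of "%T. ap T (pu v)"] have "ap (?B ^ Suc N) ?A = 0" using D unfolding dd by(simp only: ap_mult ap_v0)
  hence z: "ap (dv 1 ^ Suc N) ?D = 0" using rd_D1[OF n2(1), of "km(1 := 0)" kp "Suc N" "?A"] by(simp add: rd_lin del: power_Suc)
  let ?C = "ap (xv 1 ^ km 1) (RD (pu v))"
  have r: "?D = ?C" proof(cases "km 1 = 0")
   case True
   thus ?thesis by(simp add: fun_upd_idem)
  next
   case False
   hence "kp 1 = 0" using kpkm[of lam mu 1] by simp
   thus ?thesis using rd_mul_pos[of 1 n kp km "km 1" "pu v", OF n2(2)] by simp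
  qed
  have nl: "EX M. ap (dv 1 ^ M) (RD (pu v)) = 0" unfolding P1[symmetric] by(rule fin_nilp[OF _ fin_pu]) (use n1 in simp)
  have "ap (dv 1 ^ (Suc (d 1) + km 1)) ?C = 0" using z unfolding r N' .
  from nilp_cancel_pow[of "dv 1" "xv 1" 1 "RD (pu v)" "Suc (d 1)" "km 1", OF _ _ nl this]
  have "ap (dv 1 ^ Suc (d 1)) (RD (pu v)) = 0" by(simp add: dx_v del: power_Suc)
  thus ?thesis unfolding P1 .
 qed
qed

text \<open>The sl(2) of the simple root between i and i + 1: its string length
  \<open>lam i - lam (Suc i)\<close> exceeds the wanted bound by the shifts \<open>kp i\<close> and
  \<open>B\<close>, which are removed one after the other by \<open>nilp_cancel_pow\<close>.\<close>

lemma deg_Suc: assumes v: "v : VP mu" and i: "i : {1..<n}" shows "ap (PQ (Suc i) ^ Suc (d (Suc i))) (RD (pu v)) = 0"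
proof -
 let ?i = "int i" and ?k = "int i + 1"
 have I: "?i : I" "?k : I" using i by(auto simp: Iset_def)
 let ?e = "1 *: F ?i ?k" and ?f = "F ?k ?i" and ?h = "F ?i ?i - F ?k ?k"
 have ef: "?e * ?f = ?f * ?e + ?h" using comm[OF I I(2,1)] i by(simp add: kd_def)
 have he: "?h * ?e = ?e * ?h + (?e + ?e)" using comm[OF I(1,1) I] comm[OF I(2,2) I] i by(simp add: kd_def alg)
 let ?C = "of_int (lam (Suc i))"
 have "xs (ap ?f w) = 0" for w using xs_low[OF I(2,1), of w] by simp
 moreover have "xs (ap ?h w) = (of_int (lam i) - ?C) * xs w" for w proof -
  have "nat ?k = Suc i" by simp
  thus ?thesis using xs(3)[OF I(1), of w] xs(3)[OF I(2), of w] i by(simp add: lf_diff[OF lf_xs] lm_def alg)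
 qed
 moreover obtain M where "?e ^ M = 0" using F_nilp[OF I, of 1] by auto
 ultimately obtain N where N: "of_int (lam i) - ?C = (of_nat N :: complex)" "!!w. xs (ap (?e ^ Suc N) w) = 0" using sl2_covector[OF ef he] by blast
 let ?D = "DD ?i ?k ^ Suc N"
 have D: "ap ?D (pu v) = 0" using pu_word_zero[OF v I _ N(2)] by simp
 \<comment> \<open>Index n carries no shift, since x_n = 1 leaves only the variable x_{-n}.\<close>
 define B where "B = (if Suc i = n then 0 else km (Suc i))"
 have N': "Suc N = Suc (d (Suc i)) + B + kp i" proof -
  let ?G = "bet n lam mu (Suc i)"
  have "of_nat (d (Suc i)) = alph lam mu (Suc i) - ?G" using d[of "Suc i"] i by simp
  moreover have "alph lam mu (Suc i) = of_int (lam i) - of_nat (kp i) - of_nat (Suc i) + 1/2" using i by(auto simp: alph_def kdf_def min_def)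
  moreover have "?G = ?C + of_nat B - of_nat (Suc i) + 1/2" by(auto simp: bet_def kdf_def max_def B_def)
  ultimately have "of_nat (d (Suc i) + B + kp i) = (of_nat N :: complex)" using N(1) by simp
  thus ?thesis unfolding of_nat_eq_iff by simp
 qed
 have xi: "xr (- ?i) = xv (- ?i)" using i by(auto simp: xr_def)
 have DDe: "DD ?i ?k = xr ?k * dv ?i - xv (- ?i) * dv (- ?i - 1)" using i by(simp add: DD_def theta_def xi)
 let ?B = "ap (xr ?k ^ B) (pu v)"
 \<comment> \<open>These multiplications commute with the vector field and bring the shifts
   \<open>kp i\<close> and \<open>km (Suc i)\<close> to 0, as \<open>rd_D_mid\<close> and
   \<open>rd_D_last\<close> require.\<close>
 define g where "g = ap (xv (- ?i) ^ kp i) ?B"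
 have xrc: "xr ?k * xv j = xv j * xr ?k" for j by(auto simp: xr_def xx_comm)
 have c1: "DD ?i ?k * xv (- ?i) = xv (- ?i) * DD ?i ?k" proof -
  have "dv ?i * xv (- ?i) = xv (- ?i) * dv ?i" "dv (- ?i - 1) * xv (- ?i) = xv (- ?i) * dv (- ?i - 1)" using i by(auto intro!: dx_diff)
  thus ?thesis unfolding DDe left_diff_distrib right_diff_distrib mult.assoc by(simp add: xrc flip: mult.assoc)
 qed
 have c2: "DD ?i ?k * xr ?k = xr ?k * DD ?i ?k" proof -
  have "dv ?i * xr ?k = xr ?k * dv ?i" "dv (- ?i - 1) * xr ?k = xr ?k * dv (- ?i - 1)" using i by(auto simp: xr_def intro!: dx_diff)
  thus ?thesis unfolding DDe left_diff_distrib right_diff_distrib mult.assoc by(simp add: xrc flip: mult.assoc)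
 qed
 have Dg: "ap ?D g = 0" proof -
  have "ap ?D g = ap (DD ?i ?k ^ Suc N * xv (- ?i) ^ kp i) ?B" by(simp add: g_def del: power_Suc)
  also have "... = ap (xv (- ?i) ^ kp i) (ap (DD ?i ?k ^ Suc N * xr ?k ^ B) (pu v))" unfolding commute_pow2[OF c1] by simp
  also have "... = 0" unfolding commute_pow2[OF c2] by(simp add: D del: power_Suc)
  finally show ?thesis .
 qed
 let ?kp = "kp(i := 0)" and ?km = "if Suc i = n then km else km(Suc i := 0)"
 have r1: "rd n ?kp ?km g = ap (xv i ^ kp i) (rd n kp ?km ?B)" proof(cases "kp i = 0")
  case True
  thus ?thesis by(simp add: g_def fun_upd_idem)
 next
  case False
  hence "km i = 0" using kpkm[of lam mu i] by simp
  thus ?thesis using rd_mul_neg[of i n ?km kp "kp i" "?B", OF i] by(simp add: g_def)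
 qed
 let ?A = "ap (xv (Suc i) ^ B) (RD (pu v))"
 have r2: "rd n kp ?km ?B = ?A" proof(cases "Suc i = n | B = 0")
  case True
  thus ?thesis by(auto simp: B_def fun_upd_idem split: if_splits)
 next
  case False
  hence S: "Suc i : {1..<n}" and k: "kp (Suc i) = 0" using kpkm[of lam mu "Suc i"] i by(auto simp: B_def)
  have "xr ?k = xv (int (Suc i))" using False i by(auto simp: xr_def add.commute)
  thus ?thesis using rd_mul_pos[of "Suc i" n kp km B "pu v", OF S k] False by(simp add: B_def)
 qed
 have PQn: "dv i - dv (Suc i) = - PQ (Suc i)" using i by(simp add: PQ_def)
 let ?E = "ap (xv i ^ kp i) ?A"
 have "ap ((dv i - dv (Suc i)) ^ Suc N) (rd n ?kp ?km g) = 0" proof(cases "Suc i = n")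
  case True
  have "DD ?i ?k = dv (int i) - xv (- int i) * dv (- nn)" proof -
   have en: "- int i - 1 = - nn" "int i + 1 = nn" using True by linarith+
   show ?thesis unfolding DDe unfolding en by simp
  qed
  hence "ap ((dv (int i) - xv (- int i) * dv (- nn)) ^ Suc N) g = 0" using Dg by simp
  thus ?thesis using rd_D_last[OF i True, of ?kp km "Suc N" g] True by(simp add: rd_lin del: power_Suc)
 next
  case False
  hence S: "Suc i : {1..<n}" using i by auto
  have "xr ?k = xv ?k" using False by(auto simp: xr_def)
  hence "ap ((xv (int i + 1) * dv (int i) - xv (- int i) * dv (- int i - 1)) ^ Suc N) g = 0" using Dg unfolding DDe by simp
  thus ?thesis using rd_D_mid[OF i S, of ?kp "km(Suc i := 0)" "Suc N" g] False by(simp add: rd_lin del: power_Suc)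
 qed
 hence "ap (((- 1) *: PQ (Suc i)) ^ Suc N) ?E = 0" unfolding PQn r1 r2 by simp
 hence z: "ap (PQ (Suc i) ^ (Suc (d (Suc i)) + B + kp i)) ?E = 0" unfolding pow_scl N' by(auto dest!: vs_eq_0)
 have S: "Suc i : {1..n}" "i : {1..n}" using i by auto
 have p1: "ap (PQ (Suc i)) (ap (xv i) h) = ap (xv i) (ap (PQ (Suc i)) h) + (- 1) *. h" for h
  using i dx_v[of i h] arg_cong[OF dx_diff[of "Suc i" i], of "%T. ap T h"] by(simp add: PQ_def vs_simps ap_vdiff)
 have p2: "ap (PQ (Suc i)) (ap (xv (Suc i)) h) = ap (xv (Suc i)) (ap (PQ (Suc i)) h) + 1 *. h" for h
  using i dx_v[of "Suc i" h] arg_cong[OF dx_diff[of i "Suc i"], of "%T. ap T h"] by(simp add: PQ_def vs_simps ap_vdiff)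
 have "ap (PQ (Suc i) ^ (Suc (d (Suc i)) + B)) ?A = 0" by(rule nilp_cancel_pow[OF p1 _ fin_nilp[OF S(1) fin_xv[OF S(1) fin_pu]] z]) simp
 from nilp_cancel_pow[of "PQ (Suc i)" "xv (Suc i)" 1 "RD (pu v)" "Suc (d (Suc i))" B, OF p2 _ fin_nilp[OF S(1) fin_pu] this]
 show ?thesis by simp
qed

lemma Ph_HH: assumes v: "v : VP mu" shows "Ph v : HH d [1..<Suc n]"
proof -
 have z: "ap (dv m ^ Suc (d m)) (Ph v) = 0" if m: "m : {1..n}" for m proof -
  have "ap (PQ m ^ Suc (d m)) (RD (pu v)) = 0" proof(cases "m = 1")
   case True
   thus ?thesis using deg_1[OF v] by simp
  next
   case False
   then obtain i where "m = Suc i" "i : {1..<n}" using m by(cases m) auto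
   thus ?thesis using deg_Suc[OF v] by simp
  qed
  moreover have "rc n (ap (PQ m ^ K) h) = ap (dv m ^ K) (rc n h)" for K h using m by(induction K) (simp_all add: rc_P)
  ultimately show ?thesis by(metis Ph_def rc_lin(4))
 qed
 show ?thesis unfolding HH_def
 proof(intro CollectI allI impI conjI ballI)
  fix c assume c: "Ph v c ~= 0"
  hence nj: "nj n c" by(auto simp: Ph_def rc_def split: if_splits)
  show "c i = 0" if "i ~: set [1..<Suc n]" for i proof -
   have "i ~: {1..n}" using that by auto
   thus ?thesis using nj unfolding nj_def by blast
  qed
  show "c i <= d i" if "i : set [1..<Suc n]" for i proof(rule ccontr)
   assume "~ c i <= d i"
   moreover have "i : {1..n}" using that by auto
   ultimately show False using dv_pow_zero[OF z, of i c] c by simp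
  qed
 qed
qed

end

section \<open>Equivariance under the long-root sl(2)\<close>

definition Em :: "nat => arr lop" where "Em n = (SUM m:{1..n}. dv m)"
definition Ep :: "(nat => nat) => nat => arr lop" where "Ep d n = (SUM m:{1..n}. of_nat (d m) *: xv m - xv m * (xv m * dv m))"

text \<open>The adjoint action on an operator matrix equals the action of matrix units on its
  indices, so the entry \<open>True True\<close> determines the other three by commutators.\<close>

definition eqv :: "'x lop => 'x lop => (bool => bool => 'x lop) => bool" where
 "eqv A B M <-> (ALL c d. ad A (M c d) = (if c then M False d else 0) - (if d then 0 else M c True)
   & ad B (M c d) = (if c then 0 else M True d) - (if d then M c False else 0))"

lemma eqvD: "eqv A B M ==> ad A (M c d) = (if c then M False d else 0) - (if d then 0 else M c True)"
 "eqv A B M ==> ad B (M c d) = (if c then 0 else M True d) - (if d then M c False else 0)" by(simp_all add: eqv_def)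
lemma eqv_mm: "eqv A B M ==> eqv A B N ==> eqv A B (mm M N)" unfolding eqv_def[of A B "mm M N"] mm_def ad_simps by(auto simp: eqvD alg)
lemma eqv_id2: "eqv A B id2" by(auto simp: eqv_def id2_def ad_simps)

lemma ad_weyl: "ad (dv i) (xv i) = 1" "ad (xv i) (dv i) = - 1" "ad (dv i) (dv i) = 0" "ad (xv i) (xv i) = 0"
 "i ~= j ==> ad (dv i) (xv j) = 0" "i ~= j ==> ad (xv i) (dv j) = 0" "ad (dv i) (dv j) = 0" "ad (xv i) (xv j) = 0" by(auto simp: ad_def dx_same dx_diff dd_comm xx_comm)

lemma eqv_lx:
 assumes i: "i : {1..n}" shows "eqv (Em n) (Ep d n) (lx d i z)" proof -
 have A: "ad (Em n) (lx d i z a b) = ad (dv i) (lx d i z a b)" for a b proof -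
  have "ad (Em n) (lx d i z a b) = (SUM m:{1..n}. if m = i then ad (dv i) (lx d i z a b) else 0)"
   unfolding Em_def ad_sum by(intro sum.cong) (auto simp: lx_def ad_simps ad_weyl)
  thus ?thesis using i by simp
 qed
 let ?B = "of_nat (d i) *: xv i - xv i * (xv i * dv i)"
 have B: "ad (Ep d n) (lx d i z a b) = ad ?B (lx d i z a b)" for a b proof -
  have "ad (Ep d n) (lx d i z a b) = (SUM m:{1..n}. if m = i then ad ?B (lx d i z a b) else 0)"
   unfolding Ep_def ad_sum by(intro sum.cong) (auto simp: lx_def ad_simps ad_weyl)
  thus ?thesis using i by simp
 qed
 have "ad (dv i) (lx d i z c e) = (if c then lx d i z False e else 0) - (if e then 0 else lx d i z c True)" for c e
  by(cases c; cases e) (simp_all add: lx_def ad_simps ad_weyl, (intro lop_eqI ext; simp add: vl alg)+)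
 moreover have "ad ?B (lx d i z c e) = (if c then 0 else lx d i z True e) - (if e then lx d i z c False else 0)" for c e
  by(cases c; cases e; intro lop_eqI ext; simp add: lx_def ad_def dx_v vl ap_two alg)
 ultimately show ?thesis unfolding eqv_def A B by blast
qed

lemma eqv_Zm: "set is <= {1..n} ==> eqv (Em n) (Ep d n) (Zm d c c' is u)" by(induction "is") (auto intro!: eqv_mm eqv_lx simp: eqv_id2)

lemma infinite_big: "infinite {u :: complex. cmod u > R}"
proof
 assume f: "finite {u :: complex. cmod u > R}"
 have "inj (%k. of_nat (k + nat \<lceil>R\<rceil> + 1) :: complex)" by(auto simp: inj_on_def)
 moreover have "range (%k. of_nat (k + nat \<lceil>R\<rceil> + 1) :: complex) <= {u. cmod u > R}" proof
  fix u :: complex assume "u : range (%k. of_nat (k + nat \<lceil>R\<rceil> + 1) :: complex)"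
  then obtain k where "u = of_nat (k + nat \<lceil>R\<rceil> + 1)" by blast
  hence "cmod u = real (k + nat \<lceil>R\<rceil> + 1)" by(simp only: norm_of_nat)
  also have "... > R" by linarith
  finally show "u : {u. cmod u > R}" by simp
 qed
 ultimately show False using f by(metis finite_subset infinite_UNIV_nat finite_imageD)
qed

text \<open>Real copies of the parameters, so that order arguments can decide which complex numbers
  vanish.\<close>

definition ra :: "(nat => int) => (nat => int) => nat => real" where
 "ra lam \<mu> i = (if i = 1 then - 1/2 else of_int (min (lam (i - 1)) (\<mu> (i - 1))) - of_nat i + 1/2)"
definition rb :: "nat => (nat => int) => (nat => int) => nat => real" where
 "rb n lam \<mu> i = (if i = n then of_int (lam n) - of_nat n + 1/2 else of_int (max (lam i) (\<mu> i)) - of_nat i + 1/2)"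

lemma al_ra: "alph lam mu i = of_real (ra lam mu i)" by(simp add: alph_def ra_def)
lemma be_rb: "bet n lam mu i = of_real (rb n lam mu i)" by(simp add: bet_def rb_def)

section \<open>The resolvent as a Neumann series\<close>

definition ser :: "(nat => ('v::finite) lop) => 'v lop => bool" where
 "ser T L <-> (ALL x y. (%k. ent (T k) x y) sums ent L x y)"

lemma ent_simps:
 "ent (S + T) x y = ent S x y + ent T x y" "ent (S - T) x y = ent S x y - ent T x y"
 "ent (c *: T) x y = c * ent T x y" "ent 1 x y = kd x y" by(simp_all add: ent_def fa vs_apply kd_def)
lemma ent_sum: "ent (SUM a:A. f a) x y = (SUM a:A. ent (f a) x y)" by(simp add: ent_def ap_sum sum_fun_apply)
lemma ent_mo: "ent (mo UNIV A) x (y :: 'v::finite) = A x y" by(simp add: ent_def ap_mo app_def kd_def if_distrib[of "%z. _ * z"] cong: if_cong)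
lemma ent_eqI: "(!!x y. ent S x y = ent T x y) ==> S = (T :: 'v::finite lop)" by(intro lop_eqI ext) (simp add: ap_ent)

lemma ser_simps:
 "ser S K ==> ser T L ==> ser (%k. S k + T k) (K + L)"
 "ser S K ==> ser T L ==> ser (%k. S k - T k) (K - L)"
 "ser T L ==> ser (%k. c *: T k) (c *: L)"
 "ser T L ==> ser (%k. X * T k) (X * L)"
 "ser T L ==> ser (%k. T k * X) (L * X)" by(auto simp: ser_def ent_simps ent_mult intro!: sums_add sums_diff sums_mult sums_mult2 sums_sum)
lemma ser_sum: "(!!a. a : A ==> ser (T a) (L a)) ==> ser (%k. SUM a:A. T a k) (SUM a:A. L a)" by(auto simp: ser_def ent_sum intro!: sums_sum)
lemma ser_shift: "ser T L ==> ser (%k. T (Suc k)) (L - T 0)" unfolding ser_def ent_simps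
proof(intro allI)
 fix x y assume "ALL x y. (%k. ent (T k) x y) sums ent L x y"
 thus "(%k. ent (T (Suc k)) x y) sums (ent L x y - ent (T 0) x y)" using sums_Suc_iff[of "%k. ent (T k) x y" "ent L x y - ent (T 0) x y"] by simp
qed
lemma ser_unique: "ser T K ==> ser T L ==> K = L" unfolding ser_def by(rule ent_eqI) (meson sums_unique2)

context sp_rep
begin

primrec Fp :: "nat => int => int => 'v lop" where
 "Fp 0 i j = kd i j *: 1"
| "Fp (Suc k) i j = (SUM l:I. F i l * Fp k l j)"

lemma sum_kd: "i : I ==> (SUM l:I. kd l i *: f l) = (f i :: 'v lop)"
 "i : I ==> (SUM l:I. kd i l *: f l) = (f i :: 'v lop)" by(simp_all add: kd_def if_distrib[of "%z. z *: _"] scl_simps cong: if_cong)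

lemma Fp_Suc: "i : I ==> j : I ==> Fp (Suc k) i j = (SUM l:I. Fp k i l * F l j)"
proof(induction k arbitrary: i)
 case 0
 have "Fp (Suc 0) i j = (SUM l:I. kd l j *: F i l)" by(simp add: scl_simps)
 moreover have "(SUM l:I. Fp 0 i l * F l j) = (SUM l:I. kd i l *: F l j)" by(simp add: scl_simps)
 ultimately show ?case using sum_kd 0 by simp
next
 case (Suc k)
 have "Fp (Suc (Suc k)) i j = (SUM l:I. F i l * (SUM m:I. Fp k l m * F m j))" using Suc by(simp only: Fp.simps(2)[of "Suc k"] cong: sum.cong)
 also have "... = (SUM m:I. Fp (Suc k) i m * F m j)" by(simp add: sum_distrib_left sum_distrib_right mult.assoc) (rule sum.swap)
 finally show ?case .
qed

lemma teq_lin: "teq Z ==> teq (%i j. z *: Z i j)"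
proof(subst teq_def, intro ballI)
 fix a b c d assume Z: "teq Z" and *: "a : I" "b : I" "c : I" "d : I"
 let ?A = "ad (F a b) (z *: Z c d)"
 have "?A = z *: ad (F a b) (Z c d)" by(simp add: ad_def scl_simps)
 thus "?A = tq (%i j. z *: Z i j) a b c d" unfolding teqD[OF Z *] by(simp add: scl_simps mult_ac)
qed

text \<open>The commutator is a derivation, and the terms in which it moves the contracted index
  cancel.\<close>

lemma teq_mult:
 assumes Z: "teq Z" shows "teq (%i j. SUM l:I. F i l * Z l j)" unfolding teq_def proof(intro ballI)
 fix a b c d assume *: "a : I" "b : I" "c : I" "d : I"
 let ?Z = "%i j. SUM l:I. F i l * Z l j" and ?t = "theta a b"
 let ?A = "F c (- a) * Z (- b) d"
 have "ad (F a b) (F c l * Z l d) = ad (F a b) (F c l) * Z l d + F c l * ad (F a b) (Z l d)" for l by(simp add: ad_def alg)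
 hence "ad (F a b) (?Z c d) = (SUM l:I. ad (F a b) (F c l) * Z l d + F c l * ad (F a b) (Z l d))"
  by(simp add: ad_def sum_distrib_left sum_distrib_right flip: sum_subtractf)
 also have "... = (SUM l:I. kd c b *: (F a l * Z l d) - kd a l *: (F c b * Z l d) - (?t * kd c (- a)) *: (F (- b) l * Z l d) + kd (- b) l *: (?t *: (F c (- a) * Z l d))
   + (kd l b *: (F c l * Z a d) - kd a d *: (F c l * Z l b) - kd l (- a) *: (?t *: (F c l * Z (- b) d)) + (?t * kd (- b) d) *: (F c l * Z l (- a))))"
  by(intro sum.cong refl) (simp add: teqD[OF teq_F *(1-3)] teqD[OF Z *(1,2) _ *(4)] alg scl_simps mult_ac)
 also have "... = kd c b *: ?Z a d - F c b * Z a d - (?t * kd c (- a)) *: ?Z (- b) d + ?t *: ?A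
   + (F c b * Z a d - kd a d *: ?Z c b - ?t *: ?A + (?t * kd (- b) d) *: ?Z c (- a))" proof -
  have s: "(SUM l:A. z *: f l) = z *: (SUM l:A. f l)" for z and f :: "int => 'v lop" and A by(rule lop_eqI) (simp add: ap_sum vs_sum)
  have 1: "(SUM l:I. kd a l *: (F c b * Z l d)) = F c b * Z a d"
   "(SUM l:I. kd (- b) l *: (?t *: (F c (- a) * Z l d))) = ?t *: ?A"
   "(SUM l:I. kd l b *: (F c l * Z a d)) = F c b * Z a d"
   "(SUM l:I. kd l (- a) *: (?t *: (F c l * Z (- b) d))) = ?t *: ?A" using * by(simp_all only: sum_kd Iset_minus)
  show ?thesis by(simp only: sum.distrib sum_subtractf 1) (simp only: s)
 qed
 also have "... = tq ?Z a b c d" by(simp add: scl_simps)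
 finally show "ad (F a b) (?Z c d) = ..." .
qed

lemma teq_Fp: "teq (Fp k)"
proof(induction k)
 case 0 show ?case unfolding teq_def by(simp add: ad_def scl_simps mult_ac)
next
 case (Suc k) thus ?case using teq_mult[of "Fp k"] by(simp add: teq_def)
qed

definition RR :: real where
 "RR = (SUM i:I. SUM j:I. SUM x:UNIV. SUM y:UNIV. cmod (ent (F i j) x y))"

lemma RR_nonneg: "0 <= RR" unfolding RR_def by(intro sum_nonneg) auto

lemma Fp_bound: "i : I ==> cmod (ent (Fp k i j) x y) <= RR ^ k"
proof(induction k arbitrary: i x)
 case 0 show ?case by(simp add: ent_simps kd_def)
next
 case (Suc k)
 let ?A = "SUM l:I. SUM z:UNIV. cmod (ent (F i l) x z)"
 have "cmod (ent (Fp (Suc k) i j) x y) = cmod (SUM l:I. SUM z:UNIV. ent (F i l) x z * ent (Fp k l j) z y)" by(simp add: ent_sum ent_mult)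
 also have "... <= (SUM l:I. SUM z:UNIV. cmod (ent (F i l) x z) * RR ^ k)"
  by(intro order_trans[OF norm_sum] sum_mono) (auto simp: norm_mult intro!: mult_left_mono Suc.IH)
 also have "... = ?A * RR ^ k" by(simp add: sum_distrib_right)
 also have "... <= RR * RR ^ k" proof(rule mult_right_mono)
  have "(SUM l:I. SUM z:UNIV. cmod (ent (F i l) x z)) <= (SUM l:I. SUM x:UNIV. SUM z:UNIV. cmod (ent (F i l) x z))"
   by(intro sum_mono member_le_sum) (auto intro: sum_nonneg)
  also have "... <= RR" unfolding RR_def
   by(rule member_le_sum[where f = "%i. SUM l:I. SUM x:UNIV. SUM z:UNIV. cmod (ent (F i l) x z)"]) (use Suc.prems in "auto intro!: sum_nonneg")
  finally show "?A <= RR" .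
 qed (simp add: RR_nonneg)
 finally show ?case by simp
qed

definition GN :: "complex => int => int => 'v lop" where
 "GN w i j = mo UNIV (%x y. \<Sum>k. ent ((1 / w) ^ Suc k *: Fp k i j) x y)"

lemma ser_GN: assumes w: "RR < cmod w" and i: "i : I" shows "ser (%k. (1 / w) ^ Suc k *: Fp k i j) (GN w i j)" unfolding ser_def GN_def ent_mo
proof(intro allI summable_sums)
 fix x y
 have w0: "0 < cmod w" using w RR_nonneg by linarith
 show "summable (%k. ent ((1 / w) ^ Suc k *: Fp k i j) x y)" proof(rule summable_comparison_test')
  show "summable (%k. (1 / cmod w) * (RR / cmod w) ^ k)" using w w0 RR_nonneg by(intro summable_mult summable_geometric) simp
  fix k :: nat assume "k >= 0"
  let ?A = "norm (ent ((1 / w) ^ Suc k *: Fp k i j) x y)"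
  have "?A = (1 / cmod w) ^ Suc k * cmod (ent (Fp k i j) x y)" by(simp add: ent_simps norm_mult norm_power norm_divide)
  also have "... <= (1 / cmod w) ^ Suc k * RR ^ k" by(intro mult_left_mono Fp_bound i) simp
  also have "... = (1 / cmod w) * (RR / cmod w) ^ k" by(simp add: power_divide)
  finally show "?A <= (1 / cmod w) * (RR / cmod w) ^ k" .
 qed
qed

lemma GN_eq:
 assumes w: "RR < cmod w" and i: "i : I" and j: "j : I"
 shows "(SUM l:I. F i l * GN w l j) = w *: GN w i j - kd i j *: 1"
  and "(SUM l:I. GN w i l * F l j) = w *: GN w i j - kd i j *: 1" proof -
 let ?T = "%k. (1 / w) ^ Suc k *: Fp k i j"
 have w0: "w ~= 0" using w RR_nonneg by auto
 have s: "ser (%k. w *: ?T (Suc k)) (w *: (GN w i j - ?T 0))" by(intro ser_simps(3) ser_shift[of ?T] ser_GN w i)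
 have e: "w *: (GN w i j - ?T 0) = w *: GN w i j - kd i j *: 1" using w0 by(simp add: scl_simps)
 have c: "(SUM l:A. z *: f l) = z *: (SUM l:A. f l)" for z and f :: "int => 'v lop" and A by(rule lop_eqI) (simp add: ap_sum vs_sum)
 have t: "w *: ?T (Suc k) = (1 / w) ^ Suc k *: Fp (Suc k) i j" for k proof -
  have "w * (1 / w) ^ Suc (Suc k) = (1 / w) ^ Suc k" using w0 by simp
  thus ?thesis by(metis scl_simps(3))
 qed
 let ?A = "SUM l:I. F i l * GN w l j"
 have "ser (%k. SUM l:I. F i l * ((1 / w) ^ Suc k *: Fp k l j)) ?A" by(intro ser_sum ser_simps(4) ser_GN w)
 moreover have "(SUM l:I. F i l * ((1 / w) ^ Suc k *: Fp k l j)) = w *: ?T (Suc k)" for k unfolding t unfolding Fp.simps(2) by(simp only: scl_simps(2) c)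
 ultimately show "?A = w *: GN w i j - kd i j *: 1" using ser_unique[OF _ s[unfolded e]] by(simp only:)
 let ?B = "SUM l:I. GN w i l * F l j"
 have "ser (%k. SUM l:I. ((1 / w) ^ Suc k *: Fp k i l) * F l j) ?B" by(intro ser_sum ser_simps(5) ser_GN w i)
 moreover have "(SUM l:I. ((1 / w) ^ Suc k *: Fp k i l) * F l j) = w *: ?T (Suc k)" for k unfolding t unfolding Fp_Suc[OF i j] by(simp only: scl_simps(1) c)
 ultimately show "?B = w *: GN w i j - kd i j *: 1" using ser_unique[OF _ s[unfolded e]] by(simp only:)
qed

lemma teq_GN: assumes w: "RR < cmod w" shows "teq (GN w)" unfolding teq_def
proof(intro ballI)
 fix a b c d assume *: "a : I" "b : I" "c : I" "d : I"
 let ?T = "%i j k. (1 / w) ^ Suc k *: Fp k i j"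
 let ?A = "ad (F a b) (GN w c d)"
 have "ser (%k. ad (F a b) (?T c d k)) ?A" unfolding ad_def using * by(intro ser_simps ser_GN w)
 moreover have "ad (F a b) (?T c d k) = tq (%i j. ?T i j k) a b c d" for k by(rule teqD[OF teq_lin[OF teq_Fp] *])
 moreover have "ser (%k. tq (%i j. ?T i j k) a b c d)
   (tq (GN w) a b c d)" using * by(intro ser_simps ser_GN w) auto
 ultimately show "?A = tq (GN w) a b c d" using ser_unique by(simp only:)
qed

text \<open>Beyond \<open>R\<close> the Neumann series at u + n + 1/2 converges, and none of the
  linear factors in \<open>u\<close> occurring in \<open>piS_value\<close> vanishes.\<close>

abbreviation "R == RR + 3 * real n + 3"
abbreviation "Gf u == GN (u + of_nat n + 1/2)"

lemma Rw: assumes u: "R < cmod u" shows "RR < cmod (u + of_nat n + 1/2)"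
proof -
 let ?w = "u + of_nat n + 1/2"
 have "cmod u <= cmod ?w + cmod (of_nat n + 1/2)" using norm_triangle_ineq4[of ?w "of_nat n + 1/2"] by(simp add: alg)
 moreover have "cmod (of_nat n + 1/2 :: complex) <= real n + 1/2" using norm_triangle_ineq[of "of_nat n :: complex" "1/2"] by simp
 ultimately show ?thesis using u by simp
qed
lemmas teqGf = teq_GN[OF Rw] and Gf_eq = GN_eq(1)[OF Rw _ nI]

end

section \<open>Bijectivity of the encoding\<close>

locale sp_fin = sp_br n F lam xi mu d for n and F :: "int => int => ('v::finite) lop" and lam xi mu d +
 assumes lam1: "lam 1 <= 0" and dom: "!!i. 1 <= i ==> i < n ==> lam (Suc i) <= lam i"
  and nz: "VP mu ~= {0}"
begin

definition rl :: "nat list" where "rl = rev [1..<Suc n]"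
abbreviation "ZZ == Zm d (alph lam mu) (%i. - bet n lam mu i) rl"
definition ib :: "bool => int" where "ib a = (if a then nn else - nn)"

lemma Ph_pp:
 assumes u: "R < cmod u" and v: "v : VP mu"
 shows "S0 u *. Ph (ap (Gf u nn nn) v) = ap (ZZ u True True) (Ph v)" proof -
 interpret L: sp_lax n F lam xi mu v "Gf u" u by unfold_locales (use v teqGf[OF u] Gf_eq[OF u] in auto)
 have "L.SS n = S0 u" by(simp add: L.SS_def S0_def L.kap_def L.kan_def)
 thus ?thesis using L.lax_nn_rc[OF d] by(simp add: Ph_def pu_def rl_def)
qed

lemma rl_set: "set rl <= {1..n}" "distinct rl" by(auto simp: rl_def)

lemma Ph_e: "v : VP mu ==> Ph (ap (F (- nn) nn) v) = 2 *. ap (Em n) (Ph v)" by(simp add: Ph_raise Em_def ap_sum)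
lemma Ph_f: "v : VP mu ==> Ph (ap (F nn (- nn)) v) = 2 *. ap (Ep d n) (Ph v)" by(simp add: Ph_lower Ep_def ap_sum)

lemma two_cancel: "2 *. (f :: 'x => complex) = 2 *. g ==> f = g" by(auto simp: fun_eq_iff vs_apply)

text \<open>Commutators with \<open>F (- nn) nn\<close> and \<open>F nn (- nn)\<close> lead from the
  (n,n) entry to the two off-diagonal ones and from there to the last. \<open>Ph\<close> carries
  these generators to \<open>2 Em\<close> and \<open>2 Ep\<close>, and \<open>eqv\<close> gives the
  same commutators in the model.\<close>

lemma Ph_inter:
 assumes u: "R < cmod u" and v: "v : VP mu"
 shows "S0 u *. Ph (ap (Gf u (ib a) (ib b)) v) = ap (ZZ u a b) (Ph v)" proof -
 let ?e = "F (- nn) nn" and ?f = "F nn (- nn)" and ?z = "S0 u"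
 let ?A = "Gf u nn nn" and ?B = "Gf u (- nn) nn" and ?C = "Gf u (- nn) (- nn)" and ?D = "Gf u nn (- nn)"
 have nn: "nn ~= - nn" "- nn ~= nn" using n1 by auto
 have mI: "- nn : I" by simp
 note T = teqGf[OF u]
 have VA: "ap ?A w : VP mu" and VB: "ap ?B w : VP mu" and Ve: "ap ?e w : VP mu" and Vf: "ap ?f w : VP mu" if "w : VP mu" for w
  using that by(auto intro!: VP_teq[OF T] VP_teq[OF teq_F])
 have E: "eqv (Em n) (Ep d n) (ZZ u)" by(rule eqv_Zm[OF rl_set(1)])
 have c: "?e * ?A - ?A * ?e = 2 *: ?B" "?f * ?A - ?A * ?f = - 2 *: ?D" "?f * ?B - ?B * ?f = 2 *: (?A - ?C)"
  using teqD[OF T mI nI nI nI] teqD[OF T nI mI nI nI] teqD[OF T nI mI mI nI] nn n1 by(simp_all add: ad_def kd_def theta_def scl_two[of 1, simplified])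
 have step: "k *. (?z *. Ph (ap T' w)) = 2 *. ap (ad X Z) (Ph w)"
  if c: "g * A - A * g = k *: T'" and V: "!!w. w : VP mu ==> ap g w : VP mu" "!!w. w : VP mu ==> ap A w : VP mu"
   and g: "!!w. w : VP mu ==> Ph (ap g w) = 2 *. ap X (Ph w)" and A: "!!w. w : VP mu ==> ?z *. Ph (ap A w) = ap Z (Ph w)"
   and w: "w : VP mu" for g A k T' X Z w proof -
  have "k *. (?z *. Ph (ap T' w)) = ?z *. Ph (ap (k *: T') w)" by(simp add: Ph_lin vs_simps mult.commute)
  also have "... = ?z *. Ph (ap g (ap A w)) - ?z *. Ph (ap A (ap g w))" unfolding c[symmetric] by(simp add: Ph_lin vs_simps)
  also have "... = 2 *. ap X (?z *. Ph (ap A w)) - ap Z (Ph (ap g w))" using A[OF V(1)[OF w]] g[OF V(2)[OF w]] by(simp add: ap_vs vs_simps mult.commute)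
  also have "... = 2 *. ap (ad X Z) (Ph w)" unfolding A[OF w] g[OF w] by(simp add: ad_def ap_vs vs_simps)
  finally show ?thesis .
 qed
 note pp = Ph_pp[OF u]
 let ?E = "ZZ u False False"
 have ad: "ad (Em n) (ZZ u True True) = ZZ u False True" "ad (Ep d n) (ZZ u True True) = - ZZ u True False"
  "ad (Ep d n) (ZZ u False True) = ZZ u True True - ?E" using E by(simp_all add: eqv_def)
 have mp: "?z *. Ph (ap ?B w) = ap (ZZ u False True) (Ph w)" if "w : VP mu" for w by(rule two_cancel, rule step[OF c(1) Ve VA Ph_e pp that, unfolded ad])
 have neg: "f = g" if "- 2 *. f = 2 *. - g" for f g :: "arr => complex" using that by(auto simp: fun_eq_iff vs_apply fa)
 have pm: "?z *. Ph (ap ?D w) = ap (ZZ u True False) (Ph w)" if "w : VP mu" for w by(rule neg, rule step[OF c(2) Vf VA Ph_f pp that, unfolded ad ap_minus])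
 have mm: "?z *. Ph (ap ?C w) = ap ?E (Ph w)" if "w : VP mu" for w proof -
  have "?z *. Ph (ap (?A - ?C) w) = ap (ZZ u True True - ?E) (Ph w)" by(rule two_cancel, rule step[OF c(3) Vf VB Ph_f mp that, unfolded ad])
  thus ?thesis unfolding ap_diff Ph_lin(2) vs_simps(5) pp[OF that] by(simp only: diff_left_imp_eq)
 qed
 show ?thesis using pp[OF v] mp[OF v] pm[OF v] mm[OF v] by(cases a; cases b) (simp_all add: ib_def)
qed

lemma lam_le: "i : {1..n} ==> lam i <= 0"
proof(induction i)
 case (Suc i)
 thus ?case using lam1 dom[of i] by(cases "i = 0") auto
qed simp

lemma ra_neg: "i : {1..n} ==> ra lam mu i <= - 1/2"
proof -
 assume i: "i : {1..n}"
 show ?thesis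
 proof(cases "i = 1")
  case False
  hence "lam (i - 1) <= 0" using i by(intro lam_le) auto
  hence "min (lam (i - 1)) (mu (i - 1)) <= 0" by simp
  hence "real_of_int (min (lam (i - 1)) (mu (i - 1))) <= 0" by linarith
  moreover have "real i >= 2" using i False by auto
  ultimately show ?thesis using False by(simp add: ra_def)
 qed (simp add: ra_def)
qed
lemma rb_ra: "i : {1..n} ==> ra lam mu i = rb n lam mu i + real (d i)"
proof -
 assume "i : {1..n}"
 hence "complex_of_real (ra lam mu i) = of_real (rb n lam mu i + real (d i))" using d[of i] unfolding al_ra be_rb by(simp add: alg)
 thus ?thesis by(simp only: of_real_eq_iff)
qed
text \<open>Together with \<open>rb_ra\<close> this orders the intervals from beta_i to alpha_i
  strictly downwards in i.\<close>

lemma ra_lt: "i : {1..n} ==> j : {1..n} ==> i < j ==> ra lam mu j < rb n lam mu i"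
proof(induction j)
 case (Suc j)
 show ?case
 proof(cases "i = j")
  case True
  thus ?thesis using Suc.prems by(auto simp: ra_def rb_def)
 next
  case False
  hence "ra lam mu j < rb n lam mu i" using Suc by auto
  moreover have "ra lam mu (Suc j) < rb n lam mu j" using Suc.prems by(auto simp: ra_def rb_def)
  ultimately show ?thesis using rb_ra[of j] Suc.prems by simp
 qed
qed simp

text \<open>The intervals are disjoint and all parameters are negative, so no difference or sum of
  two parameters takes a value that a \<open>p\<close> between 1 and \<open>d i\<close> would
  require.\<close>

lemma conds: "cond d (alph lam mu) (%i. - bet n lam mu i) rl" "cond d (%i. - bet n lam mu i) (alph lam mu) rl"
proof -
 let ?a = "ra lam mu" and ?b = "rb n lam mu"
 have nz: "z ~= 0" if "z = of_real r" "r ~= 0" for z :: complex and r using that by simp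
 have rl: "i : {1..n}" if "i : set rl" for i using that rl_set by blast
 have *: "cond d c c' rl" if c: "!!i. c i = of_real (a i)" "!!i. c' i = of_real (b i)"
  and 1: "!!i p. i : {1..n} ==> p : {1..d i} ==> 2 * real p - 1 - a i + b i - real (d i) ~= 0"
  and 2: "!!i j p. i : {1..n} ==> p : {1..d i} ==> j : {1..n} ==> j ~= i ==> real p - 1 - a i + a j - real (d j) ~= 0 & real p - 1 - a i + b j - real (d j) ~= 0"
  for c c' a b unfolding cond_def
 proof(intro ballI conjI impI)
  fix i p assume ip: "i : set rl" "p : {1..d i}"
  show "2 * of_nat p - 1 - c i + c' i - of_nat (d i) ~= 0" by(rule nz[OF _ 1[OF rl[OF ip(1)] ip(2)]]) (simp add: c)
  fix j assume j: "j : set rl" "j ~= i"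
  note 2 = 2[OF rl[OF ip(1)] ip(2) rl[OF j(1)] j(2)]
  show "of_nat p - 1 - c i + c j - of_nat (d j) ~= 0" by(rule nz[OF _ conjunct1[OF 2]]) (simp add: c)
  show "of_nat p - 1 - c i + c' j - of_nat (d j) ~= 0" by(rule nz[OF _ conjunct2[OF 2]]) (simp add: c)
 qed
 have L: "?b i < ?a i + 1 & ?a j < ?b i | ?a i < ?b j" if "i : {1..n}" "j : {1..n}" "j ~= i" for i j
  using ra_lt[of i j] ra_lt[of j i] rb_ra[of i] that by(cases "i < j") auto
 let ?A = "%i. - bet n lam mu i"
 show "cond d (alph lam mu) ?A rl" proof(rule *[OF al_ra, where b = "%i. - ?b i"])
  fix i p assume i: "i : {1..n}" "p : {1..d i}"
  show "2 * real p - 1 - ?a i + - ?b i - real (d i) ~= 0" using ra_neg[OF i(1)] rb_ra[OF i(1)] i(2) by auto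
  fix j assume j: "j : {1..n}" "j ~= i"
  show "real p - 1 - ?a i + ?a j - real (d j) ~= 0 & real p - 1 - ?a i + - ?b j - real (d j) ~= 0"
   using L[OF i(1) j] ra_neg[OF i(1)] ra_neg[OF j(1)] rb_ra[OF i(1)] rb_ra[OF j(1)] i(2) by auto
 qed (simp add: be_rb)
 show "cond d ?A (alph lam mu) rl" proof(rule *[where a = "%i. - ?b i", OF _ al_ra])
  fix i p assume i: "i : {1..n}" "p : {1..d i}"
  show "2 * real p - 1 - - ?b i + ?a i - real (d i) ~= 0" using ra_neg[OF i(1)] rb_ra[OF i(1)] i(2) by auto
  fix j assume j: "j : {1..n}" "j ~= i"
  show "real p - 1 - - ?b i + - ?b j - real (d j) ~= 0 & real p - 1 - - ?b i + ?a j - real (d j) ~= 0"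
   using L[OF i(1) j] ra_neg[OF i(1)] ra_neg[OF j(1)] rb_ra[OF i(1)] rb_ra[OF j(1)] i(2) by auto
 qed (simp add: be_rb)
qed

text \<open>The image is a nonzero submodule of an irreducible module. For large \<open>u\<close>
  its stability is that of \<open>VP mu\<close> under the resolvent entries; for the other
  \<open>u\<close> it follows from polynomial dependence.\<close>

lemma Ph_image: "Ph ` VP mu = HH d rl"
proof(rule Zm_irred[OF rl_set(2) conds])
 show sub: "csubspace (Ph ` VP mu)" proof(rule csubI)
  show "0 : Ph ` VP mu" using Ph_lin(4) csub_0[OF VP_sub] by(metis image_eqI)
  show "f + g : Ph ` VP mu" if fg: "f : Ph ` VP mu" "g : Ph ` VP mu" for f g proof -
   obtain x y where "f = Ph x" "g = Ph y" "x : VP mu" "y : VP mu" using fg by blast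
   thus ?thesis using csub_add[OF VP_sub, of x y] by(auto simp flip: Ph_lin(1))
  qed
  show "c *. f : Ph ` VP mu" if "f : Ph ` VP mu" for c f proof -
   obtain x where "f = Ph x" "x : VP mu" using \<open>f : Ph ` VP mu\<close> by blast
   thus ?thesis using csub_vs[OF VP_sub, of x c] by(auto simp flip: Ph_lin(3))
  qed
 qed
 show "Ph ` VP mu <= HH d rl" using Ph_HH HH_set[of "[1..<Suc n]" rl d] by(auto simp: rl_def simp del: upt_Suc)
 obtain v where "v : VP mu" "v ~= 0" using nz csub_0[OF VP_sub] by blast
 thus "Ph ` VP mu ~= {0}" using Ph_inj by blast
 fix u a b h assume "h : Ph ` VP mu"
 then obtain v where v: "h = Ph v" "v : VP mu" by blast
 show "ap (ZZ u a b) h : Ph ` VP mu" proof(rule PF_in_subspace[OF sub LP_PF[OF LP_Zm] infinite_big])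
  fix u assume u: "u : {u. R < cmod u}"
  let ?A = "ap (Gf u (ib a) (ib b)) v"
  have "ap (ZZ u a b) h = Ph (S0 u *. ?A)" using Ph_inter[of u v a b] u v by(simp add: Ph_lin)
  moreover have "S0 u *. ?A : VP mu" using u v(2) by(intro csub_vs[OF VP_sub] VP_teq[OF teqGf]) (auto simp: ib_def)
  ultimately show "ap (ZZ u a b) h : Ph ` VP mu" by blast
 qed
qed

lemma Ph_bij: "bij_betw Ph (VP mu) (HH d rl)"
proof(rule bij_betw_imageI[OF _ Ph_image], rule inj_onI)
 fix x y assume xy: "x : VP mu" "y : VP mu" "Ph x = Ph y"
 have "x + (- 1) *. y : VP mu" using xy csub_add[OF VP_sub] csub_vs[OF VP_sub] by blast
 moreover have "Ph (x + (- 1) *. y) = 0" using xy(3) by(simp add: Ph_lin vs_simps)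
 ultimately have "x + (- 1) *. y = 0" by(rule Ph_inj)
 thus "x = y" by(simp add: vs_simps)
qed

theorem branching:
 "EX phi. (ALL x:VP mu. ALL y:VP mu. phi (x + y) = phi x + phi y) & (ALL z. ALL x:VP mu. phi (z *. x) = z *. phi x)
   & bij_betw phi (VP mu) (HH d [1..<Suc n])
   & (ALL u a b. ALL x:VP mu. R < cmod u --> S0 u *. phi (ap (Gf u (ib a) (ib b)) x) = ap (Zm d (alph lam mu) (%i. - bet n lam mu i) [1..<Suc n] u a b) (phi x))"
proof -
 have s: "set rl = set [1..<Suc n]" "distinct [1..<Suc n]" by(auto simp: rl_def)
 have c: "- bet n lam mu i = of_nat (d i) - alph lam mu i" if "i : set rl" for i using d[of i] that rl_set(1) by(auto simp: alg)
 let ?C = "%i. - bet n lam mu i"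
 obtain psi where psi: "ALL x:HH d rl. ALL y:HH d rl. psi (x + y) = psi x + psi y" "ALL z. ALL x:HH d rl. psi (z *. x) = z *. psi x"
  "bij_betw psi (HH d rl) (HH d rl)"
  "ALL x:HH d rl. ALL u a b. psi (ap (ZZ u a b) x) = ap (Zm d (alph lam mu) ?C [1..<Suc n] u a b) (psi x)"
  using site_reorder[OF rl_set(2) s(2,1) c conds] by blast
 have PH: "Ph x : HH d rl" if "x : VP mu" for x using Ph_image that by blast
 let ?B = "psi \<circ> Ph"
 show ?thesis
 proof(intro exI[of _ "psi \<circ> Ph"] conjI ballI allI impI)
  show "bij_betw ?B (VP mu) (HH d [1..<Suc n])" using bij_betw_trans[OF Ph_bij psi(3)] HH_set[OF s(1), of d] by(simp del: upt_Suc)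
 next
  fix u a b x assume x: "x : VP mu" and u: "R < cmod u"
  let ?A = "Gf u (ib a) (ib b)"
  have G: "ap ?A x : VP mu" by(rule VP_teq[OF teqGf[OF u]]) (use x in "auto simp: ib_def")
  have "S0 u *. psi (Ph (ap ?A x)) = psi (S0 u *. Ph (ap ?A x))" using psi(2) PH[OF G] by simp
  thus "S0 u *. ?B (ap ?A x) = ap (Zm d (alph lam mu) ?C [1..<Suc n] u a b) (?B x)" using psi(4) PH[OF x] by(simp add: Ph_inter[OF u x] del: upt_Suc)
 qed (use psi(1,2) PH in "auto simp: Ph_lin")
qed

end

text \<open>\<open>good P T\<close> says that \<open>T\<close> preserves the kernel of \<open>1 - P\<close>, i.e. the symmetric tensors.\<close>

definition good :: "'x lop => 'x lop => bool" where "good P T <-> (1 - P) * T * (1 + P) = 0"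

section \<open>Fusion identities\<close>

lemma good_mult:
 assumes P: "P * P = 1" and S: "good P S" and T: "good P T" shows "good P (S * T)" proof -
 have h: "(1/2) *: (1 + P) + (1/2) *: (1 - P) = 1" by(rule lop_eqI, rule ext) (simp add: vl field_simps)
 let ?A = "(1 - P) * S * (1 - P)"
 let ?B = "(1/2) *: (1 + P) + (1/2) *: (1 - P)"
 have "(1 - P) * S * ?B = (1/2) *: ((1 - P) * S * (1 + P)) + (1/2) *: ?A" by(simp only: distrib_left scl_simps(2))
 also have "... = (1/2) *: ?A" using S unfolding good_def by simp
 finally have "(1 - P) * S * ?B = (1/2) *: ?A" .
 hence "(1 - P) * S = (1/2) *: ?A" unfolding h by simp
 hence "(1 - P) * S * T * (1 + P) = (1/2) *: ((1 - P) * S * ((1 - P) * T * (1 + P)))" by(metis mult.assoc scl_simps(1))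
 thus ?thesis using T by(simp add: good_def mult.assoc)
qed

lemma good_comm: "P * P = 1 ==> P * T = T * P ==> good P T"
proof -
 assume P: "P * P = 1" and c: "P * T = T * P"
 have "(1 - P) * T = T * (1 - P)" using c by(simp add: alg)
 hence "(1 - P) * T * (1 + P) = T * ((1 - P) * (1 + P))" by(simp add: mult.assoc)
 also have "(1 - P) * (1 + P) = 0" using P by(simp add: alg)
 finally show ?thesis by(simp add: good_def)
qed

lemma good_list: "P * P = 1 ==> (!!T. T : set L ==> good P T) ==> good P (prod_list L)" by(induction L) (auto intro: good_mult good_comm)

text \<open>Between \<open>1 - P\<close> and \<open>1 + P\<close> the three nontrivial terms of the
  product become the same operator \<open>Q\<close> up to sign, so a single scalar equation
  remains.\<close>

lemma good_fusion:
 assumes P: "P * P = 1" and a: "P * Ka = Kb * P" and b: "P * Kb = Ka * P" and ab: "Ka * Kb = P * Kb"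
  and xy: "- x + y + x * y = 0"
 shows "good P ((1 - x *: Ka) * (1 - y *: Kb))" proof -
 define Q where "Q = Ka + P * Kb - P * Ka - Kb"
 have PP: "P * (P * T) = T" for T using P by(simp flip: mult.assoc)
 have aP: "Ka * P = P * Kb" "Kb * P = P * Ka" using a b by simp_all
 have qa: "(1 - P) * Ka * (1 + P) = Q" by(simp add: Q_def alg aP PP)
 have qb: "(1 - P) * Kb * (1 + P) = - Q" by(simp add: Q_def alg aP PP)
 have qp: "(1 - P) * (P * Kb) * (1 + P) = Q" by(simp add: Q_def alg aP PP)
 have q1: "(1 - P) * 1 * (1 + P) = 0" using P by(simp add: alg)
 have "(1 - x *: Ka) * (1 - y *: Kb) = 1 - x *: Ka - y *: Kb + (x * y) *: (P * Kb)" by(simp add: alg scl_simps ab)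
 hence "(1 - P) * ((1 - x *: Ka) * (1 - y *: Kb)) * (1 + P) = (1 - P) * 1 * (1 + P) - x *: ((1 - P) * Ka * (1 + P)) - y *: ((1 - P) * Kb * (1 + P)) + (x * y) *: ((1 - P) * (P * Kb) * (1 + P))"
  by simp (rule lop_eqI, rule ext, simp add: vl alg)
 also have "... = (- x + y + x * y) *: Q" unfolding qa qb qp q1 by(rule lop_eqI, rule ext) (simp add: vl alg)
 finally show ?thesis unfolding xy good_def by simp
qed

text \<open>Moving \<open>P\<close> through the product replaces the claim by
  \<open>(1 - P) (T - T') = 0\<close>, where \<open>T'\<close> has \<open>F1\<close> and
  \<open>F2\<close> exchanged. The commutator \<open>FF\<close> reduces this to a multiple of
  \<open>(1 - P) (F1 - F2)\<close>, whose scalar vanishes by \<open>xy\<close>.\<close>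

lemma good_reflection:
 assumes P: "P * P = 1" and PF: "P * F1 = F2 * P" and PF': "P * F2 = F1 * P" and PK: "P * K = - K" and KP: "K * P = - K"
  and KF: "K * F2 = - (K * F1)" and FK: "F2 * K = - (F1 * K)"
  and FF: "F1 * F2 = F2 * F1 + P * (F2 - F1) + K * F1 - F1 * K"
  and xy: "x - y + x * y = 0"
 shows "good P ((1 + x *: F1) * (1 + (x / 2) *: K) * (1 + y *: F2))" proof -
 have PP: "P * (P * T) = T" for T using P by(simp flip: mult.assoc)
 let ?A = "1 + (x / 2) *: K"
 have FP: "F1 * P = P * F2" "F2 * P = P * F1" using PF PF' by simp_all
 let ?T = "(1 + x *: F1) * ?A * (1 + y *: F2)" and ?T' = "(1 + x *: F2) * ?A * (1 + y *: F1)"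
 have t1: "(1 + x *: F1) * P = P * (1 + x *: F2)" "(1 + y *: F2) * P = P * (1 + y *: F1)" "?A * P = P * ?A"
  by(simp_all add: distrib_left distrib_right scl_simps(1,2) FP PK KP)
 have TP: "?T * P = P * ?T'" proof -
  have "?T * P = (1 + x *: F1) * (?A * ((1 + y *: F2) * P))" by(simp only: mult.assoc)
  also have "... = (1 + x *: F1) * (?A * P * (1 + y *: F1))" unfolding t1(2) by(simp only: mult.assoc)
  also have "... = (1 + x *: F1) * P * (?A * (1 + y *: F1))" unfolding t1(3) by(simp only: mult.assoc)
  also have "... = P * ?T'" unfolding t1(1) by(simp only: mult.assoc)
  finally show ?thesis .
 qed
 have "(1 - P) * ?T * (1 + P) = (1 - P) * ?T * 1 + (1 - P) * ?T * P" by(rule distrib_left)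
 also have "... = (1 - P) * ?T + (1 - P) * (?T * P)" by(simp only: mult.assoc mult_1_right)
 also have "... = (1 - P) * ?T - (1 - P) * ?T'" unfolding TP by(simp add: left_diff_distrib PP)
 also have "... = (1 - P) * (?T - ?T')" by(simp add: right_diff_distrib)
 also have "?T - ?T' = (x - y) *: (F1 - F2) + (x * y) *: (F1 * F2 - F2 * F1) + (x * (x / 2)) *: (F1 * K - F2 * K) + ((x / 2) * y) *: (K * F2 - K * F1) + (x * (x / 2) * y) *: (F1 * (K * F2) - F2 * K * F1)"
  by(rule lop_eqI, rule ext) (simp add: vl alg)
 also have "... = (x - y) *: (F1 - F2) + (x * y) *: (P * (F2 - F1)) + (x * x - x * y) *: (F1 * K)" unfolding KF FK FF by(rule lop_eqI, rule ext) (simp add: vl alg)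
 also have "(1 - P) * ... = (x - y) *: ((1 - P) * (F1 - F2)) + (x * y) *: ((1 - P) * (P * (F2 - F1))) + (x * x - x * y) *: ((1 - P) * (F1 * K))"
  by(simp only: distrib_left scl_simps(2))
 also have "(1 - P) * (P * (F2 - F1)) = (1 - P) * (F1 - F2)" by(simp add: left_diff_distrib right_diff_distrib PP)
 also have "(1 - P) * (F1 * K) = 0" proof -
  have "P * (F1 * K) = F2 * (P * K)" by(simp add: PF flip: mult.assoc)
  also have "... = F1 * K" unfolding PK by(simp add: FK)
  finally show ?thesis by(simp add: left_diff_distrib)
 qed
 also have "(x - y) *: ((1 - P) * (F1 - F2)) + (x * y) *: ((1 - P) * (F1 - F2)) + (x * x - x * y) *: 0 = (x - y + x * y) *: ((1 - P) * (F1 - F2))"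
  by(simp add: scl_simps(7))
 finally show ?thesis unfolding xy good_def by simp
qed

section \<open>Operators on the tensor space\<close>

definition sl :: "('v \<times> 'b => complex) => 'b => 'v => complex" where "sl z a = (%y. z (y, a))"

lemma sl_simps [simp]: "sl (f + g) a = sl f a + sl g a" "sl (f - g) a = sl f a - sl g a" "sl (c *. f) a = c *. sl f a" "sl (- f) a = - sl f a" "sl 0 a = 0"
 by(auto simp: sl_def fun_eq_iff fa vs_apply)
lemma sl_sum: "sl (SUM x:A. f x) a = (SUM x:A. sl (f x) a)" by(induction A rule: infinite_finite_induct) auto
lemma sl_eqI: "(!!a. sl f a = sl g a) ==> f = g" by(auto simp: sl_def fun_eq_iff)
lemma lop_slI: "(!!z a. sl (ap S z) a = sl (ap T z) a) ==> S = T" by(intro lop_eqI sl_eqI)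
lemma sl_lv: "sl (ap (lv T) z) a = ap T (sl z a)" by(simp add: sl_def ap_lv)

text \<open>An operator given by its effect on slices. A tensor with values in the module is a
  function of an index function and a module coordinate, and a slice is its module component at one
  index function.\<close>

definition slop :: "('b => ('b => 'v => complex) => 'v => complex) => ('v \<times> 'b) lop" where
 "slop Phi = Lop (%z (y, a). Phi a (sl z) y)"

lemma sl_slop:
 fixes Phi :: "'b => ('b => 'v => complex) => 'v => complex"
 assumes "!!a f g. Phi a (%b. f b + g b) = Phi a f + Phi a g" "!!a c f. Phi a (%b. c *. f b) = c *. Phi a f"
 shows "sl (ap (slop Phi) z) a = Phi a (sl z)" proof -
 have e: "sl (f + g) = (%b. sl f b + sl g b)" "sl (%x. c * f x) = (%b. c *. sl f b)" for f g :: "'v \<times> 'b => complex" and c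
  by(auto simp: sl_def fun_eq_iff fa vs_apply)
 have "clin (%z (y, a). Phi a (sl z) y)" by(intro clinI ext) (auto simp: e assms fa vs_apply)
 thus ?thesis unfolding slop_def by(subst ap_Lop) (auto simp: sl_def[of "%(y, a). _ y a"])
qed

definition sw :: "nat => nat => (nat => 'a) => nat => 'a" where "sw k l a = a(k := a l, l := a k)"

definition Po :: "nat => nat => 'v tns lop" where
 "Po k l = slop (%a f. f (sw k l a))"
lemma sl_Po: "sl (ap (Po k l) z) a = sl z (sw k l a)" unfolding Po_def by(rule sl_slop) auto

lemma sw_sw [simp]: "sw k l (sw k l a) = a" by(auto simp: sw_def)
lemma sw_simps: "k ~= l ==> sw k l a k = a l" "k ~= l ==> sw k l a l = a k" "m ~= k ==> m ~= l ==> sw k l a m = a m"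
 "k ~= l ==> (sw k l a)(k := j) = sw k l (a(l := j))" "k ~= l ==> (sw k l a)(l := j) = sw k l (a(k := j))"
 "m ~= k ==> m ~= l ==> (sw k l a)(m := j) = sw k l (a(m := j))" by(auto simp: sw_def fun_eq_iff)
lemma Po_Po: "Po k l * Po k l = 1" by(rule lop_slI) (simp add: sl_Po)

lemma theta_mult: "j ~= 0 ==> theta i j * theta j k = theta i k" "j ~= 0 ==> theta i j * theta k j = theta i k"
 "j ~= 0 ==> theta j i * theta j k = theta i k" by(auto simp: theta_def sgn_if)
lemma theta_neg: "theta (- i) j = - theta i j" "theta i (- j) = - theta i j" by(simp_all add: theta_def sgn_minus)

lemma Iset_neg_sum: "(SUM j:Iset n. f (- j)) = (SUM j:Iset n. f j :: 'c::comm_monoid_add)" by(rule sum.reindex_bij_witness[of _ uminus uminus]) auto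

context sp_rep
begin

abbreviation "NN == 2 * n"

text \<open>Index functions are total, so the places from 2n on are pinned to 0; this matches them
  one to one with the lists in the definition of the determinant.\<close>

definition ok :: "(nat => int) => bool" where "ok a <-> (ALL r. if r < 2 * n then a r : I else a r = 0)"

lemma okD: "ok a ==> k < 2 * n ==> a k : I" unfolding ok_def by metis
lemma ok_upd: "ok a ==> k < 2 * n ==> j : I ==> ok (a(k := j))" unfolding ok_def by auto
lemma ok_sw: "k < 2 * n ==> l < 2 * n ==> ok (sw k l a) = ok a"
proof -
 assume k: "k < NN" "l < NN"
 have "ok (sw k l a)" if "ok a" for a unfolding ok_def sw_def using that k unfolding ok_def by auto
 from this[of a] this[of "sw k l a"] show ?thesis by auto
qed

definition Fo :: "nat => 'v tns lop" where
 "Fo k = slop (%a f. if ok a then SUM j:I. ap (F (a k) j) (f (a(k := j))) else 0)"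
text \<open>The contraction contained in \<open>Rt\<close>: on tensor places k and l,
  \<open>Rt w\<close> is 1 minus this operator divided by \<open>w\<close>
  (\<open>rep_R\<close>).\<close>

definition Ko :: "nat => nat => 'v tns lop" where
 "Ko k l = slop (%a f. if ok a & a k = - a l then SUM j:I. theta (a l) j *. f (a(k := - j, l := j)) else 0)"
definition Uo :: "nat => int => int => 'v tns lop" where
 "Uo k i j = slop (%a f. if ok a & a k = i then f (a(k := j)) else 0)"

lemma sl_Fo: "sl (ap (Fo k) z) a = (if ok a then SUM j:I. ap (F (a k) j) (sl z (a(k := j))) else 0)"
 unfolding Fo_def by(rule sl_slop) (auto simp: ap_vadd ap_vs sum.distrib vs_sum)
lemma sl_Ko: "sl (ap (Ko k l) z) a = (if ok a & a k = - a l then SUM j:I. theta (a l) j *. sl z (a(k := - j, l := j)) else 0)"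
 unfolding Ko_def by(rule sl_slop) (auto simp: vs_simps sum.distrib vs_sum mult.commute)
lemma sl_Uo: "sl (ap (Uo k i j) z) a = (if ok a & a k = i then sl z (a(k := j)) else 0)" unfolding Uo_def by(rule sl_slop) auto

lemma Po_Fo: assumes "k < NN" "l < NN" "k ~= l"
 shows "Po k l * Fo k = Fo l * Po k l" "Po k l * Fo l = Fo k * Po k l" using assms by(auto intro!: lop_slI simp: sl_Po sl_Fo ok_sw sw_simps)

lemma Po_Fo2: assumes "k < NN" "l < NN" "k ~= l" "m ~= k" "m ~= l" shows "Po k l * Fo m = Fo m * Po k l"
 using assms by(auto intro!: lop_slI simp: sl_Po sl_Fo ok_sw sw_simps)

lemma Ko_sym: assumes "k ~= l" shows "Ko k l = Ko l k"
proof(rule lop_slI)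
 fix z :: "'v tnv" and a
 have "(SUM j:I. theta (a l) j *. sl z (a(k := - j, l := j))) = (SUM j:I. theta (- a l) j *. sl z (a(l := - j, k := j)))"
  using Iset_neg_sum[of "%j. theta (- a l) j *. sl z (a(l := - j, k := j))" n] assms by(simp add: theta_neg fun_upd_twist)
 thus "sl (ap (Ko k l) z) a = sl (ap (Ko l k) z) a" by(auto simp: sl_Ko)
qed

lemma Po_Ko: assumes "k < NN" "l < NN" "k ~= l"
 shows "Po k l * Ko k l = - Ko k l" "Ko k l * Po k l = - Ko k l" proof -
 show P: "Po k l * Ko k l = - Ko k l" proof(rule lop_slI)
  fix z :: "'v tnv" and a
  have "sl z (sw k l (a(l := - j, k := j))) = sl z (a(k := - j, l := j))" for j using assms by(simp add: sw_def fun_upd_twist)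
  thus "sl (ap (Po k l * Ko k l) z) a = sl (ap (- Ko k l) z) a" using assms by(auto simp: sl_Po sl_Ko ok_sw sw_simps theta_neg vs_simps sum_negf)
 qed
 show "Ko k l * Po k l = - Ko k l" proof(rule lop_slI)
  fix z :: "'v tnv" and a
  have "sl z (sw k l (a(k := - j, l := j))) = sl z (a(k := j, l := - j))" for j using assms by(simp add: sw_def fun_upd_twist)
  moreover have "(SUM j:I. theta (a l) j *. sl z (a(k := j, l := - j))) = (SUM j:I. - (theta (a l) j *. sl z (a(k := - j, l := j))))"
   using Iset_neg_sum[of "%j. - (theta (a l) j *. sl z (a(k := - j, l := j)))" n] by(simp add: theta_neg vs_simps)
  ultimately show "sl (ap (Ko k l * Po k l) z) a = sl (ap (- Ko k l) z) a" by(simp add: sl_Ko sl_Po sum_negf)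
 qed
qed

lemma Po_Ko2: assumes "k < NN" "l < NN" "k ~= l" "j ~= k" "j ~= l"
 shows "Po k l * Ko j k = Ko j l * Po k l" "Po k l * Ko j l = Ko j k * Po k l" using assms by(auto intro!: lop_slI simp: sl_Po sl_Ko ok_sw sw_simps)

lemma Po_Ko3: assumes "k < NN" "l < NN" "k ~= l" "j ~= k" "j ~= l" "i ~= k" "i ~= l"
 shows "Po k l * Ko i j = Ko i j * Po k l" using assms by(auto intro!: lop_slI simp: sl_Po sl_Ko ok_sw sw_simps)

text \<open>Two contractions sharing the place \<open>j\<close> merely carry the index from one of
  the other two places to the other.\<close>

lemma Ko_Ko: assumes "j < NN" "k < NN" "l < NN" "j ~= k" "j ~= l" "k ~= l"
 shows "Ko j k * Ko j l = Po k l * Ko j l" proof(rule lop_slI)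
 fix z :: "'v tnv" and a
 let ?A = "sl (ap (Po k l * Ko j l) z) a"
 let ?C = "sl (ap (Ko j k * Ko j l) z) a"
 show "?C = ?A" proof(cases "ok a & a j = - a k")
  case False
  thus ?thesis using assms by(auto simp: sl_Ko sl_Po ok_sw) (auto simp: sw_def)
 next
  case True
  have al: "a l : I" using True assms by(auto intro: okD)
  let ?g = "%q. sl z (a(k := a l, j := - q, l := q))"
  let ?B = "SUM q:I. theta (a l) q *. ?g q"
  have "?C = (SUM p:I. theta (a k) p *. sl (ap (Ko j l) z) (a(j := - p, k := p)))" using True by(simp add: sl_Ko)
  also have "... = (SUM p:I. if p = a l then theta (a k) (a l) *. ?B else 0)" proof(intro sum.cong refl)
   fix p assume p: "p : I"
   let ?D = "a(j := - p, k := p)"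
   have "ok ?D" using True assms p by(intro ok_upd) auto
   moreover have "a(j := - a l, k := a l, j := - q, l := q) = a(k := a l, j := - q, l := q)" for q using assms by(simp add: fun_upd_twist)
   ultimately show "theta (a k) p *. sl (ap (Ko j l) z) ?D = (if p = a l then theta (a k) (a l) *. ?B else 0)" using assms by(auto simp: sl_Ko)
  qed
  also have "... = (SUM q:I. theta (a k) q *. ?g q)" using al Iset_nz[OF al] by(simp add: vs_sum vs_simps theta_mult)
  also have "... = ?A" proof -
   have "(sw k l a)(j := - q, l := q) = a(k := a l, j := - q, l := q)" for q using assms by(auto simp: sw_def fun_eq_iff)
   hence "?A = (SUM q:I. theta (sw k l a l) q *. ?g q)" using True assms by(simp add: sl_Po sl_Ko ok_sw) (simp add: sw_simps(1-3))
   thus ?thesis using assms by(simp add: sw_simps)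
  qed
  finally show ?thesis .
 qed
qed

text \<open>The relation between \<open>F (- b) (- a)\<close> and \<open>F a b\<close> lets
  \<open>F\<close> move from one end of the contraction to the other with a sign.\<close>

lemma Ko_Fo: assumes "k < NN" "l < NN" "k ~= l"
 shows "Ko k l * Fo l = - (Ko k l * Fo k)" "Fo l * Ko k l = - (Fo k * Ko k l)" proof -
 show "Ko k l * Fo l = - (Ko k l * Fo k)" proof(rule lop_slI)
  fix z :: "'v tnv" and a
  let ?D = "sl (ap (- (Ko k l * Fo k)) z) a"
  let ?E = "sl (ap (Ko k l * Fo l) z) a"
  show "?E = ?D" proof(cases "ok a & a k = - a l")
   case False
   thus ?thesis by(auto simp: sl_Ko)
  next
   case True
   let ?g = "%j q. sl z (a(k := j, l := q))"
   have okj: "ok (a(k := - j, l := j))" if "j : I" for j using True assms that by(intro ok_upd) auto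
   have "?E = (SUM j:I. SUM q:I. theta (a l) j *. ap (F j q) (?g (- j) q))" using True assms okj by(simp add: sl_Ko sl_Fo vs_sum)
   also have "... = (SUM j:I. SUM q:I. - (theta (a l) q *. ap (F (- q) (- j)) (?g (- j) q)))" proof(intro sum.cong refl)
    fix j q assume jq: "j : I" "q : I"
    show "theta (a l) j *. ap (F j q) (?g (- j) q) = - (theta (a l) q *. ap (F (- q) (- j)) (?g (- j) q))"
     unfolding sym[OF jq] using theta_mult(2)[OF Iset_nz[OF jq(2)], of "a l" j] by(simp add: vs_simps)
   qed
   also have "... = (SUM j:I. SUM q:I. - (theta (a l) q *. ap (F (- q) j) (?g j q)))" by(rule Iset_neg_sum)
   also have "... = - (SUM q:I. SUM j:I. theta (a l) q *. ap (F (- q) j) (?g j q))" by(simp add: sum_negf) (rule sum.swap)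
   also have "... = ?D" using True assms okj by(simp add: sl_Ko sl_Fo vs_sum fun_upd_twist)
   finally show ?thesis .
  qed
 qed
 show "Fo l * Ko k l = - (Fo k * Ko k l)" proof(rule lop_slI)
  fix z :: "'v tnv" and a
  let ?G = "sl (ap (Fo l * Ko k l) z) a"
  show "?G = sl (ap (- (Fo k * Ko k l)) z) a" proof(cases "ok a")
   case False
   thus ?thesis by(auto simp: sl_Fo)
  next
   case True
   have ak: "a k : I" "a l : I" using True assms by(auto intro: okD)
   let ?h = "SUM j:I. theta (a l) j *. sl z (a(k := - j, l := j))"
   let ?A = "theta (a k) (a l)"
   let ?B = "ap (F (a k) (- a l)) ?h"
   let ?C = "F (a l) (- a k)"
   have "?G = (SUM q:I. if q = - a k then ap ?C (- (?A *. ?h)) else 0)" unfolding ap_mult sl_Fo using True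
   proof(simp only: if_True, intro sum.cong refl)
    fix q assume q: "q : I"
    have o: "ok (a(l := q))" using True assms q by(intro ok_upd)
    have "(SUM j:I. theta (- a k) j *. sl z (a(k := - j, l := j))) = - (?A *. ?h)"
     using theta_mult(1)[OF Iset_nz[OF ak(2)], of "a k"] by(simp add: vs_sum vs_simps theta_neg sum_negf)
    thus "ap (F (a l) q) (sl (ap (Ko k l) z) (a(l := q))) = (if q = - a k then ap ?C (- (?A *. ?h)) else 0)" using o assms by(auto simp: sl_Ko fun_upd_twist)
   qed
   also have "... = - (?A *. ap ?C ?h)" using ak by(simp add: ap_vminus ap_vs)
   also have "... = - ?B" using sym[of "a k" "- a l"] ak theta_mult(2)[OF Iset_nz[OF ak(2)], of "a k" "a k"] theta_same(1)[OF Iset_nz[OF ak(1)]]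
    by(simp add: theta_neg vs_simps)
   also have "... = - (SUM q:I. if q = - a l then ?B else 0)" using ak by simp
   also have "... = - sl (ap (Fo k * Ko k l) z) a" unfolding ap_mult sl_Fo using True
   proof(simp only: if_True, intro arg_cong[where f = uminus] sum.cong refl)
    fix q assume q: "q : I"
    have o: "ok (a(k := q))" using True assms q by(intro ok_upd)
    thus "(if q = - a l then ?B else 0) = ap (F (a k) q) (sl (ap (Ko k l) z) (a(k := q)))" using assms by(auto simp: sl_Ko)
   qed
   finally show ?thesis by simp
  qed
 qed
qed

text \<open>The commutation relations of sp(2n) as one identity: the permutation gives the terms of
  gl type, the contraction those with negated indices.\<close>

lemma Fo_Fo: assumes "k < NN" "l < NN" "k ~= l"
 shows "Fo k * Fo l = Fo l * Fo k + Po k l * (Fo l - Fo k) + Ko k l * Fo k - Fo k * Ko k l" proof(rule lop_slI)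
 fix z :: "'v tnv" and a
 let ?A = "sl (ap (Fo l * Fo k + Po k l * (Fo l - Fo k) + Ko k l * Fo k - Fo k * Ko k l) z) a"
 let ?H = "sl (ap (Fo k * Fo l) z) a"
 show "?H = ?A" proof(cases "ok a")
  case False
  thus ?thesis using assms by(auto simp: sl_Fo sl_Po sl_Ko ok_sw)
 next
  case True
  have ak: "a k : I" "a l : I" using True assms by(auto intro: okD)
  let ?g = "%i j. sl z (a(k := i, l := j))"
  have o: "ok (a(k := j))" "ok (a(l := j))" if "j : I" for j using True assms that by(auto intro: ok_upd)
  have o2: "ok (a(k := - j, l := j))" if "j : I" for j using True assms that by(intro ok_upd) auto
  have kl: "?H = (SUM i:I. SUM j:I. ap (F (a k) i * F (a l) j) (?g i j))" using True o assms by(simp add: sl_Fo ap_vsum)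
  let ?G = "SUM i:I. SUM j:I. ap (F (a l) j * F (a k) i) (?g i j)"
  let ?K = "sl (ap (Fo l * Fo k) z) a"
  have lk: "?K = ?G" proof -
   have "?K = (SUM j:I. SUM i:I. ap (F (a l) j * F (a k) i) (?g i j))" using True o assms by(simp add: sl_Fo ap_vsum fun_upd_twist)
   also have "... = ?G" by(rule sum.swap)
   finally show ?thesis .
  qed
  let ?L = "SUM j:I. ap (F (a k) j) (?g (a l) j)"
  let ?N = "sl (ap (Po k l * Fo l) z) a"
  have p1: "?N = ?L" proof -
   have "sw k l (a(k := j)) = a(k := a l, l := j)" for j using assms by(auto simp: sw_def fun_eq_iff)
   thus ?thesis using True assms by(simp add: sl_Po sl_Fo ok_sw sw_simps)
  qed
  let ?M = "SUM i:I. ap (F (a l) i) (?g i (a k))"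
  let ?P = "sl (ap (Po k l * Fo k) z) a"
  have p2: "?P = ?M" proof -
   have "sw k l (a(l := j)) = a(k := j, l := a k)" for j using assms by(auto simp: sw_def fun_eq_iff)
   thus ?thesis using True assms by(simp add: sl_Po sl_Fo ok_sw sw_simps)
  qed
  let ?D = "sl (ap (Ko k l * Fo k) z) a"
  have k1: "?D = (if a k = - a l then SUM i:I. SUM j:I. - (theta (a k) i *. ap (F (- i) j) (?g i j)) else 0)" proof(cases "a k = - a l")
   case t: True
   let ?Q = "sl (ap (Ko k l * Fo l) z) a"
   have "?D = - ?Q" unfolding Ko_Fo(1)[OF assms] by simp
   also have "?Q = (SUM i:I. theta (a l) i *. (SUM j:I. ap (F i j) (?g (- i) j)))" using True t assms o2 by(simp add: sl_Ko sl_Fo)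
   also have "... = (SUM i:I. theta (a l) (- i) *. (SUM j:I. ap (F (- i) j) (?g i j)))"
    using Iset_neg_sum[of "%i. theta (a l) (- i) *. (SUM j:I. ap (F (- i) j) (?g i j))" n] by simp
   finally show ?thesis using t by(simp add: vs_sum sum_negf theta_neg vs_simps)
  qed (use True assms in "simp add: sl_Ko")
  let ?C = "F (a l) (- a k)"
  let ?E = "sl (ap (Fo k * Ko k l) z) a"
  have k2: "?E = (SUM i:I. - (theta (a k) i *. ap ?C (?g i (- i))))" proof -
   let ?B = "SUM j:I. theta (- a k) j *. ?g (- j) j"
   let ?R = "sl (ap (Fo l * Ko k l) z) a"
   have "?E = - ?R" unfolding Ko_Fo(2)[OF assms] by simp
   also have "?R = (SUM q:I. if q = - a k then ap ?C ?B else 0)" unfolding ap_mult sl_Fo using True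
   proof(simp only: if_True, intro sum.cong refl)
    fix q assume q: "q : I"
    show "ap (F (a l) q) (sl (ap (Ko k l) z) (a(l := q))) = (if q = - a k then ap ?C ?B else 0)" using o(2)[OF q] assms by(auto simp: sl_Ko fun_upd_twist)
   qed
   also have "... = ap ?C ?B" using ak by simp
   also have "?B = (SUM j:I. theta (a k) j *. ?g j (- j))" using Iset_neg_sum[of "%j. theta (a k) j *. ?g j (- j)" n] by(simp add: theta_neg)
   finally show ?thesis by(simp add: ap_vsum ap_vs sum_negf)
  qed
  have "?H = (SUM i:I. SUM j:I. ap (F (a l) j * F (a k) i) (?g i j)
    + (if i = a l then ap (F (a k) j) (?g (a l) j) else 0) - (if j = a k then ap (F (a l) i) (?g i (a k)) else 0)
    + (if a k = - a l then - (theta (a k) i *. ap (F (- i) j) (?g i j)) else 0)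
    - (if j = - i then - (theta (a k) i *. ap ?C (?g i (- i))) else 0))" unfolding kl proof(intro sum.cong refl)
   fix i j assume ij: "i : I" "j : I"
   show "ap (F (a k) i * F (a l) j) (?g i j) = ap (F (a l) j * F (a k) i) (?g i j)
    + (if i = a l then ap (F (a k) j) (?g (a l) j) else 0) - (if j = a k then ap (F (a l) i) (?g i (a k)) else 0)
    + (if a k = - a l then - (theta (a k) i *. ap (F (- i) j) (?g i j)) else 0)
    - (if j = - i then - (theta (a k) i *. ap ?C (?g i (- i))) else 0)" unfolding comm[OF ak(1) ij(1) ak(2) ij(2)] by(auto simp: kd_def vs_simps)
  qed
  also have "... = ?A" proof -
   have s1: "(SUM i:I. SUM j:I. if i = a l then ap (F (a k) j) (?g (a l) j) else 0) = ?L" using ak by(subst sum.swap) simp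
   have s2: "(SUM i:I. SUM j:I. if j = a k then ap (F (a l) i) (?g i (a k)) else 0) = ?M" using ak by simp
   have s3: "(SUM i:I. SUM j:I. if a k = - a l then - (theta (a k) i *. ap (F (- i) j) (?g i j)) else 0) = ?D" unfolding k1 by simp
   have s4: "(SUM i:I. SUM j:I. if j = - i then - (theta (a k) i *. ap ?C (?g i (- i))) else 0) = ?E" unfolding k2 by simp
   have "?A
    = ?K + (?N - ?P) + ?D - ?E" by(simp add: right_diff_distrib)
   thus ?thesis unfolding sum.distrib sum_subtractf s1 s2 s3 s4 lk p1 p2 by(simp add: alg)
  qed
  finally show ?thesis .
 qed
qed

end

lemma sw_sym: "sw k l a = sw l k a" by(auto simp: sw_def fun_eq_iff)
lemma Po_sym: "Po k l = Po l k" by(rule lop_slI) (simp only: sl_Po sw_sym[of k l])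

lemma Po_conj: "p < q ==> Po q (Suc q) * Po p q * Po q (Suc q) = Po p (Suc q)"
 by(rule lop_slI, simp add: sl_Po, rule arg_cong[where f = "sl _"]) (auto simp: sw_def fun_eq_iff)

definition bs :: "(nat => int) => ('v => complex) => 'v tnv" where
 "bs c v = (%(y, a). if a = c then v y else 0)"

lemma sl_bs: "sl (bs c v) a = (if a = c then v else 0)" by(auto simp: sl_def bs_def fun_eq_iff fa)

lemma bs_lin: "bs c (f + g) = bs c f + bs c g" "bs c (z *. f) = z *. bs c f" "bs c 0 = 0" "bs c (- f) = - bs c f" by(rule sl_eqI; simp add: sl_bs)+

lemma ap_Po_bs: "ap (Po p q) (bs c v) = bs (sw p q c) v"
proof -
 have "sw p q a = c <-> a = sw p q c" for a using sw_sw[of p q] by metis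
 thus ?thesis by(intro sl_eqI) (simp add: sl_Po sl_bs)
qed

section \<open>The product in the Sklyanin determinant\<close>

context sp_rep
begin

abbreviation "SN == {sigma. sigma permutes {..<NN}}"

lemma Ko_Fo_comm: assumes "k < NN" "l < NN" "m < NN" "m ~= k" "m ~= l" "k ~= l" shows "Ko k l * Fo m = Fo m * Ko k l"
proof(rule lop_slI)
 fix z :: "'v tnv" and a
 let ?A = "sl (ap (Ko k l * Fo m) z) a"
 let ?B = "sl (ap (Fo m * Ko k l) z) a"
 show "?A = ?B" proof(cases "ok a & a k = - a l")
  case False
  thus ?thesis using assms ok_upd by(auto simp: sl_Ko sl_Fo intro!: sum.neutral)
 next
  case True
  let ?g = "%j q. sl z (a(k := - j, l := j, m := q))"
  have o: "ok (a(k := - j, l := j))" if "j : I" for j using True assms that by(intro ok_upd) auto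
  have o2: "ok (a(m := j))" if "j : I" for j using True assms that by(intro ok_upd) auto
  have "?A = (SUM j:I. SUM q:I. theta (a l) j *. ap (F (a m) q) (?g j q))" using True assms o by(simp add: sl_Ko sl_Fo vs_sum)
  also have "... = (SUM q:I. SUM j:I. theta (a l) j *. ap (F (a m) q) (?g j q))" by(rule sum.swap)
  also have "... = ?B" proof -
   have "a(m := q, k := - j, l := j) = a(k := - j, l := j, m := q)" for q j using assms by(auto simp: fun_eq_iff)
   thus ?thesis using True assms o2 by(simp add: sl_Ko sl_Fo ap_vsum ap_vs)
  qed
  finally show ?thesis .
 qed
qed

lemma Ko_Ko_comm: assumes "k < NN" "l < NN" "p < NN" "q < NN" "k ~= l" "p ~= q" "p ~= k" "p ~= l" "q ~= k" "q ~= l"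
 shows "Ko k l * Ko p q = Ko p q * Ko k l" proof(rule lop_slI)
 fix z :: "'v tnv" and a
 have o: "ok (a(k := - j, l := j))" "ok (a(p := - j, q := j))" if "j : I" "ok a" for j using assms that by(auto intro!: ok_upd)
 let ?A = "sl (ap (Ko k l * Ko p q) z) a"
 let ?B = "sl (ap (Ko p q * Ko k l) z) a"
 show "?A = ?B" proof(cases "ok a & a k = - a l & a p = - a q")
  case False
  thus ?thesis using assms o by(auto simp: sl_Ko intro!: sum.neutral)
 next
  case True
  let ?g = "%i j. (theta (a l) i * theta (a q) j) *. sl z (a(k := - i, l := i, p := - j, q := j))"
  have "?A = (SUM i:I. SUM j:I. ?g i j)" using True assms o by(simp add: sl_Ko vs_sum vs_simps)
  also have "... = (SUM j:I. SUM i:I. ?g i j)" by(rule sum.swap)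
  also have "... = ?B" proof -
   have "a(p := - j, q := j, k := - i, l := i) = a(k := - i, l := i, p := - j, q := j)" for i j using assms by(auto simp: fun_eq_iff)
   thus ?thesis using True assms o by(simp add: sl_Ko vs_sum vs_simps mult.commute)
  qed
  finally show ?thesis .
 qed
qed

text \<open>Places are numbered from 0: the factor S_{k+1}(u - k) has the denominator u - k - 1/2,
  and the argument -2u + I + J - 2 becomes -2u + k + l.\<close>

definition Sx :: "complex => nat => 'v tns lop" where
 "Sx u k = 1 + (1 / (u - of_nat k - 1/2)) *: Fo k"
definition Rx :: "complex => nat => nat => 'v tns lop" where
 "Rx u k l = 1 - (1 / (- 2 * u + of_nat k + of_nat l)) *: Ko k l"
definition Xf :: "complex => nat => 'v tns lop" where
 "Xf u k = Sx u k * prod_list (map (Rx u k) [Suc k..<NN])"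
definition XX :: "complex => nat => 'v tns lop" where
 "XX u m = prod_list (map (Xf u) [0..<m])"

text \<open>Excludes the poles of all factors of \<open>XX u NN\<close>: their denominators vanish
  only where 2u is one of these integers.\<close>

definition gen :: "complex => bool" where
 "gen u <-> (ALL m<=2 * NN + 1. 2 * u ~= of_nat m)"

lemma gen_nz: assumes u: "gen u" and k: "k <= NN"
 shows "u - of_nat k - 1/2 ~= 0" "l <= NN ==> - 2 * u + of_nat k + of_nat l ~= 0" proof -
 show "u - of_nat k - 1/2 ~= 0" proof
  assume "u - of_nat k - 1/2 = 0"
  hence "2 * u = of_nat (2 * k + 1)" by(simp add: field_simps)
  moreover have "2 * k + 1 <= 2 * NN + 1" using k by simp
  ultimately show False using u unfolding gen_def by blast
 qed
 assume l: "l <= NN"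
 show "- 2 * u + of_nat k + of_nat l ~= 0" proof
  assume "- 2 * u + of_nat k + of_nat l = 0"
  hence "2 * u = of_nat (k + l)" by(simp add: alg)
  moreover have "k + l <= 2 * NN + 1" using k l by simp
  ultimately show False using u unfolding gen_def by blast
 qed
qed

lemma inv_rel: "w ~= 0 ==> w + 1 ~= 0 ==> - (1 / w) + 1 / (w + 1) + 1 / w * (1 / (w + 1)) = (0 :: complex)" by(simp add: field_simps)

lemma inv_rel2: "w ~= 0 ==> w + x ~= 0 ==> 1 / (w + x) + 1 / w * (1 / (w + x)) * x = 1 / (w :: complex)"
proof -
 assume w: "w ~= 0" "w + x ~= 0"
 define y where "y = 1 / (w + x)"
 have "y + 1 / w * y * x = (1 / w) * ((w + x) * y)" using w(1) by(simp add: distrib_right distrib_left)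
 also have "(w + x) * y = 1" using w(2) by(simp add: y_def)
 finally show ?thesis unfolding y_def by simp
qed
lemma inv_rel3: "1 / (- 2 * a) = - ((1 / a) / (2 :: complex))" by simp

lemma inv_rel4: "1 + l / a - - (1 / (2 * a)) * 2 = 1 + (1 + l) / (a :: complex)" by(simp add: add_divide_distrib)

lemma commP:
 assumes "P * T = T * (P :: 'x lop)" shows "P * (1 - c *: T) = (1 - c *: T) * P" "P * (1 + c *: T) = (1 + c *: T) * P" using assms by(simp_all add: alg scl_simps)

text \<open>The arguments of the two factors differ by 1, and reciprocals of such numbers satisfy
  the scalar equation of \<open>good_fusion\<close> (\<open>inv_rel\<close>).\<close>

lemma good_R_left:
 assumes u: "gen u" and j: "j < NN" "j ~= l" "j ~= Suc l" and l: "Suc l < NN"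
 shows "good (Po l (Suc l)) (Rx u j l * Rx u j (Suc l))" proof -
 let ?w = "- 2 * u + of_nat j + of_nat l"
 have w: "?w ~= 0" "?w + 1 ~= 0" "- 2 * u + of_nat j + of_nat (Suc l) = ?w + 1" using gen_nz(2)[OF u, of j l] gen_nz(2)[OF u, of j "Suc l"] j l by(simp_all add: alg)
 show ?thesis unfolding Rx_def w(3) by(rule good_fusion[OF Po_Po _ _ _ inv_rel[OF w(1,2)]]) (use j l in "auto intro!: Po_Ko2 Ko_Ko")
qed

lemma good_R_right:
 assumes u: "gen u" and j: "j < NN" "j ~= l" "j ~= Suc l" and l: "Suc l < NN"
 shows "good (Po l (Suc l)) (Rx u l j * Rx u (Suc l) j)" proof -
 have "Rx u l j = Rx u j l" "Rx u (Suc l) j = Rx u j (Suc l)" using j by(simp_all add: Rx_def Ko_sym[of _ j] alg)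
 thus ?thesis using good_R_left[OF assms] by simp
qed

lemma good_Sx: "Suc l < NN ==> k ~= l ==> k ~= Suc l ==> good (Po l (Suc l)) (Sx u k)" unfolding Sx_def by(rule good_comm[OF Po_Po], rule commP, rule Po_Fo2) auto

lemma good_Rx: "Suc l < NN ==> j ~= l ==> j ~= Suc l ==> i ~= l ==> i ~= Suc l ==> good (Po l (Suc l)) (Rx u i j)"
 unfolding Rx_def by(rule good_comm[OF Po_Po], rule commP, rule Po_Ko3) auto

lemma good_Xf_less:
 assumes u: "gen u" and l: "Suc l < NN" and j: "j < l"
 shows "good (Po l (Suc l)) (Xf u j)" proof -
 have L: "[Suc j..<NN] = [Suc j..<l] @ [l, Suc l] @ [Suc (Suc l)..<NN]" proof -
  have "[Suc j..<NN] = [Suc j..<l] @ [l..<NN]" using j l upt_add_eq_append[of "Suc j" l "NN - l"] by simp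
  moreover have "[l..<NN] = l # Suc l # [Suc (Suc l)..<NN]" using l by(simp add: upt_conv_Cons)
  ultimately show ?thesis by simp
 qed
 have "prod_list (map (Rx u j) [Suc j..<NN]) = prod_list (map (Rx u j) [Suc j..<l]) * ((Rx u j l * Rx u j (Suc l)) * prod_list (map (Rx u j) [Suc (Suc l)..<NN]))"
  unfolding L by(simp add: mult.assoc)
 moreover have "good (Po l (Suc l)) ..." using j l u by(intro good_mult[OF Po_Po] good_list[OF Po_Po] good_R_left) (auto intro!: good_Rx)
 ultimately show ?thesis unfolding Xf_def using j l by(intro good_mult[OF Po_Po] good_Sx) auto
qed

lemma good_Xf_greater: "Suc l < NN ==> Suc l < j ==> good (Po l (Suc l)) (Xf u j)"
 unfolding Xf_def by(intro good_mult[OF Po_Po] good_list[OF Po_Po] good_Sx) (auto intro!: good_Rx)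

lemma prod_list_commute: "(!!T. T : set L ==> S * T = T * (S :: 'a :: ring_1)) ==> S * prod_list L = prod_list L * S" by(induction L) (simp_all, metis mult.assoc)

lemma prod_list_merge:
 assumes "distinct L" "!!i j. i : set L ==> j : set L ==> i ~= j ==> f i * g j = g j * (f i :: 'a :: ring_1)"
 shows "prod_list (map f L) * prod_list (map g L) = prod_list (map (%l. f l * g l) L)" using assms proof(induction L)
 case (Cons l L)
 let ?A = "prod_list (map f L)"
 have "g l * ?A = ?A * g l" proof(rule prod_list_commute)
  fix T assume "T : set (map f L)"
  then obtain x where x: "T = f x" "x : set L" by auto
  have "f x * g l = g l * f x" by(rule Cons.prems(2)) (use x Cons.prems(1) in auto)
  thus "g l * T = T * g l" by(simp add: x)
 qed
 hence "f l * ?A * (g l * prod_list (map g L)) = f l * g l * (?A * prod_list (map g L))" by(metis mult.assoc)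
 thus ?case using Cons by simp
qed simp

text \<open>The R-matrices from place l to places beyond l + 1 commute with
  \<open>Sx u (Suc l)\<close> and can be interleaved with those from l + 1. This isolates one block
  for \<open>good_reflection\<close> and pairs for \<open>good_fusion\<close>.\<close>

lemma good_Xf_pair:
 assumes u: "gen u" and l: "Suc l < NN"
 shows "good (Po l (Suc l)) (Xf u l * Xf u (Suc l))" proof -
 let ?L = "[Suc (Suc l)..<NN]"
 let ?P = "prod_list (map (Rx u l) ?L)"
 have L: "[Suc l..<NN] = Suc l # ?L" using l by(simp add: upt_conv_Cons)
 have c: "?P * Sx u (Suc l) = Sx u (Suc l) * ?P" proof(rule prod_list_commute[symmetric])
  fix T assume "T : set (map (Rx u l) ?L)"
  then obtain p where p: "T = Rx u l p" "Suc l < p" "p < NN" by auto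
  have "Fo (Suc l) * Ko l p = Ko l p * Fo (Suc l)" using p l by(intro Ko_Fo_comm[symmetric]) auto
  thus "Sx u (Suc l) * T = T * Sx u (Suc l)" unfolding p(1) Sx_def Rx_def by(intro commP(2)[symmetric] commP(1)[symmetric])
 qed
 let ?A = "prod_list (map (%p. Rx u l p * Rx u (Suc l) p) ?L)"
 let ?B = "Sx u l * Rx u l (Suc l) * Sx u (Suc l)"
 let ?C = "prod_list (map (Rx u (Suc l)) ?L)"
 have "Xf u l * Xf u (Suc l) = Sx u l * Rx u l (Suc l) * (?P * Sx u (Suc l)) * ?C" unfolding Xf_def L by(simp add: mult.assoc)
 also have "... = ?B * (?P * ?C)" unfolding c by(simp add: mult.assoc)
 also have "?P * ?C = ?A" proof(rule prod_list_merge)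
  fix i j assume ij: "i : set ?L" "j : set ?L" "i ~= j"
  have "Ko l i * Ko (Suc l) j = Ko (Suc l) j * Ko l i" using ij l by(intro Ko_Ko_comm) auto
  thus "Rx u l i * Rx u (Suc l) j = Rx u (Suc l) j * Rx u l i" unfolding Rx_def by(intro commP(1)[symmetric] commP(1))
 qed simp
 finally have X: "Xf u l * Xf u (Suc l) = ?B * ?A" .
 have "good (Po l (Suc l)) ?B" proof -
  let ?a = "u - of_nat l - 1/2"
  have a: "?a ~= 0" "?a - 1 ~= 0" "u - of_nat (Suc l) - 1/2 = ?a - 1" using gen_nz(1)[OF u, of l] gen_nz(1)[OF u, of "Suc l"] l by(simp_all add: alg)
  have w: "- 2 * u + of_nat l + of_nat (Suc l) = - 2 * ?a" by(simp add: alg)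
  have "1 - (1 / (- 2 * ?a)) *: Ko l (Suc l) = 1 + ((1 / ?a) / 2) *: Ko l (Suc l)" proof -
   show ?thesis unfolding inv_rel3 scl_simps(9) by simp
  qed
  moreover have "1 / ?a - 1 / (?a - 1) + 1 / ?a * (1 / (?a - 1)) = 0" using a(1,2) by(simp add: divide_simps)
  ultimately show ?thesis unfolding Sx_def Rx_def w a(3) using l Po_Fo[of l "Suc l"] Po_Ko[of l "Suc l"] Ko_Fo[of l "Suc l"] Fo_Fo[of l "Suc l"]
   by(simp only:) (rule good_reflection[OF Po_Po], auto)
 qed
 moreover have "good (Po l (Suc l)) ?A" by(rule good_list[OF Po_Po]) (use l u in "auto intro!: good_R_right")
 ultimately show ?thesis unfolding X by(rule good_mult[OF Po_Po])
qed

lemma good_XX_less: "gen u ==> Suc l < NN ==> m <= l ==> good (Po l (Suc l)) (XX u m)" unfolding XX_def by(intro good_list[OF Po_Po]) (auto intro!: good_Xf_less)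

lemma good_XX: assumes u: "gen u" and l: "Suc l < NN" shows "good (Po l (Suc l)) (XX u NN)"
proof -
 have L: "[0..<NN] = [0..<l] @ [l, Suc l] @ [Suc (Suc l)..<NN]" proof -
  have "[0..<NN] = [0..<l] @ [l..<NN]" using l upt_add_eq_append[of 0 l "NN - l"] by simp
  moreover have "[l..<NN] = l # Suc l # [Suc (Suc l)..<NN]" using l by(simp add: upt_conv_Cons)
  ultimately show ?thesis by simp
 qed
 let ?A = "prod_list (map (Xf u) [Suc (Suc l)..<NN])"
 have "XX u NN = XX u l * ((Xf u l * Xf u (Suc l)) * ?A)" unfolding XX_def L by(simp add: mult.assoc)
 moreover have "good (Po l (Suc l)) ?A" by(rule good_list[OF Po_Po]) (use l in "auto intro!: good_Xf_greater")
 ultimately show ?thesis by(simp only:) (intro good_mult[OF Po_Po] good_XX_less good_Xf_pair u l order_refl)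
qed

text \<open>\<open>C\<close> sees only the antisymmetric part in the tensor places from
  \<open>k\<close> on.\<close>

definition alt :: "'v tns lop => nat => bool" where
 "alt C k <-> (ALL p q. k <= p --> p < NN --> k <= q --> q < NN --> p ~= q --> C * Po p q = - C)"

lemma altD: "alt C k ==> k <= p ==> p < NN ==> k <= q ==> q < NN ==> p ~= q ==> C * Po p q = - C" unfolding alt_def by blast

lemma altI:
 assumes a: "!!p. k <= p ==> Suc p < NN ==> C * Po p (Suc p) = - C" shows "alt C k" proof -
 have lt: "C * Po p (p + Suc t) = - C" if "k <= p" "p + Suc t < NN" for p t using that proof(induction t)
  case (Suc t)
  let ?q = "p + Suc t"
  have pc: "Po p (Suc ?q) = Po ?q (Suc ?q) * Po p ?q * Po ?q (Suc ?q)" by(rule Po_conj[symmetric]) simp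
  have "C * Po p (Suc ?q) = C * Po ?q (Suc ?q) * Po p ?q * Po ?q (Suc ?q)" unfolding pc by(simp only: mult.assoc)
  also have "... = - C" using a[of ?q] Suc by simp
  finally show ?case by simp
 qed (use a in simp)
 have "C * Po p q = - C" if "k <= p" "p < q" "q < NN" for p q using lt[of p "q - p - 1"] that by simp
 thus ?thesis unfolding alt_def by(metis Po_sym linorder_neqE_nat)
qed

lemma alt_swap: "alt C k ==> k <= p ==> p < NN ==> k <= q ==> q < NN ==> p ~= q ==> ap C (bs (sw p q c) v) = - ap C (bs c v)"
 using altD[of C k p q] by(metis ap_Po_bs ap_minus ap_mult)

lemma alt_kill: assumes "alt C k" "k <= p" "p < NN" "k <= q" "q < NN" "p ~= q" "c p = c q" shows "ap C (bs c v) = 0"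
proof -
 have "sw p q c = c" using assms(7) by(auto simp: sw_def fun_eq_iff)
 hence "ap C (bs c v) = - ap C (bs c v)" using alt_swap[OF assms(1-6), of c v] by simp
 thus ?thesis by(auto simp: fun_eq_iff fa)
qed

definition Ao :: "'v tns lop" where
 "Ao = slop (%a f. SUM sigma:SN. (sign sigma / fact NN) *. f (a \<circ> sigma))"

lemma sl_Ao: "sl (ap Ao z) a = (SUM sigma:SN. (sign sigma / fact NN) *. sl z (a \<circ> sigma))"
 unfolding Ao_def by(rule sl_slop) (auto simp: vs_simps sum.distrib vs_sum mult.commute)

lemma alt_Ao: "alt Ao 0" unfolding alt_def
proof(intro allI impI)
 fix p q assume pq: "p < NN" "q < NN" "p ~= q"
 let ?t = "transpose p q"
 let ?P = "SN"
 have t: "?t permutes {..<NN}" using pq by(simp add: permutes_swap_id)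
 show "Ao * Po p q = - Ao" proof(rule lop_slI)
  fix z :: "'v tnv" and a :: "nat => int"
  have s: "sw p q (a \<circ> sigma) = a \<circ> (sigma \<circ> ?t)" for sigma by(auto simp: sw_def fun_eq_iff transpose_def)
  let ?A = "sl (ap (Ao * Po p q) z) a"
  have "sl (ap (- Ao) z) a = (SUM sigma:?P. - ((sign sigma / fact NN) *. sl z (a \<circ> sigma)))" by(simp add: sl_Ao sum_negf)
  also have "... = (SUM sigma:?P. - ((sign (sigma \<circ> ?t) / fact NN) *. sl z (a \<circ> (sigma \<circ> ?t))))"
   by(rule sum_permutations_compose_right[OF t])
  also have "... = ?A" unfolding ap_mult sl_Ao sl_Po s proof(intro sum.cong refl)
   fix sigma assume "sigma : ?P"
   hence "permutation sigma" "permutation ?t" using t by(auto intro: permutation_permutes[THEN iffD2])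
   hence "sign (sigma \<circ> ?t) = - sign sigma" using pq by(simp add: sign_compose sign_swap_id)
   thus "- ((sign (sigma \<circ> ?t) / fact NN) *. sl z (a \<circ> (sigma \<circ> ?t))) = (sign sigma / fact NN) *. sl z (a \<circ> (sigma \<circ> ?t))" by(simp add: vs_simps)
  qed
  finally show "?A = sl (ap (- Ao) z) a" ..
 qed
qed

text \<open>\<open>C\<close> is half of \<open>C * (1 - P)\<close>, so it sees only what
  \<open>good\<close> controls.\<close>

lemma alt_good:
 assumes C: "C * Po p q = - C" and g: "good (Po p q) T" shows "C * T * Po p q = - (C * T)" proof -
 let ?A = "T * (1 + Po p q)"
 have "C * (1 - Po p q) = C + C" using C by(simp add: right_diff_distrib)
 hence "(C + C) * ?A = 0" using g unfolding good_def by(metis mult.assoc mult_zero_right)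
 hence "(1/2) *: (C * ?A + C * ?A) = 0" by(simp add: distrib_right)
 hence "C * T * (1 + Po p q) = 0" unfolding half_scl by(simp add: mult.assoc)
 thus ?thesis by(simp add: distrib_left eq_neg_iff_add_eq_0 add.commute)
qed

lemma alt_XX: "gen u ==> alt (Ao * XX u NN) 0" by(rule altI, rule alt_good) (auto intro!: altD[OF alt_Ao] good_XX)
lemma alt_Bk: "gen u ==> alt (Ao * XX u k) k" by(rule altI, rule alt_good) (auto intro!: altD[OF alt_Ao] good_XX_less)

lemma alt_Sx: assumes "alt C k" shows "alt (C * Sx u k) (Suc k)" unfolding alt_def
proof(intro allI impI)
 fix p q assume pq: "Suc k <= p" "p < NN" "Suc k <= q" "q < NN" "p ~= q"
 have "Po p q * Sx u k = Sx u k * Po p q" unfolding Sx_def using pq by(intro commP Po_Fo2) auto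
 hence "C * Sx u k * Po p q = C * Po p q * Sx u k" by(simp add: mult.assoc)
 thus "C * Sx u k * Po p q = - (C * Sx u k)" using altD[OF assms, of p q] pq by simp
qed

text \<open>To the right of an antisymmetriser, K_l K_p = P K_p becomes -K_p. All products of
  contractions collapse, and the product of R-matrices becomes linear with a single coefficient, by
  \<open>inv_rel2\<close>.\<close>

lemma alt_fuse:
 assumes C: "alt C (Suc k)" and u: "gen u" and p: "Suc k <= p" "p <= NN"
 shows "C * prod_list (map (Rx u k) [Suc k..<p]) = C * (1 - (1 / (- 2 * u + of_nat k + of_nat (Suc k))) *: (SUM l:{Suc k..<p}. Ko k l))" using p
proof(induction p rule: dec_induct)
 case (step p)
 let ?w = "- 2 * u + of_nat k + of_nat (Suc k)" and ?w' = "- 2 * u + of_nat k + of_nat p"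
 let ?S = "SUM l:{Suc k..<p}. Ko k l"
 have w: "?w ~= 0" "?w' ~= 0" by(rule gen_nz(2)[OF u]; use step in simp)+
 let ?A = "of_nat (p - Suc k)"
 have ww: "?w' = ?w + ?A" using step by(simp add: of_nat_diff)
 have K: "C * Ko k l * Ko k p = - (C * Ko k p)" if l: "l : {Suc k..<p}" for l proof -
  have "C * Ko k l * Ko k p = C * Po l p * Ko k p" using Ko_Ko[of k l p] l step by(simp add: mult.assoc)
  thus ?thesis using altD[OF C, of l p] l step by simp
 qed
 let ?C = "?A *: (C * Ko k p)"
 have SK: "C * ?S * Ko k p = - ?C" proof -
  have "C * ?S * Ko k p = (SUM l:{Suc k..<p}. - (C * Ko k p))" unfolding sum_distrib_left sum_distrib_right by(intro sum.cong refl K)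
  also have "... = - ?C" by(simp add: sum_negf) (rule lop_eqI, simp add: ap_of_nat)
  finally show ?thesis .
 qed
 let ?B = "prod_list (map (Rx u k) [Suc k..<p])"
 let ?D = "1 - (1 / ?w) *: ?S"
 have IH: "C * ?B = C * ?D" using step by simp
 have "C * prod_list (map (Rx u k) [Suc k..<Suc p]) = C * ?B * Rx u k p" using step.hyps by(simp add: mult.assoc)
 also have "... = C * ?D * Rx u k p" unfolding IH ..
 also have "... = C - (1 / ?w) *: (C * ?S) - (1 / ?w') *: (C * Ko k p) + (1 / ?w * (1 / ?w')) *: (C * ?S * Ko k p)"
  unfolding Rx_def by(rule lop_eqI, rule ext) (simp add: vl alg)
 also have "... = C - (1 / ?w) *: (C * ?S) - (1 / ?w' + 1 / ?w * (1 / ?w') * ?A) *: (C * Ko k p)" unfolding SK by(rule lop_eqI, rule ext) (simp add: vl alg)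
 also have "1 / ?w' + 1 / ?w * (1 / ?w') * ?A = 1 / ?w" using w unfolding ww by(intro inv_rel2)
 also have "C - (1 / ?w) *: (C * ?S) - (1 / ?w) *: (C * Ko k p) = C * (1 - (1 / ?w) *: (SUM l:{Suc k..<Suc p}. Ko k l))"
  using step by(simp add: right_diff_distrib distrib_left scl_simps)
 finally show ?case .
qed simp

lemma Fo_bs: assumes c: "ok c" and k: "k < NN" shows "ap (Fo k) (bs c v) = (SUM i:I. bs (c(k := i)) (ap (F i (c k)) v))"
proof(rule sl_eqI)
 fix a
 have ck: "c k : I" by(rule okD[OF c k])
 let ?C = "sl (ap (Fo k) (bs c v)) a"
 have L: "?C = (if ok a then SUM j:I. if a(k := j) = c then ap (F (a k) j) v else 0 else 0)" unfolding sl_Fo sl_bs by(intro if_cong sum.cong refl) auto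
 let ?A = "SUM i:I. if a = c(k := i) then ap (F i (c k)) v else 0"
 let ?B = "sl (SUM i:I. bs (c(k := i)) (ap (F i (c k)) v)) a"
 have R: "?B = ?A" by(simp add: sl_sum sl_bs)
 show "?C = ?B" proof(cases "ok a & a(k := c k) = c")
  case True
  have "a(k := j) = c <-> j = c k" for j using True by(metis fun_upd_same)
  moreover have "a = c(k := i) <-> i = a k" for i using True by(metis fun_upd_same fun_upd_triv fun_upd_upd)
  moreover have "a k : I" using True k by(auto intro: okD)
  ultimately show ?thesis unfolding L R using True ck by simp
 next
  case False
  have "a ~= c(k := i)" if "i : I" for i using False ok_upd[OF c k that] by auto
  hence "?A = 0" by(intro sum.neutral) auto
  moreover have "ok a ==> (SUM j:I. if a(k := j) = c then ap (F (a k) j) v else 0) = 0" using False by(intro sum.neutral) auto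
  ultimately show ?thesis unfolding L R by simp
 qed
qed

lemma Uo_bs: assumes c: "ok c" and k: "k < NN" and i: "i : I" shows "ap (Uo k i j) (bs c v) = (if c k = j then bs (c(k := i)) v else 0)"
proof(rule sl_eqI)
 fix a
 have "ok a & a k = i & a(k := j) = c <-> c k = j & a = c(k := i)" using ok_upd[OF c k i] by(metis fun_upd_same fun_upd_triv fun_upd_upd)
 thus "sl (ap (Uo k i j) (bs c v)) a = sl (if c k = j then bs (c(k := i)) v else 0) a" by(auto simp: sl_Uo sl_bs)
qed

lemma Ko_bs: assumes c: "ok c" and kl: "k < NN" "l < NN" "k ~= l"
 shows "ap (Ko k l) (bs c v) = (if c k = - c l then SUM j:I. theta j (c l) *. bs (c(k := - j, l := j)) v else 0)" proof(rule sl_eqI)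
 fix a
 have cl: "c l : I" by(rule okD[OF c kl(2)])
 let ?B = "sl (ap (Ko k l) (bs c v)) a"
 have L: "?B = (if ok a & a k = - a l then SUM j:I. if a(k := - j, l := j) = c then theta (a l) j *. v else 0 else 0)"
  unfolding sl_Ko sl_bs by(intro if_cong sum.cong refl) auto
 show "?B = sl (if c k = - c l then SUM j:I. theta j (c l) *. bs (c(k := - j, l := j)) v else 0) a" proof(cases "c k = - c l")
  case False
  have "a(k := - j, l := j) ~= c" for j using False kl by auto
  thus ?thesis unfolding L using False by simp
 next
  case True
  let ?A = "SUM j:I. if a = c(k := - j, l := j) then theta j (c l) *. v else 0"
  have R: "sl (SUM j:I. theta j (c l) *. bs (c(k := - j, l := j)) v) a = ?A" by(simp add: sl_sum sl_bs) (intro sum.cong refl, simp)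
  show ?thesis
  proof(cases "ok a & a k = - a l & a(k := - c l, l := c l) = c")
   case t: True
   have 1: "a(k := - j, l := j) = c <-> j = c l" for j using t by(metis fun_upd_same)
   have 2: "a = c(k := - i, l := i) <-> i = a l" for i proof
    assume "i = a l"
    hence "c(k := - i, l := i) = a(k := - i, l := i)" using t kl by(metis fun_upd_twist fun_upd_upd)
    also have "... = a" using t kl \<open>i = a l\<close> by(auto simp: fun_eq_iff)
    finally show "a = c(k := - i, l := i)" by simp
   qed auto
   have "a l : I" using t kl by(auto intro: okD)
   thus ?thesis unfolding L using True R cl t by(simp add: 1 2)
  next
   case f: False
   have "a ~= c(k := - i, l := i)" if i: "i : I" for i proof
    assume a: "a = c(k := - i, l := i)"
    have "ok a" unfolding a using c kl i by(auto intro!: ok_upd)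
    moreover have "a k = - a l" using kl by(simp add: a)
    moreover have "a(k := - c l, l := c l) = c" using kl True by(auto simp: a fun_eq_iff)
    ultimately show False using f by blast
   qed
   hence "?A = 0" by(intro sum.neutral) auto
   moreover have "ok a & a k = - a l ==> (SUM j:I. if a(k := - j, l := j) = c then theta (a l) j *. v else 0) = 0" using f by(intro sum.neutral) auto
   ultimately show ?thesis unfolding L using True R by simp
  qed
 qed
qed

text \<open>The indices -n, ..., -1, 1, ..., n in increasing order; an operator alternating in all
  places is determined by its values there (\<open>alt_zero\<close>).\<close>

definition Jc :: "nat => int" where
 "Jc r = (if r < n then int r - nn else if r < NN then int r - nn + 1 else 0)"

lemma ok_Jc: "ok Jc" by(auto simp: ok_def Jc_def Iset_def)
lemma Jc_mono: "p < NN ==> q < NN ==> Jc p < Jc q <-> p < q" by(auto simp: Jc_def)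
lemma Jc_inj: "p < NN ==> q < NN ==> Jc p = Jc q <-> p = q" by(auto simp: Jc_def split: if_splits)
lemma Jc_surj: "i : I ==> EX r<NN. Jc r = i" by(rule exI[of _ "if i < 0 then nat (i + nn) else nat (i + nn - 1)"]) (auto simp: Jc_def Iset_def)
lemma Jc_above: "i : I ==> k < NN ==> Jc k < i ==> EX r<NN. Jc r = i & k < r" using Jc_surj[of i] Jc_mono[of k] by auto

end

context sp_hwrep
begin

text \<open>Replacing \<open>i0\<close> by a smaller index annihilates \<open>xi\<close>; replacing
  it by a larger one repeats an index at a later place, which \<open>C\<close> kills. Only the
  weight of \<open>xi\<close> is left.\<close>

lemma Sx_bs_hw:
 assumes C: "alt C k" and k: "k < NN" and c: "ok c" and i0: "c k = i0"
  and rep: "!!i. i : I ==> i0 < i ==> EX r. k < r & r < NN & c r = i"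
 shows "ap (C * Sx u k) (bs c xi) = (1 + lm i0 / (u - of_nat k - 1/2)) *. ap C (bs c xi)" proof -
 have i0': "i0 : I" using okD[OF c k] i0 by simp
 let ?A = "ap C (bs c xi)"
 have "ap C (ap (Fo k) (bs c xi)) = (SUM i:I. if i = i0 then lm i0 *. ?A else 0)" unfolding Fo_bs[OF c k] ap_vsum i0
 proof(intro sum.cong refl)
  fix i assume i: "i : I"
  consider "i < i0" | "i = i0" | "i0 < i" by linarith
  thus "ap C (bs (c(k := i)) (ap (F i i0) xi)) = (if i = i0 then lm i0 *. ?A else 0)" proof cases
   case 1
   thus ?thesis using xir[OF i i0' 1] by(simp add: bs_lin)
  next
   case 2
   thus ?thesis using xiw'[OF i] i0 by(simp add: bs_lin ap_vs fun_upd_idem)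
  next
   case 3
   then obtain r where r: "k < r" "r < NN" "c r = i" using rep[OF i] by blast
   have "ap C (bs (c(k := i)) (ap (F i i0) xi)) = 0" by(rule alt_kill[OF C, of k r]) (use r k in auto)
   thus ?thesis using 3 by simp
  qed
 qed
 also have "... = lm i0 *. ?A" using i0' by simp
 finally show ?thesis by(simp add: Sx_def ap_vadd ap_vs vs_simps)
qed

text \<open>The scalar contributed by the block \<open>Xf u k\<close>. For k < n the index opposite
  to \<open>Jc k\<close> lies to the right, and the contraction with it adds 1 to the
  weight.\<close>

definition ck :: "complex => nat => complex" where
 "ck u k = (if k < n then 1 + (1 + lm (Jc k)) / (u - of_nat k - 1/2) else 1 + lm (Jc k) / (u - of_nat k - 1/2))"

lemma hw_step:
 assumes u: "gen u" and k: "k < NN"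
 shows "ap (Ao * XX u (Suc k)) (bs Jc xi) = ck u k *. ap (Ao * XX u k) (bs Jc xi)" proof -
 let ?C = "Ao * XX u k" and ?a = "u - of_nat k - 1/2" and ?w = "- 2 * u + of_nat k + of_nat (Suc k)"
 have C: "alt ?C k" by(rule alt_Bk[OF u])
 have C': "alt (?C * Sx u k) (Suc k)" by(rule alt_Sx[OF C])
 have wa: "1 / ?w = - (1 / (2 * ?a))" proof -
  have e: "?w = - (2 * ?a)" by(simp add: alg)
  show ?thesis unfolding e by(rule minus_divide_right[symmetric])
 qed
 let ?A = "ap ?C (bs Jc xi)"
 let ?K = "ap (?C * Sx u k) (bs Jc xi)"
 have S1: "?K = (1 + lm (Jc k) / ?a) *. ?A" by(rule Sx_bs_hw[OF C k ok_Jc refl]) (use Jc_above[OF _ k] in blast)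
 have Kz: "ap (Ko k l) (bs Jc xi) = 0" if "Suc k <= l" "l < NN" "Jc k ~= - Jc l" for l using that k by(subst Ko_bs[OF ok_Jc]) auto
 let ?B = "SUM l:{Suc k..<NN}. ap (Ko k l) (bs Jc xi)"
 have "XX u (Suc k) = XX u k * Xf u k" by(simp add: XX_def)
 hence "Ao * XX u (Suc k) = (?C * Sx u k) * prod_list (map (Rx u k) [Suc k..<NN])" by(simp add: Xf_def mult.assoc)
 also have "... = (?C * Sx u k) * (1 - (1 / ?w) *: (SUM l:{Suc k..<NN}. Ko k l))" by(rule alt_fuse[OF C' u]) (use k in auto)
 finally have X: "ap (Ao * XX u (Suc k)) (bs Jc xi) = ?K - (1 / ?w) *. ap (?C * Sx u k) ?B" by(simp only: ap_mult ap_diff ap_1 ap_scl ap_sum ap_vdiff ap_vs)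
 show ?thesis
 proof(cases "k < n")
  case False
  have "?B = 0" by(intro sum.neutral ballI Kz) (use False k in "auto simp: Jc_def")
  thus ?thesis unfolding X S1 using False by(simp add: ck_def)
 next
  case True
  \<comment> \<open>The only later place whose index is opposite to \<open>Jc k\<close>.\<close>
  let ?l = "NN - 1 - k" and ?m = "nn - int k"
  have l: "Suc k <= ?l" "?l < NN" "k < ?l" "k ~= ?l" "Jc k = - ?m" "Jc ?l = ?m" using True by(auto simp: Jc_def)
  have mI: "?m : I" "- ?m : I" "?m > 0" using True by(auto simp: Iset_def)
  let ?c = "%j. Jc(k := - j, ?l := j)"
  have okc: "ok (?c j)" if "j : I" for j using that k l by(auto intro!: ok_upd ok_Jc)
  let ?D = "SUM j:I. theta j ?m *. bs (?c j) xi"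
  have "?B = (SUM l:{Suc k..<NN}. if l = ?l then ap (Ko k ?l) (bs Jc xi) else 0)" proof(intro sum.cong refl)
   fix p assume p: "p : {Suc k..<NN}"
   have "Jc k = - Jc p ==> p = ?l" using p l Jc_inj[of p ?l] by auto
   thus "ap (Ko k p) (bs Jc xi) = (if p = ?l then ap (Ko k ?l) (bs Jc xi) else 0)" using Kz[of p] p by auto
  qed
  also have "... = ap (Ko k ?l) (bs Jc xi)" using l by simp
  also have "... = ?D" using l k by(subst Ko_bs[OF ok_Jc]) auto
  finally have K: "?B = ?D" .
  have above: "EX r. k < r & r < NN & r ~= ?l & Jc r = j" if "j : I" "- ?m < j" "j ~= ?m" for j using Jc_above[OF that(1) k] that l by auto
  let ?G = "1 + lm ?m / ?a"
  let ?H = "1 + lm (- ?m) / ?a"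
  \<comment> \<open>Only the indices m and -m survive, with coefficients 1 - lm/a and 1 + lm/a, so
    their sum 2 is free of the weight.\<close>
  have t: "theta j ?m *. ap (?C * Sx u k) (bs (?c j) xi)
   = (if j = ?m then ?H *. ?A else 0) + (if j = - ?m then ?G *. ?A else 0)"
   if j: "j : I" for j proof -
   consider "j = ?m" | "- ?m < j" "j ~= ?m" | "j = - ?m" | "j < - ?m" by linarith
   thus ?thesis
   proof cases
    case 1
    have "?c ?m = Jc" using l by(auto simp: fun_eq_iff)
    moreover have "theta ?m ?m = 1" using mI by(simp add: theta_def)
    ultimately show ?thesis using S1 l(5) mI(3) by(simp add: 1)
   next
    case 2
    then obtain r where r: "k < r" "r < NN" "r ~= ?l" "Jc r = j" using above[OF j] by blast
    have "ap (?C * Sx u k) (bs (?c j) xi) = 0" by(rule alt_kill[OF C', of ?l r]) (use r l in auto)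
    thus ?thesis using 2 by simp
   next
    case 3
    have c: "?c (- ?m) = sw k ?l Jc" using l by(auto simp: fun_eq_iff sw_def)
    let ?E = "bs (?c (- ?m)) xi"
    have "ap (?C * Sx u k) ?E = ?G *. ap ?C ?E" proof(rule Sx_bs_hw[OF C k okc[OF mI(2)]])
     show "(?c (- ?m)) k = ?m" using l by simp
     fix i assume i: "i : I" "?m < i"
     then obtain r where "k < r" "r < NN" "r ~= ?l" "Jc r = i" using above[OF i(1)] mI(3) by auto
     thus "EX r. k < r & r < NN & (?c (- ?m)) r = i" by(intro exI[of _ r]) auto
    qed
    also have "ap ?C ?E = - ?A" unfolding c by(rule alt_swap[OF C]) (use k l in auto)
    finally have E0: "ap (?C * Sx u k) ?E = ?G *. - ?A" .
    have E: "ap (?C * Sx u k) ?E = - (?G *. ?A)" unfolding E0 by(rule vs_simps(8))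
    have th: "theta (- ?m) ?m = - 1" using mI by(simp add: theta_def)
    show ?thesis unfolding 3 E th using mI(3) by(simp add: vs_simps)
   next
    case 4
    obtain r where r: "k < r" "r < NN" "r ~= ?l" "Jc r = - j" using above[of "- j"] j 4 mI(3) by auto
    have "ap (?C * Sx u k) (bs (?c j) xi) = (1 + lm (- j) / ?a) *. ap ?C (bs (?c j) xi)" proof(rule Sx_bs_hw[OF C k okc[OF j]])
     show "(?c j) k = - j" using l by simp
     fix i assume i: "i : I" "- j < i"
     then obtain r where "k < r" "r < NN" "r ~= ?l" "Jc r = i" using above[OF i(1)] 4 mI(3) by auto
     thus "EX r. k < r & r < NN & (?c j) r = i" by(intro exI[of _ r]) auto
    qed
    also have "ap ?C (bs (?c j) xi) = 0" by(rule alt_kill[OF C, of k r]) (use r l k in auto)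
    finally have E0: "ap (?C * Sx u k) (bs (?c j) xi) = (1 + lm (- j) / ?a) *. 0" .
    show ?thesis unfolding E0 using 4 mI(3) by simp
   qed
  qed
  have "ap (?C * Sx u k) ?D = ?H *. ?A + ?G *. ?A" proof -
   have "ap (?C * Sx u k) ?D = (SUM j:I. (if j = ?m then ?H *. ?A else 0)
     + (if j = - ?m then ?G *. ?A else 0))" unfolding ap_vsum ap_vs by(intro sum.cong refl t)
   thus ?thesis unfolding sum.distrib using mI(1,2) by(simp only: sum.delta[OF finite_Iset] if_True)
  qed
  moreover have "lm (- ?m) = - lm ?m" using mI by(simp add: lm_def)
  ultimately have "ap (Ao * XX u (Suc k)) (bs Jc xi) = (1 + lm (Jc k) / ?a - (1 / ?w) * 2) *. ?A"
   unfolding X S1 K by(simp add: vs_simps(1) flip: vs_simps(6) vs_simps(7))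
  also have "1 + lm (Jc k) / ?a - (1 / ?w) * 2 = ck u k" unfolding wa inv_rel4 ck_def using True by simp
  finally show ?thesis .
 qed
qed

definition dd :: "complex => complex" where "dd u = (PROD k:{..<NN}. ck u k)"

lemma hw_value: assumes u: "gen u" shows "ap (Ao * XX u NN) (bs Jc xi) = dd u *. ap Ao (bs Jc xi)"
proof -
 have "m <= NN ==> ap (Ao * XX u m) (bs Jc xi) = (PROD k:{..<m}. ck u k) *. ap Ao (bs Jc xi)" for m proof(induction m)
  case (Suc m)
  thus ?case using hw_step[OF u, of m] by(simp add: vs_simps mult.commute del: ap_mult)
 qed (simp add: XX_def)
 thus ?thesis by(simp add: dd_def)
qed

end

section \<open>Invariance under the total action and the scalar value\<close>

definition Ps :: "(nat => nat) => 'v tns lop" where "Ps sigma = slop (%a f. f (a \<circ> sigma))"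
lemma sl_Ps: "sl (ap (Ps sigma) z) a = sl z (a \<circ> sigma)" unfolding Ps_def by(rule sl_slop) auto

context sp_rep
begin

lemma ok_perm: "sigma permutes {..<NN} ==> ok (a \<circ> sigma) <-> ok a"
proof -
 assume s: "sigma permutes {..<NN}"
 have "ok (b \<circ> t)" if b: "ok b" and t: "t permutes {..<NN}" for b t unfolding ok_def proof
  fix r
  have "r < NN <-> t r < NN" using permutes_in_image[OF t, of r] by simp
  moreover have "~ r < NN ==> t r = r" using t by(simp add: permutes_def)
  ultimately show "if r < NN then (b \<circ> t) r : I else (b \<circ> t) r = 0" using b unfolding ok_def by(metis comp_apply)
 qed
 note h = this
 have "a = (a \<circ> sigma) \<circ> inv sigma" using permutes_inv_o(1)[OF s] by(simp add: comp_assoc)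
 thus ?thesis using h[of a sigma] h[of "a \<circ> sigma" "inv sigma"] s permutes_inv[OF s] by auto
qed

definition Wk :: "int => int => nat => 'v tns lop" where
 "Wk a b k = Uo k b a - theta a b *: Uo k (- a) (- b)"
text \<open>The total action of \<open>F a b\<close> on tensors and module, where each tensor factor
  carries the dual of the vector representation.\<close>

definition To :: "int => int => 'v tns lop" where
 "To a b = lv (F a b) - (SUM k:{..<NN}. Wk a b k)"

lemma Uo_Fo: assumes "l ~= k" "k < NN" "l < NN" "j : I"
 shows "Uo l i j * Fo k = Fo k * Uo l i j" proof(rule lop_slI)
 fix z :: "'v tnv" and a
 have o: "ok (a(k := q))" if "q : I" "ok a" for q using that assms by(intro ok_upd)
 have o2: "ok a ==> ok (a(l := j))" using assms by(intro ok_upd)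
 show "sl (ap (Uo l i j * Fo k) z) a = sl (ap (Fo k * Uo l i j) z) a" using assms o o2 by(auto simp: sl_Uo sl_Fo fun_upd_twist intro!: sum.cong sum.neutral[symmetric])
qed

lemma Wk_Fo: "a : I ==> b : I ==> l ~= k ==> k < NN ==> l < NN ==> Wk a b l * Fo k = Fo k * Wk a b l"
 unfolding Wk_def using Uo_Fo[of l k a b] Uo_Fo[of l k "- b" "- a"] by(simp add: alg scl_simps)

lemma lv_Fo: assumes a: "a : I" and b: "b : I" and k: "k < NN"
 shows "(lv (F a b) - Wk a b k) * Fo k = Fo k * (lv (F a b) - Wk a b k)" proof(rule lop_slI)
 fix z :: "'v tnv" and c
 show "sl (ap ((lv (F a b) - Wk a b k) * Fo k) z) c = sl (ap (Fo k * (lv (F a b) - Wk a b k)) z) c" proof(cases "ok c")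
  case False
  thus ?thesis by(simp add: sl_Fo sl_lv Wk_def sl_Uo)
 next
  case True
  have ck: "c k : I" by(rule okD[OF True k])
  have o: "ok (c(k := q))" if "q : I" for q using that True k by(intro ok_upd)
  let ?z = "%j. sl z (c(k := j))" and ?i = "c k"
  let ?B = "if ?i = - a then SUM j:I. ap (F (- b) j) (?z j) else 0"
  let ?C = "if ?i = b then SUM j:I. ap (F a j) (?z j) else 0"
  let ?G = "ap (F a b) (SUM j:I. ap (F ?i j) (?z j))"
  have L: "sl (ap ((lv (F a b) - Wk a b k) * Fo k) z) c = ?G - ?C
    + theta a b *. ?B" using True o a b by(simp add: sl_lv sl_Fo Wk_def sl_Uo)
  have D: "(SUM j:I. ap (F ?i j) (if j = q then f else 0)) = ap (F ?i q) f" if "q : I" for q f proof -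
   have "(SUM j:I. ap (F ?i j) (if j = q then f else 0)) = (SUM j:I. if j = q then ap (F ?i q) f else 0)" by(intro sum.cong) auto
   thus ?thesis using that by simp
  qed
  let ?A = "ap (F ?i (- a)) (?z (- b))"
  let ?D = "ap (F ?i b) (?z a)"
  let ?E = "SUM j:I. ap (F ?i j) (ap (F a b) (?z j))"
  have R: "sl (ap (Fo k * (lv (F a b) - Wk a b k)) z) c = ?E - ?D + theta a b *. ?A" proof -
   have "sl (ap (Fo k * (lv (F a b) - Wk a b k)) z) c = (SUM j:I. ap (F ?i j) (ap (F a b) (?z j)) - ap (F ?i j) (if j = b then ?z a else 0) + theta a b *. ap (F ?i j) (if j = - a then ?z (- b) else 0))"
    using True o by(simp add: sl_lv sl_Fo Wk_def sl_Uo) (intro sum.cong refl, simp add: ap_vdiff ap_vs)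
   thus ?thesis using a b by(simp add: sum.distrib sum_subtractf D vs_sum[symmetric])
  qed
  have "?G = (SUM j:I. ap (F ?i j) (ap (F a b) (?z j)) + (if ?i = b then ap (F a j) (?z j) else 0) - (if j = a then ?D else 0)
    - theta a b *. (if ?i = - a then ap (F (- b) j) (?z j) else 0) + theta a b *. (if j = - b then ?A else 0))" unfolding ap_vsum
  proof(intro sum.cong refl)
   fix j assume j: "j : I"
   let ?H = "ap (F a b) (ap (F ?i j) (?z j))"
   have "?H = ap (F a b * F ?i j) (?z j)" by simp
   also have "... = ap (F ?i j) (ap (F a b) (?z j)) + (if ?i = b then ap (F a j) (?z j) else 0) - (if j = a then ?D else 0)
    - theta a b *. (if ?i = - a then ap (F (- b) j) (?z j) else 0) + theta a b *. (if j = - b then ?A else 0)" unfolding comm[OF a b ck j] by(auto simp: kd_def vs_simps)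
   finally show "?H = ..." .
  qed
  also have "... = ?E + ?C - ?D
    - theta a b *. ?B + theta a b *. ?A" unfolding sum.distrib sum_subtractf vs_sum[symmetric] using a b by simp
  finally show ?thesis unfolding L R by simp
 qed
qed

lemma To_Fo: assumes ab: "a : I" "b : I" and k: "k < NN" shows "To a b * Fo k = Fo k * To a b"
proof -
 let ?A = "SUM l:{..<NN} - {k}. Wk a b l"
 have T: "To a b = (lv (F a b) - Wk a b k) - ?A" using k by(simp add: To_def sum.remove[of "{..<NN}" k])
 have "?A * Fo k = Fo k * ?A" unfolding sum_distrib_left sum_distrib_right using ab k by(intro sum.cong refl Wk_Fo) auto
 thus ?thesis unfolding T left_diff_distrib right_diff_distrib[of "Fo k"] using lv_Fo[OF ab k] by(simp add: left_diff_distrib right_diff_distrib)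
qed

lemma Uo_Ko: assumes "m ~= k" "m ~= l" "k < NN" "l < NN" "m < NN" "j : I"
 shows "Uo m i j * Ko k l = Ko k l * Uo m i j" proof(rule lop_slI)
 fix z :: "'v tnv" and a
 have o: "ok (a(k := - q, l := q))" if "q : I" "ok a" for q using that assms by(intro ok_upd) auto
 have o2: "ok a ==> ok (a(m := j))" using assms by(intro ok_upd)
 have e: "a(m := j, k := - q, l := q) = a(k := - q, l := q, m := j)" for q using assms by(auto simp: fun_eq_iff)
 show "sl (ap (Uo m i j * Ko k l) z) a = sl (ap (Ko k l * Uo m i j) z) a" using assms o o2 by(auto simp: sl_Uo sl_Ko e intro!: sum.cong sum.neutral[symmetric])
qed

lemma Wk_Ko: "a : I ==> b : I ==> m ~= k ==> m ~= l ==> k < NN ==> l < NN ==> m < NN ==> Wk a b m * Ko k l = Ko k l * Wk a b m"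
 unfolding Wk_def using Uo_Ko[of m k l a b] Uo_Ko[of m k l "- b" "- a"] by(simp add: alg scl_simps)

text \<open>The contraction is made from the invariant symplectic form, so the action on its two
  places cancels on either side.\<close>

lemma Wk_Ko_zero: assumes a: "a : I" and b: "b : I" and kl: "k < NN" "l < NN" "k ~= l"
 shows "(Wk a b k + Wk a b l) * Ko k l = 0" "Ko k l * (Wk a b k + Wk a b l) = 0" proof -
 have nz: "a ~= 0" "b ~= 0" using Iset_nz a b by auto
 have th: "theta a b * theta b j = theta a j" "theta a b * theta a j = theta b j" "theta a b * theta j a = theta j b" for j using nz by(auto simp: theta_def sgn_if)
 let ?A = "Wk a b k + Wk a b l"
 let ?B = "Uo k (- a) (- b)"
 let ?C = "Uo l (- a) (- b)"
 show "?A * Ko k l = 0" proof(rule lop_slI)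
  fix z :: "'v tnv" and c
  have o: "ok (c(m := j))" if "ok c" "j : I" "m < NN" for m j using that by(intro ok_upd)
  let ?S = "%q. SUM j:I. theta q j *. sl z (c(k := - j, l := j))"
  have neg: "?S (- q) = - ?S q" for q by(simp add: theta_neg vs_simps sum_negf)
  have tS: "theta a b *. ?S b = ?S a" "theta a b *. ?S a = ?S b" by(simp_all add: vs_sum vs_simps th)
  have U1: "sl (ap (Uo k p q * Ko k l) z) c = (if ok c & c k = p & c l = - q then ?S (- q) else 0)" if "q : I" for p q
   using o kl that by(auto simp: sl_Uo sl_Ko fun_upd_twist)
  have U2: "sl (ap (Uo l p q * Ko k l) z) c = (if ok c & c l = p & c k = - q then ?S q else 0)" if "q : I" for p q
   using o kl that by(auto simp: sl_Uo sl_Ko fun_upd_twist)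
  let ?D = "sl (ap (Uo k b a * Ko k l) z) c"
  let ?E = "sl (ap (Uo l b a * Ko k l) z) c"
  let ?M = "sl (ap (?A * Ko k l) z) c"
  let ?N = "sl (ap (?B * Ko k l) z) c"
  let ?P = "sl (ap (?C * Ko k l) z) c"
  have "?M = ?D - theta a b *. ?N
    + (?E - theta a b *. ?P)" by(simp add: Wk_def)
  also have "... = 0" proof -
   define A where "A <-> ok c & c k = b & c l = - a"
   define B where "B <-> ok c & c k = - a & c l = b"
   have e1: "?D = (if A then - ?S a else 0)" unfolding U1[OF a] neg A_def ..
   have e2: "?N = (if B then ?S b else 0)" using U1[of "- b" "- a"] b unfolding B_def by simp
   have e3: "?E = (if B then ?S a else 0)" unfolding U2[OF a] B_def by(intro if_cong) auto
   have e4: "?P = (if A then - ?S b else 0)" using U2[of "- b" "- a"] b unfolding A_def neg by(simp add: conj_commute)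
   have tS': "theta a b *. - ?S b = - ?S a" unfolding tS(1)[symmetric] by(rule vs_simps(8))
   show ?thesis unfolding e1 e2 e3 e4 by(cases A; cases B) (simp_all only: if_True if_False tS tS', simp_all)
  qed
  finally show "?M = sl (ap 0 z) c" by simp
 qed
 show "Ko k l * ?A = 0" proof(rule lop_slI)
  fix z :: "'v tnv" and c
  have o: "ok (c(k := - j, l := j))" if "ok c" "j : I" for j using that kl by(intro ok_upd) auto
  have U1: "sl (ap (Ko k l * Uo k p q) z) c = (if ok c & c k = - c l then theta (c l) (- p) *. sl z (c(k := q, l := - p)) else 0)" if "p : I" for p q
  proof -
   have "sl (ap (Ko k l * Uo k p q) z) c = (if ok c & c k = - c l then SUM j:I. if j = - p then theta (c l) (- p) *. sl z (c(k := q, l := - p)) else 0 else 0)"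
    using o kl unfolding ap_mult sl_Ko by(intro if_cong sum.cong refl) (auto simp: sl_Uo fun_upd_twist)
   thus ?thesis using that by simp
  qed
  have U2: "sl (ap (Ko k l * Uo l p q) z) c = (if ok c & c k = - c l then theta (c l) p *. sl z (c(k := - p, l := q)) else 0)" if "p : I" for p q
  proof -
   have "sl (ap (Ko k l * Uo l p q) z) c = (if ok c & c k = - c l then SUM j:I. if j = p then theta (c l) p *. sl z (c(k := - p, l := q)) else 0 else 0)"
    using o kl unfolding ap_mult sl_Ko by(intro if_cong sum.cong refl) (auto simp: sl_Uo fun_upd_twist)
   thus ?thesis using that by simp
  qed
  let ?G = "sl (ap (Ko k l * Uo k b a) z) c"
  let ?H = "sl (ap (Ko k l * Uo l b a) z) c"
  let ?Q = "sl (ap (Ko k l * ?A) z) c"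
  let ?R = "sl (ap (Ko k l * ?B) z) c"
  let ?T = "sl (ap (Ko k l * ?C) z) c"
  have "?Q = ?G - theta a b *. ?R
    + (?H - theta a b *. ?T)" proof -
   have "Ko k l * ?A = Ko k l * Uo k b a - theta a b *: (Ko k l * ?B) + (Ko k l * Uo l b a - theta a b *: (Ko k l * ?C))"
    by(simp add: Wk_def distrib_left right_diff_distrib scl_simps(2))
   thus ?thesis by(simp del: ap_mult)
  qed
  also have "... = 0" proof -
   define P where "P <-> ok c & c k = - c l"
   let ?K = "sl z (c(k := a, l := - b))"
   have e1: "?G = (if P then - (theta (c l) b *. ?K) else 0)" unfolding U1[OF b] P_def theta_neg vs_simps(9) ..
   let ?L = "sl z (c(k := - b, l := a))"
   have e2: "?R = (if P then theta (c l) a *. ?L else 0)" using U1[of "- a" "- b"] a unfolding P_def by simp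
   have e3: "?H = (if P then theta (c l) b *. ?L else 0)" unfolding U2[OF b] P_def ..
   have e4: "?T = (if P then - (theta (c l) a *. ?K) else 0)" using U2[of "- a" "- b"] a unfolding P_def theta_neg vs_simps(9) by simp
   show ?thesis unfolding e1 e2 e3 e4 by(cases P) (simp_all add: vs_simps th)
  qed
  finally show "?Q = sl (ap 0 z) c" by simp
 qed
qed

lemma lv_Ko: "lv T * Ko k l = Ko k l * lv T" by(rule lop_slI) (simp add: sl_lv sl_Ko ap_vsum ap_vs)

lemma To_Ko: assumes ab: "a : I" "b : I" and kl: "k < NN" "l < NN" "k ~= l" shows "To a b * Ko k l = Ko k l * To a b"
proof -
 let ?A = "SUM m:{..<NN} - {k} - {l}. Wk a b m"
 have "(SUM m:{..<NN}. Wk a b m) = Wk a b k + (Wk a b l + ?A)" using kl by(simp add: sum.remove[of "{..<NN}" k] sum.remove[of "{..<NN} - {k}" l])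
 hence T: "To a b = lv (F a b) - (Wk a b k + Wk a b l) - ?A" by(simp add: To_def)
 have "?A * Ko k l = Ko k l * ?A" unfolding sum_distrib_left sum_distrib_right using ab kl by(intro sum.cong refl Wk_Ko) auto
 thus ?thesis unfolding T left_diff_distrib[of _ _ "Ko k l"] right_diff_distrib[of "Ko k l"] Wk_Ko_zero[OF ab kl] lv_Ko by simp
qed

lemma Ps_Uo: assumes s: "sigma permutes {..<NN}" and j: "j : I" shows "Ps sigma * Uo k i j = Uo (sigma k) i j * Ps sigma"
proof(rule lop_slI)
 fix z :: "'v tnv" and a
 have "(a \<circ> sigma)(k := j) = a(sigma k := j) \<circ> sigma" using permutes_inj[OF s] by(auto simp: fun_eq_iff inj_eq)
 thus "sl (ap (Ps sigma * Uo k i j) z) a = sl (ap (Uo (sigma k) i j * Ps sigma) z) a" by(simp add: sl_Ps sl_Uo ok_perm[OF s])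
qed

lemma Ps_To: assumes s: "sigma permutes {..<NN}" and ab: "a : I" "b : I" shows "Ps sigma * To a b = To a b * Ps sigma"
proof -
 have 1: "Ps sigma * lv (F a b) = lv (F a b) * Ps sigma" by(rule lop_slI) (simp add: sl_Ps sl_lv)
 let ?A = "SUM k:{..<NN}. Wk a b (sigma k)"
 let ?B = "SUM k:{..<NN}. Wk a b k"
 have "Ps sigma * Wk a b k = Wk a b (sigma k) * Ps sigma" for k unfolding Wk_def using Ps_Uo[OF s, of a k b] Ps_Uo[OF s, of "- b" k "- a"] ab
  by(simp add: left_diff_distrib right_diff_distrib scl_simps)
 hence "Ps sigma * ?B = ?A * Ps sigma" by(simp add: sum_distrib_left sum_distrib_right)
 also have "?A = ?B" using sum.permute[OF s, of "Wk a b"] by(simp add: comp_def)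
 finally show ?thesis unfolding To_def left_diff_distrib right_diff_distrib 1 by simp
qed

lemma Ao_Ps: "Ao = (SUM sigma:SN. (sign sigma / fact NN) *: Ps sigma)" by(rule lop_slI) (simp add: sl_Ao ap_sum sl_sum sl_Ps)

lemma To_Ao: "a : I ==> b : I ==> To a b * Ao = Ao * To a b" unfolding Ao_Ps sum_distrib_left sum_distrib_right by(intro sum.cong refl) (simp add: Ps_To scl_simps)

lemma To_XX: assumes ab: "a : I" "b : I" shows "To a b * XX u NN = XX u NN * To a b" unfolding XX_def
proof(rule prod_list_commute)
 fix T assume "T : set (map (Xf u) [0..<NN])"
 then obtain k where k: "T = Xf u k" "k < NN" by auto
 have S: "To a b * Sx u k = Sx u k * To a b" unfolding Sx_def by(rule commP[OF To_Fo[OF ab k(2)]])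
 let ?A = "map (Rx u k) [Suc k..<NN]"
 have "To a b * prod_list ?A = prod_list ?A * To a b" proof(rule prod_list_commute)
  fix T assume "T : set ?A"
  then obtain l where l: "T = Rx u k l" "k < l" "l < NN" by auto
  show "To a b * T = T * To a b" unfolding l(1) Rx_def by(rule commP[OF To_Ko[OF ab]]) (use l k in auto)
 qed
 thus "To a b * T = T * To a b" unfolding k(1) Xf_def using S by(metis mult.assoc)
qed

text \<open>On fully antisymmetric tensors the tensor places act by the trace of a symplectic
  matrix, which is 0.\<close>

lemma alt_W: assumes C: "alt C 0" and ab: "a : I" "b : I"
 shows "ap (C * (SUM k:{..<NN}. Wk a b k)) (bs Jc v) = 0" proof -
 have U: "ap C (SUM k:{..<NN}. ap (Uo k i j) (bs Jc v)) = (if i = j then ap C (bs Jc v) else 0)" if ij: "i : I" "j : I" for i j proof -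
  obtain r where r: "r < NN" "Jc r = j" using Jc_surj[OF ij(2)] by blast
  have "(SUM k:{..<NN}. ap (Uo k i j) (bs Jc v)) = (SUM k:{..<NN}. if k = r then bs (Jc(r := i)) v else 0)" proof(intro sum.cong refl)
   fix k assume "k : {..<NN}"
   thus "ap (Uo k i j) (bs Jc v) = (if k = r then bs (Jc(r := i)) v else 0)" using Uo_bs[OF ok_Jc, of k i j v] ij r Jc_inj[of k r] by auto
  qed
  also have "... = bs (Jc(r := i)) v" using r by simp
  finally have e: "(SUM k:{..<NN}. ap (Uo k i j) (bs Jc v)) = bs (Jc(r := i)) v" .
  show ?thesis
  proof(cases "i = j")
   case True
   hence "Jc(r := i) = Jc" using r by auto
   thus ?thesis unfolding e using True by simp
  next
   case False
   obtain q where q: "q < NN" "Jc q = i" using Jc_surj[OF ij(1)] by blast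
   have "ap C (bs (Jc(r := i)) v) = 0" by(rule alt_kill[OF C, of q r]) (use q r False in auto)
   thus ?thesis unfolding e using False by simp
  qed
 qed
 have "ap (C * (SUM k:{..<NN}. Wk a b k)) (bs Jc v) = ap C (SUM k:{..<NN}. ap (Uo k b a) (bs Jc v)) - theta a b *. ap C (SUM k:{..<NN}. ap (Uo k (- a) (- b)) (bs Jc v))"
  by(simp add: Wk_def ap_sum sum_subtractf ap_vdiff ap_vs flip: vs_sum)
 also have "... = 0" using ab U[of b a] U[of "- a" "- b"] Iset_nz[OF ab(1)] by(auto simp: theta_same)
 finally show ?thesis .
qed

text \<open>A transposition makes a basis tensor agree with \<open>Jc\<close> in one more place,
  unless it misses an index; then it repeats another one and \<open>C\<close> kills it.\<close>

lemma alt_zero: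
 assumes C: "alt C 0" and J: "!!v. ap C (bs Jc v) = 0" and c: "ok c" shows "ap C (bs c v) = 0" using c
proof(induction "card {r:{..<NN}. c r ~= Jc r}" arbitrary: c rule: less_induct)
 case less
 show ?case
 proof(cases "EX r<NN. c r ~= Jc r")
  case False
  hence "c = Jc" using less.prems ok_Jc unfolding ok_def by(metis ext)
  thus ?thesis using J by simp
 next
  case True
  then obtain r where r: "r < NN" "c r ~= Jc r" by blast
  show ?thesis
  proof(cases "EX s<NN. c s = Jc r")
   case True
   then obtain s where s: "s < NN" "c s = Jc r" by blast
   have sr: "s ~= r" using s r by auto
   let ?c = "sw r s c"
   have "{q:{..<NN}. ?c q ~= Jc q} \<subset> {q:{..<NN}. c q ~= Jc q}" proof -
    have "{q:{..<NN}. ?c q ~= Jc q} <= {q:{..<NN}. c q ~= Jc q} - {r}" using s sr r Jc_inj[of r s] by(auto simp: sw_def split: if_splits)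
    thus ?thesis using r by auto
   qed
   hence "card {q:{..<NN}. ?c q ~= Jc q} < card {q:{..<NN}. c q ~= Jc q}" by(rule psubset_card_mono[rotated]) simp
   moreover have "ok ?c" using less.prems r s by(simp add: ok_sw)
   ultimately have "ap C (bs ?c v) = 0" by(rule less.hyps)
   thus ?thesis using alt_swap[OF C, of r s c v] r s sr by simp
  next
   case False
   have "~ inj_on c {..<NN}" proof
    assume i: "inj_on c {..<NN}"
    have "c ` {..<NN} <= Jc ` {..<NN} - {Jc r}" proof
     fix x assume "x : c ` {..<NN}"
     then obtain k where k: "k < NN" "x = c k" by auto
     hence "x : I" using okD[OF less.prems] by simp
     then obtain q where "q < NN" "Jc q = x" using Jc_surj by blast
     hence "x : Jc ` {..<NN}" by(intro image_eqI[of _ _ q]) auto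
     thus "x : Jc ` {..<NN} - {Jc r}" using False k by auto
    qed
    hence "card (c ` {..<NN}) <= card (Jc ` {..<NN} - {Jc r})" by(intro card_mono) auto
    also have "... < card (Jc ` {..<NN})" using r by(intro card_Diff1_less) auto
    also have "... <= NN" using card_image_le[of "{..<NN}" Jc] by simp
    finally show False using card_image[OF i] by simp
   qed
   then obtain p q where "p < NN" "q < NN" "p ~= q" "c p = c q" unfolding inj_on_def by auto
   thus ?thesis using alt_kill[OF C, of p q c v] by simp
  qed
 qed
qed

lemma alt_lin: "alt A k ==> alt B k ==> alt (A - c *: B) k" unfolding alt_def by(auto simp: left_diff_distrib scl_simps)

end

context sp_hwrep
begin

text \<open>\<open>To a b\<close> commutes with the whole product, and after antisymmetrisation it
  acts through the module alone. Hence the vectors with the right scalar form a submodule, and it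
  contains \<open>xi\<close>.\<close>

lemma hw_all: assumes u: "gen u" shows "ap (Ao * XX u NN) (bs Jc v) = dd u *. ap Ao (bs Jc v)"
proof -
 let ?C = "Ao * XX u NN - dd u *: Ao"
 define W where "W = {v. ap ?C (bs Jc v) = 0}"
 have C: "alt ?C 0" by(rule alt_lin[OF alt_XX[OF u] alt_Ao])
 have "W = {0} | W = UNIV" proof(rule irr)
  show "csubspace W" unfolding W_def by(rule csubI) (auto simp: bs_lin ap_vadd ap_vs simp del: ap_diff)
  fix a b f assume ab: "a : I" "b : I" "f : W"
  let ?A = "bs Jc (ap (F a b) f)"
  let ?B = "SUM k:{..<NN}. Wk a b k"
  let ?D = "ap (To a b) (bs Jc f)"
  have T: "?D = ?A - ap ?B (bs Jc f)" proof -
   have "ap (lv (F a b)) (bs Jc f) = ?A" by(rule sl_eqI) (simp add: sl_lv sl_bs)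
   thus ?thesis by(simp add: To_def)
  qed
  have "?C * To a b = To a b * ?C" using To_Ao[OF ab(1,2)] To_XX[OF ab(1,2), of u] by(simp add: left_diff_distrib right_diff_distrib scl_simps(1,2)) (metis mult.assoc)
  hence "ap ?C ?D = ap (To a b) (ap ?C (bs Jc f))" by(metis ap_mult)
  also have "... = 0" using ab(3) unfolding W_def by(simp del: ap_diff)
  finally have "ap ?C ?A - ap (?C * ?B) (bs Jc f) = 0" unfolding T by(simp only: ap_vdiff ap_mult)
  thus "ap (F a b) f : W" unfolding alt_W[OF C ab(1,2)] W_def by simp
 qed
 moreover have "xi : W" using hw_value[OF u] by(simp add: W_def)
 ultimately have "v : W" using xi0 by auto
 thus ?thesis by(simp add: W_def)
qed

theorem sdet_op: assumes u: "gen u" and c: "ok c" shows "ap (Ao * XX u NN) (bs c v) = dd u *. ap Ao (bs c v)"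
proof -
 have "ap (Ao * XX u NN - dd u *: Ao) (bs c v) = 0" by(rule alt_zero[OF alt_lin[OF alt_XX[OF u] alt_Ao] _ c]) (use hw_all[OF u] in simp)
 thus ?thesis by simp
qed

end

section \<open>Comparison with the determinant and the comatrix on lists\<close>

definition fn :: "int list => nat => int" where "fn b r = (if r < length b then b ! r else 0)"

lemma finite_LC: "finite (LC n m)"
proof -
 have "LC n m = {a. set a <= Iset n & length a = m}" by(auto simp: LC_def)
 thus ?thesis by(simp add: finite_lists_length_eq)
qed

lemma prod_list_concat: "prod_list (concat Ls) = prod_list (map prod_list Ls :: 'a::monoid_mult list)" by(induction Ls) auto

context sp_rep
begin

definition unf :: "(nat => int) => int list" where "unf c = map c [0..<NN]"

lemma fn_unf: "ok c ==> fn (unf c) = c" unfolding ok_def fn_def unf_def by(rule ext) (metis add.left_neutral diff_zero length_map length_upt nth_map_upt)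
lemma unf_LC: "ok c ==> unf c : LC n NN" using okD[of c] by(auto simp: unf_def LC_def)
lemma ok_fn: "b : LC n NN ==> ok (fn b)" by(auto simp: LC_def ok_def fn_def)
lemma unf_fn: "b : LC n NN ==> unf (fn b) = b" by(auto simp: LC_def unf_def fn_def intro!: nth_equalityI)
lemma unf_nth: "r < NN ==> unf c ! r = c r" by(simp add: unf_def)
lemma fn_nth: "b : LC n NN ==> r < NN ==> fn b r = b ! r" by(simp add: LC_def fn_def)
lemma unf_len: "length (unf c) = NN" by(simp add: unf_def)
lemma ok_eq: "ok c ==> ok c' ==> c = c' <-> (ALL r<NN. c r = c' r)" unfolding ok_def by(metis ext)

text \<open>\<open>M\<close> is the matrix of \<open>T\<close> on basis tensors, and the result has
  no component outside admissible index functions; so matrix products over \<open>SC n\<close>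
  correspond to products of operators.\<close>

definition repS :: "(int list \<times> 'v) op => 'v tns lop => bool" where
 "repS M T <-> (ALL b:LC n NN. ALL y c. sl (ap T (bs (fn b) (kd y))) c = (if ok c then (%x. M (unf c, x) (b, y)) else 0))"

lemma repSD: "repS M T ==> b : LC n NN ==> sl (ap T (bs (fn b) (kd y))) c = (if ok c then (%x. M (unf c, x) (b, y)) else 0)" unfolding repS_def by blast

lemma vec_kd: "(SUM z:UNIV. g z *. kd z) = (g :: 'v => complex)" by(rule ext) (simp add: sum_fun_apply vs_apply kd_def if_distrib[of "%z. _ * z"] cong: if_cong)

lemma kd_sym: "kd x y = kd y x" by(auto simp: kd_def)

lemma rep_expand:
 assumes T: "repS M T" and b: "b : LC n NN"
 shows "ap T (bs (fn b) (kd y)) = (SUM p:SC n. M p (b, y) *. bs (fn (fst p)) (kd (snd p)))" proof(rule sl_eqI)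
 fix c
 let ?A = "SUM a:LC n NN. SUM z:UNIV. M (a, z) (b, y) *. (if c = fn a then kd z else 0)"
 let ?B = "sl (SUM p:SC n. M p (b, y) *. bs (fn (fst p)) (kd (snd p))) c"
 have R: "?B
   = ?A" by(simp add: sl_sum sl_bs SC_def sum.cartesian_product split_def)
 show "sl (ap T (bs (fn b) (kd y))) c = ?B" proof(cases "ok c")
  case True
  let ?C = "%x. M (unf c, x) (b, y)"
  have "?A = (SUM a:LC n NN. if a = unf c then ?C else 0)" proof(intro sum.cong refl)
   fix a assume a: "a : LC n NN"
   have "c = fn a <-> a = unf c" using fn_unf[OF True] unf_fn[OF a] by auto
   thus "(SUM z:UNIV. M (a, z) (b, y) *. (if c = fn a then kd z else 0)) = (if a = unf c then ?C else 0)" by(auto simp: vec_kd)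
  qed
  thus ?thesis unfolding R repSD[OF T b] using True unf_LC[OF True] by(simp add: finite_LC)
 next
  case False
  have "?A = 0" using False ok_fn by(intro sum.neutral ballI) auto
  thus ?thesis unfolding R repSD[OF T b] using False by simp
 qed
qed

lemma rep_mult: assumes T: "repS M T" and T': "repS M' T'" shows "repS (mmul (SC n) M M') (T * T')" unfolding repS_def
proof(intro ballI allI)
 fix b c and y :: "'v" assume b: "b : LC n NN"
 let ?A = "sl (ap (T * T') (bs (fn b) (kd y))) c"
 have "?A = (SUM p:SC n. M' p (b, y) *. sl (ap T (bs (fn (fst p)) (kd (snd p)))) c)" by(simp add: rep_expand[OF T' b] ap_vsum ap_vs sl_sum)
 also have "... = (SUM p:SC n. M' p (b, y) *. (if ok c then (%x. M (unf c, x) p) else 0))" using repSD[OF T] by(intro sum.cong refl) (auto simp: SC_def)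
 also have "... = (if ok c then (%x. mmul (SC n) M M' (unf c, x) (b, y)) else 0)" by(rule ext) (auto simp: sum_fun_apply vs_apply mmul_def mult.commute fa)
 finally show "?A = ..." .
qed

lemma rep_one: "repS kd 1" unfolding repS_def
proof(intro ballI allI)
 fix b c and y :: "'v" assume b: "b : LC n NN"
 show "sl (ap 1 (bs (fn b) (kd y))) c = (if ok c then (%x. kd (unf c, x) (b, y)) else 0)" proof(cases "ok c")
  case True
  have "c = fn b <-> unf c = b" using fn_unf[OF True] unf_fn[OF b] by metis
  thus ?thesis by(intro ext) (simp add: sl_bs True kd_def fa)
 next
  case False
  hence "c ~= fn b" using ok_fn[OF b] by blast
  thus ?thesis by(simp add: sl_bs False)
 qed
qed

lemma rep_list: "list_all2 repS Ms Ts ==> repS (mprod (SC n) Ms) (prod_list Ts)" by(induction rule: list_all2_induct) (auto intro: rep_one rep_mult)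

lemma rep_S:
 assumes k: "k < NN" and rho: "!!i j x y. i : I ==> j : I ==> rho (Fm i j) x y = ap (F i j) (kd y) x"
 shows "repS (embS k (Sop n rho (u - of_nat k))) (Sx u k)" unfolding repS_def proof(intro ballI allI)
 fix b c and y :: "'v" assume b: "b : LC n NN"
 let ?a = "u - of_nat k - 1/2"
 have okb: "ok (fn b)" by(rule ok_fn[OF b])
 let ?C = "sl (ap (Sx u k) (bs (fn b) (kd y))) c"
 show "?C = (if ok c then (%x. embS k (Sop n rho (u - of_nat k)) (unf c, x) (b, y)) else 0)" proof(cases "ok c")
  case False
  thus ?thesis using okb by(auto simp: Sx_def sl_Fo sl_bs)
 next
  case True
  define g where "g <-> (ALL r<NN. r ~= k --> c r = b ! r)"
  have bk: "b ! k : I" using okD[OF okb k] fn_nth[OF b k] by simp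
  have ck: "c k : I" by(rule okD[OF True k])
  have 1: "c = fn b <-> g & c k = b ! k" unfolding ok_eq[OF True okb] g_def using k fn_nth[OF b] by auto
  have 2: "c(k := j) = fn b <-> g & j = b ! k" if "j : I" for j unfolding ok_eq[OF ok_upd[OF True k that] okb] g_def using k fn_nth[OF b] by auto
  let ?A = "if g then ap (F (c k) (b ! k)) (kd y) else 0"
  let ?B = "SUM j:I. ap (F (c k) j) (sl (bs (fn b) (kd y)) (c(k := j)))"
  have "?B = (SUM j:I. if j = b ! k then ?A else 0)" by(intro sum.cong refl) (simp add: sl_bs 2)
  hence e: "?B = ?A" using bk by simp
  have "?C = (if g & c k = b ! k then kd y else 0) + (1 / ?a) *. ?A" using True e by(simp add: Sx_def sl_Fo) (simp add: sl_bs 1)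
  moreover have "(ALL r<length (unf c). r ~= k --> unf c ! r = b ! r) <-> g" by(simp add: g_def unf_len unf_nth)
  ultimately show ?thesis using True k ck bk by(auto simp: fun_eq_iff fa vs_apply embS_def Sop_def unf_nth rho kd_def)
 qed
qed

lemma rep_R:
 assumes kl: "k < NN" "l < NN" "k ~= l"
 shows "repS (embR k l (Rt (- 2 * u + of_nat k + of_nat l))) (Rx u k l)" unfolding repS_def proof(intro ballI allI)
 fix b c and y :: "'v" assume b: "b : LC n NN"
 let ?w = "- 2 * u + of_nat k + of_nat l"
 have okb: "ok (fn b)" by(rule ok_fn[OF b])
 let ?A = "bs (fn b) (kd y)"
 show "sl (ap (Rx u k l) ?A) c = (if ok c then (%x. embR k l (Rt ?w) (unf c, x) (b, y)) else 0)" proof(cases "ok c")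
  case False
  thus ?thesis using okb by(auto simp: Rx_def sl_Ko sl_bs)
 next
  case True
  define g where "g <-> (ALL r<NN. r ~= k & r ~= l --> c r = b ! r)"
  have bI: "b ! k : I" "b ! l : I" using okD[OF okb kl(1)] okD[OF okb kl(2)] fn_nth[OF b kl(1)] fn_nth[OF b kl(2)] by simp_all
  have 1: "c = fn b <-> g & c k = b ! k & c l = b ! l" unfolding ok_eq[OF True okb] g_def using kl fn_nth[OF b] by auto
  have 2: "c(k := - j, l := j) = fn b <-> g & b ! k = - b ! l & j = b ! l" if "j : I" for j proof -
   have o: "ok (c(k := - j, l := j))" using True kl that by(intro ok_upd) auto
   have "(c(k := - j, l := j)) r = (if r = k then - j else if r = l then j else c r)" for r using kl(3) by simp
   hence "(ALL r<NN. (c(k := - j, l := j)) r = fn b r) <-> (ALL r<NN. (if r = k then - j else if r = l then j else c r) = b ! r)" using fn_nth[OF b] by simp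
   also have "... <-> - j = b ! k & j = b ! l & g" unfolding g_def using kl by(smt (verit))
   finally show ?thesis unfolding ok_eq[OF o okb] by auto
  qed
  let ?C = "if g & b ! k = - b ! l then theta (c l) (b ! l) *. kd y else 0"
  let ?D = "SUM j:I. theta (c l) j *. sl ?A (c(k := - j, l := j))"
  have "?D = (SUM j:I. if j = b ! l then ?C else 0)" by(intro sum.cong refl) (simp add: sl_bs 2)
  hence e: "?D = ?C" using bI by simp
  let ?B = "if c k = - c l then if g & b ! k = - b ! l then theta (c l) (b ! l) *. kd y else 0 else 0"
  let ?E = "if g & c k = b ! k & c l = b ! l then kd y else 0"
  have "sl (ap (Rx u k l) ?A) c = ?E - (1 / ?w) *. ?B" proof -
   have "sl (ap (Rx u k l) ?A) c = sl ?A c - (1 / ?w) *. (if c k = - c l then SUM j:I. theta (c l) j *. sl ?A (c(k := - j, l := j)) else 0)"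
    using True by(simp add: Rx_def sl_Ko)
   also have "... = ?E - (1 / ?w) *. ?B" unfolding e by(simp only: sl_bs 1)
   finally show ?thesis .
  qed
  moreover have "(ALL r<length (unf c). r ~= k & r ~= l --> unf c ! r = b ! r) <-> g" by(simp add: g_def unf_len unf_nth)
  ultimately show ?thesis using True kl by(auto simp: fun_eq_iff fa vs_apply embR_def Rt_def unf_nth kd_def)
 qed
qed

text \<open>\<open>antisym\<close> permutes the second word and \<open>Ao\<close> the first, so the
  sum is reindexed by inverse permutations.\<close>

lemma rep_A: "repS (antisym NN) Ao" unfolding repS_def
proof(intro ballI allI)
 fix b c and y :: "'v" assume b: "b : LC n NN"
 have okb: "ok (fn b)" by(rule ok_fn[OF b])
 let ?P = "SN"
 let ?A = "sl (ap Ao (bs (fn b) (kd y))) c"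
 let ?B = "%x. antisym NN (unf c, x) (b, y)"
 show "?A = (if ok c then ?B else 0)" proof(cases "ok c")
  case False
  have "?A = (SUM sigma:?P. 0)" unfolding sl_Ao sl_bs proof(intro sum.cong refl)
   fix sigma assume "sigma : ?P"
   hence "~ ok (c \<circ> sigma)" using False ok_perm[of sigma c] by simp
   hence "c \<circ> sigma ~= fn b" using okb by metis
   thus "(sign sigma / fact NN) *. (if c \<circ> sigma = fn b then kd y else 0) = 0" by simp
  qed
  thus ?thesis using False by simp
 next
  case True
  have "?A = (SUM sigma:?P. (sign sigma / fact NN) *. (if ALL r<NN. c (sigma r) = b ! r then kd y else 0))" unfolding sl_Ao sl_bs
  proof(intro sum.cong refl)
   fix sigma assume s: "sigma : ?P"
   have "ok (c \<circ> sigma)" using s ok_perm[of sigma c] True by simp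
   hence "c \<circ> sigma = fn b <-> (ALL r<NN. c (sigma r) = b ! r)" using ok_eq[OF _ okb, of "c \<circ> sigma"] fn_nth[OF b] by auto
   thus "(sign sigma / fact NN) *. (if c \<circ> sigma = fn b then kd y else 0) = (sign sigma / fact NN) *. (if ALL r<NN. c (sigma r) = b ! r then kd y else 0)" by simp
  qed
  also have "... = (SUM sigma:?P. (sign (inv sigma) / fact NN) *. (if ALL r<NN. c (inv sigma r) = b ! r then kd y else 0))" by(rule sum_permutations_inverse)
  also have "... = (SUM sigma:?P. (sign sigma / fact NN) *. (if ALL r<NN. c r = b ! (sigma r) then kd y else 0))"
  proof(intro sum.cong refl)
   fix sigma assume "sigma : ?P"
   hence p: "sigma permutes {..<NN}" by simp
   have "(ALL r<NN. c (inv sigma r) = b ! r) <-> (ALL r<NN. c r = b ! (sigma r))"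
    using permutes_in_image[OF p] permutes_in_image[OF permutes_inv[OF p]] permutes_inverses[OF p] by(metis lessThan_iff)
   thus "(sign (inv sigma) / fact NN) *. (if ALL r<NN. c (inv sigma r) = b ! r then kd y else 0) = (sign sigma / fact NN) *. (if ALL r<NN. c r = b ! (sigma r) then kd y else 0)"
    using p by(simp add: sign_inverse permutes_imp_permutation[OF finite_lessThan])
  qed
  also have "... = ?B" by(rule ext) (auto simp: sum_fun_apply vs_apply antisym_def unf_nth kd_sym[of y] fa sum_distrib_left sum_divide_distrib intro!: sum.cong)
  finally show ?thesis using True by simp
 qed
qed

end

context sp_hwrep
begin

lemma rep_X:
 assumes rho: "!!i j x y. i : I ==> j : I ==> rho (Fm i j) x y = ap (F i j) (kd y) x"
 shows "repS (mprod (SC n) (sdet_factors n rho u)) (XX u NN)" proof -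
 let ?L = "concat (map (%k. Sx u k # map (Rx u k) [Suc k..<NN]) [0..<NN])"
 have "XX u NN = prod_list ?L" by(simp add: XX_def prod_list_concat comp_def Xf_def[abs_def])
 moreover have "list_all2 repS (sdet_factors n rho u) ?L" proof -
  have a: "list_all2 (list_all2 repS) (map (%k. embS k (Sop n rho (u - of_nat k)) # map (%l. embR k l (Rt (- 2 * u + of_nat k + of_nat l))) [Suc k..<NN]) ks) (map (%k. Sx u k # map (Rx u k) [Suc k..<NN]) ks)"
   if "set ks <= {..<NN}" for ks using that proof(induction ks)
   case Nil show ?case by simp
  next
   case (Cons k ks)
   have k: "k < NN" using Cons.prems by simp
   have "list_all2 repS (map (%l. embR k l (Rt (- 2 * u + of_nat k + of_nat l))) [Suc k..<NN]) (map (Rx u k) [Suc k..<NN])"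
    unfolding list_all2_map1 list_all2_map2 by(rule list.rel_refl_strong) (rule rep_R, use k in auto)
   moreover have "repS (embS k (Sop n rho (u - of_nat k))) (Sx u k)" by(rule rep_S[OF k rho])
   ultimately show ?case using Cons by simp
  qed
  have cc: "list_all2 (list_all2 P) As Bs ==> list_all2 P (concat As) (concat Bs)" for P :: "(int list \<times> 'v) op => 'v tns lop => bool" and As Bs
   by(induction rule: list_all2_induct) (auto intro: list_all2_appendI)
  show ?thesis unfolding sdet_factors_def by(rule cc, rule a) auto
 qed
 ultimately show ?thesis using rep_list by simp
qed

text \<open>Uniqueness in the definite description needs one nonzero block of the antisymmetriser:
  at the word of \<open>Jc\<close> it is the identity of the module divided by (2n)!.\<close>

theorem sdet_value:
 assumes rho: "!!i j x y. i : I ==> j : I ==> rho (Fm i j) x y = ap (F i j) (kd y) x" and u: "gen u"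
 shows "sdet n rho u = (%x y. dd u * kd x y)" proof -
 let ?A = "antisym NN :: (int list \<times> 'v) op"
 let ?B = "mprod (SC n) (sdet_factors n rho u)"
 have AX: "mmul (SC n) ?A ?B (a, x) (b, y) = dd u * ?A (a, x) (b, y)"
  if a: "a : LC n NN" and b: "b : LC n NN" for a b x y proof -
  have okc: "ok (fn a)" "ok (fn b)" using ok_fn a b by auto
  have X: "repS (mmul (SC n) ?A ?B) (Ao * XX u NN)" by(rule rep_mult[OF rep_A rep_X]) (rule rho)
  have "sl (ap (Ao * XX u NN) (bs (fn b) (kd y))) (fn a) x = dd u * sl (ap Ao (bs (fn b) (kd y))) (fn a) x" unfolding sdet_op[OF u okc(2)] by(simp add: vs_apply)
  thus ?thesis unfolding repSD[OF X b] repSD[OF rep_A b] using okc(1) by(simp only: if_True unf_fn[OF a])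
 qed
 have lift: "mmul (SC n) (liftT D) ?A (a, x) (b, y) = (SUM z:UNIV. D x z * ?A (a, z) (b, y))" if a: "a : LC n NN" for D a x b y proof -
  have "mmul (SC n) (liftT D) ?A (a, x) (b, y) = (SUM c:LC n NN. SUM z:UNIV. kd a c * D x z * ?A (c, z) (b, y))"
   by(simp add: mmul_def SC_def sum.cartesian_product split_def liftT_def)
  also have "... = (SUM c:LC n NN. if c = a then (SUM z:UNIV. D x z * ?A (a, z) (b, y)) else 0)" by(intro sum.cong refl) (auto simp: kd_def)
  finally show ?thesis using a by(simp add: finite_LC)
 qed
 let ?D = "%x y :: 'v. dd u * kd x y"
 have liftD: "mmul (SC n) (liftT ?D) ?A (a, x) (b, y) = dd u * ?A (a, x) (b, y)" if "a : LC n NN" for a x b y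
  unfolding lift[OF that] by(simp add: kd_def if_distrib[of "%z. _ * z"] if_distrib[of "%z. z * _"] cong: if_cong)
 let ?J = "unf Jc"
 have J: "?J : LC n NN" by(rule unf_LC[OF ok_Jc])
 \<comment> \<open>\<open>Jc\<close> is injective on the tensor places, so only the identity
   permutation fixes its word.\<close>
 have AJ: "?A (?J, x) (?J, y) = kd x y / fact NN" for x y proof -
  have "(SUM sigma:SN. (sign sigma :: complex) * (if (ALL r<NN. ?J ! r = ?J ! (sigma r)) then 1 else 0)) = (SUM sigma:SN. if sigma = id then 1 else 0)"
  proof(intro sum.cong refl)
   fix sigma assume s: "sigma : SN"
   have "sigma = id" if h: "ALL r<NN. ?J ! r = ?J ! (sigma r)" proof(rule ext)
    fix r
    show "sigma r = id r" proof(cases "r < NN")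
     case True
     hence "sigma r < NN" using permutes_in_image[of sigma "{..<NN}" r] s by simp
     thus ?thesis using h True Jc_inj[of r "sigma r"] by(auto simp: unf_nth)
    next
     case False
     thus ?thesis using s by(simp add: permutes_def)
    qed
   qed
   thus "(sign sigma :: complex) * (if (ALL r<NN. ?J ! r = ?J ! (sigma r)) then 1 else 0) = (if sigma = id then 1 else 0)" by auto
  qed
  also have "... = 1" using permutes_id[of "{..<NN}"] finite_permutations[of "{..<NN}"] by simp
  finally show ?thesis by(simp add: antisym_def)
 qed
 show ?thesis unfolding sdet_def
 proof(rule the_equality)
  show "ALL p:SC n. ALL q:SC n. mmul (SC n) (antisym NN) ?B p q = mmul (SC n) (liftT ?D) (antisym NN) p q"
   by(auto simp: SC_def AX[unfolded SC_def] liftD[unfolded SC_def])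
  fix D :: "'v op" assume D: "ALL p:SC n. ALL q:SC n. mmul (SC n) (antisym NN) ?B p q = mmul (SC n) (liftT D) (antisym NN) p q"
  show "D = ?D" proof(intro ext)
   fix x y :: 'v
   have "(?J, x) : SC n" "(?J, y) : SC n" using J by(simp_all add: SC_def)
   hence "mmul (SC n) ?A ?B (?J, x) (?J, y) = mmul (SC n) (liftT D) ?A (?J, x) (?J, y)" using D by blast
   hence "dd u * (kd x y / fact NN) = (SUM z:UNIV. D x z * (kd z y / fact NN))" unfolding AX[OF J J] lift[OF J] AJ .
   also have "... = D x y / fact NN" by(simp add: kd_def if_distrib[of "%z. _ * z"] if_distrib[of "%z. z / _"] cong: if_cong)
   finally show "D x y = dd u * kd x y" by simp
  qed
 qed
qed

end

text \<open>Places n - m and n + m - 1 carry the opposite indices -m and m, whose scalars are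
  combined in \<open>dd_value\<close>.\<close>

lemma prod_pair: fixes n :: nat shows "(PROD k:{..<2 * n}. g k) = (PROD m:{1..n}. g (n - m) * g (n + m - 1) :: complex)"
proof -
 let ?A = "PROD k:{n..<2 * n}. g k"
 let ?B = "PROD k:{..<n}. g k"
 have "{..<2 * n} = {..<n} \<union> {n..<2 * n}" by auto
 hence "(PROD k:{..<2 * n}. g k) = ?B * ?A" by(simp add: prod.union_disjoint ivl_disj_int)
 moreover have "?B = (PROD m:{1..n}. g (n - m))" by(rule prod.reindex_bij_witness[of _ "%m. n - m" "%k. n - k"]) auto
 moreover have "?A = (PROD m:{1..n}. g (n + m - 1))" by(rule prod.reindex_bij_witness[of _ "%m. n + m - 1" "%k. k + 1 - n"]) auto
 ultimately show ?thesis by(simp add: prod.distrib)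
qed

text \<open>One numerator of each factor cancels a denominator of the next factor, the other one a
  denominator of the previous factor.\<close>

lemma telescope:
 assumes nz: "!!m. m <= n ==> (u :: complex) + 1/2 - of_nat m ~= 0" "!!m. m <= n ==> u + 1/2 + of_nat m ~= 0"
 shows "(PROD m:{1..n}. (u - of_nat m + 1/2) * (u + of_nat m - 1/2) / ((u - of_nat m + 3/2) * (u + of_nat m + 1/2)))
   * (u + of_nat n + 1/2) = u - of_nat n + 1/2" using nz proof(induction n)
 case (Suc n)
 let ?p = "%m. (u - of_nat m + 1/2) * (u + of_nat m - 1/2) / ((u - of_nat m + 3/2) * (u + of_nat m + 1/2))"
 let ?A = "PROD m:{1..n}. ?p m"
 have IH: "?A * (u + of_nat n + 1/2) = u - of_nat n + 1/2" by(rule Suc.IH) (use Suc.prems in auto)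
 have e: "u - of_nat (Suc n) + 3/2 = u + 1/2 - of_nat n" "u + of_nat (Suc n) - 1/2 = u + of_nat n + 1/2"
   "u + of_nat (Suc n) + 1/2 = u + 1/2 + of_nat (Suc n)" by(simp_all add: field_simps)
 have nn: "u + 1/2 - of_nat n ~= 0" "u + 1/2 + of_nat (Suc n) ~= 0" using Suc.prems(1)[of n] Suc.prems(2)[of "Suc n"] by simp_all
 have pS: "(PROD m:{1..Suc n}. f m) = (PROD m:{1..n}. f m) * f (Suc n)" for f :: "nat => complex" by simp
 have ar: "P * (A * B / (C * D)) * D = P * B * (A / C)" if "D ~= 0" for P A B C D :: complex using that by simp
 let ?B = "u + of_nat (Suc n) + 1/2"
 have "(PROD m:{1..Suc n}. ?p m) * ?B = (?A * ?p (Suc n)) * ?B" by(simp only: pS)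
 also have "... = (u - of_nat n + 1/2) * ((u - of_nat (Suc n) + 1/2) / (u + 1/2 - of_nat n))" unfolding e ar[OF nn(2)] IH ..
 also have "u - of_nat n + 1/2 = u + 1/2 - of_nat n" by simp
 finally show ?case by(simp only: times_divide_eq_right nonzero_mult_div_cancel_left[OF nn(1)])
qed simp

context sp_hwrep
begin

text \<open>For this \<open>w\<close> the matrix S(u - 2n + 1) is 1 - F/w, with inverse w times the
  resolvent. A left inverse gives existence and a right inverse uniqueness in the definite
  description.\<close>

lemma Fhat_value:
 assumes rho: "!!i j x y. i : I ==> j : I ==> rho (Fm i j) x y = ap (F i j) (kd y) x" and u: "gen u"
  and w: "w = 2 * of_nat n - u - 1/2" "RR < cmod w" and i: "i : I" and j: "j : I"
 shows "Fhat n rho u (i, x) (j, y) = dd u * w * ent (GN w i j) x y" proof -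
 let ?B = "I \<times> (UNIV :: 'v set)"
 let ?S = "Sop n rho (u - 2 * of_nat n + 1)"
 define T :: "(int \<times> 'v) op" where "T = (%(i, x) (j, y). w * ent (GN w i j) x y)"
 have w0: "w ~= 0" using w(2) RR_nonneg by auto
 have S: "?S (i, x) (j, y) = kd i j * kd x y - ent (F i j) x y / w" if "i : I" "j : I" for i j x y proof -
  have "u - 2 * of_nat n + 1 - 1/2 = - w" by(simp add: w(1))
  thus ?thesis by(simp only: Sop_def split rho[OF that]) (simp add: kd_def ent_def)
 qed
 have sB: "(SUM p:?B. f p) = (SUM i:I. SUM x:UNIV. f (i, x))" for f :: "int \<times> 'v => complex" by(simp add: sum.cartesian_product)
 have k1: "(SUM l:I. SUM z:UNIV. f l z * (kd l j * kd z y)) = f j y" if "j : I" for f :: "int => 'v => complex" and j y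
  using that by(simp add: kd_def if_distrib[of "%z. _ * z"] cong: if_cong)
 have k2: "(SUM l:I. SUM z:UNIV. (kd i l * kd x z) * f l z) = f i x" if "i : I" for f :: "int => 'v => complex" and i x
  using k1[OF that, of f x] by(simp add: kd_sym[of i] kd_def mult.commute eq_commute cong: if_cong)
 have TS: "mmul ?B T ?S (i, x) (j, y) = kd i j * kd x y" if "i : I" "j : I" for i j x y proof -
  have "mmul ?B T ?S (i, x) (j, y) = (SUM l:I. SUM z:UNIV. w * ent (GN w i l) x z * (kd l j * kd z y) - ent (GN w i l) x z * ent (F l j) z y)"
   unfolding mmul_def sB by(intro sum.cong refl) (simp only: S T_def split that, use w0 in "simp add: alg")
  also have "... = w * ent (GN w i j) x y - ent (SUM l:I. GN w i l * F l j) x y" unfolding sum_subtractf by(simp only: k1[OF that(2)] ent_sum ent_mult)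
  also have "... = kd i j * kd x y" unfolding GN_eq[OF w(2) that] by(simp add: ent_simps)
  finally show ?thesis .
 qed
 have ST: "mmul ?B ?S T (i, x) (j, y) = kd i j * kd x y" if "i : I" "j : I" for i j x y proof -
  have "mmul ?B ?S T (i, x) (j, y) = (SUM l:I. SUM z:UNIV. (kd i l * kd x z) * (w * ent (GN w l j) z y) - ent (F i l) x z * ent (GN w l j) z y)"
   unfolding mmul_def sB by(intro sum.cong refl) (simp only: S T_def split that, use w0 in "simp add: alg")
  also have "... = w * ent (GN w i j) x y - ent (SUM l:I. F i l * GN w l j) x y" unfolding sum_subtractf by(simp only: k2[OF that(1)] ent_sum ent_mult)
  also have "... = kd i j * kd x y" unfolding GN_eq[OF w(2) that] by(simp add: ent_simps)
  finally show ?thesis .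
 qed
 define M where "M = (%p q. if p : ?B & q : ?B then dd u * T p q else 0)"
 let ?A = "sdet n rho u"
 have sd: "liftV ?A (i, x) (j, y) = dd u * (kd i j * kd x y)" for i j and x y :: 'v proof -
  have "sdet n rho u = (%x y. dd u * kd x y)" by(rule sdet_value[OF rho u])
  thus ?thesis by(simp add: liftV_def)
 qed
 have "Fhat n rho u = M" unfolding Fhat_def proof(rule the_equality, intro conjI)
  show "ALL p q. p ~: ?B | q ~: ?B --> M p q = 0" by(auto simp: M_def)
  show "ALL p:?B. ALL q:?B. mmul ?B M ?S p q = liftV ?A p q" proof(intro ballI)
   fix p q assume p: "p : ?B" and q: "q : ?B"
   obtain i x j y where pq: "p = (i, x)" "q = (j, y)" "i : I" "j : I" using p q by auto
   have "mmul ?B M ?S p q = dd u * mmul ?B T ?S p q" using p by(simp add: mmul_def M_def sum_distrib_left mult.assoc)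
   thus "mmul ?B M ?S p q = liftV ?A p q" unfolding pq(1,2) TS[OF pq(3,4)] sd .
  qed
  fix X assume X: "(ALL p q. p ~: ?B | q ~: ?B --> X p q = 0) & (ALL p:?B. ALL q:?B. mmul ?B X ?S p q = liftV ?A p q)"
  show "X = M" proof(intro ext)
   fix p q
   show "X p q = M p q" proof(cases "p : ?B & q : ?B")
    case False
    hence "X p q = 0" using X by blast
    thus ?thesis unfolding M_def using False by(simp only: if_False)
   next
    case True
    obtain i x j y where pq: "p = (i, x)" "q = (j, y)" "i : I" "j : I" using True by auto
    let ?C = "SUM r:?B. X p r * mmul ?B ?S T r q"
    have "X p q = ?C" proof -
     have "?C = (SUM l:I. SUM z:UNIV. X p (l, z) * (kd l j * kd z y))" unfolding sB pq(2) using ST pq(4) by(intro sum.cong refl) simp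
     thus ?thesis using k1[OF pq(4), of "%l z. X p (l, z)" y] pq(2) by simp
    qed
    also have "... = (SUM r:?B. mmul ?B X ?S p r * T r q)" unfolding mmul_def sum_distrib_left sum_distrib_right by(subst sum.swap) (simp add: mult.assoc)
    also have "... = (SUM l:I. SUM z:UNIV. (kd i l * kd x z) * (dd u * T (l, z) q))"
     unfolding sB using X True sd pq(1) by(intro sum.cong refl) (simp add: mult_ac)
    also have "... = M p q" unfolding k2[OF pq(3)] using True by(simp add: M_def pq(1))
    finally show ?thesis .
   qed
  qed
 qed
 thus ?thesis using i j by(simp add: M_def T_def)
qed

lemma dd_value: "dd (- u + of_nat n - 1) = (PROD m:{1..n}. (u + 1/2 - (of_int (lam m) - of_nat m)) * (u + 1/2 + (of_int (lam m) - of_nat m)) / ((u - of_nat m + 3/2) * (u + of_nat m + 1/2)))"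
 if nz: "!!m. m : {1..n} ==> u - of_nat m + 3/2 ~= 0" "!!m. m : {1..n} ==> u + of_nat m + 1/2 ~= 0" unfolding dd_def prod_pair
proof(intro prod.cong refl)
 fix m assume m: "m : {1..n}"
 let ?u = "- u + of_nat n - 1" and ?l = "of_int (lam m) :: complex"
 have ar: "1 + (1 - ?l) / (- X) = (X - 1 + ?l) / X" "1 + ?l / (- X) = (X - ?l) / X" if "X ~= 0" for X using that by(simp_all add: field_simps)
 let ?A = "u - of_nat m + 3/2"
 let ?D = "u + 1/2 + (?l - of_nat m)"
 have 1: "ck ?u (n - m) = ?D / ?A" proof -
  have J: "Jc (n - m) = - int m" "n - m < n" using m by(auto simp: Jc_def of_nat_diff)
  have e: "?u - of_nat (n - m) - 1/2 = - ?A" using m by(simp add: of_nat_diff)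
  have "lm (Jc (n - m)) = - ?l" unfolding J(1) using m by(simp add: lm_def)
  hence "ck ?u (n - m) = 1 + (1 - ?l) / (- ?A)" unfolding ck_def e using J(2) by simp
  also have "... = (u - of_nat m + 3/2 - 1 + ?l) / ?A" by(rule ar(1)[OF nz(1)[OF m]])
  also have "u - of_nat m + 3/2 - 1 + ?l = u + 1/2 + (?l - of_nat m)" by simp
  finally show ?thesis .
 qed
 let ?B = "u + of_nat m + 1/2"
 let ?C = "ck ?u (n + m - 1)"
 let ?E = "u + 1/2 - (?l - of_nat m)"
 have 2: "?C = ?E / ?B" proof -
  have J: "Jc (n + m - 1) = int m" "~ n + m - 1 < n" using m by(auto simp: Jc_def of_nat_diff)
  have e: "?u - of_nat (n + m - 1) - 1/2 = - ?B" using m by(simp add: of_nat_diff)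
  have "lm (Jc (n + m - 1)) = ?l" unfolding J(1) using m by(simp add: lm_def)
  hence "?C = 1 + ?l / (- ?B)" unfolding ck_def e using J(2) by simp
  also have "... = (u + of_nat m + 1/2 - ?l) / ?B" by(rule ar(2)[OF nz(2)[OF m]])
  also have "u + of_nat m + 1/2 - ?l = u + 1/2 - (?l - of_nat m)" by simp
  finally show ?thesis .
 qed
 show "ck ?u (n - m) * ?C = ?E * ?D / (?A * ?B)" unfolding 1 2 by(simp add: mult.commute)
qed

text \<open>The comatrix argument -u + n - 1 makes \<open>w\<close> equal to u + n + 1/2. The
  normalising factor and the scalar of the determinant combine by \<open>telescope\<close> to
  \<open>S0 u\<close> divided by u^(2n).\<close>

lemma piS_value:
 assumes rho: "!!i j x y. i : I ==> j : I ==> rho (Fm i j) x y = ap (F i j) (kd y) x"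
  and u: "R < cmod u" and i: "i : I" and j: "j : I"
 shows "mo UNIV (piS n rho i j u) = (inverse u ^ NN * S0 u) *: Gf u i j" proof -
 let ?w = "u + of_nat n + 1/2" and ?us = "- u + of_nat n - 1"
 have big: "u ~= z" if "cmod z <= 3 * real n + 3" for z using u that RR_nonneg by auto
 have half: "u + of_real x ~= 0" if "\<bar>x\<bar> <= 3 * real n + 3" for x using big[of "- of_real x"] that by(auto simp: add_eq_0_iff)
 have nz: "u + 1/2 - of_nat m ~= 0" "u + 1/2 + of_nat m ~= 0" "u - of_nat m + 3/2 ~= 0" "u + of_nat m + 1/2 ~= 0" if "m <= n" for m
  using half[of "1/2 - real m"] half[of "1/2 + real m"] half[of "3/2 - real m"] that by(auto simp: alg)
 have u0: "u ~= 0" using half[of 0] by simp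
 have gen: "gen ?us" unfolding gen_def proof(intro allI impI notI)
  fix m assume m: "m <= 2 * NN + 1" and e: "2 * ?us = of_nat m"
  have "2 * (u + of_real (real m / 2 + 1 - real n)) = of_nat m - 2 * ?us" by(simp add: alg)
  hence "2 * (u + of_real (real m / 2 + 1 - real n)) = 0" unfolding e by(simp only: diff_self)
  hence "u + of_real (real m / 2 + 1 - real n) = 0" by(simp only: mult_eq_0_iff zero_neq_numeral[symmetric] simp_thms)
  moreover have "\<bar>real m / 2 + 1 - real n\<bar> <= 3 * real n + 3" using m by(auto simp: abs_if)
  ultimately show False using half by blast
 qed
 have w: "RR < cmod ?w" by(rule Rw[OF u])
 let ?P = "PROD m:{1..n}. (u + 1/2 - (of_int (lam m) - of_nat m)) * (u + 1/2 + (of_int (lam m) - of_nat m))"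
 let ?Q = "PROD m:{1..n}. (u - of_nat m + 3/2) * (u + of_nat m + 1/2)"
 let ?N = "PROD m:{1..n}. (u - of_nat m + 1/2) * (u + of_nat m - 1/2)"
 have d: "dd ?us = ?P / ?Q" unfolding prod_dividef[symmetric] by(rule dd_value) (use nz in auto)
 have c: "cfun n u = inverse u ^ NN * ?N" proof -
  have "cfun n u = (PROD m:{1..n}. inverse u ^ 2 * ((u - of_nat m + 1/2) * (u + of_nat m - 1/2)))"
   unfolding cfun_def by(intro prod.cong refl) (use u0 in "simp add: field_simps power2_eq_square")
  thus ?thesis by(simp add: prod.distrib power_mult)
 qed
 have tel: "?N / ?Q * ?w = u - of_nat n + 1/2" unfolding prod_dividef[symmetric] by(rule telescope) (use nz in auto)
 have s: "cfun n u * (2 * u + 1) / (2 * u - 2 * of_nat n + 1) * (dd ?us * ?w) = inverse u ^ NN * S0 u" proof -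
  have e: "2 * u - 2 * of_nat n + 1 = 2 * (u - of_nat n + 1/2)" "2 * u + 1 = 2 * (u + 1/2)" "u - of_nat n + 1/2 ~= 0" using nz(1)[of n] by(simp_all add: alg)
  have ar: "A * N * (2 * h) / (2 * b) * (P / Q * y) = A * (h * P) * ((N / Q * y) / b)" for A N h b P Q y :: complex by(simp add: mult_ac)
  have "cfun n u * (2 * u + 1) / (2 * u - 2 * of_nat n + 1) * (dd ?us * ?w) = inverse u ^ NN * S0 u * ((?N / ?Q * ?w) / (u - of_nat n + 1/2))"
   unfolding c d e S0_def by(rule ar)
  thus ?thesis unfolding tel using e(3) by simp
 qed
 have ww: "?w = 2 * of_nat n - ?us - 1/2" by simp
 show "mo UNIV (piS n rho i j u) = (inverse u ^ NN * S0 u) *: GN ?w i j"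
  by(rule ent_eqI) (simp only: ent_mo ent_simps piS_def Fhat_value[OF rho gen ww w i j] s[symmetric] mult.assoc)
qed

end

section \<open>From the given module to the isomorphism\<close>

lemma Zm_cong: "(!!i. i : set is ==> c' i = c'' i) ==> Zm d c c' is u = Zm d c c'' is u" by(induction "is") auto

lemma kd_pair: "kd (x, y) (a, b) = kd x a * kd y b" by(simp add: kd_def)
lemma kd_eq: "a = b ==> kd a b = 1" and kd_ne: "a ~= b ==> kd a b = 0" by(simp_all add: kd_def)

lemma mbr_Fm:
 assumes a: "a : Iset n" and b: "b : Iset n" and c: "c : Iset n" and d: "d : Iset n"
 shows "mbr (Iset n) (Fm a b) (Fm c d) = (%x y. kd c b * Fm a d x y + ((- kd a d) * Fm c b x y
   + ((- theta a b * kd c (- a)) * Fm (- b) d x y + (theta a b * kd (- b) d) * Fm c (- a) x y)))" proof(intro ext)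
 fix x y
 have s: "(SUM z:Iset n. kd z i * f z) = f i" if "i : Iset n" for f :: "int => complex" and i
  using that by(simp add: kd_def if_distrib[of "%z. z * _"] cong: if_cong)
 have m: "mmul (Iset n) (Fm a b) (Fm c d) x y = kd x a * Fm c d b y - theta a b * kd x (- b) * Fm c d (- a) y"
  if "a : Iset n" "b : Iset n" for a b c d proof -
  have "mmul (Iset n) (Fm a b) (Fm c d) x y = (SUM z:Iset n. kd z b * (kd x a * Fm c d z y)) - (SUM z:Iset n. kd z (- a) * (theta a b * kd x (- b) * Fm c d z y))"
   unfolding mmul_def by(subst Fm_def) (simp add: kd_pair alg flip: sum_subtractf)
  thus ?thesis using s that by simp
 qed
 \<comment> \<open>\<open>theta\<close> enters only through a sign function with these rules, which
   settle all sixteen cases of coinciding indices.\<close>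
 obtain sigma :: "int => complex" where t: "!!i j. theta i j = sigma i * sigma j" and sm: "!!i. sigma (- i) = - sigma i"
  and sq: "!!i. i : Iset n ==> sigma i * sigma i = 1" by(rule that[of "%i. of_int (sgn i)"]) (auto simp: theta_def sgn_if Iset_def)
 have sq2: "sigma i * (sigma i * z) = z" if "i : Iset n" for i z using sq[OF that] by(simp flip: mult.assoc)
 note S = t sm sq[OF a] sq[OF b] sq[OF c] sq[OF d] sq2[OF a] sq2[OF b] sq2[OF c] sq2[OF d]
 show "mbr (Iset n) (Fm a b) (Fm c d) x y = kd c b * Fm a d x y + ((- kd a d) * Fm c b x y
   + ((- theta a b * kd c (- a)) * Fm (- b) d x y + (theta a b * kd (- b) d) * Fm c (- a) x y))" unfolding mbr_def m[OF a b] m[OF c d] unfolding Fm_def kd_pair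
  by(cases "c = b"; cases "d = a"; cases "a = - c"; cases "b = - d") (simp_all add: S kd_eq kd_ne alg)
qed

lemma Fm_neg: "a : Iset n ==> b : Iset n ==> Fm (- b) (- a) = (%x y. (- theta a b) * Fm a b x y)" by(auto simp: Fm_def theta_def fun_eq_iff kd_pair alg sgn_if Iset_def)

lemma Fm_gsp: assumes i: "i : Iset n" and j: "j : Iset n" shows "Fm i j : gsp n" unfolding gsp_def
proof(rule CollectI, rule exI[of _ "%i' j'. kd i' i * kd j' j"], intro ext)
 fix a b
 let ?A = "SUM i':Iset n. SUM j':Iset n. kd i' i * kd j' j * Fm i' j' a b"
 have "?A = (SUM i':Iset n. kd i' i * (SUM j':Iset n. kd j' j * Fm i' j' a b))" by(simp add: sum_distrib_left mult.assoc)
 also have "... = Fm i j a b" using i j by(simp add: kd_def if_distrib[of "%z. z * _"] cong: if_cong)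
 finally show "Fm i j a b = ?A" ..
qed

lemma gsp_add: assumes "X : gsp n" "Y : gsp n" shows "(%a b. X a b + Y a b) : gsp n"
proof -
 obtain c e where "X = (%a b. SUM i:Iset n. SUM j:Iset n. c i j * Fm i j a b)" "Y = (%a b. SUM i:Iset n. SUM j:Iset n. e i j * Fm i j a b)"
  using assms by(auto simp: gsp_def)
 thus ?thesis unfolding gsp_def by(intro CollectI exI[of _ "%i j. c i j + e i j"]) (simp add: fun_eq_iff distrib_right sum.distrib)
qed
lemma gsp_scale: assumes "X : gsp n" shows "(%a b. z * X a b) : gsp n"
proof -
 obtain c where "X = (%a b. SUM i:Iset n. SUM j:Iset n. c i j * Fm i j a b)" using assms by(auto simp: gsp_def)
 thus ?thesis unfolding gsp_def by(intro CollectI exI[of _ "%i j. z * c i j"]) (simp add: fun_eq_iff sum_distrib_left mult.assoc)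
qed

locale sp_mod =
 fixes n :: nat and rho :: "(int => int => complex) => ('v::finite) op"
 assumes M: "sp_module n rho"
begin

definition FF :: "int => int => 'v lop" where "FF i j = mo UNIV (rho (Fm i j))"

lemma rho_add: "X : gsp n ==> Y : gsp n ==> mo UNIV (rho (%a b. X a b + Y a b)) = mo UNIV (rho X) + mo UNIV (rho Y)"
 and rho_mbr: "X : gsp n ==> Y : gsp n ==> mo UNIV (rho (mbr (Iset n) X Y)) = mo UNIV (rho X) * mo UNIV (rho Y) - mo UNIV (rho Y) * mo UNIV (rho X)"
 and rho_scale: "X : gsp n ==> mo UNIV (rho (%a b. z * X a b)) = z *: mo UNIV (rho X)" using M by(simp_all add: sp_module_def mo_add mo_mbr mo_scl)

lemma FF_entry: "rho (Fm i j) x y = ap (FF i j) (kd y) x" using ent_mo[of "rho (Fm i j)" x y] by(simp add: ent_def FF_def)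

lemma FF_comm:
 assumes "a : Iset n" "b : Iset n" "c : Iset n" "d : Iset n"
 shows "FF a b * FF c d = FF c d * FF a b + kd c b *: FF a d - kd a d *: FF c b
    - theta a b *: (kd c (- a) *: FF (- b) d - kd (- b) d *: FF c (- a))" proof -
 have g: "Fm a b : gsp n" "Fm c d : gsp n" "Fm a d : gsp n" "Fm c b : gsp n" "Fm (- b) d : gsp n" "Fm c (- a) : gsp n" using assms by(simp_all add: Fm_gsp)
 have "FF a b * FF c d - FF c d * FF a b = kd c b *: FF a d + ((- kd a d) *: FF c b + ((- theta a b * kd c (- a)) *: FF (- b) d + (theta a b * kd (- b) d) *: FF c (- a)))"
  unfolding FF_def rho_mbr[OF g(1,2), symmetric] mbr_Fm[OF assms] by(simp only: rho_add rho_scale gsp_add gsp_scale g)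
 thus ?thesis by(simp add: scl_simps alg)
qed

lemma FF_sym: "a : Iset n ==> b : Iset n ==> FF (- b) (- a) = (- theta a b) *: FF a b" unfolding FF_def by(subst Fm_neg) (simp_all only: rho_scale Fm_gsp)

text \<open>Irreducibility is given for all of \<open>gsp n\<close>, whose elements are combinations
  of the \<open>Fm i j\<close>; stability under those therefore has to be extended.\<close>

lemma invariant:
 assumes U: "csubspace U" and F: "!!a b f. a : Iset n ==> b : Iset n ==> f : U ==> ap (FF a b) f : U"
  and X: "X : gsp n" and f: "f : U"
 shows "app UNIV (rho X) f : U" proof -
 define G where "G X <-> X : gsp n & (ALL f:U. ap (mo UNIV (rho X)) f : U)" for X
 have Fg: "G (Fm i j)" if "i : Iset n" "j : Iset n" for i j using that F Fm_gsp by(simp add: G_def FF_def)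
 have add: "G (%a b. X a b + Y a b)" if "G X" "G Y" for X Y using that unfolding G_def by(auto simp: rho_add gsp_add intro: csub_add[OF U])
 have scale: "G (%a b. z * X a b)" if "G X" for X z using that unfolding G_def by(auto simp: rho_scale gsp_scale intro: csub_vs[OF U])
 have n0: "EX i. i : Iset n ==> G (%a b. 0)" using scale[OF Fg, of _ _ 0] by auto
 have sum: "G (%a b. SUM p:A. Y p a b)" if "finite A" "ALL p:A. G (Y p)" "G (%a b. 0)" for A :: "int set" and Y
  using that by(induction A rule: finite_induct) (auto intro: add)
 have z: "G (%a b. 0)" proof(cases "EX i. i : Iset n")
  case False
  hence I: "Iset n = {}" by auto
  have "(%a b. 0) : gsp n" unfolding gsp_def I by simp
  thus ?thesis using rho_scale[of "%a b. 0" 0] csub_0[OF U] by(simp add: G_def scl_simps)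
 qed (rule n0)
 obtain c where X: "X = (%a b. SUM i:Iset n. SUM j:Iset n. c i j * Fm i j a b)" using X by(auto simp: gsp_def)
 have "G X" unfolding X by(intro sum z ballI scale Fg finite_Iset)
 thus ?thesis using f by(simp add: G_def ap_mo)
qed

lemma Vplus_VP: assumes "sp_rep n FF" shows "Vplus n rho \<mu> = sp_rep.VP n FF \<mu>"
 unfolding Vplus_def sp_rep.VP_def[OF assms] FF_def ap_mo by(simp add: vs_def zero_fun_def)

end

theorem theorem5p2:
  fixes n :: nat and lam \<mu> :: "nat \<Rightarrow> int"
    and \<rho> :: "(int \<Rightarrow> int \<Rightarrow> complex) \<Rightarrow> ('v::finite) op" and \<xi> :: "'v \<Rightarrow> complex"
    and W :: "nat \<Rightarrow> 'w set" and E :: "nat \<Rightarrow> int \<Rightarrow> int \<Rightarrow> 'w op"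
  assumes n: "n \<ge> 1"
    and dom0: "0 \<ge> lam 1" and dom: "\<forall>i. 1 \<le> i \<and> i < n \<longrightarrow> lam i \<ge> lam (Suc i)"
    and V: "sp_module n \<rho>" "sp_irreducible n \<rho>" "sp_hw n \<rho> lam \<xi>"
    and nz: "Vplus n \<rho> \<mu> \<noteq> {\<lambda>x. 0}"
    and L: "\<forall>k\<in>{1..n}. gl2_hw (int n) (W k) (E k) (alph lam \<mu> k) (bet n lam \<mu> k)"
  shows "\<exists>\<phi> :: ('v \<Rightarrow> complex) \<Rightarrow> ('w list \<Rightarrow> complex).
           (\<forall>f\<in>Vplus n \<rho> \<mu>. \<forall>g\<in>Vplus n \<rho> \<mu>. \<phi> (\<lambda>x. f x + g x) = (\<lambda>ks. \<phi> f ks + \<phi> g ks))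
         \<and> (\<forall>c. \<forall>f\<in>Vplus n \<rho> \<mu>. \<phi> (\<lambda>x. c * f x) = (\<lambda>ks. c * \<phi> f ks))
         \<and> bij_betw \<phi> (Vplus n \<rho> \<mu>) (vsp (TC n W))
         \<and> (\<exists>R. \<forall>u. cmod u > R \<longrightarrow>
              (\<forall>i\<in>{- int n, int n}. \<forall>j\<in>{- int n, int n}. \<forall>f\<in>Vplus n \<rho> \<mu>.
                 \<phi> (app UNIV (piS n \<rho> i j u) f) = app (TC n W) (Stens n W E i j u) (\<phi> f)))"
proof -
 interpret P: sp_mod n \<rho> by unfold_locales (rule V(1))
 interpret H: sp_hwrep n P.FF lam \<xi>
 proof(unfold_locales, rule n, erule (3) P.FF_comm, erule (1) P.FF_sym)
  show "U = {0} | U = UNIV" if U: "csubspace U" "!!a b f. a : Iset n ==> b : Iset n ==> f : U ==> ap (P.FF a b) f : U" for U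
   using V(2) U(1) P.invariant[OF U] unfolding sp_irreducible_def zero_fun_def by blast
  show "\<xi> ~= 0" using V(3) by(simp add: sp_hw_def zero_fun_def)
  show "ap (P.FF (int i) (int i)) \<xi> = of_int (lam i) *. \<xi>" if "i : {1..n}" for i using V(3) that unfolding sp_hw_def P.FF_def ap_mo vs_def by blast
  show "ap (P.FF a b) \<xi> = 0" if "a : Iset n" "b : Iset n" "a < b" for a b using V(3) that unfolding sp_hw_def P.FF_def ap_mo zero_fun_def by blast
 qed
 have VP: "Vplus n \<rho> \<mu> = H.VP \<mu>" by(rule P.Vplus_VP) unfold_locales
 \<comment> \<open>The gl(2)-modules provide the degrees \<open>d k\<close> together with the
   monomial bases.\<close>
 have "ALL k. EX d w. k : {1..n} --> gbasis (int n) (W k) (E k) (alph lam \<mu> k) (bet n lam \<mu> k) d w"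
  using L gl2_gbasis n by(metis of_nat_0_eq_iff not_one_le_zero)
 then obtain d w where gb: "!!k. k : {1..n} ==> gbasis (int n) (W k) (E k) (alph lam \<mu> k) (bet n lam \<mu> k) (d k) (w k)" by metis
 have piS: "mo UNIV (piS n \<rho> i j u) = (inverse u ^ (2 * n) * H.S0 u) *: H.Gf u i j" if "H.R < cmod u" "i : Iset n" "j : Iset n" for u i j
  using H.piS_value[of \<rho> u i j] that P.FF_entry by auto
 have nI: "int n : Iset n" using n by(auto simp: Iset_def)
 interpret B: sp_fin n P.FF lam \<xi> \<mu> d
 proof
  show "alph lam \<mu> i - bet n lam \<mu> i = of_nat (d i)" if "i : {1..n}" for i using gb[OF that] by(simp add: gbasis_def)
  show "H.VP \<mu> ~= {0}" using nz unfolding VP zero_fun_def .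
 qed (use dom0 dom in auto)
 let ?B = "alph lam \<mu>"
 let ?C = "%i. - bet n lam \<mu> i"
 obtain \<psi> where ps: "ALL x:H.VP \<mu>. ALL y:H.VP \<mu>. \<psi> (x + y) = \<psi> x + \<psi> y" "ALL z. ALL x:H.VP \<mu>. \<psi> (z *. x) = z *. \<psi> x"
   "bij_betw \<psi> (H.VP \<mu>) (HH d [1..<Suc n])"
   "ALL u a b. ALL x:H.VP \<mu>. H.R < cmod u --> H.S0 u *. \<psi> (ap (H.Gf u (B.ib a) (B.ib b)) x) = ap (Zm d ?B ?C [1..<Suc n] u a b) (\<psi> x)"
  using B.branching by blast
 let ?t = "tau d w 0 n"
 let ?D = "%i. of_nat (d i) - alph lam \<mu> i"
 \<comment> \<open>The relation alpha_i - beta_i = \<open>d i\<close> identifies the right-hand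
   parameters of the two descriptions of the model.\<close>
 have Z: "Zm d ?B ?D [1..<Suc n] u = Zm d ?B ?C [1..<Suc n] u" for u proof(rule Zm_cong)
  fix i assume "i : set [1..<Suc n]"
  hence "i : {1..n}" by auto
  from B.d[OF this] show "of_nat (d i) - alph lam \<mu> i = - bet n lam \<mu> i" by(simp add: alg)
 qed
 \<comment> \<open>Both sides carry the factor u^(-2n): on the left from the normalisation of the
   comatrix, on the right from the denominators of the 2n evaluation factors.\<close>
 have eq: "?t (\<psi> (app UNIV (piS n \<rho> i j u) f)) = app (TC n W) (Stens n W E i j u) (?t (\<psi> f))"
  if u: "H.R < cmod u" and i: "i : {- int n, int n}" and j: "j : {- int n, int n}" and f: "f : H.VP \<mu>" for u i j f proof -
  have I: "i : Iset n" "j : Iset n" using i j nI by auto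
  obtain a where a: "i = B.ib a" using i by(metis B.ib_def insertE singletonD)
  obtain b where b: "j = B.ib b" using j by(metis B.ib_def insertE singletonD)
  have x: "ap (H.Gf u i j) f : H.VP \<mu>" by(rule B.VP_teq[OF H.teqGf[OF u] i j f])
  have u0: "u ~= 0" using u H.RR_nonneg by auto
  have "app UNIV (piS n \<rho> i j u) f = inverse u ^ (2 * n) *. (H.S0 u *. ap (H.Gf u i j) f)" unfolding ap_mo[symmetric] piS[OF u I] by(simp only: ap_scl vs_simps(1))
  hence "\<psi> (app UNIV (piS n \<rho> i j u) f) = inverse u ^ (2 * n) *. (H.S0 u *. \<psi> (ap (H.Gf u i j) f))" using ps(2) x by(simp add: vs_simps(1))
  also have "... = inverse u ^ (2 * n) *. ap (Zm d ?B ?C [1..<Suc n] u a b) (\<psi> f)" using ps(4) u f unfolding a b by(simp only: simp_thms)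
  finally have e: "?t (\<psi> (app UNIV (piS n \<rho> i j u) f)) = inverse u ^ (2 * n) *. ?t (ap (Zm d ?B ?C [1..<Suc n] u a b) (\<psi> f))" by(simp only: tau_vs)
  have "\<psi> f : HH d [1..<Suc n]" using ps(3) f by(rule bij_betwE[rule_format])
  hence s: "app (TC n W) (Stens n W E (ix (int n) a) (ix (int n) b) u) (?t (\<psi> f)) = inverse u ^ (2 * n) *. ?t (ap (Zm d ?B ?D [1..<Suc n] u a b) (\<psi> f))"
   by(intro Stens_tau[OF gb n u0])
  have ib: "B.ib a = ix (int n) a" for a by(simp add: B.ib_def ix_def)
  show ?thesis unfolding e unfolding a b ib by(rule s[unfolded Z, symmetric])
 qed
 let ?A = "?t \<circ> \<psi>"
 show ?thesis unfolding VP
 proof(intro exI[of _ "?t \<circ> \<psi>"] conjI allI ballI)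
  fix f g assume fg: "f : H.VP \<mu>" "g : H.VP \<mu>"
  have "(%x. f x + g x) = f + g" by(simp add: fun_eq_iff fa)
  hence "\<psi> (%x. f x + g x) = \<psi> f + \<psi> g" using ps(1) fg by simp
  thus "?A (%x. f x + g x) = (%ks. ?A f ks + ?A g ks)" unfolding comp_def by(simp only: tau_add) (simp only: fa plus_fun_def)
 next
  fix c f assume f: "f : H.VP \<mu>"
  have "(%x. c * f x) = c *. f" by(simp add: vs_def)
  hence "\<psi> (%x. c * f x) = c *. \<psi> f" using ps(2) f by simp
  thus "?A (%x. c * f x) = (%ks. c * ?A f ks)" unfolding comp_def by(simp only: tau_vs) (simp only: vs_def)
 next
  show "bij_betw ?A (H.VP \<mu>) (vsp (TC n W))" by(rule bij_betw_trans[OF ps(3) tau_bij[OF gb]])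
 next
  show "EX R. ALL u. R < cmod u --> (ALL i:{- int n, int n}. ALL j:{- int n, int n}. ALL f:H.VP \<mu>.
         ?A (app UNIV (piS n \<rho> i j u) f) = app (TC n W) (Stens n W E i j u) (?A f))" using eq by(intro exI[of _ H.R]) simp
 qed
qed

end
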